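(* If the walled Brauer algebra $B_{r,s}(\delta)$ is semisimple, then its center is $Z(B_{r,s}(\delta))=\{p(L_1,\dots,L_{r+s}) : p\in S_{r,s}[x;y]\}$; i.e. the supersymmetric polynomials in the Jucys-Murphy elements generate the center.
   Context: $B_{r,s}(\delta)$ ($r,s\ge0$, $\delta\in\mathbb C$) has basis the $(r,s)$-walled Brauer diagrams (two rows of $r+s$ vertices numbered $1,\dots,r+s$, wall after the first $r$ in each row, each vertex joined to exactly one other, vertical strands do not cross the wall, horizontal strands within a row cross it), product by stacking $d_1$ under $d_2$ and multiplying by $\delta^n$ for $n$ removed closed loops. $(a,b)$ ($a<b$ same side) is the transposition diagram; $e_{j,k}$ ($j\le r<k$) has horizontal strands joining $j,k$ in both rows, others straight. Jucys-Murphy elements: $L_k=\sum_{j=1}^{k-1}(j,k)$ for $1\le k\le r$, $L_k=-\sum_{j=1}^r e_{j,k}+\sum_{j=r+1}^{k-1}(j,k)+\delta$ for $r<k\le r+s$ (they commute). $S_{r,s}[x;y]$ is the algebra of polynomials in $x_1,\dots,x_r,y_1,\dots,y_s$ symmetric in the $x$'s and separately in the $y$'s such that the substitution $x_r=-y_1=t$ gives a polynomial independent of $t$; evaluation is $x_i\mapsto L_i$, $y_j\mapsto L_{r+j}$. Known fact: $B_{r,s}(\delta)$ is semisimple iff $r=0$ or $s=0$, or $\delta\notin\mathbb Z$, or $|\delta|>r+s-2$, or $\delta=0$ and $(r,s)\in\{(1,2),(1,3),(2,1),(3,1)\}$. *)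

theory Defs
  imports Complex_Main "HOL-Combinatorics.Permutations" "HOL-Combinatorics.Transposition" "HOL-Library.Function_Algebras"
begin

text \<open>A vertex is (row, index): row True = top row, False = bottom row; index in {1..r+s}.
  A diagram is an involution d on the vertex set without fixed points (d x is the vertex
  joined to x), extended by the identity outside the vertex set.\<close>

type_synonym vtx = "bool \<times> nat"
type_synonym diag = "vtx \<Rightarrow> vtx"
type_synonym elt = "diag \<Rightarrow> complex"

definition verts :: "nat \<Rightarrow> vtx set" where
  "verts n = UNIV \<times> {1..n}"

definition left_of_wall :: "nat \<Rightarrow> vtx \<Rightarrow> bool" where
  "left_of_wall r x \<longleftrightarrow> snd x \<le> r"

definition wdiag :: "nat \<Rightarrow> nat \<Rightarrow> diag \<Rightarrow> bool" where
  "wdiag r s d \<longleftrightarrow>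
     (\<forall>x. x \<notin> verts (r+s) \<longrightarrow> d x = x) \<and>
     (\<forall>x \<in> verts (r+s). d x \<in> verts (r+s) \<and> d x \<noteq> x \<and> d (d x) = x \<and>
        (fst (d x) \<noteq> fst x \<longrightarrow> (left_of_wall r (d x) \<longleftrightarrow> left_of_wall r x)) \<and>
        (fst (d x) = fst x \<longrightarrow> (left_of_wall r (d x) \<longleftrightarrow> \<not> left_of_wall r x)))"

definition WD :: "nat \<Rightarrow> nat \<Rightarrow> diag set" where
  "WD r s = {d. wdiag r s d}"

text \<open>Stacking an upper diagram over a lower one: three layers 0 (top), 1 (middle), 2 (bottom).\<close>

definition emb_up :: "vtx \<Rightarrow> nat \<times> nat" where
  "emb_up x = (if fst x then 0 else 1, snd x)"

definition emb_lo :: "vtx \<Rightarrow> nat \<times> nat" where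
  "emb_lo x = (if fst x then 1 else 2, snd x)"

definition emb_out :: "vtx \<Rightarrow> nat \<times> nat" where
  "emb_out x = (if fst x then 0 else 2, snd x)"

definition stack_edges :: "nat \<Rightarrow> diag \<Rightarrow> diag \<Rightarrow> ((nat \<times> nat) \<times> (nat \<times> nat)) set" where
  "stack_edges n up lo =
     {(emb_up x, emb_up (up x)) | x. x \<in> verts n} \<union> {(emb_lo x, emb_lo (lo x)) | x. x \<in> verts n}"

definition stack_conn :: "nat \<Rightarrow> diag \<Rightarrow> diag \<Rightarrow> ((nat \<times> nat) \<times> (nat \<times> nat)) set" where
  "stack_conn n up lo = (stack_edges n up lo \<union> (stack_edges n up lo)\<inverse>)\<^sup>*"

definition compose :: "nat \<Rightarrow> diag \<Rightarrow> diag \<Rightarrow> diag" where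
  "compose n up lo = (\<lambda>x. if x \<in> verts n
      then (THE y. y \<in> verts n \<and> y \<noteq> x \<and> (emb_out x, emb_out y) \<in> stack_conn n up lo)
      else x)"

definition loops :: "nat \<Rightarrow> diag \<Rightarrow> diag \<Rightarrow> nat" where
  "loops n up lo = card ((\<lambda>m. stack_conn n up lo `` {m}) `
      {(1::nat, i) | i. i \<in> {1..n} \<and> (\<forall>y \<in> verts n. ((1, i), emb_out y) \<notin> stack_conn n up lo)})"

definition WB :: "nat \<Rightarrow> nat \<Rightarrow> elt set" where
  "WB r s = {a. \<forall>d. d \<notin> WD r s \<longrightarrow> a d = 0}"

text \<open>Product d1 d2 = stacking d1 under d2 (d2 is the upper diagram), times delta^loops.\<close>
definition wb_mult :: "nat \<Rightarrow> nat \<Rightarrow> complex \<Rightarrow> elt \<Rightarrow> elt \<Rightarrow> elt" where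
  "wb_mult r s \<delta> a b = (\<lambda>d. if d \<in> WD r s then
     (\<Sum>(d1, d2) \<in> {(d1, d2). d1 \<in> WD r s \<and> d2 \<in> WD r s \<and> compose (r+s) d2 d1 = d}.
        a d1 * b d2 * \<delta> ^ loops (r+s) d2 d1)
     else 0)"

definition bas :: "diag \<Rightarrow> elt" where
  "bas d = (\<lambda>d'. if d' = d then 1 else 0)"

definition id_diag :: "nat \<Rightarrow> diag" where
  "id_diag n = (\<lambda>x. if x \<in> verts n then (\<not> fst x, snd x) else x)"

definition wb_one :: "nat \<Rightarrow> nat \<Rightarrow> elt" where
  "wb_one r s = bas (id_diag (r+s))"

definition trans_diag :: "nat \<Rightarrow> nat \<Rightarrow> nat \<Rightarrow> diag" where
  "trans_diag n a b = (\<lambda>x. if x \<in> verts n then (\<not> fst x, Transposition.transpose a b (snd x)) else x)"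

definition e_diag :: "nat \<Rightarrow> nat \<Rightarrow> nat \<Rightarrow> diag" where
  "e_diag n j k = (\<lambda>x. if x \<in> verts n then
      (if snd x = j then (fst x, k) else if snd x = k then (fst x, j) else (\<not> fst x, snd x))
     else x)"

definition wb_smult :: "complex \<Rightarrow> elt \<Rightarrow> elt" where
  "wb_smult c a = (\<lambda>d. c * a d)"

definition JM :: "nat \<Rightarrow> nat \<Rightarrow> complex \<Rightarrow> nat \<Rightarrow> elt" where
  "JM r s \<delta> k = (if k \<le> r
     then (\<Sum>j\<in>{1..<k}. bas (trans_diag (r+s) j k))
     else - (\<Sum>j\<in>{1..r}. bas (e_diag (r+s) j k))
          + (\<Sum>j\<in>{r+1..<k}. bas (trans_diag (r+s) j k))
          + wb_smult \<delta> (wb_one r s))"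

definition wb_pow :: "nat \<Rightarrow> nat \<Rightarrow> complex \<Rightarrow> elt \<Rightarrow> nat \<Rightarrow> elt" where
  "wb_pow r s \<delta> a n = (wb_mult r s \<delta> a ^^ n) (wb_one r s)"

text \<open>A polynomial is given by its coefficient function on exponent vectors m :: nat \<Rightarrow> nat;
  variable i (1 \<le> i \<le> r) is x_i, variable r+j (1 \<le> j \<le> s) is y_j.\<close>

definition poly_vars :: "nat \<Rightarrow> ((nat \<Rightarrow> nat) \<Rightarrow> complex) \<Rightarrow> bool" where
  "poly_vars n c \<longleftrightarrow> finite {m. c m \<noteq> 0} \<and> (\<forall>m. c m \<noteq> 0 \<longrightarrow> (\<forall>i. i \<notin> {1..n} \<longrightarrow> m i = 0))"

definition sym_in :: "nat set \<Rightarrow> ((nat \<Rightarrow> nat) \<Rightarrow> complex) \<Rightarrow> bool" where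
  "sym_in A c \<longleftrightarrow> (\<forall>\<sigma>. \<sigma> permutes A \<longrightarrow> (\<forall>m. c (m \<circ> \<sigma>) = c m))"

text \<open>After substituting x_r = t, y_1 = -t, the coefficient of t^k (k \<ge> 1) times any monomial
  in the remaining variables vanishes, i.e. the result is independent of t.\<close>
definition subst_indep :: "nat \<Rightarrow> ((nat \<Rightarrow> nat) \<Rightarrow> complex) \<Rightarrow> bool" where
  "subst_indep r c \<longleftrightarrow> (\<forall>m k. m r = 0 \<longrightarrow> m (r+1) = 0 \<longrightarrow> k \<ge> 1 \<longrightarrow>
      (\<Sum>a\<in>{0..k}. (-1) ^ (k - a) * c (m(r := a, r+1 := k - a))) = 0)"

definition supersym :: "nat \<Rightarrow> nat \<Rightarrow> ((nat \<Rightarrow> nat) \<Rightarrow> complex) \<Rightarrow> bool" where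
  "supersym r s c \<longleftrightarrow> poly_vars (r+s) c \<and> sym_in {1..r} c \<and> sym_in {r+1..r+s} c \<and>
      (r > 0 \<and> s > 0 \<longrightarrow> subst_indep r c)"

definition mono_JM :: "nat \<Rightarrow> nat \<Rightarrow> complex \<Rightarrow> (nat \<Rightarrow> nat) \<Rightarrow> elt" where
  "mono_JM r s \<delta> m = foldr (\<lambda>i acc. wb_mult r s \<delta> (wb_pow r s \<delta> (JM r s \<delta> i) (m i)) acc)
      [1..<r+s+1] (wb_one r s)"

definition eval_JM :: "nat \<Rightarrow> nat \<Rightarrow> complex \<Rightarrow> ((nat \<Rightarrow> nat) \<Rightarrow> complex) \<Rightarrow> elt" where
  "eval_JM r s \<delta> c = (\<Sum>m \<in> {m. c m \<noteq> 0}. wb_smult (c m) (mono_JM r s \<delta> m))"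

definition wb_center :: "nat \<Rightarrow> nat \<Rightarrow> complex \<Rightarrow> elt set" where
  "wb_center r s \<delta> = {z \<in> WB r s. \<forall>a \<in> WB r s. wb_mult r s \<delta> z a = wb_mult r s \<delta> a z}"

definition left_ideal :: "nat \<Rightarrow> nat \<Rightarrow> complex \<Rightarrow> elt set \<Rightarrow> bool" where
  "left_ideal r s \<delta> I \<longleftrightarrow> I \<subseteq> WB r s \<and> 0 \<in> I \<and> (\<forall>x\<in>I. \<forall>y\<in>I. x + y \<in> I) \<and>
     (\<forall>a \<in> WB r s. \<forall>x \<in> I. wb_mult r s \<delta> a x \<in> I)"

definition max_left_ideal :: "nat \<Rightarrow> nat \<Rightarrow> complex \<Rightarrow> elt set \<Rightarrow> bool" where
  "max_left_ideal r s \<delta> I \<longleftrightarrow> left_ideal r s \<delta> I \<and> I \<noteq> WB r s \<and>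
     (\<forall>J. left_ideal r s \<delta> J \<and> I \<subseteq> J \<and> J \<noteq> WB r s \<longrightarrow> J = I)"

definition jacobson_rad :: "nat \<Rightarrow> nat \<Rightarrow> complex \<Rightarrow> elt set" where
  "jacobson_rad r s \<delta> = WB r s \<inter> \<Inter>{I. max_left_ideal r s \<delta> I}"

definition wb_semisimple :: "nat \<Rightarrow> nat \<Rightarrow> complex \<Rightarrow> bool" where
  "wb_semisimple r s \<delta> \<longleftrightarrow> jacobson_rad r s \<delta> = {0}"

end

theory Submission
  imports Defs "HOL-Computational_Algebra.Polynomial_Factorial" "HOL-Computational_Algebra.Field_as_Ring" "HOL-Computational_Algebra.Fundamental_Theorem_Algebra"
begin

declare split_paired_All [simp del] split_paired_Ex [simp del]

text \<open>Write J k for the ideal spanned by the diagrams with at least k horizontal strands in a row.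
  That supersymmetric polynomials evaluate to central elements follows from the relations between the
  Jucys-Murphy elements and the generators. For the converse, a central z in J k is treated modulo
  J (k+1): semisimplicity makes the algebra von Neumann regular, so z is determined there by its
  action on the diagram f with k nested arcs around the wall, and this action is that of a central
  element of the group algebra of the permutations of the remaining vertical strands. On f, the
  supersymmetric power sum of degree a acts as the difference of the a-th power sums of the
  Jucys-Murphy elements x of the left block and of the negatives of \<delta> + y of the right block. If
  \<delta> is not an integer or |\<delta>| > r + s - 2, then the spectra of the x and of the -(\<delta> + y) are
  disjoint, hence some polynomial is 1 on the former and 0 on the latter; this separates the two
  power sums, and power sums of Jucys-Murphy elements generate the centre of the group algebra of a
  symmetric group. The four exceptional algebras with \<delta> = 0 are treated by hand.

  For every other \<delta> regularity fails. On a product of hook-type eigenvectors of the last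
  Jucys-Murphy elements of both blocks, with contents adding up to -\<delta>, the sum of all arcs e(i,j)
  acts as zero modulo J 2, hence so does every single arc; regularity would force the resulting
  element of J 1 into J 2, which its coefficients contradict.\<close>

section \<open>Stacking of diagrams\<close>

text \<open>Regularity enters through one computation: if a central \<open>y\<close> in
  \<open>J k\<close> sends \<open>fk k\<close> into \<open>J (Suc k)\<close>, then \<open>y\<close>
  multiplies all of \<open>J k\<close> into \<open>J (Suc k)\<close>, so
  \<open>y = y * (a * y)\<close> lies in \<open>J (Suc k)\<close>. The approximant subtracted from a
  central \<open>z\<close> must therefore lie in \<open>J k\<close> itself. This is the obstacle at
  positive levels, and the reason for an extra factor \<open>Q\<close> in \<open>Zs\<close> that
  kills the lower levels and acts on \<open>fk k\<close> by a nonzero scalar. For generic \<delta>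
  it comes from the separating polynomial, whose supersymmetric power sum acts on level
  \<open>i\<close> as the number \<open>rk - i\<close> of left vertical strands; in the exceptional
  algebras a polynomial in the first power sum replaces it. On the negative side, the eigenvalues of
  the last Jucys-Murphy element of the symmetric group on N letters are the contents of removable
  boxes of Young diagrams with N boxes: all nonzero c with |c| < N, and 0 only for N = 1 or N >= 4.
  The gap at 0 for N = 2, 3 produces the exceptional algebras, and for r = s = 2 it leaves \<delta>
  = 1 and \<delta> = -1 to a separate argument.\<close>

lemma single_valued_rtrancl_linear:
  assumes "single_valued R" "(x, y) \<in> R\<^sup>*" "(x, z) \<in> R\<^sup>*"
  shows "(y, z) \<in> R\<^sup>* \<or> (z, y) \<in> R\<^sup>*"
  using assms(2,3,1)
proof (induction rule: converse_rtrancl_induct)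
  case base
  then show ?case by blast
next
  case (step x x')
  from step.prems(1) show ?case
  proof (cases rule: converse_rtranclE)
    case base
    then show ?thesis using step.hyps by (meson converse_rtrancl_into_rtrancl)
  next
    case (step x'')
    then have "x'' = x'" using \<open>(x, x') \<in> R\<close> \<open>single_valued R\<close> by (auto dest: single_valuedD)
    then show ?thesis using step \<open>(x', z) \<in> R\<^sup>* \<Longrightarrow> single_valued R \<Longrightarrow> _\<close> \<open>single_valued R\<close> by auto
  qed
qed

text \<open>At most one edge leaves and at most one enters each node, so a component is a directed
  path or cycle: a further undirected step either prolongs the directed path already found or
  retraces it.\<close>

lemma biunique_conn:
  assumes sv: "single_valued R" and svi: "single_valued (R\<inverse>)" and c: "(x, y) \<in> (R \<union> R\<inverse>)\<^sup>*"
  shows "(x, y) \<in> R\<^sup>* \<or> (y, x) \<in> R\<^sup>*"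
  using c
proof (induction rule: rtrancl_induct)
  case base
  then show ?case by blast
next
  case (step y z)
  consider "(x, y) \<in> R\<^sup>*" "(y, z) \<in> R" | "(x, y) \<in> R\<^sup>*" "(z, y) \<in> R" | "(y, x) \<in> R\<^sup>*" "(y, z) \<in> R"
    | "(y, x) \<in> R\<^sup>*" "(z, y) \<in> R" using step by blast
  then show ?case
  proof cases
    case 2
    then have "(y, x) \<in> (R\<inverse>)\<^sup>*" "(y, z) \<in> (R\<inverse>)\<^sup>*" by (auto simp: rtrancl_converse)
    from single_valued_rtrancl_linear[OF svi this] show ?thesis by (auto simp: rtrancl_converse)
  next
    case 3
    then show ?thesis using single_valued_rtrancl_linear[OF sv, of y x z] by auto
  qed (auto intro: rtrancl_into_rtrancl converse_rtrancl_into_rtrancl)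
qed

text \<open>If the path never ended, the successor map would be an injection of the finite reachable
  set into itself, hence onto, and the source \<open>x\<close> would have a predecessor.\<close>

lemma finite_path_ends:
  assumes fin: "finite R" and sv: "single_valued R" and svi: "single_valued (R\<inverse>)"
    and x: "x \<notin> Range R"
  shows "\<exists>y. (x, y) \<in> R\<^sup>* \<and> y \<notin> Domain R"
proof (rule ccontr)
  assume "\<not> ?thesis"
  then have dom: "R\<^sup>* `` {x} \<subseteq> Domain R" by auto
  define f where "f y = (THE z. (y, z) \<in> R)" for y
  have f: "(y, z) \<in> R \<Longrightarrow> f y = z" for y z
    unfolding f_def using sv by (auto dest: single_valuedD)
  have fR: "(y, f y) \<in> R" if "y \<in> R\<^sup>* `` {x}" for y
    using that dom f by blast
  have "finite (Domain R)" using fin by (simp add: finite_Domain)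
  then have finS: "finite (R\<^sup>* `` {x})" using dom finite_subset by blast
  have "inj_on f (R\<^sup>* `` {x})"
    by (intro inj_onI) (metis fR converseI single_valuedD svi)
  moreover have "f ` (R\<^sup>* `` {x}) \<subseteq> R\<^sup>* `` {x}"
    using fR by (auto intro: rtrancl_into_rtrancl)
  ultimately have "f ` (R\<^sup>* `` {x}) = R\<^sup>* `` {x}"
    using finS by (simp add: endo_inj_surj)
  then have "x \<in> f ` (R\<^sup>* `` {x})" by simp
  then obtain y where "y \<in> R\<^sup>* `` {x}" "x = f y" by (rule imageE)
  then show False using fR x by blast
qed

text \<open>Orient each strand from its positive end to its negative end. A walled diagram joins positive
  to negative vertices, and a vertex of the middle row of a stack has opposite signs in the two
  diagrams, so the strands of a stack become directed paths.\<close>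

definition pos_end :: "nat \<Rightarrow> vtx \<Rightarrow> bool" where
  "pos_end r x \<longleftrightarrow> (fst x \<longleftrightarrow> left_of_wall r x)"

text \<open>The two wall conditions and the absence of fixed points combine into the single
  requirement that the ends of a strand have opposite signs.\<close>

lemma wdiag_iff:
  "wdiag r s d \<longleftrightarrow> (\<forall>x. x \<notin> verts (r+s) \<longrightarrow> d x = x) \<and>
     (\<forall>x \<in> verts (r+s). d x \<in> verts (r+s) \<and> d (d x) = x \<and> (pos_end r (d x) \<longleftrightarrow> \<not> pos_end r x))"
proof -
  have "(d x \<noteq> x \<and> (fst (d x) \<noteq> fst x \<longrightarrow> (left_of_wall r (d x) \<longleftrightarrow> left_of_wall r x)) \<and>
        (fst (d x) = fst x \<longrightarrow> (left_of_wall r (d x) \<longleftrightarrow> \<not> left_of_wall r x))) \<longleftrightarrow>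
        (pos_end r (d x) \<longleftrightarrow> \<not> pos_end r x)" for x
    unfolding pos_end_def by auto
  then show ?thesis unfolding wdiag_def by blast
qed

lemma finite_verts [simp]: "finite (verts n)"
  by (simp add: verts_def)

lemma mem_verts [simp]: "(b, i) \<in> verts n \<longleftrightarrow> 1 \<le> i \<and> i \<le> n"
  by (auto simp: verts_def)

definition stack_path :: "nat \<Rightarrow> nat \<Rightarrow> diag \<Rightarrow> diag \<Rightarrow> ((nat \<times> nat) \<times> (nat \<times> nat)) set" where
  "stack_path r s up lo =
     {(emb_up x, emb_up (up x)) | x. x \<in> verts (r+s) \<and> pos_end r x} \<union>
     {(emb_lo x, emb_lo (lo x)) | x. x \<in> verts (r+s) \<and> pos_end r x}"

lemma emb_out_inj: "emb_out x = emb_out y \<Longrightarrow> x = y"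
  by (auto simp: emb_out_def prod_eq_iff split: if_splits)

lemma stack_conn_sym: "(a, b) \<in> stack_conn n u l \<Longrightarrow> (b, a) \<in> stack_conn n u l"
  unfolding stack_conn_def by (metis converse_Un converse_converse rtrancl_converseD sup_commute converseI)

lemma stack_conn_trans: "(a, b) \<in> stack_conn n u l \<Longrightarrow> (b, c) \<in> stack_conn n u l \<Longrightarrow> (a, c) \<in> stack_conn n u l"
  unfolding stack_conn_def by auto

lemma stack_conn_refl [simp]: "(a, a) \<in> stack_conn n u l"
  unfolding stack_conn_def by auto

context
  fixes r s :: nat and up lo :: diag
  assumes up: "wdiag r s up" and lo: "wdiag r s lo"
begin

lemma stack_pathI:
  assumes "x \<in> verts (r+s)"
  shows "pos_end r x \<Longrightarrow> (emb_up x, emb_up (up x)) \<in> stack_path r s up lo"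
    "pos_end r x \<Longrightarrow> (emb_lo x, emb_lo (lo x)) \<in> stack_path r s up lo"
    "\<not> pos_end r x \<Longrightarrow> (emb_up (up x), emb_up x) \<in> stack_path r s up lo"
    "\<not> pos_end r x \<Longrightarrow> (emb_lo (lo x), emb_lo x) \<in> stack_path r s up lo"
proof -
  have u: "up x \<in> verts (r+s)" "up (up x) = x" "pos_end r (up x) \<longleftrightarrow> \<not> pos_end r x"
    and l: "lo x \<in> verts (r+s)" "lo (lo x) = x" "pos_end r (lo x) \<longleftrightarrow> \<not> pos_end r x"
    using assms up lo unfolding wdiag_iff by blast+
  show "pos_end r x \<Longrightarrow> (emb_up x, emb_up (up x)) \<in> stack_path r s up lo"
    "pos_end r x \<Longrightarrow> (emb_lo x, emb_lo (lo x)) \<in> stack_path r s up lo"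
    unfolding stack_path_def using assms by blast+
  show "(emb_up (up x), emb_up x) \<in> stack_path r s up lo" if "\<not> pos_end r x"
  proof -
    have "(emb_up (up x), emb_up (up (up x))) \<in> stack_path r s up lo"
      unfolding stack_path_def using u(1,3) that by blast
    then show ?thesis using u(2) by simp
  qed
  show "(emb_lo (lo x), emb_lo x) \<in> stack_path r s up lo" if "\<not> pos_end r x"
  proof -
    have "(emb_lo (lo x), emb_lo (lo (lo x))) \<in> stack_path r s up lo"
      unfolding stack_path_def using l(1,3) that by blast
    then show ?thesis using l(2) by simp
  qed
qed

lemma stack_pathE:
  assumes "(p, q) \<in> stack_path r s up lo"
  obtains x where "x \<in> verts (r+s)" "pos_end r x" "p = emb_up x" "q = emb_up (up x)"
      "up x \<in> verts (r+s)" "up (up x) = x" "\<not> pos_end r (up x)"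
    | x where "x \<in> verts (r+s)" "pos_end r x" "p = emb_lo x" "q = emb_lo (lo x)"
      "lo x \<in> verts (r+s)" "lo (lo x) = x" "\<not> pos_end r (lo x)"
  using assms up lo unfolding wdiag_iff stack_path_def by blast

lemma stack_edges_path:
  "stack_edges (r+s) up lo \<union> (stack_edges (r+s) up lo)\<inverse> = stack_path r s up lo \<union> (stack_path r s up lo)\<inverse>"
proof -
  have "stack_edges (r+s) up lo \<subseteq> stack_path r s up lo \<union> (stack_path r s up lo)\<inverse>"
    unfolding stack_edges_def using stack_pathI by blast
  moreover have "stack_path r s up lo \<subseteq> stack_edges (r+s) up lo"
    unfolding stack_edges_def stack_path_def by blast
  ultimately show ?thesis by blast
qed

lemma stack_conn_path: "stack_conn (r+s) up lo = (stack_path r s up lo \<union> (stack_path r s up lo)\<inverse>)\<^sup>*"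
  by (simp add: stack_conn_def stack_edges_path)

lemma finite_stack_path: "finite (stack_path r s up lo)"
proof -
  have "stack_path r s up lo \<subseteq> (\<lambda>x. (emb_up x, emb_up (up x))) ` verts (r+s) \<union> (\<lambda>x. (emb_lo x, emb_lo (lo x))) ` verts (r+s)"
    unfolding stack_path_def by blast
  then show ?thesis by (rule finite_subset) simp
qed

lemma single_valued_stack_path: "single_valued (stack_path r s up lo)"
proof (rule single_valuedI)
  fix p a b assume "(p, a) \<in> stack_path r s up lo" "(p, b) \<in> stack_path r s up lo"
  moreover have i: "emb_up x = emb_up y \<Longrightarrow> x = y" "emb_lo x = emb_lo y \<Longrightarrow> x = y" for x y
    by (auto simp: emb_up_def emb_lo_def prod_eq_iff split: if_splits)
  moreover have "emb_up x = emb_lo y \<Longrightarrow> pos_end r x \<longleftrightarrow> \<not> pos_end r y" for x y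
    by (auto simp: emb_up_def emb_lo_def prod_eq_iff pos_end_def left_of_wall_def split: if_splits)
  ultimately show "a = b"
    by (elim stack_pathE) (metis i)+
qed

lemma single_valued_stack_path_converse: "single_valued ((stack_path r s up lo)\<inverse>)"
proof (rule single_valuedI)
  fix p a b assume "(p, a) \<in> (stack_path r s up lo)\<inverse>" "(p, b) \<in> (stack_path r s up lo)\<inverse>"
  then have "(a, p) \<in> stack_path r s up lo" "(b, p) \<in> stack_path r s up lo" by auto
  moreover have i: "emb_up x = emb_up y \<Longrightarrow> x = y" "emb_lo x = emb_lo y \<Longrightarrow> x = y" for x y
    by (auto simp: emb_up_def emb_lo_def prod_eq_iff split: if_splits)
  moreover have "emb_up x = emb_lo y \<Longrightarrow> pos_end r x \<longleftrightarrow> \<not> pos_end r y" for x y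
    by (auto simp: emb_up_def emb_lo_def prod_eq_iff pos_end_def left_of_wall_def split: if_splits)
  ultimately show "a = b"
    by (elim stack_pathE) (metis i)+
qed

lemma emb_out_Range: "x \<in> verts (r+s) \<Longrightarrow> emb_out x \<in> Range (stack_path r s up lo) \<longleftrightarrow> \<not> pos_end r x"
proof -
  assume x: "x \<in> verts (r+s)"
  have 1: "emb_out x = emb_up y \<Longrightarrow> x = y" "emb_out x = emb_lo y \<Longrightarrow> x = y" for y
    by (auto simp: emb_out_def emb_up_def emb_lo_def prod_eq_iff split: if_splits)
  have 2: "emb_out x = emb_up x \<or> emb_out x = emb_lo x"
    by (auto simp: emb_out_def emb_up_def emb_lo_def)
  show ?thesis
  proof
    assume "emb_out x \<in> Range (stack_path r s up lo)"
    then show "\<not> pos_end r x"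
      using 1 by (elim RangeE stack_pathE) metis+
  next
    assume n: "\<not> pos_end r x"
    show "emb_out x \<in> Range (stack_path r s up lo)"
      using 2 stack_pathI(3,4)[OF x n] by (metis Range.intros)
  qed
qed

lemma emb_out_Domain: "x \<in> verts (r+s) \<Longrightarrow> emb_out x \<in> Domain (stack_path r s up lo) \<longleftrightarrow> pos_end r x"
proof -
  assume x: "x \<in> verts (r+s)"
  have 1: "emb_out x = emb_up y \<Longrightarrow> x = y" "emb_out x = emb_lo y \<Longrightarrow> x = y" for y
    by (auto simp: emb_out_def emb_up_def emb_lo_def prod_eq_iff split: if_splits)
  have 2: "emb_out x = emb_up x \<or> emb_out x = emb_lo x"
    by (auto simp: emb_out_def emb_up_def emb_lo_def)
  show ?thesis
  proof
    assume "emb_out x \<in> Domain (stack_path r s up lo)"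
    then show "pos_end r x"
      using 1 by (elim DomainE stack_pathE) metis+
  next
    assume n: "pos_end r x"
    show "emb_out x \<in> Domain (stack_path r s up lo)"
      using 2 stack_pathI(1,2)[OF x n] by (metis Domain.DomainI)
  qed
qed

lemma middle_Domain_Range:
  assumes "i \<in> {1..r+s}"
  shows "(1, i) \<in> Domain (stack_path r s up lo)" "(1, i) \<in> Range (stack_path r s up lo)"
proof -
  have e: "emb_up (False, i) = (1, i)" "emb_lo (True, i) = (1, i)"
    by (auto simp: emb_up_def emb_lo_def)
  have v: "(b, i) \<in> verts (r+s)" for b using assms by simp
  have p: "pos_end r (True, i) \<longleftrightarrow> \<not> pos_end r (False, i)" by (simp add: pos_end_def left_of_wall_def)
  show "(1, i) \<in> Domain (stack_path r s up lo)"
    using stack_pathI(1,2)[OF v] e p by (metis Domain.DomainI)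
  show "(1, i) \<in> Range (stack_path r s up lo)"
    using stack_pathI(3,4)[OF v] e p by (metis Range.intros)
qed

lemma stack_path_nodes:
  assumes "(p, q) \<in> stack_path r s up lo"
  shows "(\<exists>x \<in> verts (r+s). q = emb_out x) \<or> (\<exists>i \<in> {1..r+s}. q = (1, i))"
    "(\<exists>x \<in> verts (r+s). p = emb_out x) \<or> (\<exists>i \<in> {1..r+s}. p = (1, i))"
proof -
  have e: "(\<exists>x \<in> verts (r+s). emb_up y = emb_out x) \<or> (\<exists>i \<in> {1..r+s}. emb_up y = (1, i))"
     "(\<exists>x \<in> verts (r+s). emb_lo y = emb_out x) \<or> (\<exists>i \<in> {1..r+s}. emb_lo y = (1, i))" if "y \<in> verts (r+s)" for y
    using that by (cases "fst y"; force simp: emb_up_def emb_lo_def emb_out_def verts_def)+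
  show "(\<exists>x \<in> verts (r+s). q = emb_out x) \<or> (\<exists>i \<in> {1..r+s}. q = (1, i))"
    "(\<exists>x \<in> verts (r+s). p = emb_out x) \<or> (\<exists>i \<in> {1..r+s}. p = (1, i))"
    using assms e by (elim stack_pathE; metis)+
qed

text \<open>The directed path through an outer vertex, followed forwards from a positive and
  backwards from a negative one, must stop. Middle vertices always have a successor and a
  predecessor, so it stops at an outer vertex, of the opposite sign.\<close>

lemma stack_conn_partner:
  assumes x: "x \<in> verts (r+s)"
  shows "\<exists>y. y \<in> verts (r+s) \<and> (emb_out x, emb_out y) \<in> stack_conn (r+s) up lo \<and> (pos_end r y \<longleftrightarrow> \<not> pos_end r x)"
proof -
  let ?R = "stack_path r s up lo"
  have sub: "?R\<^sup>* \<subseteq> stack_conn (r+s) up lo" "(?R\<inverse>)\<^sup>* \<subseteq> stack_conn (r+s) up lo"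
    unfolding stack_conn_path by (auto intro: rtrancl_mono[THEN subsetD])
  show ?thesis
  proof (cases "pos_end r x")
    case True
    then have "emb_out x \<notin> Range ?R" using emb_out_Range[OF x] by simp
    from finite_path_ends[OF finite_stack_path single_valued_stack_path single_valued_stack_path_converse this]
    obtain q where q: "(emb_out x, q) \<in> ?R\<^sup>*" "q \<notin> Domain ?R" by blast
    then have "q \<noteq> emb_out x" using True emb_out_Domain[OF x] by auto
    then obtain p where "(p, q) \<in> ?R" using q(1) by (metis rtranclE)
    then obtain y where y: "y \<in> verts (r+s)" "q = emb_out y"
      using stack_path_nodes(1) middle_Domain_Range(1) q(2) by blast
    then show ?thesis using q sub emb_out_Domain[OF y(1)] True by (metis subsetD)
  next
    case False
    then have "emb_out x \<notin> Range (?R\<inverse>)" using emb_out_Domain[OF x] by simp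
    from finite_path_ends[OF _ single_valued_stack_path_converse _ this]
    obtain q where q: "(emb_out x, q) \<in> (?R\<inverse>)\<^sup>*" "q \<notin> Domain (?R\<inverse>)"
      using finite_stack_path single_valued_stack_path by auto
    then have "q \<noteq> emb_out x" using False emb_out_Range[OF x] by auto
    then obtain p where "(p, q) \<in> ?R\<inverse>" using q(1) by (metis rtranclE)
    then have "(q, p) \<in> ?R" by simp
    then obtain y where y: "y \<in> verts (r+s)" "q = emb_out y"
      using stack_path_nodes(2) middle_Domain_Range(2) q(2) by (metis Domain_converse)
    then show ?thesis using q sub emb_out_Range[OF y(1)] False by (metis subsetD Domain_converse)
  qed
qed

lemma stack_conn_unique_pos:
  assumes x: "x \<in> verts (r+s)" "pos_end r x" and y: "y \<in> verts (r+s)" "y \<noteq> x"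
    and xy: "(emb_out x, emb_out y) \<in> stack_conn (r+s) up lo"
  shows "(emb_out x, emb_out y) \<in> (stack_path r s up lo)\<^sup>* \<and> \<not> pos_end r y"
proof -
  let ?R = "stack_path r s up lo"
  have "(emb_out x, emb_out y) \<in> ?R\<^sup>* \<or> (emb_out y, emb_out x) \<in> ?R\<^sup>*"
    using xy biunique_conn[OF single_valued_stack_path single_valued_stack_path_converse]
    unfolding stack_conn_path by blast
  moreover have "(emb_out y, emb_out x) \<notin> ?R\<^sup>*"
    using emb_out_Range[OF x(1)] x(2) y(2) emb_out_inj by (metis Range.intros rtranclE)
  ultimately have *: "(emb_out x, emb_out y) \<in> ?R\<^sup>*" by blast
  then have "emb_out y \<in> Range ?R" using y(2) emb_out_inj by (metis Range.intros rtranclE)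
  then show ?thesis using * emb_out_Range[OF y(1)] by blast
qed

text \<open>Paths from a common positive start are nested, so their outer end is unique. A negative
  \<open>x\<close> is reduced to this case through its positive partner.\<close>

lemma stack_conn_unique:
  assumes x: "x \<in> verts (r+s)" and y: "y \<in> verts (r+s)" "y \<noteq> x" and z: "z \<in> verts (r+s)" "z \<noteq> x"
    and xy: "(emb_out x, emb_out y) \<in> stack_conn (r+s) up lo"
    and xz: "(emb_out x, emb_out z) \<in> stack_conn (r+s) up lo"
  shows "y = z"
proof -
  let ?R = "stack_path r s up lo"
  have pos: "y = z" if "x \<in> verts (r+s)" "pos_end r x" "y \<in> verts (r+s)" "y \<noteq> x" "z \<in> verts (r+s)" "z \<noteq> x"
     "(emb_out x, emb_out y) \<in> stack_conn (r+s) up lo" "(emb_out x, emb_out z) \<in> stack_conn (r+s) up lo" for x y z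
  proof -
    have a: "(emb_out x, emb_out y) \<in> ?R\<^sup>*" "(emb_out x, emb_out z) \<in> ?R\<^sup>*" "\<not> pos_end r y" "\<not> pos_end r z"
      using stack_conn_unique_pos that by blast+
    then have "(emb_out y, emb_out z) \<in> ?R\<^sup>* \<or> (emb_out z, emb_out y) \<in> ?R\<^sup>*"
      using single_valued_rtrancl_linear[OF single_valued_stack_path] by blast
    then show "y = z"
      using emb_out_Domain that a emb_out_inj by (metis Domain.DomainI converse_rtranclE)
  qed
  show ?thesis
  proof (cases "pos_end r x")
    case True
    then show ?thesis using pos assms by blast
  next
    case False
    show ?thesis
    proof (rule ccontr)
      assume "y \<noteq> z"
      have "pos_end r y"
      proof (rule ccontr)
        assume ny: "\<not> pos_end r y"
        obtain w where w: "w \<in> verts (r+s)" "(emb_out x, emb_out w) \<in> stack_conn (r+s) up lo" "pos_end r w"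
          using stack_conn_partner[OF x] False by blast
        have "x = y"
          using pos[of w x y] w False ny x y xy by (metis stack_conn_sym stack_conn_trans)
        then show False using y by simp
      qed
      then have "x = z"
        using pos[of y x z] x y z xy xz \<open>y \<noteq> z\<close> by (metis stack_conn_sym stack_conn_trans)
      then show False using z by simp
    qed
  qed
qed

lemma compose_props:
  assumes x: "x \<in> verts (r+s)"
  shows "compose (r+s) up lo x \<in> verts (r+s)"
    "(emb_out x, emb_out (compose (r+s) up lo x)) \<in> stack_conn (r+s) up lo"
    "pos_end r (compose (r+s) up lo x) \<longleftrightarrow> \<not> pos_end r x"
proof -
  obtain y where y: "y \<in> verts (r+s)" "(emb_out x, emb_out y) \<in> stack_conn (r+s) up lo" "pos_end r y \<longleftrightarrow> \<not> pos_end r x"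
    using stack_conn_partner[OF x] by blast
  have "(THE y. y \<in> verts (r+s) \<and> y \<noteq> x \<and> (emb_out x, emb_out y) \<in> stack_conn (r+s) up lo) = y"
    using x y stack_conn_unique[OF x] by (intro the_equality) blast+
  then have "compose (r+s) up lo x = y"
    unfolding compose_def using x by simp
  then show "compose (r+s) up lo x \<in> verts (r+s)"
    "(emb_out x, emb_out (compose (r+s) up lo x)) \<in> stack_conn (r+s) up lo"
    "pos_end r (compose (r+s) up lo x) \<longleftrightarrow> \<not> pos_end r x"
    using y by auto
qed

lemma compose_eqI:
  assumes "x \<in> verts (r+s)" "y \<in> verts (r+s)" "y \<noteq> x" "(emb_out x, emb_out y) \<in> stack_conn (r+s) up lo"
  shows "compose (r+s) up lo x = y"
  using stack_conn_unique[OF assms(1) _ _ assms(2,3) _ assms(4)] compose_props[OF assms(1)] by metis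

lemma wdiag_compose: "wdiag r s (compose (r+s) up lo)"
  unfolding wdiag_iff
proof (intro conjI allI impI ballI)
  fix x assume "x \<notin> verts (r+s)"
  then show "compose (r+s) up lo x = x" by (simp add: compose_def)
next
  fix x assume x: "x \<in> verts (r+s)"
  note p = compose_props[OF x]
  show "compose (r+s) up lo x \<in> verts (r+s)" "pos_end r (compose (r+s) up lo x) \<longleftrightarrow> \<not> pos_end r x"
    using p by auto
  show "compose (r+s) up lo (compose (r+s) up lo x) = x"
    using compose_eqI[OF p(1) x] p stack_conn_sym[OF p(2)] by metis
qed

end

section \<open>Counting colourings\<close>

text \<open>The number of two-colourings of the middle row of a stack that extend given colourings of the
  outer rows determines both the composite diagram and the number of closed loops. Counting the
  colourings of the two middle rows of a triple stack in two ways therefore gives associativity.\<close>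

definition colour :: "nat set \<Rightarrow> nat set \<Rightarrow> vtx \<Rightarrow> bool" where
  "colour T B x \<longleftrightarrow> snd x \<in> (if fst x then T else B)"

definition compat :: "nat \<Rightarrow> diag \<Rightarrow> nat set \<Rightarrow> nat set \<Rightarrow> bool" where
  "compat n d T B \<longleftrightarrow> (\<forall>x \<in> verts n. colour T B x \<longleftrightarrow> colour T B (d x))"

lemma colour_simps [simp]: "colour T B (True, i) \<longleftrightarrow> i \<in> T" "colour T B (False, i) \<longleftrightarrow> i \<in> B"
  by (auto simp: colour_def)

lemma compat_empty [simp]: "compat n d {} {}"
  by (simp add: compat_def colour_def)

definition middle_colourings :: "nat \<Rightarrow> diag \<Rightarrow> diag \<Rightarrow> nat set \<Rightarrow> nat set \<Rightarrow> nat set set" where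
  "middle_colourings n up lo T B = {H. H \<subseteq> {1..n} \<and> compat n up T H \<and> compat n lo H B}"

lemma finite_middle_colourings [simp]: "finite (middle_colourings n up lo T B)"
  by (rule finite_subset[of _ "Pow {1..n}"]) (auto simp: middle_colourings_def)

text \<open>Everything connected to an outer vertex has its colour forced, consistently so exactly
  when the composite diagram is compatible with the outer colours; the closed loops can be coloured
  freely and independently.\<close>

lemma card_middle_colourings:
  assumes up: "wdiag r s up" and lo: "wdiag r s lo"
  shows "card (middle_colourings (r+s) up lo T B) =
    (if compat (r+s) (compose (r+s) up lo) T B then 2 ^ loops (r+s) up lo else 0)"
proof -
  let ?n = "r+s"
  let ?conn = "stack_conn ?n up lo"
  let ?c = "compose ?n up lo"
  define g where "g H p = (if fst p = (0::nat) then snd p \<in> T else if fst p = 1 then snd p \<in> H else snd p \<in> B)" for H and p :: "nat \<times> nat"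
  have g_up: "g H (emb_up x) \<longleftrightarrow> colour T H x" for H x by (simp add: g_def emb_up_def colour_def)
  have g_lo: "g H (emb_lo x) \<longleftrightarrow> colour H B x" for H x by (simp add: g_def emb_lo_def colour_def)
  have g_out: "g H (emb_out x) \<longleftrightarrow> colour T B x" for H x by (simp add: g_def emb_out_def colour_def)
  have g_mid: "g H (1, i) \<longleftrightarrow> i \<in> H" for H i by (simp add: g_def)
  have edges: "compat ?n up T H \<and> compat ?n lo H B \<longleftrightarrow> (\<forall>p q. (p, q) \<in> stack_edges ?n up lo \<longrightarrow> g H p = g H q)" for H
  proof -
    have "(\<forall>p q. (p, q) \<in> stack_edges ?n up lo \<longrightarrow> g H p = g H q) \<longleftrightarrow>
      (\<forall>x\<in>verts ?n. g H (emb_up x) = g H (emb_up (up x))) \<and> (\<forall>x\<in>verts ?n. g H (emb_lo x) = g H (emb_lo (lo x)))"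
      unfolding stack_edges_def by blast
    then show ?thesis unfolding compat_def g_up g_lo by blast
  qed
  have conn: "g H p = g H q" if "H \<in> middle_colourings ?n up lo T B" "(p, q) \<in> ?conn" for H p q
  proof -
    have "\<forall>p q. (p, q) \<in> stack_edges ?n up lo \<longrightarrow> g H p = g H q"
      using edges that(1) unfolding middle_colourings_def by blast
    note * = this
    from that(2)[unfolded stack_conn_def] show ?thesis
      by (induction rule: rtrancl_induct) (use * in blast)+
  qed
  show ?thesis
  proof (cases "compat ?n ?c T B")
    case False
    then obtain x where x: "x \<in> verts ?n" "colour T B x \<noteq> colour T B (?c x)" unfolding compat_def by blast
    have "middle_colourings ?n up lo T B = {}"
      using conn[OF _ compose_props(2)[OF up lo x(1)]] x(2) g_out by blast
    then show ?thesis using False by simp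
  next
    case True
    define Om where "Om = {i \<in> {1..?n}. \<forall>y\<in>verts ?n. ((1,i), emb_out y) \<notin> ?conn}"
    define cl where "cl i = ?conn `` {(1::nat, i::nat)}" for i
    \<comment> \<open>A colouring is encoded by the set of closed loops that it contains.\<close>
    define F where "F H = cl ` (H \<inter> Om)" for H
    have loops: "loops ?n up lo = card (cl ` Om)"
      unfolding loops_def Om_def cl_def by (rule arg_cong[where f=card]) auto
    have finOm: "finite Om" unfolding Om_def by simp
    have cl_eq: "cl i = cl j \<longleftrightarrow> ((1,i),(1,j)) \<in> ?conn" for i j
      unfolding cl_def using stack_conn_sym stack_conn_trans stack_conn_refl by blast
    have inj: "inj_on F (middle_colourings ?n up lo T B)"
    proof (rule inj_onI, rule ccontr)
      have sub: "H \<subseteq> H'" if H: "H \<in> middle_colourings ?n up lo T B" and H': "H' \<in> middle_colourings ?n up lo T B" and F: "F H = F H'" for H H'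
      proof
        fix i assume i: "i \<in> H"
        show "i \<in> H'"
        proof (cases "i \<in> Om")
          case True
          then have "cl i \<in> F H'" using F i unfolding F_def by blast
          then obtain j where "j \<in> H'" "((1,i),(1,j)) \<in> ?conn" unfolding F_def cl_eq[symmetric] by blast
          then show ?thesis using conn[OF H'] g_mid by metis
        next
          case False
          moreover have "i \<in> {1..?n}" using H i unfolding middle_colourings_def by blast
          ultimately obtain y where "((1,i), emb_out y) \<in> ?conn" unfolding Om_def by blast
          then show ?thesis using conn[OF H'] conn[OF H] g_mid g_out i by metis
        qed
      qed
      fix H H' assume "H \<in> middle_colourings ?n up lo T B" "H' \<in> middle_colourings ?n up lo T B" "F H = F H'" "H \<noteq> H'"
      then show False using sub[of H H'] sub[of H' H] by auto
    qed
    have "F ` middle_colourings ?n up lo T B = Pow (cl ` Om)"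
    proof (intro equalityI subsetI)
      fix S assume "S \<in> F ` middle_colourings ?n up lo T B"
      then show "S \<in> Pow (cl ` Om)" unfolding F_def by blast
    next
      fix S assume S: "S \<in> Pow (cl ` Om)"
      \<comment> \<open>The colouring with prescribed set \<open>S\<close> of loops: nodes connected
        to the outer rows copy the outer colour, all others ask whether their component belongs to
        \<open>S\<close>.\<close>
      define \<gamma> where "\<gamma> p \<longleftrightarrow> (if \<exists>y\<in>verts ?n. (p, emb_out y) \<in> ?conn then \<exists>y\<in>verts ?n. (p, emb_out y) \<in> ?conn \<and> colour T B y else ?conn `` {p} \<in> S)" for p
      define H where "H = {i \<in> {1..?n}. \<gamma> (1, i)}"
      have \<gamma>_conn: "\<gamma> p = \<gamma> q" if "(p, q) \<in> ?conn" for p q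
      proof -
        have "(p, z) \<in> ?conn \<longleftrightarrow> (q, z) \<in> ?conn" for z
          using that stack_conn_sym stack_conn_trans by metis
        then show ?thesis unfolding \<gamma>_def Image_singleton by simp
      qed
      have out_eq: "colour T B y = colour T B x" if "x \<in> verts ?n" "y \<in> verts ?n" "(emb_out x, emb_out y) \<in> ?conn" for x y
        using compose_eqI[OF up lo that(1,2) _ that(3)] True that unfolding compat_def by metis
      have \<gamma>_out: "\<gamma> (emb_out x) = g H (emb_out x)" if "x \<in> verts ?n" for x
        unfolding \<gamma>_def g_out using that out_eq[OF that] stack_conn_refl by metis
      have \<gamma>_mid: "\<gamma> (1, i) = g H (1, i)" if "i \<in> {1..?n}" for i
        unfolding g_mid H_def using that by simp
      have node: "\<gamma> (emb_up x) = g H (emb_up x)" "\<gamma> (emb_lo x) = g H (emb_lo x)" if "x \<in> verts ?n" for x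
      proof -
        have i: "snd x \<in> {1..?n}" using that by (auto simp: verts_def)
        show "\<gamma> (emb_up x) = g H (emb_up x)" "\<gamma> (emb_lo x) = g H (emb_lo x)"
          using \<gamma>_out[OF that] \<gamma>_mid[OF i] by (auto simp: emb_up_def emb_lo_def emb_out_def)
      qed
      have nodes: "\<gamma> p = g H p \<and> \<gamma> q = g H q" if "(p, q) \<in> stack_edges ?n up lo" for p q
      proof -
        have "up x \<in> verts ?n" "lo x \<in> verts ?n" if "x \<in> verts ?n" for x
          using that up lo unfolding wdiag_iff by blast+
        then show ?thesis using that node unfolding stack_edges_def by blast
      qed
      have "g H p = g H q" if "(p, q) \<in> stack_edges ?n up lo" for p q
        using nodes[OF that] \<gamma>_conn[of p q] that unfolding stack_conn_def by blast
      then have "compat ?n up T H \<and> compat ?n lo H B" using edges by blast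
      then have HC: "H \<in> middle_colourings ?n up lo T B"
        unfolding middle_colourings_def H_def by blast
      have \<gamma>_Om: "\<gamma> (1, i) \<longleftrightarrow> cl i \<in> S" if "i \<in> Om" for i
        using that unfolding \<gamma>_def Om_def cl_def by simp
      have "F H = S"
      proof (intro equalityI subsetI)
        fix c assume "c \<in> F H"
        then obtain i where "i \<in> H" "i \<in> Om" "c = cl i" unfolding F_def by blast
        then show "c \<in> S" using \<gamma>_Om unfolding H_def by blast
      next
        fix c assume c: "c \<in> S"
        then obtain i where i: "i \<in> Om" "c = cl i" using S by blast
        then have "i \<in> H" using \<gamma>_Om c unfolding H_def Om_def by blast
        then show "c \<in> F H" using i unfolding F_def by blast
      qed
      then show "S \<in> F ` middle_colourings ?n up lo T B" using HC by blast
    qed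
    then have "card (middle_colourings ?n up lo T B) = card (Pow (cl ` Om))"
      using card_image[OF inj] by simp
    then show ?thesis using True loops finOm by (simp add: card_Pow)
  qed
qed

text \<open>Colour exactly the two ends of the strand of \<open>d\<close> at \<open>x\<close>. This
  colouring is compatible with \<open>d\<close>, and compatibility with \<open>d'\<close> confines
  \<open>d' x\<close> to these two ends.\<close>

lemma wdiag_eqI:
  assumes d: "wdiag r s d" and d': "wdiag r s d'"
    and eq: "\<And>T B. T \<subseteq> {1..r+s} \<Longrightarrow> B \<subseteq> {1..r+s} \<Longrightarrow> compat (r+s) d T B \<Longrightarrow> compat (r+s) d' T B"
  shows "d = d'"
proof
  fix x
  show "d x = d' x"
  proof (cases "x \<in> verts (r+s)")
    case False
    then show ?thesis using d d' unfolding wdiag_iff by metis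
  next
    case True
    have dx: "d x \<in> verts (r+s)" "d (d x) = x" using d True unfolding wdiag_iff by blast+
    define T where "T = {i. (True, i) \<in> {x, d x}}"
    define B where "B = {i. (False, i) \<in> {x, d x}}"
    have col: "colour T B y \<longleftrightarrow> y \<in> {x, d x}" for y
      by (cases y; cases "fst y") (auto simp: T_def B_def)
    have "compat (r+s) d T B" unfolding compat_def col
    proof
      fix y assume "y \<in> verts (r+s)"
      then have "d (d y) = y" using d unfolding wdiag_iff by blast
      then show "y \<in> {x, d x} \<longleftrightarrow> d y \<in> {x, d x}" using dx(2) unfolding insert_iff empty_iff by metis
    qed
    moreover have "T \<subseteq> {1..r+s}" "B \<subseteq> {1..r+s}"
      using True dx(1) unfolding T_def B_def verts_def by auto
    ultimately have "compat (r+s) d' T B" using eq by blast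
    then have "d' x \<in> {x, d x}" using True col unfolding compat_def by blast
    moreover have "d' x \<noteq> x" using d' True unfolding wdiag_def by blast
    ultimately show ?thesis by simp
  qed
qed

text \<open>Criterion behind the explicit products of diagrams below. The empty colouring is always
  compatible and reads off the number of loops; the places where the count is nonzero determine the
  composite.\<close>

lemma compose_loops_eqI:
  assumes up: "wdiag r s up" and lo: "wdiag r s lo" and d: "wdiag r s d"
    and card: "\<And>T B. T \<subseteq> {1..r+s} \<Longrightarrow> B \<subseteq> {1..r+s} \<Longrightarrow>
      card (middle_colourings (r+s) up lo T B) = (if compat (r+s) d T B then 2 ^ l else 0)"
  shows "compose (r+s) up lo = d" "loops (r+s) up lo = l"
proof -
  have "(2::nat) ^ loops (r+s) up lo = 2 ^ l"
    using card_middle_colourings[OF up lo, of "{}" "{}"] card[of "{}" "{}"] by simp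
  then show l: "loops (r+s) up lo = l" by simp
  have "compat (r+s) (compose (r+s) up lo) T B \<longleftrightarrow> compat (r+s) d T B" if "T \<subseteq> {1..r+s}" "B \<subseteq> {1..r+s}" for T B
    using card_middle_colourings[OF up lo, of T B] card[OF that] by (auto split: if_splits)
  then show "compose (r+s) up lo = d"
    using wdiag_eqI[OF wdiag_compose[OF up lo] d] by blast
qed

lemma compose_assoc:
  assumes a: "wdiag r s a" and b: "wdiag r s b" and c: "wdiag r s c"
  shows "compose (r+s) (compose (r+s) a b) c = compose (r+s) a (compose (r+s) b c)" (is "?l = ?r")
    and "loops (r+s) a b + loops (r+s) (compose (r+s) a b) c =
      loops (r+s) b c + loops (r+s) a (compose (r+s) b c)" (is "?k = ?m")
proof -
  let ?n = "r+s"
  note ab = wdiag_compose[OF a b] and bc = wdiag_compose[OF b c]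
  have eq: "(if compat ?n ?l T B then 2 ^ ?k else 0) = (if compat ?n ?r T B then 2 ^ ?m else (0::nat))" for T B
  proof -
    let ?S = "{(H1, H2). H1 \<subseteq> {1..?n} \<and> H2 \<subseteq> {1..?n} \<and> compat ?n a T H1 \<and> compat ?n b H1 H2 \<and> compat ?n c H2 B}"
    let ?X = "{H2. H2 \<subseteq> {1..?n} \<and> compat ?n c H2 B}" and ?Y = "{H1. H1 \<subseteq> {1..?n} \<and> compat ?n a T H1}"
    have fin: "finite ?X" "finite ?Y" by (auto intro: finite_subset[of _ "Pow {1..?n}"])
    have "?S = prod.swap ` Sigma ?X (middle_colourings ?n a b T)"
      unfolding middle_colourings_def by force
    then have "card ?S = card (Sigma ?X (middle_colourings ?n a b T))"
      by (simp add: card_image)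
    also have "\<dots> = (\<Sum>H2\<in>?X. card (middle_colourings ?n a b T H2))"
      using fin by simp
    also have "\<dots> = (\<Sum>H2\<in>?X. if compat ?n (compose ?n a b) T H2 then 2 ^ loops ?n a b else 0)"
      by (simp add: card_middle_colourings[OF a b])
    also have "\<dots> = (\<Sum>H2\<in>middle_colourings ?n (compose ?n a b) c T B. 2 ^ loops ?n a b)"
      using fin by (intro sum.mono_neutral_cong_right) (auto simp: middle_colourings_def)
    also have "\<dots> = (if compat ?n ?l T B then 2 ^ ?k else 0)"
      by (simp add: card_middle_colourings[OF ab c] power_add)
    finally have 1: "card ?S = (if compat ?n ?l T B then 2 ^ ?k else 0)" .
    have "?S = Sigma ?Y (\<lambda>H1. middle_colourings ?n b c H1 B)"
      unfolding middle_colourings_def by auto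
    then have "card ?S = (\<Sum>H1\<in>?Y. card (middle_colourings ?n b c H1 B))"
      using fin by simp
    also have "\<dots> = (\<Sum>H1\<in>?Y. if compat ?n (compose ?n b c) H1 B then 2 ^ loops ?n b c else 0)"
      by (simp add: card_middle_colourings[OF b c])
    also have "\<dots> = (\<Sum>H1\<in>middle_colourings ?n a (compose ?n b c) T B. 2 ^ loops ?n b c)"
      using fin by (intro sum.mono_neutral_cong_right) (auto simp: middle_colourings_def)
    also have "\<dots> = (if compat ?n ?r T B then 2 ^ ?m else 0)"
      by (simp add: card_middle_colourings[OF a bc] power_add)
    finally show ?thesis using 1 by simp
  qed
  have "(2::nat) ^ ?k = 2 ^ ?m" using eq[of "{}" "{}"] by simp
  then show "?k = ?m" by simp
  have "compat ?n ?l T B \<Longrightarrow> compat ?n ?r T B" for T B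
    using eq[of T B] by (auto split: if_splits)
  then show "?l = ?r"
    using wdiag_eqI[OF wdiag_compose[OF ab c] wdiag_compose[OF a bc]] by blast
qed

section \<open>Flips, permutation diagrams and surgery\<close>

text \<open>Reflection exchanging the two rows. It reverses stacking, hence induces an
  anti-involution \<open>fl\<close> of the algebra, by which statements about top rows carry over to
  bottom rows.\<close>

definition flip_diag :: "diag \<Rightarrow> diag" where
  "flip_diag d = (\<lambda>x. apfst Not (d (apfst Not x)))"

lemma flip_flip [simp]: "flip_diag (flip_diag d) = d"
  by (rule ext, simp add: flip_diag_def apfst_def map_prod_def split: prod.splits)

lemma wdiag_flip: "wdiag r s d \<Longrightarrow> wdiag r s (flip_diag d)"
proof -
  assume d: "wdiag r s d"
  have v: "apfst Not x \<in> verts (r+s) \<longleftrightarrow> x \<in> verts (r+s)" and p: "pos_end r (apfst Not x) \<longleftrightarrow> \<not> pos_end r x"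
    and i: "apfst Not (apfst Not x) = x" for x :: vtx
    by (cases x; auto simp: verts_def pos_end_def left_of_wall_def)+
  show ?thesis using d unfolding wdiag_iff flip_diag_def by (simp add: v p i)
qed

lemma compat_flip: "compat n (flip_diag d) T B \<longleftrightarrow> compat n d B T"
proof -
  have c: "colour T B (apfst Not x) \<longleftrightarrow> colour B T x" and v: "apfst Not x \<in> verts n \<longleftrightarrow> x \<in> verts n"
    and i: "apfst Not (apfst Not x) = x" for x T B
    by (cases x; auto simp: verts_def colour_def)+
  show ?thesis unfolding compat_def flip_diag_def c by (metis c v i)
qed

lemma compose_flip:
  assumes up: "wdiag r s up" and lo: "wdiag r s lo"
  shows "compose (r+s) (flip_diag lo) (flip_diag up) = flip_diag (compose (r+s) up lo)"
    "loops (r+s) (flip_diag lo) (flip_diag up) = loops (r+s) up lo"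
proof -
  have "middle_colourings (r+s) (flip_diag lo) (flip_diag up) T B = middle_colourings (r+s) up lo B T" for T B
    unfolding middle_colourings_def compat_flip by blast
  then have "card (middle_colourings (r+s) (flip_diag lo) (flip_diag up) T B) =
    (if compat (r+s) (flip_diag (compose (r+s) up lo)) T B then 2 ^ loops (r+s) up lo else 0)" for T B
    by (simp add: card_middle_colourings[OF up lo] compat_flip)
  from compose_loops_eqI[OF wdiag_flip[OF lo] wdiag_flip[OF up] wdiag_flip[OF wdiag_compose[OF up lo]] this]
  show "compose (r+s) (flip_diag lo) (flip_diag up) = flip_diag (compose (r+s) up lo)"
    "loops (r+s) (flip_diag lo) (flip_diag up) = loops (r+s) up lo" by auto
qed

section \<open>Permutation diagrams that respect the wall\<close>

definition wall_perm :: "nat \<Rightarrow> nat \<Rightarrow> (nat \<Rightarrow> nat) \<Rightarrow> bool" where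
  "wall_perm r s \<sigma> \<longleftrightarrow> \<sigma> permutes {1..r+s} \<and> (\<forall>i. \<sigma> i \<le> r \<longleftrightarrow> i \<le> r)"

text \<open>Top vertex \<open>i\<close> is joined to bottom vertex \<open>\<sigma> i\<close>. As the
  left factor of a product is stacked below, products of these diagrams become compositions in the
  same order.\<close>

definition perm_diag :: "nat \<Rightarrow> (nat \<Rightarrow> nat) \<Rightarrow> diag" where
  "perm_diag n \<sigma> = (\<lambda>x. if x \<in> verts n then (if fst x then (False, \<sigma> (snd x)) else (True, inv \<sigma> (snd x))) else x)"

lemma wall_perm_bij: "wall_perm r s \<sigma> \<Longrightarrow> bij \<sigma>"
  unfolding wall_perm_def using permutes_bij by blast

lemma wall_perm_inv_apply: "wall_perm r s \<sigma> \<Longrightarrow> inv \<sigma> (\<sigma> i) = i" "wall_perm r s \<sigma> \<Longrightarrow> \<sigma> (inv \<sigma> i) = i"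
  by (auto simp: wall_perm_def permutes_inverses)

lemma wall_perm_id [simp]: "wall_perm r s id"
  by (simp add: wall_perm_def permutes_id)

lemma wall_perm_comp: "wall_perm r s \<sigma> \<Longrightarrow> wall_perm r s \<tau> \<Longrightarrow> wall_perm r s (\<sigma> \<circ> \<tau>)"
  by (auto simp: wall_perm_def permutes_compose)

lemma wall_perm_inv: "wall_perm r s \<sigma> \<Longrightarrow> wall_perm r s (inv \<sigma>)"
  unfolding wall_perm_def by (metis permutes_inv permutes_inverses(1))

lemma wall_perm_le: "wall_perm r s \<sigma> \<Longrightarrow> \<sigma> i \<le> r \<longleftrightarrow> i \<le> r"
  by (simp add: wall_perm_def)

lemma wall_perm_mem: "wall_perm r s \<sigma> \<Longrightarrow> 1 \<le> \<sigma> i \<and> \<sigma> i \<le> r+s \<longleftrightarrow> 1 \<le> i \<and> i \<le> r+s"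
  using permutes_in_image[of \<sigma> "{1..r+s}" i] by (simp add: wall_perm_def)

lemma wall_perm_transpose:
  "a \<in> {1..r+s} \<Longrightarrow> b \<in> {1..r+s} \<Longrightarrow> (a \<le> r \<longleftrightarrow> b \<le> r) \<Longrightarrow> wall_perm r s (Transposition.transpose a b)"
  by (auto simp: wall_perm_def permutes_swap_id transpose_def)

lemma wdiag_perm_diag:
  assumes "wall_perm r s \<sigma>"
  shows "wdiag r s (perm_diag (r+s) \<sigma>)"
  unfolding wdiag_iff
proof (intro conjI allI impI ballI)
  fix x assume "x \<notin> verts (r+s)" then show "perm_diag (r+s) \<sigma> x = x" by (simp add: perm_diag_def)
next
  fix x assume x: "x \<in> verts (r+s)"
  then obtain b i where xi: "x = (b, i)" and i: "1 \<le> i" "i \<le> r+s" by (cases x) auto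
  have m: "(1 \<le> \<sigma> i \<and> \<sigma> i \<le> r+s)" "(1 \<le> inv \<sigma> i \<and> inv \<sigma> i \<le> r+s)"
    using wall_perm_mem[OF assms, of i] wall_perm_mem[OF wall_perm_inv[OF assms], of i] i by auto
  note inv = wall_perm_inv_apply[OF assms]
  show "perm_diag (r+s) \<sigma> x \<in> verts (r+s)" "perm_diag (r+s) \<sigma> (perm_diag (r+s) \<sigma> x) = x"
    using m inv i by (auto simp: perm_diag_def xi)
  show "pos_end r (perm_diag (r+s) \<sigma> x) \<longleftrightarrow> \<not> pos_end r x"
    using wall_perm_le[OF assms, of i] wall_perm_le[OF wall_perm_inv[OF assms], of i] i
    by (auto simp: perm_diag_def xi pos_end_def left_of_wall_def)
qed

lemma compat_perm_diag:
  assumes "wall_perm r s \<sigma>"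
  shows "compat (r+s) (perm_diag (r+s) \<sigma>) T B \<longleftrightarrow> (\<forall>i\<in>{1..r+s}. i \<in> T \<longleftrightarrow> \<sigma> i \<in> B)"
proof
  assume c: "compat (r+s) (perm_diag (r+s) \<sigma>) T B"
  show "\<forall>i\<in>{1..r+s}. i \<in> T \<longleftrightarrow> \<sigma> i \<in> B"
  proof
    fix i assume "i \<in> {1..r+s}"
    then have "(True, i) \<in> verts (r+s)" by simp
    then show "i \<in> T \<longleftrightarrow> \<sigma> i \<in> B" using c unfolding compat_def by (fastforce simp: perm_diag_def)
  qed
next
  assume c: "\<forall>i\<in>{1..r+s}. i \<in> T \<longleftrightarrow> \<sigma> i \<in> B"
  show "compat (r+s) (perm_diag (r+s) \<sigma>) T B" unfolding compat_def
  proof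
    fix x assume x: "x \<in> verts (r+s)"
    then obtain b i where xi: "x = (b, i)" and i: "1 \<le> i" "i \<le> r+s" by (cases x) auto
    show "colour T B x \<longleftrightarrow> colour T B (perm_diag (r+s) \<sigma> x)"
      using c i wall_perm_mem[OF wall_perm_inv[OF assms], of i] wall_perm_inv_apply[OF assms]
      by (cases b) (auto simp: xi perm_diag_def)
  qed
qed

definition relabel_bot :: "(nat \<Rightarrow> nat) \<Rightarrow> vtx \<Rightarrow> vtx" where
  "relabel_bot \<sigma> x = (if fst x then x else (False, \<sigma> (snd x)))"

lemma relabel_bot_simps [simp]: "relabel_bot \<sigma> (True, i) = (True, i)" "relabel_bot \<sigma> (False, i) = (False, \<sigma> i)"
  by (auto simp: relabel_bot_def)

lemma fst_relabel_bot [simp]: "fst (relabel_bot \<sigma> x) = fst x"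
  by (simp add: relabel_bot_def)

text \<open>The bottom colouring forces the middle one to be the preimage of \<open>B\<close> under
  \<open>\<sigma>\<close>: at most one solution, hence no loop, and only the bottom ends get
  relabelled.\<close>

lemma compose_perm_diag:
  assumes d: "wdiag r s d" and \<sigma>: "wall_perm r s \<sigma>"
  defines "d' \<equiv> relabel_bot \<sigma> \<circ> d \<circ> relabel_bot (inv \<sigma>)"
  shows "compose (r+s) d (perm_diag (r+s) \<sigma>) = d'" "loops (r+s) d (perm_diag (r+s) \<sigma>) = 0" "wdiag r s d'"
proof -
  let ?n = "r+s"
  note inv = wall_perm_inv_apply[OF \<sigma>]
  have v: "relabel_bot \<sigma> x \<in> verts ?n \<longleftrightarrow> x \<in> verts ?n" "relabel_bot (inv \<sigma>) x \<in> verts ?n \<longleftrightarrow> x \<in> verts ?n" for x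
    using wall_perm_mem[OF \<sigma>] wall_perm_mem[OF wall_perm_inv[OF \<sigma>]]
    by (cases x; cases "fst x"; auto)+
  have i: "relabel_bot \<sigma> (relabel_bot (inv \<sigma>) x) = x" "relabel_bot (inv \<sigma>) (relabel_bot \<sigma> x) = x" for x
    using inv by (cases x; cases "fst x"; simp)+
  have p: "pos_end r (relabel_bot \<sigma> x) \<longleftrightarrow> pos_end r x" "pos_end r (relabel_bot (inv \<sigma>) x) \<longleftrightarrow> pos_end r x" for x
    using wall_perm_le[OF \<sigma>] wall_perm_le[OF wall_perm_inv[OF \<sigma>]]
    by (cases x; cases "fst x"; simp add: pos_end_def left_of_wall_def)+
  show d': "wdiag r s d'"
    using d unfolding wdiag_iff d'_def by (simp add: v i p)
  have co: "colour T B (relabel_bot \<sigma> x) \<longleftrightarrow> colour T (\<sigma> -` B) x" for T B x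
    by (cases x; cases "fst x") auto
  have co': "colour T B x \<longleftrightarrow> colour T (\<sigma> -` B) (relabel_bot (inv \<sigma>) x)" for T B x
    using inv by (cases x; cases "fst x") auto
  have cd': "compat ?n d' T B \<longleftrightarrow> compat ?n d T (\<sigma> -` B)" for T B
    unfolding compat_def
  proof (rule iffI; rule ballI)
    fix x assume a: "\<forall>x\<in>verts ?n. colour T B x = colour T B (d' x)" and x: "x \<in> verts ?n"
    have "relabel_bot \<sigma> x \<in> verts ?n" using x v by simp
    then have "colour T B (relabel_bot \<sigma> x) = colour T B (d' (relabel_bot \<sigma> x))" using a by blast
    then show "colour T (\<sigma> -` B) x = colour T (\<sigma> -` B) (d x)" by (simp add: d'_def i co)
  next
    fix x assume a: "\<forall>x\<in>verts ?n. colour T (\<sigma> -` B) x = colour T (\<sigma> -` B) (d x)" and x: "x \<in> verts ?n"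
    have "relabel_bot (inv \<sigma>) x \<in> verts ?n" using x v by simp
    then have "colour T (\<sigma> -` B) (relabel_bot (inv \<sigma>) x) = colour T (\<sigma> -` B) (d (relabel_bot (inv \<sigma>) x))" using a by blast
    then show "colour T B x = colour T B (d' x)" using co'[of T B x] by (simp add: d'_def co)
  qed
  have card: "card (middle_colourings ?n d (perm_diag ?n \<sigma>) T B) = (if compat ?n d' T B then 2 ^ 0 else 0)"
    if "T \<subseteq> {1..?n}" "B \<subseteq> {1..?n}" for T B
  proof -
    have sub: "\<sigma> -` B \<subseteq> {1..?n}" using that(2) wall_perm_mem[OF \<sigma>] by force
    have "H \<subseteq> {1..?n} \<and> compat ?n (perm_diag ?n \<sigma>) H B \<longleftrightarrow> H = \<sigma> -` B" for H
      unfolding compat_perm_diag[OF \<sigma>] using sub by blast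
    note * = this
    have "H \<in> middle_colourings ?n d (perm_diag ?n \<sigma>) T B \<longleftrightarrow> H = \<sigma> -` B \<and> compat ?n d' T B" for H
      unfolding middle_colourings_def cd' mem_Collect_eq using *[of H] by metis
    then have "middle_colourings ?n d (perm_diag ?n \<sigma>) T B = (if compat ?n d' T B then {\<sigma> -` B} else {})"
      by auto
    then show ?thesis by simp
  qed
  show "compose ?n d (perm_diag ?n \<sigma>) = d'" "loops ?n d (perm_diag ?n \<sigma>) = 0"
    using compose_loops_eqI[OF d wdiag_perm_diag[OF \<sigma>] d' card] by auto
qed

text \<open>Joins \<open>x\<close> to \<open>y\<close> and their former partners to each other; if
  \<open>x\<close> and \<open>y\<close> are joined already, nothing changes. This is the effect of
  stacking a diagram over \<open>e_diag\<close>.\<close>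

definition surgery :: "diag \<Rightarrow> vtx \<Rightarrow> vtx \<Rightarrow> diag" where
  "surgery d x y = (\<lambda>z. if z = x then y else if z = y then x else if z = d x then d y else if z = d y then d x else d z)"

lemma wdiag_surgery:
  assumes d: "wdiag r s d" and x: "x \<in> verts (r+s)" and y: "y \<in> verts (r+s)" and p: "pos_end r x \<longleftrightarrow> \<not> pos_end r y"
  shows "wdiag r s (surgery d x y)"
proof -
  have w: "d z \<in> verts (r+s)" "d (d z) = z" "pos_end r (d z) \<longleftrightarrow> \<not> pos_end r z" if "z \<in> verts (r+s)" for z
    using d that unfolding wdiag_iff by blast+
  have o: "d z = z" if "z \<notin> verts (r+s)" for z using d that unfolding wdiag_iff by blast
  show ?thesis unfolding wdiag_iff
  proof (intro conjI allI impI ballI)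
    fix z assume "z \<notin> verts (r+s)" then show "surgery d x y z = z"
      using o w x y unfolding surgery_def by metis
  next
    fix z assume z: "z \<in> verts (r+s)"
    show "surgery d x y z \<in> verts (r+s)" unfolding surgery_def using w x y z by simp
    show "surgery d x y (surgery d x y z) = z"
      unfolding surgery_def using w(2)[OF x] w(2)[OF y] w(2)[OF z] w(3)[OF x] w(3)[OF y] p by (smt (verit))
    show "pos_end r (surgery d x y z) \<longleftrightarrow> \<not> pos_end r z"
      unfolding surgery_def using w(3)[OF x] w(3)[OF y] w(3)[OF z] p by auto
  qed
qed

lemma wdiag_e_diag:
  assumes "1 \<le> j" "j \<le> r" "r < k" "k \<le> r+s"
  shows "wdiag r s (e_diag (r+s) j k)"
  unfolding wdiag_iff
proof (intro conjI allI impI ballI)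
  fix x assume "x \<notin> verts (r+s)" then show "e_diag (r+s) j k x = x" by (simp add: e_diag_def)
next
  fix x assume x: "x \<in> verts (r+s)"
  then obtain b i where xi: "x = (b, i)" and i: "1 \<le> i" "i \<le> r+s" by (cases x) auto
  show "e_diag (r+s) j k x \<in> verts (r+s)" "e_diag (r+s) j k (e_diag (r+s) j k x) = x"
    "pos_end r (e_diag (r+s) j k x) \<longleftrightarrow> \<not> pos_end r x"
    using assms i by (auto simp: e_diag_def xi pos_end_def left_of_wall_def)
qed

lemma compat_e_diag:
  assumes "1 \<le> j" "j \<le> r" "r < k" "k \<le> r+s"
  shows "compat (r+s) (e_diag (r+s) j k) H B \<longleftrightarrow>
    (j \<in> H \<longleftrightarrow> k \<in> H) \<and> (j \<in> B \<longleftrightarrow> k \<in> B) \<and> (\<forall>i\<in>{1..r+s}-{j,k}. i \<in> H \<longleftrightarrow> i \<in> B)"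
proof -
  have "(\<forall>x\<in>verts (r+s). Q x) \<longleftrightarrow> (\<forall>i\<in>{1..r+s}. Q (True, i) \<and> Q (False, i))" for Q
    unfolding verts_def by (metis (full_types) SigmaE SigmaI UNIV_I)
  then have "compat (r+s) (e_diag (r+s) j k) H B \<longleftrightarrow>
    (\<forall>i\<in>{1..r+s}. (i \<in> H \<longleftrightarrow> (if i = j then k \<in> H else if i = k then j \<in> H else i \<in> B)) \<and>
      (i \<in> B \<longleftrightarrow> (if i = j then k \<in> B else if i = k then j \<in> B else i \<in> H)))"
    unfolding compat_def by (auto simp: e_diag_def)
  also have "\<dots> \<longleftrightarrow> (j \<in> H \<longleftrightarrow> k \<in> H) \<and> (j \<in> B \<longleftrightarrow> k \<in> B) \<and> (\<forall>i\<in>{1..r+s}-{j,k}. i \<in> H \<longleftrightarrow> i \<in> B)"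
    (is "?L \<longleftrightarrow> ?R")
  proof
    assume L: ?L
    have "j \<in> {1..r+s}" "k \<in> {1..r+s}" "j \<noteq> k" using assms by auto
    then have "j \<in> H \<longleftrightarrow> k \<in> H" "j \<in> B \<longleftrightarrow> k \<in> B" using bspec[OF L, of j] by simp_all
    moreover have "i \<in> H \<longleftrightarrow> i \<in> B" if "i \<in> {1..r+s}-{j,k}" for i 
    proof -
      have "i \<in> {1..r+s}" "i \<noteq> j" "i \<noteq> k" using that by auto
      then show ?thesis using bspec[OF L, of i] by metis
    qed
    ultimately show ?R by (intro conjI ballI)
  next
    assume R: ?R
    show ?L
    proof
      fix i assume "i \<in> {1..r+s}"
      then have "i \<noteq> j \<Longrightarrow> i \<noteq> k \<Longrightarrow> i \<in> H \<longleftrightarrow> i \<in> B" using R by simp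
      then show "(i \<in> H \<longleftrightarrow> (if i = j then k \<in> H else if i = k then j \<in> H else i \<in> B)) \<and>
        (i \<in> B \<longleftrightarrow> (if i = j then k \<in> B else if i = k then j \<in> B else i \<in> H))" using R by simp
    qed
  qed
  finally show ?thesis .
qed

text \<open>Only the common colour \<open>v\<close> of the middle pair \<open>j\<close>,
  \<open>k\<close> is not dictated by \<open>B\<close>. If \<open>d\<close> joins the pair, both
  values fit and a loop arises; otherwise the partner in \<open>d\<close> of either vertex dictates
  \<open>v\<close>.\<close>

lemma compose_e_diag:
  assumes d: "wdiag r s d" and jk: "1 \<le> j" "j \<le> r" "r < k" "k \<le> r+s"
  shows "compose (r+s) d (e_diag (r+s) j k) = surgery d (False, j) (False, k)"
    "loops (r+s) d (e_diag (r+s) j k) = (if d (False, j) = (False, k) then 1 else 0)"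
proof -
  let ?n = "r+s" and ?x = "(False, j)" and ?y = "(False, k)"
  let ?d' = "surgery d ?x ?y"
  have xy: "?x \<in> verts ?n" "?y \<in> verts ?n" and ne: "?x \<noteq> ?y" using jk by auto
  have d': "wdiag r s ?d'"
    using jk by (intro wdiag_surgery[OF d]) (auto simp: pos_end_def left_of_wall_def)
  have w: "d z \<in> verts ?n" "d (d z) = z" "d z \<noteq> z" if "z \<in> verts ?n" for z
    using d that unfolding wdiag_def by blast+
  define h where "h v B = (if v then B \<union> {j, k} else B - {j, k})" for v and B :: "nat set"
  have sol: "H \<subseteq> {1..?n} \<and> compat ?n (e_diag ?n j k) H B \<longleftrightarrow> (j \<in> B \<longleftrightarrow> k \<in> B) \<and> (\<exists>v. H = h v B)" if B: "B \<subseteq> {1..?n}" for H B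
  proof
    assume a: "H \<subseteq> {1..?n} \<and> compat ?n (e_diag ?n j k) H B"
    then have "H = h (j \<in> H) B"
      using B jk unfolding compat_e_diag[OF jk] h_def by auto
    then show "(j \<in> B \<longleftrightarrow> k \<in> B) \<and> (\<exists>v. H = h v B)" using a unfolding compat_e_diag[OF jk] by blast
  next
    assume "(j \<in> B \<longleftrightarrow> k \<in> B) \<and> (\<exists>v. H = h v B)"
    then show "H \<subseteq> {1..?n} \<and> compat ?n (e_diag ?n j k) H B"
      using B jk unfolding compat_e_diag[OF jk] h_def by (auto split: if_splits)
  qed
  have colh: "colour T (h v B) z \<longleftrightarrow> (if z = ?x \<or> z = ?y then v else colour T B z)" for T v B z
    by (cases z; cases "fst z") (auto simp: h_def)
  have hne: "h True B \<noteq> h False B" for B unfolding h_def by auto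
  have card: "card (middle_colourings ?n d (e_diag ?n j k) T B) =
      (if compat ?n ?d' T B then 2 ^ (if d ?x = ?y then 1 else 0) else 0)"
    if TB: "T \<subseteq> {1..?n}" "B \<subseteq> {1..?n}" for T B
  proof -
    have mc: "H \<in> middle_colourings ?n d (e_diag ?n j k) T B \<longleftrightarrow>
      (\<exists>v. H = h v B \<and> (j \<in> B \<longleftrightarrow> k \<in> B) \<and> compat ?n d T (h v B))" for H
      unfolding middle_colourings_def mem_Collect_eq using sol[OF TB(2), of H] by metis
    show ?thesis
    proof (cases "d ?x = ?y")
      case True
      then have dy: "d ?y = ?x" using w(2)[OF xy(1)] by simp
      have eq: "?d' = d" unfolding surgery_def using True dy by auto
      have other: "d z \<noteq> ?x \<and> d z \<noteq> ?y" if "z \<in> verts ?n" "z \<noteq> ?x" "z \<noteq> ?y" for z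
        using w(2)[OF that(1)] that True dy by metis
      have c: "(j \<in> B \<longleftrightarrow> k \<in> B) \<and> compat ?n d T (h v B) \<longleftrightarrow> compat ?n d T B" for v
      proof -
        have "colour T B ?x = colour T B (d ?x) \<longleftrightarrow> (j \<in> B \<longleftrightarrow> k \<in> B)" "colour T B ?y = colour T B (d ?y) \<longleftrightarrow> (j \<in> B \<longleftrightarrow> k \<in> B)"
          using True dy by auto
        then show ?thesis unfolding compat_def colh using True dy other xy by (smt (verit))
      qed
      show ?thesis
      proof (cases "compat ?n d T B")
        case cT: True
        then have "middle_colourings ?n d (e_diag ?n j k) T B = {h True B, h False B}"
          unfolding set_eq_iff mc c insert_iff empty_iff by (metis (full_types))
        then show ?thesis using cT True eq hne[of B] by (simp add: numeral_2_eq_2)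
      next
        case False
        then have "middle_colourings ?n d (e_diag ?n j k) T B = {}"
          unfolding set_eq_iff mc c empty_iff by simp
        then show ?thesis using False eq by simp
      qed
    next
      case False
      have dne: "d ?x \<noteq> ?y" "d ?y \<noteq> ?x" "d ?x \<noteq> ?x" "d ?y \<noteq> ?y" "d ?x \<noteq> d ?y"
        using False w(2)[OF xy(1)] w(2)[OF xy(2)] w(3)[OF xy(1)] w(3)[OF xy(2)] ne by metis+
      have key: "(j \<in> B \<longleftrightarrow> k \<in> B) \<and> compat ?n d T (h v B) \<longleftrightarrow> compat ?n ?d' T B \<and> v = colour T B (d ?x)" for v
      proof
        assume a: "(j \<in> B \<longleftrightarrow> k \<in> B) \<and> compat ?n d T (h v B)"
        then have c: "colour T (h v B) z = colour T (h v B) (d z)" if "z \<in> verts ?n" for z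
          using that unfolding compat_def by blast
        have v: "v = colour T B (d ?x)" "v = colour T B (d ?y)"
          using c[OF xy(1)] c[OF xy(2)] dne unfolding colh by auto
        have "colour T B z = colour T B (?d' z)" if z: "z \<in> verts ?n" for z
        proof -
          consider "z = ?x" | "z = ?y" | "z = d ?x" "z \<noteq> ?x" "z \<noteq> ?y" | "z = d ?y" "z \<noteq> ?x" "z \<noteq> ?y" "z \<noteq> d ?x"
            | "z \<noteq> ?x" "z \<noteq> ?y" "z \<noteq> d ?x" "z \<noteq> d ?y" by blast
          then show ?thesis
          proof cases
            case 5
            then have "d z \<noteq> ?x" "d z \<noteq> ?y" using w(2)[OF z] by auto
            then show ?thesis using c[OF z] 5 unfolding colh surgery_def by simp
          next
            case 1
            then have "?d' z = ?y" unfolding surgery_def by simp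
            then show ?thesis using conjunct1[OF a] 1 by (simp only: colour_simps)
          next
            case 2
            then have "?d' z = ?x" using ne unfolding surgery_def by simp
            then show ?thesis using conjunct1[OF a] 2 by (simp only: colour_simps)
          next
            case 3
            then have "?d' z = d ?y" unfolding surgery_def by simp
            then show ?thesis using v 3(1) by metis
          next
            case 4
            then have "?d' z = d ?x" unfolding surgery_def by simp
            then show ?thesis using v 4(1) by metis
          qed
        qed
        then show "compat ?n ?d' T B \<and> v = colour T B (d ?x)" using v unfolding compat_def by blast
      next
        assume a: "compat ?n ?d' T B \<and> v = colour T B (d ?x)"
        then have c: "colour T B z = colour T B (?d' z)" if "z \<in> verts ?n" for z
          using that unfolding compat_def by blast
        have jkB: "j \<in> B \<longleftrightarrow> k \<in> B" using c[OF xy(1)] by (simp add: surgery_def)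
        have v: "v = colour T B (d ?x)" "v = colour T B (d ?y)"
          using c[OF w(1)[OF xy(1)]] a dne unfolding surgery_def by auto
        have "colour T (h v B) z = colour T (h v B) (d z)" if z: "z \<in> verts ?n" for z
        proof -
          consider "z = ?x" | "z = ?y" | "z = d ?x" "z \<noteq> ?x" "z \<noteq> ?y" | "z = d ?y" "z \<noteq> ?x" "z \<noteq> ?y" "z \<noteq> d ?x"
            | "z \<noteq> ?x" "z \<noteq> ?y" "z \<noteq> d ?x" "z \<noteq> d ?y" by blast
          then show ?thesis
          proof cases
            case 5
            then have "d z \<noteq> ?x" "d z \<noteq> ?y" using w(2)[OF z] by auto
            then show ?thesis using c[OF z] 5 unfolding colh surgery_def by simp
          next
            case 3 then show ?thesis using v w(2)[OF xy(1)] unfolding colh by simp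
          next
            case 4 then show ?thesis using v w(2)[OF xy(2)] unfolding colh by simp
          next
            case 1 then show ?thesis using v(1) dne unfolding colh by simp
          next
            case 2 then show ?thesis using v(2) dne unfolding colh by simp
          qed
        qed
        then show "(j \<in> B \<longleftrightarrow> k \<in> B) \<and> compat ?n d T (h v B)" using jkB unfolding compat_def by blast
      qed
      have "middle_colourings ?n d (e_diag ?n j k) T B = (if compat ?n ?d' T B then {h (colour T B (d ?x)) B} else {})"
        unfolding set_eq_iff mc key by auto
      then show ?thesis using False by simp
    qed
  qed
  show "compose ?n d (e_diag ?n j k) = ?d'"
    "loops ?n d (e_diag ?n j k) = (if d ?x = ?y then 1 else 0)"
    using compose_loops_eqI[OF d wdiag_e_diag[OF jk] d' card] by auto
qed

section \<open>The algebra as a type\<close>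

text \<open>To have the algebra available as a type of class \<^class>\<open>ring_1\<close>, the parameters are fixed to be a
  counterexample of the theorem, if there is one. No property of these constants is used before the
  very last step, so everything below holds for arbitrary parameters.\<close>

definition center_claim :: "nat \<times> nat \<times> complex \<Rightarrow> bool" where
  "center_claim = (\<lambda>(r, s, \<delta>). wb_semisimple r s \<delta> \<longrightarrow> wb_center r s \<delta> = {eval_JM r s \<delta> c | c. supersym r s c})"

definition params :: "nat \<times> nat \<times> complex" where
  "params = (SOME p. \<not> center_claim p)"

definition rk :: nat where "rk = fst params"
definition sk :: nat where "sk = fst (snd params)"
definition dl :: complex where "dl = snd (snd params)"

abbreviation nn :: nat where "nn \<equiv> rk + sk"
abbreviation W :: "diag set" where "W \<equiv> WD rk sk"

lemma finite_W [simp]: "finite (WD r s)"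
proof -
  have "d permutes verts (r+s)" if "wdiag r s d" for d
    unfolding permutes_def
  proof (intro conjI allI impI)
    show "d x = x" if "x \<notin> verts (r+s)" for x using that \<open>wdiag r s d\<close> unfolding wdiag_iff by blast
    fix y
    have "d (d z) = z" for z using \<open>wdiag r s d\<close> unfolding wdiag_iff by metis
    then show "\<exists>!x. d x = y" by metis
  qed
  then have "WD r s \<subseteq> {p. p permutes verts (r+s)}" unfolding WD_def by blast
  then show ?thesis using finite_subset finite_permutations finite_verts by blast
qed

lemma W_iff: "d \<in> WD r s \<longleftrightarrow> wdiag r s d"
  by (simp add: WD_def)

lemma compose_W [simp]: "d \<in> W \<Longrightarrow> d' \<in> W \<Longrightarrow> compose nn d d' \<in> W"
  by (simp add: W_iff wdiag_compose)

lemma flip_W [simp]: "flip_diag d \<in> W \<longleftrightarrow> d \<in> W"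
  by (metis W_iff flip_flip wdiag_flip)

lemma perm_diag_id: "perm_diag n id = id_diag n"
  by (rule ext) (auto simp: perm_diag_def id_diag_def)

lemma id_diag_W [simp]: "id_diag nn \<in> W"
  using wdiag_perm_diag[OF wall_perm_id] by (simp add: W_iff perm_diag_id)

lemma compose_id: assumes "d \<in> W"
  shows "compose nn d (id_diag nn) = d" "loops nn d (id_diag nn) = 0"
    "compose nn (id_diag nn) d = d" "loops nn (id_diag nn) d = 0"
proof -
  have d: "wdiag rk sk d" using assms by (simp add: W_iff)
  have r: "relabel_bot id = id" by (rule ext) (simp add: relabel_bot_def prod_eq_iff)
  have 1: "compose nn d (id_diag nn) = d" "loops nn d (id_diag nn) = 0" if "wdiag rk sk d" for d
    using compose_perm_diag[OF that wall_perm_id] by (auto simp: perm_diag_id r)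
  show "compose nn d (id_diag nn) = d" "loops nn d (id_diag nn) = 0" using 1 d by auto
  have f: "flip_diag (id_diag nn) = id_diag nn"
    by (rule ext) (auto simp: flip_diag_def id_diag_def verts_def)
  have "wdiag rk sk (id_diag nn)" using id_diag_W by (simp only: W_iff)
  from compose_flip[OF wdiag_flip[OF d] this] 1[OF wdiag_flip[OF d]]
  show "compose nn (id_diag nn) d = d" "loops nn (id_diag nn) d = 0" by (auto simp: f)
qed

typedef wb = "WB rk sk"
  morphisms coef Abs_wb
  by (rule exI[of _ "\<lambda>_. 0"]) (simp add: WB_def)

setup_lifting type_definition_wb

lemma coef_outside [simp]: "d \<notin> W \<Longrightarrow> coef x d = 0"
  using coef[of x] by (simp add: WB_def)

lemma wb_eqI: "(\<And>d. d \<in> W \<Longrightarrow> coef x d = coef y d) \<Longrightarrow> x = y"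
  by (metis coef_inject coef_outside ext)

instantiation wb :: ring_1
begin

lift_definition zero_wb :: wb is "\<lambda>_. 0" by (simp add: WB_def)
lift_definition one_wb :: wb is "wb_one rk sk"
  using id_diag_W by (auto simp: WB_def wb_one_def bas_def)
lift_definition plus_wb :: "wb \<Rightarrow> wb \<Rightarrow> wb" is "\<lambda>x y d. x d + y d" by (simp add: WB_def)
lift_definition minus_wb :: "wb \<Rightarrow> wb \<Rightarrow> wb" is "\<lambda>x y d. x d - y d" by (simp add: WB_def)
lift_definition uminus_wb :: "wb \<Rightarrow> wb" is "\<lambda>x d. - x d" by (simp add: WB_def)
lift_definition times_wb :: "wb \<Rightarrow> wb \<Rightarrow> wb" is "wb_mult rk sk dl" by (simp add: WB_def wb_mult_def)

lemma coef_mult: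
  "coef (x * y) d = (\<Sum>d1\<in>W. \<Sum>d2\<in>W. coef x d1 * coef y d2 * dl ^ loops nn d2 d1 * (if compose nn d2 d1 = d then 1 else 0))"
proof (cases "d \<in> W")
  case True
  have "coef (x * y) d = (\<Sum>(d1, d2) \<in> {(d1, d2). d1 \<in> W \<and> d2 \<in> W \<and> compose nn d2 d1 = d}.
        coef x d1 * coef y d2 * dl ^ loops nn d2 d1)"
    using True by (simp add: times_wb.rep_eq wb_mult_def)
  also have "\<dots> = (\<Sum>(d1, d2) \<in> W \<times> W. coef x d1 * coef y d2 * dl ^ loops nn d2 d1 * (if compose nn d2 d1 = d then 1 else 0))"
    by (rule sum.mono_neutral_cong_left) (auto split: if_splits)
  also have "\<dots> = (\<Sum>d1\<in>W. \<Sum>d2\<in>W. coef x d1 * coef y d2 * dl ^ loops nn d2 d1 * (if compose nn d2 d1 = d then 1 else 0))"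
    by (simp add: sum.cartesian_product)
  finally show ?thesis .
next
  case False
  then have "compose nn d2 d1 \<noteq> d" if "d1 \<in> W" "d2 \<in> W" for d1 d2 using that compose_W by blast
  then show ?thesis using False by simp
qed

lemma coef_simps [simp]:
  "coef 0 d = 0" "coef (x + y) d = coef x d + coef y d" "coef (x - y) d = coef x d - coef y d"
  "coef (- x) d = - coef x d"
  by (simp_all add: zero_wb.rep_eq plus_wb.rep_eq minus_wb.rep_eq uminus_wb.rep_eq)

lemma coef_one: "coef 1 d = (if d = id_diag nn then 1 else 0)"
  by (simp add: one_wb.rep_eq wb_one_def bas_def)

text \<open>Pairing a product with a function on diagrams. In a triple product this removes the sum
  over the intermediate diagram, for either bracketing.\<close>

lemma coef_mult_weighted:
  "(\<Sum>e\<in>W. coef (x * y) e * f e) =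
    (\<Sum>d1\<in>W. \<Sum>d2\<in>W. coef x d1 * coef y d2 * dl ^ loops nn d2 d1 * f (compose nn d2 d1))"
proof -
  have "(\<Sum>e\<in>W. coef (x * y) e * f e) = (\<Sum>e\<in>W. \<Sum>d1\<in>W. \<Sum>d2\<in>W. (coef x d1 * coef y d2 * dl ^ loops nn d2 d1) * (if compose nn d2 d1 = e then f e else 0))"
    unfolding coef_mult sum_distrib_right by (intro sum.cong refl) simp
  also have "\<dots> = (\<Sum>d1\<in>W. \<Sum>e\<in>W. \<Sum>d2\<in>W. (coef x d1 * coef y d2 * dl ^ loops nn d2 d1) * (if compose nn d2 d1 = e then f e else 0))"
    by (rule sum.swap)
  also have "\<dots> = (\<Sum>d1\<in>W. \<Sum>d2\<in>W. \<Sum>e\<in>W. (coef x d1 * coef y d2 * dl ^ loops nn d2 d1) * (if compose nn d2 d1 = e then f e else 0))"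
    by (intro sum.cong refl sum.swap)
  also have "\<dots> = (\<Sum>d1\<in>W. \<Sum>d2\<in>W. coef x d1 * coef y d2 * dl ^ loops nn d2 d1 * f (compose nn d2 d1))"
    by (intro sum.cong refl) (simp add: sum_distrib_left[symmetric])
  finally show ?thesis .
qed

instance
proof
  fix x y z :: wb
  show "x + y + z = x + (y + z)" "x + y = y + x" "0 + x = x" "- x + x = 0" "x - y = x + - y"
    by (rule wb_eqI, simp)+
  show "(x + y) * z = x * z + y * z" "x * (y + z) = x * y + x * z"
    by (rule wb_eqI, simp add: coef_mult algebra_simps sum.distrib)+
  show "0 \<noteq> (1::wb)"
  proof
    assume "0 = (1::wb)"
    then have "coef 0 (id_diag nn) = coef 1 (id_diag nn)" by simp
    then show False by (simp add: coef_one)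
  qed
  show "1 * x = x"
  proof (rule wb_eqI)
    fix d assume d: "d \<in> W"
    have "coef (1 * x) d = (\<Sum>d1\<in>W. (if d1 = id_diag nn then \<Sum>d2\<in>W. coef x d2 * dl ^ loops nn d2 d1 * (if compose nn d2 d1 = d then 1 else 0) else 0))"
      unfolding coef_mult coef_one by (intro sum.cong refl) simp
    also have "\<dots> = (\<Sum>d2\<in>W. coef x d2 * dl ^ loops nn d2 (id_diag nn) * (if compose nn d2 (id_diag nn) = d then 1 else 0))"
      by simp
    also have "\<dots> = (\<Sum>d2\<in>W. if d2 = d then coef x d2 else 0)"
      by (intro sum.cong refl) (simp add: compose_id)
    finally show "coef (1 * x) d = coef x d" using d by simp
  qed
  show "x * 1 = x"
  proof (rule wb_eqI)
    fix d assume d: "d \<in> W"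
    have "coef (x * 1) d = (\<Sum>d1\<in>W. \<Sum>d2\<in>W. (if d2 = id_diag nn then coef x d1 * dl ^ loops nn d2 d1 * (if compose nn d2 d1 = d then 1 else 0) else 0))"
      unfolding coef_mult coef_one by (intro sum.cong refl) simp
    also have "\<dots> = (\<Sum>d1\<in>W. coef x d1 * dl ^ loops nn (id_diag nn) d1 * (if compose nn (id_diag nn) d1 = d then 1 else 0))"
      by (simp cong: if_cong)
    also have "\<dots> = (\<Sum>d1\<in>W. if d1 = d then coef x d1 else 0)"
      by (intro sum.cong refl) (simp add: compose_id)
    finally show "coef (x * 1) d = coef x d" using d by simp
  qed
  show "(x * y) * z = x * (y * z)"
  proof (rule wb_eqI)
    fix d
    have "coef ((x * y) * z) d = (\<Sum>e\<in>W. coef (x * y) e * (\<Sum>d3\<in>W. coef z d3 * dl ^ loops nn d3 e * (if compose nn d3 e = d then 1 else 0)))"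
      unfolding coef_mult[of "x * y"] sum_distrib_left by (simp add: mult.assoc)
    also have "\<dots> = (\<Sum>d1\<in>W. \<Sum>d2\<in>W. coef x d1 * coef y d2 * dl ^ loops nn d2 d1 *
        (\<Sum>d3\<in>W. coef z d3 * dl ^ loops nn d3 (compose nn d2 d1) * (if compose nn d3 (compose nn d2 d1) = d then 1 else 0)))"
      by (rule coef_mult_weighted)
    also have "\<dots> = (\<Sum>d1\<in>W. \<Sum>d2\<in>W. \<Sum>d3\<in>W. coef x d1 * coef y d2 * coef z d3 *
        dl ^ (loops nn d2 d1 + loops nn d3 (compose nn d2 d1)) * (if compose nn d3 (compose nn d2 d1) = d then 1 else 0))"
      unfolding sum_distrib_left by (intro sum.cong refl) (simp add: power_add mult_ac)
    finally have 1: "coef ((x * y) * z) d = \<dots>" .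
    have "coef (x * (y * z)) d = (\<Sum>d1\<in>W. coef x d1 * (\<Sum>e\<in>W. coef (y * z) e * (dl ^ loops nn e d1 * (if compose nn e d1 = d then 1 else 0))))"
      unfolding coef_mult[of x] sum_distrib_left by (simp add: mult.assoc)
    also have "\<dots> = (\<Sum>d1\<in>W. coef x d1 * (\<Sum>d2\<in>W. \<Sum>d3\<in>W. coef y d2 * coef z d3 * dl ^ loops nn d3 d2 *
        (dl ^ loops nn (compose nn d3 d2) d1 * (if compose nn (compose nn d3 d2) d1 = d then 1 else 0))))"
      by (subst coef_mult_weighted) (rule refl)
    also have "\<dots> = (\<Sum>d1\<in>W. \<Sum>d2\<in>W. \<Sum>d3\<in>W. coef x d1 * coef y d2 * coef z d3 *
        dl ^ (loops nn d3 d2 + loops nn (compose nn d3 d2) d1) * (if compose nn (compose nn d3 d2) d1 = d then 1 else 0))"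
      unfolding sum_distrib_left by (intro sum.cong refl) (simp add: power_add mult_ac)
    also have "\<dots> = coef ((x * y) * z) d"
      unfolding 1 using compose_assoc[of rk sk] by (intro sum.cong refl) (simp add: W_iff add.commute)
    finally show "coef ((x * y) * z) d = coef (x * (y * z)) d" by simp
  qed
qed

end

lemma coef_sum [simp]: "coef (\<Sum>i\<in>A. f i) d = (\<Sum>i\<in>A. coef (f i) d)"
  by (induction A rule: infinite_finite_induct) auto

lift_definition scl :: "complex \<Rightarrow> wb \<Rightarrow> wb" is "\<lambda>c x d. c * x d" by (simp add: WB_def)

text \<open>Scalars are embedded as central ring elements, which makes scalar multiplication
  ordinary multiplication in the ring.\<close>

definition sc :: "complex \<Rightarrow> wb" where "sc c = scl c 1"

lemma scl_mult: "scl c x * y = scl c (x * y)" "x * scl c y = scl c (x * y)"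
  by (rule wb_eqI, simp add: coef_mult scl.rep_eq sum_distrib_left mult_ac)+

lemma sc_mult: "sc c * x = scl c x" "x * sc c = scl c x"
  by (simp_all add: sc_def scl_mult)

lemma coef_sc [simp]: "coef (sc c * x) d = c * coef x d" "coef (x * sc c) d = c * coef x d"
  by (simp_all add: sc_mult scl.rep_eq)

lemma sc_comm: "x * sc c = sc c * x"
  by (simp add: sc_mult)

lemma sc_simps [simp]: "sc 0 = 0" "sc 1 = 1" "sc (a + b) = sc a + sc b" "sc (a - b) = sc a - sc b" "sc (- a) = - sc a"
  by (rule wb_eqI, simp add: sc_def scl.rep_eq algebra_simps)+

lemma sc_times: "sc (a * b) = sc a * sc b"
  by (rule wb_eqI) (simp add: sc_def scl.rep_eq sc_mult[unfolded sc_def])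

lemma sc_power: "sc (a ^ k) = sc a ^ k"
  by (induction k) (simp_all add: sc_times)

lemma sc_sum: "sc (\<Sum>i\<in>A. f i) = (\<Sum>i\<in>A. sc (f i))"
  by (induction A rule: infinite_finite_induct) auto

lemma sc_of_nat [simp]: "sc (of_nat k) = of_nat k"
  by (induction k) auto

lemma sc_eq_iff [simp]: "sc a = sc b \<longleftrightarrow> a = b"
proof
  assume "sc a = sc b"
  then have "coef (sc a * 1) (id_diag nn) = coef (sc b * 1) (id_diag nn)" by simp
  then show "a = b" unfolding coef_sc by (simp add: coef_one)
qed simp

definition D :: "diag \<Rightarrow> wb" where "D d = (if d \<in> W then Abs_wb (bas d) else 0)"

lemma coef_D: "d \<in> W \<Longrightarrow> coef (D d) e = (if e = d then 1 else 0)"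
proof -
  assume "d \<in> W"
  moreover from this have "bas d \<in> WB rk sk" by (auto simp: WB_def bas_def)
  ultimately show ?thesis by (simp add: D_def Abs_wb_inverse) (simp add: bas_def)
qed

lemma wb_expand: "x = (\<Sum>d\<in>W. sc (coef x d) * D d)"
proof (rule wb_eqI)
  fix e assume e: "e \<in> W"
  have "coef (\<Sum>d\<in>W. sc (coef x d) * D d) e = (\<Sum>d\<in>W. if d = e then coef x d else 0)"
    unfolding coef_sum coef_sc by (intro sum.cong refl) (simp add: coef_D)
  then show "coef x e = coef (\<Sum>d\<in>W. sc (coef x d) * D d) e" using e by simp
qed

lemma wb_induct [case_names zero add scale diag]:
  assumes "Q 0" "\<And>x y. Q x \<Longrightarrow> Q y \<Longrightarrow> Q (x + y)" "\<And>c x. Q x \<Longrightarrow> Q (sc c * x)" "\<And>d. d \<in> W \<Longrightarrow> Q (D d)"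
  shows "Q (x::wb)"
proof -
  have "Q (\<Sum>d\<in>A. sc (coef x d) * D d)" if "finite A" "A \<subseteq> W" for A
    using that by (induction A) (auto intro: assms)
  then show ?thesis using wb_expand[of x] by (metis finite_W subset_refl)
qed

lemma D_one: "D (id_diag nn) = 1"
  by (rule wb_eqI) (simp add: coef_D coef_one)

lemma D_mult:
  assumes "d \<in> W" "d' \<in> W"
  shows "D d * D d' = sc (dl ^ loops nn d' d) * D (compose nn d' d)"
proof (rule wb_eqI)
  fix e
  let ?f = "\<lambda>d1 d2. dl ^ loops nn d2 d1 * (if compose nn d2 d1 = e then 1 else 0)"
  have "coef (D d * D d') e = (\<Sum>d1\<in>W. \<Sum>d2\<in>W. (if d1 = d then 1 else 0) * ((if d2 = d' then 1 else 0) * ?f d1 d2))"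
    unfolding coef_mult using assms by (simp add: coef_D mult.assoc)
  also have "\<dots> = (\<Sum>d1\<in>W. (if d1 = d then 1 else 0) * ?f d1 d')"
  proof -
    have "(\<Sum>d2\<in>W. (if d2 = d' then 1 else 0) * g d2) = g d'" for g :: "diag \<Rightarrow> complex"
      using assms by (simp add: if_distrib[of "\<lambda>x. x * _"] cong: if_cong)
    then show ?thesis by (simp only: sum_distrib_left[symmetric])
  qed
  also have "\<dots> = coef (sc (dl ^ loops nn d' d) * D (compose nn d' d)) e"
    using assms by (simp add: coef_D if_distrib[of "\<lambda>x. x * _"] cong: if_cong)
  finally show "coef (D d * D d') e = coef (sc (dl ^ loops nn d' d) * D (compose nn d' d)) e" .
qed

section \<open>The anti-involution induced by reflection\<close>

lift_definition fl :: "wb \<Rightarrow> wb" is "\<lambda>x d. x (flip_diag d)" by (simp add: WB_def)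

lemma fl_simps [simp]: "fl 0 = 0" "fl (x + y) = fl x + fl y" "fl (x - y) = fl x - fl y" "fl (- x) = - fl x" "fl (fl x) = x"
  by (rule wb_eqI, simp add: fl.rep_eq)+

lemma fl_sc_mult: "fl (sc c * x) = sc c * fl x"
  by (rule wb_eqI) (simp add: fl.rep_eq)

lemma fl_D: "d \<in> W \<Longrightarrow> fl (D d) = D (flip_diag d)"
  by (rule wb_eqI) (auto simp: fl.rep_eq coef_D)

lemma fl_sum: "fl (\<Sum>i\<in>A. f i) = (\<Sum>i\<in>A. fl (f i))"
  by (induction A rule: infinite_finite_induct) auto

lemma fl_mult: "fl (x * y) = fl y * fl x"
proof -
  have 1: "fl (D d * y) = fl y * fl (D d)" if d: "d \<in> W" for d y
  proof (induction y rule: wb_induct)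
    case (scale c x) then show ?case by (metis fl_sc_mult sc_comm mult.assoc)
  next
    case (diag d')
    then show ?case using d compose_flip[of rk sk d' d]
      by (simp add: D_mult fl_sc_mult fl_D W_iff wdiag_compose wdiag_flip)
  qed (auto simp: algebra_simps)
  show ?thesis
  proof (induction x rule: wb_induct)
    case (scale c x) then show ?case by (metis fl_sc_mult sc_comm mult.assoc)
  qed (auto simp: algebra_simps 1)
qed

lemma fl_one [simp]: "fl 1 = 1"
  by (metis fl_mult fl_simps(5) mult.right_neutral mult.left_neutral)

lemma fl_sc [simp]: "fl (sc c) = sc c"
  by (metis fl_one fl_sc_mult mult.right_neutral)

section \<open>Relations\<close>

abbreviation wp :: "(nat \<Rightarrow> nat) \<Rightarrow> bool" where "wp \<equiv> wall_perm rk sk"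

definition P :: "(nat \<Rightarrow> nat) \<Rightarrow> wb" where "P \<sigma> = D (perm_diag nn \<sigma>)"

abbreviation T :: "nat \<Rightarrow> nat \<Rightarrow> wb" where "T a b \<equiv> P (Transposition.transpose a b)"

definition E :: "nat \<Rightarrow> nat \<Rightarrow> wb" where "E i j = D (e_diag nn i j)"

definition arc :: "nat \<Rightarrow> nat \<Rightarrow> bool" where "arc i j \<longleftrightarrow> 1 \<le> i \<and> i \<le> rk \<and> rk < j \<and> j \<le> nn"

definition same_side :: "nat \<Rightarrow> nat \<Rightarrow> bool" where
  "same_side i j \<longleftrightarrow> i \<in> {1..nn} \<and> j \<in> {1..nn} \<and> (i \<le> rk \<longleftrightarrow> j \<le> rk)"

lemma wp_transpose: "same_side a b \<Longrightarrow> wp (Transposition.transpose a b)"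
  by (simp add: same_side_def wall_perm_transpose)

lemma perm_diag_W: "wp \<sigma> \<Longrightarrow> perm_diag nn \<sigma> \<in> W"
  by (simp add: W_iff wdiag_perm_diag)

lemma e_diag_W: "arc i j \<Longrightarrow> e_diag nn i j \<in> W"
  by (simp add: W_iff wdiag_e_diag arc_def)

lemma P_mult_D:
  assumes "wp \<sigma>" "d \<in> W"
  shows "P \<sigma> * D d = D (relabel_bot \<sigma> \<circ> d \<circ> relabel_bot (inv \<sigma>))"
  using compose_perm_diag[of rk sk d \<sigma>] assms perm_diag_W[OF assms(1)]
  by (simp add: P_def D_mult W_iff)

lemma P_mult:
  assumes "wp \<sigma>" "wp \<tau>"
  shows "P \<sigma> * P \<tau> = P (\<sigma> \<circ> \<tau>)"
proof -
  have "relabel_bot \<sigma> \<circ> perm_diag nn \<tau> \<circ> relabel_bot (inv \<sigma>) = perm_diag nn (\<sigma> \<circ> \<tau>)"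
  proof
    fix x :: vtx
    have i: "inv (\<sigma> \<circ> \<tau>) = inv \<tau> \<circ> inv \<sigma>"
      using assms by (simp add: o_inv_distrib wall_perm_bij)
    have m: "1 \<le> inv \<sigma> k \<and> inv \<sigma> k \<le> nn \<longleftrightarrow> 1 \<le> k \<and> k \<le> nn" for k
      using wall_perm_mem[OF wall_perm_inv[OF assms(1)]] .
    show "(relabel_bot \<sigma> \<circ> perm_diag nn \<tau> \<circ> relabel_bot (inv \<sigma>)) x = perm_diag nn (\<sigma> \<circ> \<tau>) x"
      using m[of "snd x"] wall_perm_inv_apply[OF assms(1)]
      by (cases x; cases "fst x") (auto simp: perm_diag_def i)
  qed
  then show ?thesis using P_mult_D[OF assms(1) perm_diag_W[OF assms(2)]] by (simp add: P_def)
qed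

lemma P_id: "P id = 1"
  by (simp add: P_def perm_diag_id D_one)

lemma P_inv: assumes "wp \<sigma>" shows "P \<sigma> * P (inv \<sigma>) = 1" "P (inv \<sigma>) * P \<sigma> = 1"
proof -
  have "\<sigma> \<circ> inv \<sigma> = id" "inv \<sigma> \<circ> \<sigma> = id"
    using assms permutes_inv_o unfolding wall_perm_def by blast+
  then show "P \<sigma> * P (inv \<sigma>) = 1" "P (inv \<sigma>) * P \<sigma> = 1"
    using P_mult[OF assms wall_perm_inv[OF assms]] P_mult[OF wall_perm_inv[OF assms] assms] by (simp_all add: P_id)
qed

lemma T_square: "same_side a b \<Longrightarrow> T a b * T a b = 1"
  by (simp add: P_mult wp_transpose P_id)

lemma T_commute: "T a b = T b a"
  by (simp add: transpose_commute)

lemma fl_P: assumes "wp \<sigma>" shows "fl (P \<sigma>) = P (inv \<sigma>)"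
proof -
  have "flip_diag (perm_diag nn \<sigma>) = perm_diag nn (inv \<sigma>)"
    using wall_perm_bij[OF assms]
    by (intro ext) (auto simp: flip_diag_def perm_diag_def verts_def inv_inv_eq)
  then show ?thesis by (simp add: P_def fl_D perm_diag_W assms)
qed

lemma fl_T: "same_side a b \<Longrightarrow> fl (T a b) = T a b"
  by (simp add: fl_P wp_transpose)

lemma fl_E: "arc i j \<Longrightarrow> fl (E i j) = E i j"
proof -
  have "flip_diag (e_diag nn i j) = e_diag nn i j"
    by (intro ext) (auto simp: flip_diag_def e_diag_def verts_def)
  then show "arc i j \<Longrightarrow> ?thesis" by (simp add: E_def fl_D e_diag_W)
qed

lemma E_mult_D:
  assumes "arc i j" "d \<in> W"
  shows "E i j * D d = sc (if d (False, i) = (False, j) then dl else 1) * D (surgery d (False, i) (False, j))"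
  using compose_e_diag[of rk sk d i j] assms e_diag_W[OF assms(1)]
  by (simp add: E_def D_mult W_iff arc_def)

lemma wdiag_simps:
  assumes "d \<in> W"
  shows "d (d x) = x" "x \<notin> verts nn \<Longrightarrow> d x = x" "d x \<in> verts nn \<longleftrightarrow> x \<in> verts nn"
  using assms unfolding W_iff wdiag_iff by metis+

lemma relabel_transpose: "relabel_bot (Transposition.transpose j k) x =
   (if x = (False, j) then (False, k) else if x = (False, k) then (False, j) else x)"
  by (cases x; cases "fst x") (auto simp: transpose_def)

text \<open>The horizontal strand from \<open>i\<close> to \<open>k\<close> in \<open>d\<close>
  meets the arc from \<open>i\<close> to \<open>j\<close>; pulling the zigzag straight amounts to
  exchanging the bottom ends \<open>j\<close> and \<open>k\<close>.\<close>

lemma E_mult_left: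
  assumes a: "arc i j" and d: "d \<in> W" "d (False, i) = (False, k)" "k \<noteq> j" and k: "same_side j k"
  shows "E i j * D d = T j k * D d"
proof -
  have ne: "i \<noteq> j" "i \<noteq> k" using a k by (auto simp: arc_def same_side_def)
  have dk: "d (False, k) = (False, i)" using wdiag_simps(1)[OF d(1), of "(False, i)"] d(2) by simp
  have inj: "d x = d y \<longleftrightarrow> x = y" for x y using wdiag_simps(1)[OF d(1)] by metis
  let ?r = "relabel_bot (Transposition.transpose j k)"
  have "surgery d (False, i) (False, j) z = (?r \<circ> d \<circ> ?r) z" for z
  proof -
    have 1: "d (False, j) \<noteq> (False, j)" using d(1) a unfolding W_iff wdiag_def arc_def by (metis mem_verts le_trans less_imp_le_nat)
    have 2: "d (False, j) \<noteq> (False, k)" using dk inj ne by (metis Pair_inject wdiag_simps(1)[OF d(1)])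
    have 3: "d z = (False, j) \<longleftrightarrow> z = d (False, j)" "d z = (False, k) \<longleftrightarrow> z = (False, i)" for z
      using wdiag_simps(1)[OF d(1)] d(2) by metis+
    show ?thesis
      unfolding surgery_def o_def relabel_transpose using d(2,3) dk ne 1 2 3[of z] 3[of "(False, k)"] 3[of "(False, j)"]
      by (auto simp: wdiag_simps(1)[OF d(1)])
  qed
  then have "surgery d (False, i) (False, j) = ?r \<circ> d \<circ> ?r" by blast
  then show ?thesis
    using E_mult_D[OF a d(1)] P_mult_D[OF wp_transpose[OF k] d(1)] d by simp
qed

lemma E_mult_right:
  assumes a: "arc i j" and d: "d \<in> W" "d (False, k) = (False, j)" "k \<noteq> i" and k: "same_side i k"
  shows "E i j * D d = T i k * D d"
proof -
  have ne: "i \<noteq> j" "j \<noteq> k" using a k by (auto simp: arc_def same_side_def)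
  have dk: "d (False, j) = (False, k)" using wdiag_simps(1)[OF d(1), of "(False, k)"] d(2) by simp
  have inj: "d x = d y \<longleftrightarrow> x = y" for x y using wdiag_simps(1)[OF d(1)] by metis
  let ?r = "relabel_bot (Transposition.transpose i k)"
  have 1: "d (False, i) \<noteq> (False, i)" using d(1) a unfolding W_iff wdiag_def arc_def by (metis mem_verts le_trans less_imp_le_nat le_add1)
  have 2: "d (False, i) \<noteq> (False, k)" using dk inj ne by (metis Pair_inject wdiag_simps(1)[OF d(1)])
  have 4: "d (False, i) \<noteq> (False, j)" using d(2,3) inj by (metis prod.inject)
  have "surgery d (False, i) (False, j) z = (?r \<circ> d \<circ> ?r) z" for z
  proof -
    have 3: "d z = (False, i) \<longleftrightarrow> z = d (False, i)" "d z = (False, k) \<longleftrightarrow> z = (False, j)" for z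
      using wdiag_simps(1)[OF d(1)] dk by metis+
    show ?thesis
      unfolding surgery_def o_def relabel_transpose using d(2,3) dk ne 1 2 4 3[of z] 3[of "(False, k)"] 3[of "(False, i)"]
      by (auto simp: wdiag_simps(1)[OF d(1)])
  qed
  then have "surgery d (False, i) (False, j) = ?r \<circ> d \<circ> ?r" by blast
  then show ?thesis
    using E_mult_D[OF a d(1)] P_mult_D[OF wp_transpose[OF k] d(1)] 4 by simp
qed

lemma E_mult_same:
  assumes a: "arc i j" and d: "d \<in> W" "d (False, i) = (False, j)"
  shows "E i j * D d = sc dl * D d"
proof -
  have "d (False, j) = (False, i)" using wdiag_simps(1)[OF d(1), of "(False, i)"] d(2) by simp
  then have "surgery d (False, i) (False, j) = d" unfolding surgery_def using d by auto
  then show ?thesis using E_mult_D[OF a d(1)] d by simp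
qed

lemma e_diag_bot: "arc i j \<Longrightarrow> e_diag nn i j (False, i) = (False, j)" "arc i j \<Longrightarrow> e_diag nn i j (False, j) = (False, i)"
  by (auto simp: e_diag_def arc_def)

lemma E_square: "arc i j \<Longrightarrow> E i j * E i j = sc dl * E i j"
  using E_mult_same[of i j "e_diag nn i j"] by (simp add: E_def e_diag_W e_diag_bot)

lemma E_E_left: "arc i j \<Longrightarrow> arc i k \<Longrightarrow> j \<noteq> k \<Longrightarrow> E i j * E i k = T j k * E i k"
  using E_mult_left[of i j "e_diag nn i k" k] by (simp add: E_def e_diag_W e_diag_bot) (auto simp: same_side_def arc_def)

lemma E_E_right: "arc i j \<Longrightarrow> arc k j \<Longrightarrow> i \<noteq> k \<Longrightarrow> E i j * E k j = T i k * E k j"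
  using E_mult_right[of i j "e_diag nn k j" k] by (simp add: E_def e_diag_W e_diag_bot) (auto simp: same_side_def arc_def)

lemma P_E:
  assumes "wp \<sigma>" "arc i j"
  shows "P \<sigma> * E i j = E (\<sigma> i) (\<sigma> j) * P \<sigma>"
proof -
  have a: "arc (\<sigma> i) (\<sigma> j)"
    using assms wall_perm_mem[OF assms(1), of i] wall_perm_mem[OF assms(1), of j] wall_perm_le[OF assms(1), of i] wall_perm_le[OF assms(1), of j]
    by (auto simp: arc_def)
  have ij: "i \<noteq> j" "1 \<le> i" "i \<le> nn" "1 \<le> j" "j \<le> nn" using assms(2) by (auto simp: arc_def)
  note inv = wall_perm_inv_apply[OF assms(1)]
  have \<sigma>ij: "\<sigma> i \<noteq> \<sigma> j" using inv(1) ij by metis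
  have m: "1 \<le> \<sigma> k \<and> \<sigma> k \<le> nn \<longleftrightarrow> 1 \<le> k \<and> k \<le> nn" for k
      using wall_perm_mem[OF assms(1)] .
  have m': "1 \<le> inv \<sigma> k \<and> inv \<sigma> k \<le> nn \<longleftrightarrow> 1 \<le> k \<and> k \<le> nn" for k
      using wall_perm_mem[OF wall_perm_inv[OF assms(1)]] .
  have pb: "perm_diag nn \<sigma> (False, \<sigma> i) = (True, i)" "perm_diag nn \<sigma> (False, \<sigma> j) = (True, j)"
    using inv m[of i] m[of j] ij by (auto simp: perm_diag_def)
  have "(relabel_bot \<sigma> \<circ> e_diag nn i j \<circ> relabel_bot (inv \<sigma>)) z = surgery (perm_diag nn \<sigma>) (False, \<sigma> i) (False, \<sigma> j) z" for z
  proof -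
    obtain b k where z: "z = (b, k)" by (cases z)
    have "inv \<sigma> k = i \<longleftrightarrow> k = \<sigma> i" "inv \<sigma> k = j \<longleftrightarrow> k = \<sigma> j" using inv by metis+
    then show ?thesis
      unfolding z surgery_def pb o_def using \<sigma>ij ij m'[of k] inv
      by (cases b) (auto simp: e_diag_def perm_diag_def)
  qed
  then have "relabel_bot \<sigma> \<circ> e_diag nn i j \<circ> relabel_bot (inv \<sigma>) = surgery (perm_diag nn \<sigma>) (False, \<sigma> i) (False, \<sigma> j)" by blast
  then show ?thesis
    using P_mult_D[OF assms(1) e_diag_W[OF assms(2)]] E_mult_D[OF a perm_diag_W[OF assms(1)]] pb
    by (simp add: E_def P_def)
qed

lemma E_E_disjoint:
  assumes "arc i j" "arc k l" "i \<noteq> k" "j \<noteq> l"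
  shows "E i j * E k l = E k l * E i j"
proof -
  have ne: "i \<noteq> j" "i \<noteq> l" "k \<noteq> j" "k \<noteq> l" and b: "1 \<le> i" "i \<le> nn" "1 \<le> j" "j \<le> nn" "1 \<le> k" "k \<le> nn" "1 \<le> l" "l \<le> nn"
    using assms by (auto simp: arc_def)
  have 1: "surgery (e_diag nn k l) (False, i) (False, j) = surgery (e_diag nn i j) (False, k) (False, l)"
  proof
    fix z :: vtx
    obtain c m where z: "z = (c, m)" by (cases z)
    note ne' = ne ne[symmetric] assms(3,4) assms(3,4)[symmetric]
    have 1: "e_diag nn k l (False, i) = (True, i)" "e_diag nn k l (False, j) = (True, j)"
      "e_diag nn i j (False, k) = (True, k)" "e_diag nn i j (False, l) = (True, l)"
      using ne' b by (simp_all add: e_diag_def)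
    show "surgery (e_diag nn k l) (False, i) (False, j) z = surgery (e_diag nn i j) (False, k) (False, l) z"
      unfolding z surgery_def 1 by (cases c) (use b in \<open>auto simp add: e_diag_def ne'\<close>)
  qed
  have 2: "e_diag nn k l (False, i) \<noteq> (False, j)" "e_diag nn i j (False, k) \<noteq> (False, l)"
    using ne b assms(3,4) by (auto simp: e_diag_def)
  show ?thesis
    using E_mult_D[OF assms(1) e_diag_W[OF assms(2)]] E_mult_D[OF assms(2) e_diag_W[OF assms(1)]] 1 2
    by (simp add: E_def)
qed

lemma P_T:
  assumes "wp \<sigma>" "same_side i j"
  shows "P \<sigma> * T i j = T (\<sigma> i) (\<sigma> j) * P \<sigma>"
proof -
  have s: "same_side (\<sigma> i) (\<sigma> j)"
    using assms wall_perm_mem[OF assms(1), of i] wall_perm_mem[OF assms(1), of j] wall_perm_le[OF assms(1), of i] wall_perm_le[OF assms(1), of j]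
    by (auto simp: same_side_def)
  have "\<sigma> \<circ> Transposition.transpose i j = Transposition.transpose (\<sigma> i) (\<sigma> j) \<circ> \<sigma>"
    using wall_perm_inv_apply[OF assms(1)] by (intro ext) (auto simp: transpose_def dest: injD[OF bij_is_inj[OF wall_perm_bij[OF assms(1)]]])
  then show ?thesis using assms s by (simp add: P_mult wp_transpose)
qed

lemma T_T_disjoint:
  "same_side i j \<Longrightarrow> same_side k l \<Longrightarrow> {i, j} \<inter> {k, l} = {} \<Longrightarrow> T i j * T k l = T k l * T i j"
  using P_T[OF wp_transpose, of i j k l] by (simp add: transpose_def split: if_splits)

lemma T_E_disjoint:
  "same_side i j \<Longrightarrow> arc k l \<Longrightarrow> {i, j} \<inter> {k, l} = {} \<Longrightarrow> T i j * E k l = E k l * T i j"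
  using P_E[OF wp_transpose, of i j k l] by (simp add: transpose_def split: if_splits)

section \<open>Jucys-Murphy elements\<close>

definition L :: "nat \<Rightarrow> wb" where
  "L k = (if k \<le> rk then \<Sum>j\<in>{1..<k}. T j k
     else - (\<Sum>i\<in>{1..rk}. E i k) + (\<Sum>j\<in>{rk+1..<k}. T j k) + sc dl)"

lemma coef_L:
  assumes "1 \<le> k" "k \<le> nn"
  shows "coef (L k) = JM rk sk dl k"
proof -
  have t: "trans_diag nn j k = perm_diag nn (Transposition.transpose j k)" for j
    by (rule ext) (auto simp: trans_diag_def perm_diag_def)
  have bE: "coef (E i k) d = bas (e_diag nn i k) d" if "i \<in> {1..rk}" "rk < k" for i d
    using that assms by (simp add: E_def coef_D e_diag_W arc_def bas_def)
  have bT: "coef (T j k) d = bas (trans_diag nn j k) d" if "same_side j k" for j d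
    using that by (simp add: P_def coef_D perm_diag_W wp_transpose bas_def t)
  have fs: "(\<Sum>i\<in>A. f i) d = (\<Sum>i\<in>A. f i d)" for A and f :: "nat \<Rightarrow> diag \<Rightarrow> complex" and d
    by (induction A rule: infinite_finite_induct) auto
  have "coef (sc dl) d = dl * wb_one rk sk d" for d
    by (simp add: sc_def scl.rep_eq one_wb.rep_eq)
  then show ?thesis
    using assms by (intro ext) (auto simp: L_def JM_def fs wb_smult_def bE bT same_side_def fun_Compl_def intro!: sum.cong)
qed

lemma fl_L:
  assumes "1 \<le> k" "k \<le> nn" shows "fl (L k) = L k"
proof -
  have "fl (T j k) = T j k" if "1 \<le> j" "j < k" "k \<le> rk \<or> rk < j" for j
    using that assms by (intro fl_T) (auto simp: same_side_def)
  moreover have "fl (E i k) = E i k" if "1 \<le> i" "i \<le> rk" "rk < k" for i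
    using that assms by (intro fl_E) (auto simp: arc_def)
  ultimately show ?thesis
    unfolding L_def by (auto simp: fl_sum intro!: sum.cong arg_cong2[where f="(+)"] arg_cong[where f=uminus])
qed

text \<open>Conjugation by such a permutation only permutes the summands of each sum in
  \<open>L k\<close>.\<close>

lemma P_L_commute:
  assumes \<sigma>: "wp \<sigma>" and k: "1 \<le> k" "k \<le> nn" "\<sigma> k = k" "\<And>j. \<sigma> j < k \<longleftrightarrow> j < k"
  shows "P \<sigma> * L k = L k * P \<sigma>"
proof -
  have T: "P \<sigma> * (\<Sum>j\<in>A. T j k) = (\<Sum>j\<in>A. T j k) * P \<sigma>"
    if A: "\<And>j. j \<in> A \<Longrightarrow> same_side j k" "\<sigma> ` A = A" for A
  proof -
    have inj: "inj_on \<sigma> A" using \<sigma> wall_perm_bij by (meson bij_is_inj inj_on_subset subset_UNIV)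
    have "P \<sigma> * (\<Sum>j\<in>A. T j k) = (\<Sum>j\<in>A. T (\<sigma> j) k * P \<sigma>)"
      unfolding sum_distrib_left using P_T[OF \<sigma> A(1)] k by (intro sum.cong refl) simp
    also have "\<dots> = (\<Sum>j\<in>\<sigma> ` A. T j k) * P \<sigma>"
      unfolding sum_distrib_right by (simp add: sum.reindex[OF inj])
    finally show ?thesis using A by simp
  qed
  have E: "P \<sigma> * (\<Sum>i\<in>{1..rk}. E i k) = (\<Sum>i\<in>{1..rk}. E i k) * P \<sigma>" if "rk < k"
  proof -
    have im: "\<sigma> ` {1..rk} = {1..rk}"
    proof (rule endo_inj_surj)
      show "\<sigma> ` {1..rk} \<subseteq> {1..rk}"
        using wall_perm_mem[OF \<sigma>] wall_perm_le[OF \<sigma>] by (force)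
      show "inj_on \<sigma> {1..rk}" using \<sigma> wall_perm_bij by (meson bij_is_inj inj_on_subset subset_UNIV)
    qed simp
    have inj: "inj_on \<sigma> {1..rk}" using \<sigma> wall_perm_bij by (meson bij_is_inj inj_on_subset subset_UNIV)
    have "P \<sigma> * (\<Sum>i\<in>{1..rk}. E i k) = (\<Sum>i\<in>{1..rk}. E (\<sigma> i) k * P \<sigma>)"
      unfolding sum_distrib_left using P_E[OF \<sigma>] k that by (intro sum.cong refl) (simp add: arc_def)
    also have "\<dots> = (\<Sum>i\<in>\<sigma> ` {1..rk}. E i k) * P \<sigma>"
      unfolding sum_distrib_right by (simp only: sum.reindex[OF inj] o_def)
    finally show ?thesis using im by simp
  qed
  have im: "\<sigma> ` {a..<k} = {a..<k}" if "a = 1 \<or> (a = rk + 1 \<and> rk < k)" for a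
  proof (rule endo_inj_surj)
    show "\<sigma> ` {a..<k} \<subseteq> {a..<k}"
    proof
      fix x assume "x \<in> \<sigma> ` {a..<k}"
      then obtain j where j: "x = \<sigma> j" "a \<le> j" "j < k" by auto
      have "1 \<le> j \<and> j \<le> nn" using j(2,3) that k(2) by linarith
      then have "1 \<le> \<sigma> j" using wall_perm_mem[OF \<sigma>, of j] by blast
      moreover have "rk < j \<longrightarrow> rk < \<sigma> j" using wall_perm_le[OF \<sigma>, of j] by linarith
      ultimately show "x \<in> {a..<k}" using j k(4)[of j] that unfolding atLeastLessThan_iff by linarith
    qed
    show "inj_on \<sigma> {a..<k}" using \<sigma> wall_perm_bij by (meson bij_is_inj inj_on_subset subset_UNIV)
  qed simp
  show ?thesis
  proof (cases "k \<le> rk")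
    case True
    then show ?thesis unfolding L_def using T[OF _ im[of 1]] k by (simp add: same_side_def)
  next
    case False
    then have "P \<sigma> * (\<Sum>j\<in>{rk+1..<k}. T j k) = (\<Sum>j\<in>{rk+1..<k}. T j k) * P \<sigma>"
      using T[OF _ im[of "rk+1"]] k by (simp add: same_side_def)
    then show ?thesis unfolding L_def using E False by (simp add: algebra_simps sc_comm)
  qed
qed

lemma T_L_commute:
  assumes "same_side a b" "1 \<le> k" "k \<le> nn" "a \<noteq> k" "b \<noteq> k" "a < k \<longleftrightarrow> b < k"
  shows "T a b * L k = L k * T a b"
  using assms by (intro P_L_commute wp_transpose) (auto simp: transpose_def)

text \<open>Only summands sharing a vertex with the arc could fail to commute, and these cancel in
  pairs: on either side of \<open>E a b\<close>, the terms \<open>T b k\<close> and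
  \<open>E a k\<close> of \<open>L k\<close> have the same product with it.\<close>

lemma E_L_commute:
  assumes "arc a b" "b < k" "k \<le> nn"
  shows "E a b * L k = L k * E a b"
proof -
  have k: "rk < k" "\<not> k \<le> rk" using assms by (auto simp: arc_def)
  have ak: "arc a k" using assms by (simp add: arc_def)
  have bk: "same_side b k" using assms by (auto simp: arc_def same_side_def)
  have E1: "(\<Sum>i\<in>{1..rk}. E i k) = E a k + (\<Sum>i\<in>{1..rk}-{a}. E i k)"
    using assms by (subst sum.remove[of _ a]) (auto simp: arc_def)
  have T1: "(\<Sum>j\<in>{rk+1..<k}. T j k) = T b k + (\<Sum>j\<in>{rk+1..<k}-{b}. T j k)"
    using assms by (subst sum.remove[of _ b]) (auto simp: arc_def)
  have cE: "E a b * (\<Sum>i\<in>{1..rk}-{a}. E i k) = (\<Sum>i\<in>{1..rk}-{a}. E i k) * E a b"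
    unfolding sum_distrib_left sum_distrib_right using assms by (intro sum.cong refl E_E_disjoint) (auto simp: arc_def)
  have cT: "E a b * (\<Sum>j\<in>{rk+1..<k}-{b}. T j k) = (\<Sum>j\<in>{rk+1..<k}-{b}. T j k) * E a b"
    unfolding sum_distrib_left sum_distrib_right using assms
    by (intro sum.cong refl T_E_disjoint[symmetric]) (auto simp: arc_def same_side_def)
  have 1: "E a b * T b k = T b k * E a k"
    using P_E[OF wp_transpose[OF bk] ak] k assms by (simp add: transpose_def arc_def split: if_splits)
  have 2: "E a b * E a k = T b k * E a k"
    using E_E_left[OF assms(1) ak] assms by simp
  have 3: "E a k * E a b = T b k * E a b"
    using E_E_left[OF ak assms(1)] assms by (simp add: T_commute)
  have "E a b * L k = L k * E a b + (E a b * T b k - E a b * E a k) - (T b k * E a b - E a k * E a b)"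
    unfolding L_def E1 T1 using k cE cT by (simp add: algebra_simps sc_comm)
  then show ?thesis using 1 2 3 by simp
qed

lemma L_commute_less:
  assumes "1 \<le> m" "m < k" "k \<le> nn"
  shows "L m * L k = L k * L m"
proof -
  have t: "(\<Sum>j\<in>A. T j m) * L k = L k * (\<Sum>j\<in>A. T j m)" if "\<And>j. j \<in> A \<Longrightarrow> same_side j m \<and> j < m" for A
  proof -
    have "same_side j m" "j < k" "j \<noteq> k" if "j \<in> A" for j
      using \<open>\<And>j. j \<in> A \<Longrightarrow> _\<close>[OF that] assms by auto
    then show ?thesis
      unfolding sum_distrib_left sum_distrib_right using assms by (intro sum.cong refl T_L_commute) simp_all
  qed
  show ?thesis
  proof (cases "m \<le> rk")
    case True
    have "(\<Sum>j\<in>{1..<m}. T j m) * L k = L k * (\<Sum>j\<in>{1..<m}. T j m)"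
      using True by (intro t) (auto simp: same_side_def)
    then show ?thesis using True by (simp add: L_def[of m])
  next
    case False
    have 1: "(\<Sum>j\<in>{rk+1..<m}. T j m) * L k = L k * (\<Sum>j\<in>{rk+1..<m}. T j m)"
      using False assms by (intro t) (auto simp: same_side_def)
    have 2: "(\<Sum>i\<in>{1..rk}. E i m) * L k = L k * (\<Sum>i\<in>{1..rk}. E i m)"
      unfolding sum_distrib_left sum_distrib_right using assms False
      by (intro sum.cong refl E_L_commute) (auto simp: arc_def)
    show ?thesis using False 1 2 by (simp add: L_def[of m] algebra_simps sc_comm)
  qed
qed

lemma L_commute:
  assumes "m \<in> {1..nn}" "k \<in> {1..nn}"
  shows "L m * L k = L k * L m"
  using L_commute_less[of m k] L_commute_less[of k m] assms by (cases m k rule: linorder_cases) auto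

lemma L_Suc:
  assumes "same_side k (k+1)"
  shows "L (k+1) = T k (k+1) * L k * T k (k+1) + T k (k+1)"
proof -
  let ?s = "T k (k+1)"
  note w = wp_transpose[OF assms]
  have t: "?s * (\<Sum>j\<in>A. T j k) * ?s = (\<Sum>j\<in>A. T j (k+1))" if "\<And>j. j \<in> A \<Longrightarrow> same_side j k \<and> j < k" for A
  proof -
    have "?s * T j k * ?s = T j (k+1)" if "j \<in> A" for j
    proof -
      have "?s * T j k = T j (k+1) * ?s"
        using P_T[OF w, of j k] \<open>\<And>j. j \<in> A \<Longrightarrow> _\<close>[OF that] by (simp add: transpose_def split: if_splits)
      then show ?thesis using T_square[OF assms] by (simp add: mult.assoc)
    qed
    then show ?thesis by (simp add: sum_distrib_left sum_distrib_right)
  qed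
  show ?thesis
  proof (cases "k \<le> rk")
    case True
    have "?s * (\<Sum>j\<in>{1..<k}. T j k) * ?s = (\<Sum>j\<in>{1..<k}. T j (k+1))"
      using True assms by (intro t) (auto simp: same_side_def)
    then show ?thesis using True assms by (simp add: L_def same_side_def)
  next
    case False
    have 1: "?s * (\<Sum>j\<in>{rk+1..<k}. T j k) * ?s = (\<Sum>j\<in>{rk+1..<k}. T j (k+1))"
      using False assms by (intro t) (auto simp: same_side_def)
    have "?s * E i k * ?s = E i (k+1)" if "i \<in> {1..rk}" for i
    proof -
      have "?s * E i k = E i (k+1) * ?s"
        using P_E[OF w, of i k] that False assms by (simp add: transpose_def arc_def same_side_def split: if_splits)
      then show ?thesis using T_square[OF assms] by (simp add: mult.assoc)
    qed
    then have 2: "?s * (\<Sum>i\<in>{1..rk}. E i k) * ?s = (\<Sum>i\<in>{1..rk}. E i (k+1))"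
      by (simp add: sum_distrib_left sum_distrib_right)
    have 3: "?s * sc dl * ?s = sc dl" using T_square[OF assms] by (simp add: sc_comm mult.assoc)
    have "?s * L k * ?s = - (?s * (\<Sum>i\<in>{1..rk}. E i k) * ?s) + ?s * (\<Sum>j\<in>{rk+1..<k}. T j k) * ?s + ?s * sc dl * ?s"
      unfolding L_def using False by (simp only: if_False distrib_left distrib_right mult_minus_left mult_minus_right)
    then have "?s * L k * ?s = - (\<Sum>i\<in>{1..rk}. E i (k+1)) + (\<Sum>j\<in>{rk+1..<k}. T j (k+1)) + sc dl"
      unfolding 1 2 3 .
    then show ?thesis using False assms by (simp add: L_def same_side_def)
  qed
qed

text \<open>Against the wall arc, the arcs from \<open>i < rk\<close> to \<open>rk + 1\<close> turn
  into transpositions and cancel \<open>L rk\<close>; the arc itself yields \<delta>, cancelled by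
  the constant in \<open>L (rk+1)\<close>. Reflection gives the other side.\<close>

lemma L_wall:
  assumes "1 \<le> rk" "1 \<le> sk"
  shows "(L rk + L (rk+1)) * E rk (rk+1) = 0" "E rk (rk+1) * (L rk + L (rk+1)) = 0"
proof -
  let ?e = "E rk (rk+1)"
  have a: "arc rk (rk+1)" using assms by (simp add: arc_def)
  have s: "{1..rk} = insert rk {1..<rk}" using assms by auto
  have "(\<Sum>i\<in>{1..rk}. E i (rk+1)) * ?e = sc dl * ?e + (\<Sum>i\<in>{1..<rk}. T i rk) * ?e"
    unfolding s using a E_square[OF a] E_E_right[OF _ a]
    by (simp add: algebra_simps sum_distrib_right) (intro sum.cong refl, auto simp: arc_def)
  then show 1: "(L rk + L (rk+1)) * ?e = 0"
    by (simp add: L_def algebra_simps)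
  have "fl ((L rk + L (rk+1)) * ?e) = 0" using 1 by simp
  then show "?e * (L rk + L (rk+1)) = 0"
    using assms fl_E[OF a] fl_L[of rk] fl_L[of "rk+1"] by (simp add: fl_mult)
qed

section \<open>Supersymmetric polynomials as linear functionals\<close>

text \<open>A polynomial is treated as the linear functional that sends a family \<open>V\<close>
  indexed by exponent vectors to its weighted sum. Supersymmetry becomes a set of identities valid
  for every \<open>V\<close>, and these survive sums and products without computing
  coefficients.\<close>

definition comb :: "((nat \<Rightarrow> nat) \<Rightarrow> complex) \<Rightarrow> ((nat \<Rightarrow> nat) \<Rightarrow> wb) \<Rightarrow> wb" where
  "comb c V = (\<Sum>m | c m \<noteq> 0. sc (c m) * V m)"

lemma comb_cong: "(\<And>m. c m \<noteq> 0 \<Longrightarrow> V m = V' m) \<Longrightarrow> comb c V = comb c V'"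
  unfolding comb_def by (intro sum.cong) auto

lemma comb_add: "comb c (\<lambda>m. V m + V' m) = comb c V + comb c V'"
  by (simp add: comb_def distrib_left sum.distrib)

lemma comb_mult_left: "comb c (\<lambda>m. x * V m) = x * comb c V"
proof -
  have "sc a * (x * y) = x * (sc a * y)" for a y by (metis mult.assoc sc_comm)
  then show ?thesis by (simp add: comb_def sum_distrib_left)
qed

lemma comb_mult_right: "comb c (\<lambda>m. V m * x) = comb c V * x"
  by (simp add: comb_def sum_distrib_right mult.assoc)

lemma comb_superset: "finite A \<Longrightarrow> {m. c m \<noteq> 0} \<subseteq> A \<Longrightarrow> comb c V = (\<Sum>m\<in>A. sc (c m) * V m)"
  unfolding comb_def by (rule sum.mono_neutral_left) auto

text \<open>Repetitions among the exponent vectors \<open>\<mu> i\<close> are collected, so that the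
  resulting coefficients never need to be known.\<close>

lemma collect_combination:
  assumes "finite I"
  obtains c where "finite {m. c m \<noteq> 0}" "\<And>m. c m \<noteq> 0 \<Longrightarrow> m \<in> \<mu> ` I"
    "\<And>V. comb c V = (\<Sum>i\<in>I. sc (\<alpha> i) * V (\<mu> i))"
proof -
  define c where "c m = (\<Sum>i\<in>{i\<in>I. \<mu> i = m}. \<alpha> i)" for m
  have s: "m \<in> \<mu> ` I" if "c m \<noteq> 0" for m
  proof (rule ccontr)
    assume "m \<notin> \<mu> ` I"
    then have "{i\<in>I. \<mu> i = m} = {}" by blast
    then show False using that unfolding c_def by (metis sum.empty)
  qed
  have sub: "{m. c m \<noteq> 0} \<subseteq> \<mu> ` I" using s by blast
  then have fin: "finite {m. c m \<noteq> 0}" using finite_subset finite_imageI[OF assms] by blast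
  have "comb c V = (\<Sum>i\<in>I. sc (\<alpha> i) * V (\<mu> i))" for V
  proof -
    have "comb c V = (\<Sum>m\<in>\<mu> ` I. sc (c m) * V m)"
      by (rule comb_superset[OF finite_imageI[OF assms] sub])
    also have "\<dots> = (\<Sum>m\<in>\<mu> ` I. \<Sum>i\<in>{i\<in>I. \<mu> i = m}. sc (\<alpha> i) * V (\<mu> i))"
      by (intro sum.cong refl) (simp add: c_def sc_sum sum_distrib_right)
    also have "\<dots> = (\<Sum>i\<in>I. sc (\<alpha> i) * V (\<mu> i))"
      by (rule sum.image_gen[symmetric, OF assms])
    finally show ?thesis .
  qed
  then show thesis using that s fin by blast
qed

text \<open>Setting x_r = t and y_1 = -t turns the monomial of \<open>p\<close> into
  \<open>sg p\<close> times t to the power \<open>wt p\<close> times the monomial of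
  \<open>off p\<close>; index \<open>rk + 1\<close> is y_1.\<close>

definition wt :: "(nat \<Rightarrow> nat) \<Rightarrow> nat" where "wt p = p rk + p (rk+1)"
definition off :: "(nat \<Rightarrow> nat) \<Rightarrow> (nat \<Rightarrow> nat)" where "off p = p(rk := 0, rk+1 := 0)"
definition sg :: "(nat \<Rightarrow> nat) \<Rightarrow> wb" where "sg p = (-1) ^ p (rk+1)"

definition comb_sym :: "nat set \<Rightarrow> ((nat \<Rightarrow> nat) \<Rightarrow> complex) \<Rightarrow> bool" where
  "comb_sym A c \<longleftrightarrow> (\<forall>\<sigma> V. \<sigma> permutes A \<longrightarrow> comb c (\<lambda>m. V (m \<circ> \<sigma>)) = comb c V)"

text \<open>\<open>V k m\<close> is the value given to t^k times the monomial of \<open>m\<close>;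
  only the terms free of t may contribute.\<close>

definition comb_indep :: "((nat \<Rightarrow> nat) \<Rightarrow> complex) \<Rightarrow> bool" where
  "comb_indep c \<longleftrightarrow> (\<forall>V. comb c (\<lambda>p. sg p * V (wt p) (off p)) = comb c (\<lambda>p. if wt p = 0 then V 0 (off p) else 0))"

lemma comb_indicator: assumes "finite {m. c m \<noteq> 0}"
  shows "comb c (\<lambda>m. if m = m0 then 1 else 0) = sc (c m0)"
proof -
  have "comb c (\<lambda>m. if m = m0 then 1 else 0) = (\<Sum>m\<in>insert m0 {m. c m \<noteq> 0}. sc (c m) * (if m = m0 then 1 else 0))"
    using assms by (intro comb_superset) auto
  also have "\<dots> = (\<Sum>m\<in>insert m0 {m. c m \<noteq> 0}. if m = m0 then sc (c m) else 0)"
    by (intro sum.cong) auto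
  finally show ?thesis using assms by simp
qed

text \<open>For the converse the functional is tested on the indicator of a single exponent vector,
  which reads off one coefficient.\<close>

lemma sym_in_iff:
  assumes fin: "finite {m. c m \<noteq> 0}"
  shows "sym_in A c \<longleftrightarrow> comb_sym A c"
proof
  assume s: "sym_in A c"
  show "comb_sym A c" unfolding comb_sym_def
  proof (intro allI impI)
    fix \<sigma> :: "nat \<Rightarrow> nat" and V assume \<sigma>: "\<sigma> permutes A"
    have o: "\<sigma> \<circ> inv \<sigma> = id" "inv \<sigma> \<circ> \<sigma> = id" using permutes_inv_o[OF \<sigma>] by auto
    have cs: "c (m \<circ> \<sigma>) = c m" "c (m \<circ> inv \<sigma>) = c m" for m
      using s \<sigma> permutes_inv[OF \<sigma>] unfolding sym_in_def by blast+
    show "comb c (\<lambda>m. V (m \<circ> \<sigma>)) = comb c V"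
      unfolding comb_def
      by (rule sum.reindex_bij_witness[of _ "\<lambda>m. m \<circ> inv \<sigma>" "\<lambda>m. m \<circ> \<sigma>"]) (auto simp: cs o comp_assoc)
  qed
next
  assume s: "comb_sym A c"
  show "sym_in A c" unfolding sym_in_def
  proof (intro allI impI)
    fix \<sigma> m0 :: "nat \<Rightarrow> nat" assume \<sigma>: "\<sigma> permutes A"
    have o: "\<sigma> \<circ> inv \<sigma> = id" "inv \<sigma> \<circ> \<sigma> = id" using permutes_inv_o[OF \<sigma>] by auto
    have e: "m \<circ> inv \<sigma> = m0 \<longleftrightarrow> m = m0 \<circ> \<sigma>" for m
      using o by (metis comp_assoc comp_id)
    have "sc (c m0) = comb c (\<lambda>m. if m \<circ> inv \<sigma> = m0 then 1 else 0)"
      using s[unfolded comb_sym_def, rule_format, OF permutes_inv[OF \<sigma>], of "\<lambda>m. if m = m0 then 1 else 0"]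
      by (simp add: comb_indicator[OF fin])
    also have "\<dots> = sc (c (m0 \<circ> \<sigma>))" unfolding e by (rule comb_indicator[OF fin])
    finally show "c (m0 \<circ> \<sigma>) = c m0" by simp
  qed
qed

lemma sg_sc: "sg p = sc ((-1) ^ p (rk+1))"
  by (simp add: sg_def sc_power)

lemma sc_sg_mult: "sc (c p) * (sg p * x) = sc ((-1) ^ p (rk+1) * c p) * x"
  by (metis mult.assoc mult.commute sc_times sg_sc)

text \<open>The sum in \<open>subst_indep\<close> runs over one fibre of the map from
  \<open>p\<close> to \<open>(wt p, off p)\<close>, parametrised by the exponent \<open>a\<close> of
  x_r.\<close>

lemma subst_sum:
  fixes c :: "(nat \<Rightarrow> nat) \<Rightarrow> complex"
  assumes fin: "finite {m. c m \<noteq> 0}" and m: "m rk = 0" "m (rk+1) = 0"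
  shows "(\<Sum>p | c p \<noteq> 0 \<and> wt p = k \<and> off p = m. (-1) ^ p (rk+1) * c p) =
    (\<Sum>a\<in>{0..k}. (-1) ^ (k - a) * c (m(rk := a, rk+1 := k - a)))"
proof -
  let ?f = "\<lambda>a. m(rk := a, rk+1 := k - a)"
  have inj: "inj_on ?f {0..k}" by (rule inj_onI) (metis fun_upd_apply n_not_Suc_n Suc_eq_plus1)
  have "(\<Sum>p | c p \<noteq> 0 \<and> wt p = k \<and> off p = m. (-1) ^ p (rk+1) * c p) = (\<Sum>p\<in>?f ` {0..k}. (-1) ^ p (rk+1) * c p)"
  proof (rule sum.mono_neutral_left)
    show "{p. c p \<noteq> 0 \<and> wt p = k \<and> off p = m} \<subseteq> ?f ` {0..k}"
    proof
      fix p assume p: "p \<in> {p. c p \<noteq> 0 \<and> wt p = k \<and> off p = m}"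
      then have "p = ?f (p rk)" by (auto simp: wt_def off_def)
      moreover have "p rk \<in> {0..k}" using p by (auto simp: wt_def)
      ultimately show "p \<in> ?f ` {0..k}" by (rule image_eqI)
    qed
    show "\<forall>p\<in>?f ` {0..k} - {p. c p \<noteq> 0 \<and> wt p = k \<and> off p = m}. (-1) ^ p (rk+1) * c p = 0"
    proof
      fix p assume p: "p \<in> ?f ` {0..k} - {p. c p \<noteq> 0 \<and> wt p = k \<and> off p = m}"
      then obtain a where a: "a \<le> k" "p = ?f a" by auto
      have "wt p = k" "off p = m" using a m by (auto simp: wt_def off_def fun_eq_iff)
      then have "c p = 0" using p by blast
      then show "(-1) ^ p (rk+1) * c p = 0" by simp
    qed
  qed simp
  also have "\<dots> = (\<Sum>a\<in>{0..k}. (-1) ^ (k - a) * c (?f a))"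
    by (subst sum.reindex[OF inj]) simp
  finally show ?thesis .
qed

lemma off_zero [simp]: "off p rk = 0" "off p (rk+1) = 0" "off p (Suc rk) = 0"
  by (auto simp: off_def)

text \<open>Grouping the terms by \<open>(wt p, off p)\<close> reduces the functional identity to
  the coefficient condition; the indicator of one such pair recovers the condition.\<close>

lemma subst_indep_iff:
  assumes fin: "finite {m. c m \<noteq> 0}"
  shows "subst_indep rk c \<longleftrightarrow> comb_indep c"
proof
  assume s: "subst_indep rk c"
  show "comb_indep c" unfolding comb_indep_def
  proof
    fix V
    let ?S = "{m. c m \<noteq> 0}"
    let ?h = "\<lambda>p. sc (c p) * (sg p * V (wt p) (off p)) - sc (c p) * (if wt p = 0 then V 0 (off p) else 0)"
    have "(\<Sum>p\<in>?S. ?h p) = (\<Sum>y\<in>(\<lambda>p. (wt p, off p)) ` ?S. \<Sum>p\<in>{p\<in>?S. (wt p, off p) = y}. ?h p)"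
      by (rule sum.image_gen[OF fin])
    also have "\<dots> = 0"
    proof (rule sum.neutral, rule ballI)
      fix y assume "y \<in> (\<lambda>p. (wt p, off p)) ` ?S"
      then obtain q where q: "y = (wt q, off q)" by blast
      show "(\<Sum>p\<in>{p\<in>?S. (wt p, off p) = y}. ?h p) = 0"
      proof (cases "wt q = 0")
        case True
        have "sg p = 1" if "wt p = 0" for p using that by (simp add: wt_def sg_def)
        then show ?thesis using True q by (intro sum.neutral) simp
      next
        case False
        have "(\<Sum>p\<in>{p\<in>?S. (wt p, off p) = y}. ?h p) = (\<Sum>p | c p \<noteq> 0 \<and> wt p = wt q \<and> off p = off q. sc ((-1) ^ p (rk+1) * c p) * V (wt q) (off q))"
          unfolding q using False by (intro sum.cong) (auto simp: sc_sg_mult)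
        also have "\<dots> = sc (\<Sum>p | c p \<noteq> 0 \<and> wt p = wt q \<and> off p = off q. (-1) ^ p (rk+1) * c p) * V (wt q) (off q)"
          by (simp add: sc_sum sum_distrib_right)
        also have "\<dots> = 0"
          using s[unfolded subst_indep_def, rule_format, of "off q" "wt q"] False
          by (subst subst_sum[OF fin]) auto
        finally show ?thesis .
      qed
    qed
    finally show "comb c (\<lambda>p. sg p * V (wt p) (off p)) = comb c (\<lambda>p. if wt p = 0 then V 0 (off p) else 0)"
      by (simp add: comb_def sum_subtractf)
  qed
next
  assume s: "comb_indep c"
  show "subst_indep rk c" unfolding subst_indep_def
  proof (intro allI impI)
    fix m :: "nat \<Rightarrow> nat" and k :: nat assume m: "m rk = 0" "m (rk+1) = 0" and k: "1 \<le> k"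
    let ?V = "\<lambda>k' m'. if k' = k \<and> m' = m then 1 else (0::wb)"
    have "0 = comb c (\<lambda>p. if wt p = 0 then ?V 0 (off p) else 0)"
      using k by (simp add: comb_def not_le cong: if_cong)
    also have "\<dots> = comb c (\<lambda>p. sg p * ?V (wt p) (off p))"
      using s[unfolded comb_indep_def, rule_format, of ?V] by (rule sym)
    also have "\<dots> = (\<Sum>p | c p \<noteq> 0 \<and> wt p = k \<and> off p = m. sc ((-1) ^ p (rk+1) * c p))"
      unfolding comb_def using fin by (intro sum.mono_neutral_cong_right) (auto simp: sc_sg_mult sc_sg_mult[where x=1, simplified])
    also have "\<dots> = sc (\<Sum>a\<in>{0..k}. (-1) ^ (k - a) * c (m(rk := a, rk+1 := k - a)))"
      by (simp only: sc_sum[symmetric] subst_sum[OF fin m])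
    finally show "(\<Sum>a\<in>{0..k}. (-1) ^ (k - a) * c (m(rk := a, rk+1 := k - a))) = 0"
      using sc_eq_iff[of 0] by (metis sc_simps(1))
  qed
qed

definition comb_supersym :: "((nat \<Rightarrow> nat) \<Rightarrow> complex) \<Rightarrow> bool" where
  "comb_supersym c \<longleftrightarrow> poly_vars nn c \<and> comb_sym {1..rk} c \<and> comb_sym {rk+1..nn} c \<and>
     (rk > 0 \<and> sk > 0 \<longrightarrow> comb_indep c)"

lemma supersym_iff: "supersym rk sk c \<longleftrightarrow> comb_supersym c"
proof -
  have "poly_vars nn c \<Longrightarrow> finite {m. c m \<noteq> 0}" by (simp add: poly_vars_def)
  then show ?thesis
    unfolding supersym_def comb_supersym_def using sym_in_iff[of c] subst_indep_iff[of c] by metis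
qed

section \<open>Evaluation at the Jucys-Murphy elements\<close>

definition mon_list :: "nat list \<Rightarrow> (nat \<Rightarrow> nat) \<Rightarrow> wb" where
  "mon_list xs m = foldr (\<lambda>i acc. L i ^ m i * acc) xs 1"

definition mon :: "(nat \<Rightarrow> nat) \<Rightarrow> wb" where "mon m = mon_list [1..<nn+1] m"

lemma mon_list_simps [simp]: "mon_list [] m = 1" "mon_list (i # xs) m = L i ^ m i * mon_list xs m"
  by (simp_all add: mon_list_def)

lemma commute_power: "x * y = y * (x::wb) \<Longrightarrow> x * y ^ n = y ^ n * x"
  by (induction n) (auto simp: mult.assoc[symmetric], simp add: mult.assoc)

lemma commute_mon_list:
  assumes "\<And>i. i \<in> set xs \<Longrightarrow> m i \<noteq> 0 \<Longrightarrow> x * L i = L i * x"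
  shows "x * mon_list xs m = mon_list xs m * x"
  using assms
proof (induction xs)
  case (Cons i xs)
  have "x * L i ^ m i = L i ^ m i * x"
    using Cons.prems[of i] by (cases "m i = 0") (auto intro: commute_power)
  then show ?case using Cons by simp (metis mult.assoc)
qed simp

lemma commute_mon:
  assumes "\<And>i. i \<in> {1..nn} \<Longrightarrow> m i \<noteq> 0 \<Longrightarrow> x * L i = L i * x"
  shows "x * mon m = mon m * x"
  unfolding mon_def by (rule commute_mon_list) (use assms in auto)

lemma mon_list_add:
  assumes "set xs \<subseteq> {1..nn}"
  shows "mon_list xs (\<lambda>i. a i + b i) = mon_list xs a * mon_list xs b"
  using assms
proof (induction xs)
  case (Cons i xs)
  have "L i ^ b i * mon_list xs a = mon_list xs a * L i ^ b i"
    using Cons.prems by (intro commute_power[symmetric] commute_mon_list[symmetric] L_commute) auto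
  then have "mon_list xs a * (L i ^ b i * mon_list xs b) = L i ^ b i * (mon_list xs a * mon_list xs b)"
    by (metis mult.assoc)
  then show ?case using Cons by (simp add: power_add mult.assoc)
qed simp

lemma mon_add: "mon (\<lambda>i. a i + b i) = mon a * mon b"
  unfolding mon_def by (rule mon_list_add) auto

lemma mon_zero: "mon (\<lambda>_. 0) = 1"
proof -
  have "mon_list xs (\<lambda>_. 0) = 1" for xs by (induction xs) auto
  then show ?thesis by (simp add: mon_def)
qed

definition single :: "nat \<Rightarrow> nat \<Rightarrow> nat \<Rightarrow> nat" where "single k a = (\<lambda>i. if i = k then a else 0)"

lemma mon_single: "k \<in> {1..nn} \<Longrightarrow> mon (single k a) = L k ^ a"
proof -
  have "distinct xs \<Longrightarrow> mon_list xs (single k a) = (if k \<in> set xs then L k ^ a else 1)" for xs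
    by (induction xs) (auto simp: single_def)
  from this[of "[1..<nn+1]"] show "k \<in> {1..nn} \<Longrightarrow> ?thesis" by (simp add: mon_def del: upt_Suc)
qed

lemma mon_commute_L: "k \<in> {1..nn} \<Longrightarrow> L k * mon m = mon m * L k"
  by (rule commute_mon) (rule L_commute)

lemma mon_split:
  assumes "k \<in> {1..nn}" "l \<in> {1..nn}" "k \<noteq> l"
  shows "mon m = mon (m(k := 0, l := 0)) * (L k ^ m k * L l ^ m l)"
proof -
  have "m = (\<lambda>i. (m(k := 0, l := 0)) i + (single k (m k) i + single l (m l) i))"
    using assms by (auto simp: single_def)
  then have "mon m = mon (\<lambda>i. (m(k := 0, l := 0)) i + (single k (m k) i + single l (m l) i))" by simp
  also have "\<dots> = mon (m(k := 0, l := 0)) * (L k ^ m k * L l ^ m l)"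
    unfolding mon_add mon_single[OF assms(1)] mon_single[OF assms(2)] ..
  finally show ?thesis .
qed

definition ev :: "((nat \<Rightarrow> nat) \<Rightarrow> complex) \<Rightarrow> wb" where "ev c = comb c mon"

definition Zs :: "wb set" where "Zs = {ev c | c. supersym rk sk c}"

lemma coef_ev: "coef (ev c) = eval_JM rk sk dl c"
proof -
  have pow: "coef (x ^ k) = wb_pow rk sk dl (coef x) k" for x k
    by (induction k) (simp_all add: wb_pow_def one_wb.rep_eq times_wb.rep_eq)
  have "coef (mon_list xs m) = foldr (\<lambda>i acc. wb_mult rk sk dl (wb_pow rk sk dl (JM rk sk dl i) (m i)) acc) xs (wb_one rk sk)"
    if "set xs \<subseteq> {1..nn}" for xs m
    using that by (induction xs) (simp_all add: one_wb.rep_eq times_wb.rep_eq pow coef_L)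
  note * = this
  have "set [1..<nn+1] \<subseteq> {1..nn}" by auto
  then have mon: "coef (mon m) = mono_JM rk sk dl m" for m
    unfolding mon_def mono_JM_def by (rule *)
  have fs: "(\<Sum>i\<in>A. f i) d = (\<Sum>i\<in>A. f i d)" for A and f :: "(nat \<Rightarrow> nat) \<Rightarrow> diag \<Rightarrow> complex" and d
    by (induction A rule: infinite_finite_induct) auto
  show ?thesis by (rule ext) (simp add: ev_def comb_def eval_JM_def mon fs wb_smult_def)
qed

lemma Zs_I: "comb_supersym c \<Longrightarrow> ev c \<in> Zs"
  by (auto simp: Zs_def supersym_iff)

lemma Zs_E: assumes "z \<in> Zs" obtains c where "comb_supersym c" "z = ev c"
  using assms by (auto simp: Zs_def supersym_iff)

text \<open>Supersymmetry may be checked on an indexed combination with repeated exponent vectors,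
  since its functional is that of the collected polynomial.\<close>

lemma Zs_combination:
  assumes I: "finite I" and v: "\<And>i j. i \<in> I \<Longrightarrow> j \<notin> {1..nn} \<Longrightarrow> \<mu> i j = 0"
    and s: "\<And>A \<sigma> V. A = {1..rk} \<or> A = {rk+1..nn} \<Longrightarrow> \<sigma> permutes A \<Longrightarrow> (\<Sum>i\<in>I. sc (\<alpha> i) * V (\<mu> i \<circ> \<sigma>)) = (\<Sum>i\<in>I. sc (\<alpha> i) * V (\<mu> i))"
    and d: "\<And>V. rk > 0 \<Longrightarrow> sk > 0 \<Longrightarrow> (\<Sum>i\<in>I. sc (\<alpha> i) * (sg (\<mu> i) * V (wt (\<mu> i)) (off (\<mu> i)))) = (\<Sum>i\<in>I. sc (\<alpha> i) * (if wt (\<mu> i) = 0 then V 0 (off (\<mu> i)) else 0))"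
  shows "(\<Sum>i\<in>I. sc (\<alpha> i) * mon (\<mu> i)) \<in> Zs"
proof -
  obtain c where c: "finite {m. c m \<noteq> 0}" "\<And>m. c m \<noteq> 0 \<Longrightarrow> m \<in> \<mu> ` I"
    "\<And>V. comb c V = (\<Sum>i\<in>I. sc (\<alpha> i) * V (\<mu> i))" using collect_combination[OF I] by blast
  have "m j = 0" if "c m \<noteq> 0" "j \<notin> {1..nn}" for m j
    using c(2)[OF that(1)] v that(2) by (elim imageE) simp
  then have "poly_vars nn c" unfolding poly_vars_def using c(1) by simp
  moreover have "comb_sym A c" if "A = {1..rk} \<or> A = {rk+1..nn}" for A
    unfolding comb_sym_def c(3) by (intro allI impI s[OF that])
  moreover have "rk > 0 \<and> sk > 0 \<longrightarrow> comb_indep c"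
    unfolding comb_indep_def c(3) by (intro impI allI d) auto
  ultimately have "ev c \<in> Zs" by (intro Zs_I) (simp add: comb_supersym_def)
  then show ?thesis by (simp add: ev_def c(3))
qed

lemma Zs_sc: "sc a \<in> Zs"
proof -
  have "(\<Sum>i\<in>{()}. sc a * mon (\<lambda>_. 0)) \<in> Zs"
    by (rule Zs_combination) (auto simp: wt_def sg_def o_def)
  then show ?thesis by (simp add: mon_zero)
qed

lemma Zs_add: assumes "x \<in> Zs" "y \<in> Zs" shows "x + y \<in> Zs"
proof -
  obtain c c' where c: "comb_supersym c" "x = ev c" "comb_supersym c'" "y = ev c'"
    using assms Zs_E by metis
  let ?S = "{m. c m \<noteq> 0}" and ?S' = "{m. c' m \<noteq> 0}"
  let ?I = "Inl ` ?S \<union> Inr ` ?S'"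
  let ?\<alpha> = "case_sum c c'" and ?\<mu> = "case_sum (\<lambda>m. m) (\<lambda>m. m)"
  have fin: "finite ?S" "finite ?S'" using c by (auto simp: comb_supersym_def poly_vars_def)
  have sum: "(\<Sum>i\<in>?I. sc (?\<alpha> i) * V (?\<mu> i)) = comb c V + comb c' V" for V
    using fin by (subst sum.union_disjoint) (auto simp: sum.reindex comb_def)
  have "(\<Sum>i\<in>?I. sc (?\<alpha> i) * mon (?\<mu> i)) \<in> Zs"
  proof (rule Zs_combination)
    show "finite ?I" using fin by simp
    show "?\<mu> i j = 0" if "i \<in> ?I" "j \<notin> {1..nn}" for i j
      using that c unfolding comb_supersym_def poly_vars_def by auto
    show "(\<Sum>i\<in>?I. sc (?\<alpha> i) * V (?\<mu> i \<circ> \<sigma>)) = (\<Sum>i\<in>?I. sc (?\<alpha> i) * V (?\<mu> i))"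
      if "A = {1..rk} \<or> A = {rk+1..nn}" "\<sigma> permutes A" for A \<sigma> V
    proof -
      have "comb c (\<lambda>m. V (m \<circ> \<sigma>)) = comb c V" "comb c' (\<lambda>m. V (m \<circ> \<sigma>)) = comb c' V"
        using that c unfolding comb_supersym_def comb_sym_def by blast+
      then show ?thesis using sum[of "\<lambda>m. V (m \<circ> \<sigma>)"] sum[of V] by (simp only:)
    qed
    show "(\<Sum>i\<in>?I. sc (?\<alpha> i) * (sg (?\<mu> i) * V (wt (?\<mu> i)) (off (?\<mu> i)))) = (\<Sum>i\<in>?I. sc (?\<alpha> i) * (if wt (?\<mu> i) = 0 then V 0 (off (?\<mu> i)) else 0))"
      if "rk > 0" "sk > 0" for V
    proof -
      have "comb c (\<lambda>p. sg p * V (wt p) (off p)) = comb c (\<lambda>p. if wt p = 0 then V 0 (off p) else 0)"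
        "comb c' (\<lambda>p. sg p * V (wt p) (off p)) = comb c' (\<lambda>p. if wt p = 0 then V 0 (off p) else 0)"
        using that c unfolding comb_supersym_def comb_indep_def by blast+
      then show ?thesis
        using sum[of "\<lambda>m. sg m * V (wt m) (off m)"] sum[of "\<lambda>m. if wt m = 0 then V 0 (off m) else 0"] by (simp only:)
    qed
  qed
  then show ?thesis using sum[of mon] c by (simp only: ev_def)
qed

text \<open>The identities are applied to one factor while the other is held fixed inside
  \<open>V\<close>; this works because \<open>sg\<close> is multiplicative and \<open>wt\<close>,
  \<open>off\<close> are additive in the exponents.\<close>

lemma Zs_mult: assumes "x \<in> Zs" "y \<in> Zs" shows "x * y \<in> Zs"
proof -
  obtain c c' where c: "comb_supersym c" "x = ev c" "comb_supersym c'" "y = ev c'"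
    using assms Zs_E by metis
  let ?S = "{m. c m \<noteq> 0}" and ?S' = "{m. c' m \<noteq> 0}"
  let ?I = "?S \<times> ?S'"
  let ?\<alpha> = "\<lambda>(p, q). c p * c' q" and ?\<mu> = "\<lambda>(p, q) i. p i + (q i :: nat)"
  have fin: "finite ?S" "finite ?S'" using c by (auto simp: comb_supersym_def poly_vars_def)
  have sum: "(\<Sum>i\<in>?I. sc (?\<alpha> i) * V (?\<mu> i)) = comb c (\<lambda>p. comb c' (\<lambda>q. V (\<lambda>i. p i + q i)))" for V
    unfolding comb_def sum_distrib_left by (simp add: sum.cartesian_product split_def sc_times mult.assoc)
  have "(\<Sum>i\<in>?I. sc (?\<alpha> i) * mon (?\<mu> i)) \<in> Zs"
  proof (rule Zs_combination)
    show "finite ?I" using fin by simp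
    show "?\<mu> i j = 0" if "i \<in> ?I" "j \<notin> {1..nn}" for i j
      using that c unfolding comb_supersym_def poly_vars_def by auto
    show "(\<Sum>i\<in>?I. sc (?\<alpha> i) * V (?\<mu> i \<circ> \<sigma>)) = (\<Sum>i\<in>?I. sc (?\<alpha> i) * V (?\<mu> i))"
      if A: "A = {1..rk} \<or> A = {rk+1..nn}" and \<sigma>: "\<sigma> permutes A" for A \<sigma> V
    proof -
      have s: "comb c (\<lambda>m. V (m \<circ> \<sigma>)) = comb c V" "comb c' (\<lambda>m. V (m \<circ> \<sigma>)) = comb c' V" for V
        using A \<sigma> c unfolding comb_supersym_def comb_sym_def by blast+
      have "comb c (\<lambda>p. comb c' (\<lambda>q. V ((\<lambda>i. p i + q i) \<circ> \<sigma>))) = comb c (\<lambda>p. comb c' (\<lambda>q. V (\<lambda>i. (p \<circ> \<sigma>) i + (q \<circ> \<sigma>) i)))"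
        by (simp add: o_def)
      also have "\<dots> = comb c (\<lambda>p. comb c' (\<lambda>q. V (\<lambda>i. (p \<circ> \<sigma>) i + q i)))"
        using s(2)[of "\<lambda>q. V (\<lambda>i. (p \<circ> \<sigma>) i + q i)" for p] by simp
      also have "\<dots> = comb c (\<lambda>p. comb c' (\<lambda>q. V (\<lambda>i. p i + q i)))"
        using s(1)[of "\<lambda>p. comb c' (\<lambda>q. V (\<lambda>i. p i + q i))"] by simp
      finally show ?thesis using sum[of "\<lambda>m. V (m \<circ> \<sigma>)"] sum[of V] by (simp only:)
    qed
    show "(\<Sum>i\<in>?I. sc (?\<alpha> i) * (sg (?\<mu> i) * V (wt (?\<mu> i)) (off (?\<mu> i)))) = (\<Sum>i\<in>?I. sc (?\<alpha> i) * (if wt (?\<mu> i) = 0 then V 0 (off (?\<mu> i)) else 0))"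
      if "rk > 0" "sk > 0" for V
    proof -
      have i: "comb c (\<lambda>p. sg p * V (wt p) (off p)) = comb c (\<lambda>p. if wt p = 0 then V 0 (off p) else 0)"
        "comb c' (\<lambda>p. sg p * V (wt p) (off p)) = comb c' (\<lambda>p. if wt p = 0 then V 0 (off p) else 0)" for V
        using that c unfolding comb_supersym_def comb_indep_def by blast+
      have add: "sg (\<lambda>i. p i + q i) = sg p * sg q" "wt (\<lambda>i. p i + q i) = wt p + wt q"
        "off (\<lambda>i. p i + q i) = (\<lambda>i. off p i + off q i)" for p q
        by (auto simp: sg_def wt_def off_def power_add)
      have "comb c (\<lambda>p. comb c' (\<lambda>q. sg (\<lambda>i. p i + q i) * V (wt (\<lambda>i. p i + q i)) (off (\<lambda>i. p i + q i))))
        = comb c (\<lambda>p. sg p * comb c' (\<lambda>q. sg q * V (wt p + wt q) (\<lambda>i. off p i + off q i)))"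
        by (simp add: add comb_mult_left mult.assoc)
      also have "\<dots> = comb c (\<lambda>p. sg p * comb c' (\<lambda>q. if wt q = 0 then V (wt p) (\<lambda>i. off p i + off q i) else 0))"
        using i(2)[of "\<lambda>k m. V (wt p + k) (\<lambda>i. off p i + m i)" for p] by (simp cong: if_cong)
      also have "\<dots> = comb c (\<lambda>p. if wt p = 0 then comb c' (\<lambda>q. if wt q = 0 then V 0 (\<lambda>i. off p i + off q i) else 0) else 0)"
        using i(1)[of "\<lambda>k m. comb c' (\<lambda>q. if wt q = 0 then V k (\<lambda>i. m i + off q i) else 0)"] by simp
      also have "\<dots> = comb c (\<lambda>p. comb c' (\<lambda>q. if wt (\<lambda>i. p i + q i) = 0 then V 0 (off (\<lambda>i. p i + q i)) else 0))"
        by (rule comb_cong) (auto simp: add comb_def cong: if_cong intro: sum.neutral)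
      finally show ?thesis
        using sum[of "\<lambda>m. sg m * V (wt m) (off m)"] sum[of "\<lambda>m. if wt m = 0 then V 0 (off m) else 0"] by (simp only:)
    qed
  qed
  then show ?thesis using sum[of mon] c by (simp only: ev_def mon_add comb_mult_left comb_mult_right)
qed

lemma Zs_zero: "0 \<in> Zs" and Zs_one: "1 \<in> Zs" and Zs_minus: "x \<in> Zs \<Longrightarrow> - x \<in> Zs"
proof -
  show "0 \<in> Zs" "1 \<in> Zs" using Zs_sc[of 0] Zs_sc[of 1] by simp_all
  show "- x \<in> Zs" if "x \<in> Zs" using Zs_mult[OF Zs_sc[of "-1"] that] by simp
qed

lemma Zs_diff: "x \<in> Zs \<Longrightarrow> y \<in> Zs \<Longrightarrow> x - y \<in> Zs"
  using Zs_add[OF _ Zs_minus] by (metis add_uminus_conv_diff)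

lemma Zs_prod_list: "(\<And>i. i \<in> set xs \<Longrightarrow> f i \<in> Zs) \<Longrightarrow> prod_list (map f xs) \<in> Zs"
  by (induction xs) (auto intro: Zs_one Zs_mult)

text \<open>Under x_r = t, y_1 = -t the terms of these two variables are t^a and -t^a and cancel.
  For a = 0 the element is a constant.\<close>

lemma Zs_power_sum: "(\<Sum>i\<in>{1..rk}. L i ^ a) - (\<Sum>j\<in>{rk+1..nn}. (- L j) ^ a) \<in> Zs"
proof (cases "a = 0")
  case True
  have "sc (of_nat k) \<in> Zs" for k by (rule Zs_sc)
  then show ?thesis using True by (simp add: Zs_diff)
next
  case False
  let ?\<alpha> = "\<lambda>i. if i \<le> rk then 1 else - ((-1) ^ a)" and ?\<mu> = "\<lambda>i. single i a"
  have sum: "(\<Sum>i\<in>{1..nn}. sc (?\<alpha> i) * V (?\<mu> i)) = (\<Sum>i\<in>{1..rk}. V (single i a)) - (\<Sum>j\<in>{rk+1..nn}. (-1) ^ a * V (single j a))" for V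
  proof -
    have "(\<Sum>i\<in>{1..nn}. sc (?\<alpha> i) * V (?\<mu> i)) = (\<Sum>i\<in>{1..rk}. sc (?\<alpha> i) * V (?\<mu> i)) + (\<Sum>i\<in>{rk+1..nn}. sc (?\<alpha> i) * V (?\<mu> i))"
      by (subst sum.union_disjoint[symmetric]) (auto intro!: sum.cong)
    then show ?thesis by (simp add: sc_power sum_negf)
  qed
  have comp: "single i a \<circ> \<sigma> = single (inv \<sigma> i) a" if "\<sigma> permutes A" for i \<sigma> A
    using permutes_inverses[OF that] by (auto simp: single_def fun_eq_iff)
  have re: "(\<Sum>i\<in>B. f (inv \<sigma> i)) = (\<Sum>i\<in>B. f i)" if "\<sigma> permutes A" "A = {1..rk} \<or> A = {rk+1..nn}" "B = {1..rk} \<or> B = {rk+1..nn}" for A B \<sigma> and f :: "nat \<Rightarrow> wb"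
  proof -
    have "inv \<sigma> permutes B \<or> (\<forall>i\<in>B. inv \<sigma> i = i)"
      using permutes_inv[OF that(1)] that(2,3) by (auto simp: permutes_def)
    then show ?thesis
    proof
      assume "inv \<sigma> permutes B" then show ?thesis using sum.permute[of "inv \<sigma>" B f] by (simp add: o_def)
    qed (auto intro: sum.cong)
  qed
  have "(\<Sum>i\<in>{1..nn}. sc (?\<alpha> i) * mon (?\<mu> i)) \<in> Zs"
  proof (rule Zs_combination)
    show "(\<Sum>i\<in>{1..nn}. sc (?\<alpha> i) * V (?\<mu> i \<circ> \<sigma>)) = (\<Sum>i\<in>{1..nn}. sc (?\<alpha> i) * V (?\<mu> i))"
      if A: "A = {1..rk} \<or> A = {rk+1..nn}" and \<sigma>: "\<sigma> permutes A" for A \<sigma> V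
      unfolding comp[OF \<sigma>]
      using sum[of "\<lambda>m. V (m \<circ> \<sigma>)", unfolded comp[OF \<sigma>]] sum[of V] re[OF \<sigma> A, of "{1..rk}" "\<lambda>i. V (single i a)"] re[OF \<sigma> A, of "{rk+1..nn}" "\<lambda>j. (-1) ^ a * V (single j a)"]
      by (simp only: simp_thms)
    show "(\<Sum>i\<in>{1..nn}. sc (?\<alpha> i) * (sg (?\<mu> i) * V (wt (?\<mu> i)) (off (?\<mu> i)))) = (\<Sum>i\<in>{1..nn}. sc (?\<alpha> i) * (if wt (?\<mu> i) = 0 then V 0 (off (?\<mu> i)) else 0))"
      if rs: "rk > 0" "sk > 0" for V
    proof -
      have s: "{1..rk} = insert rk {1..<rk}" "{rk+1..nn} = insert (rk+1) {rk+2..nn}" using rs by auto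
      have o: "sg (single i a) = 1" "wt (single i a) = 0" if "i \<noteq> rk" "i \<noteq> rk+1" for i
        using that by (auto simp: sg_def wt_def single_def)
      have r: "sg (single rk a) = 1" "wt (single rk a) = a" "sg (single (Suc rk) a) = (-1) ^ a" "wt (single (Suc rk) a) = a"
        "off (single (Suc rk) a) = off (single rk a)"
        by (auto simp: sg_def wt_def single_def off_def)
      have q: "(-1) ^ a * ((-1) ^ a * x) = (x::wb)" for x
        by (metis mult.assoc mult.left_neutral power_add uminus_power_if even_add power_one)
      show ?thesis
        unfolding sum[of "\<lambda>m. sg m * V (wt m) (off m)"] sum[of "\<lambda>m. if wt m = 0 then V 0 (off m) else 0"]
        unfolding s using False by (simp add: o r q)
    qed
  qed (auto simp: single_def)
  moreover have "(-1) ^ a * L j ^ a = (- L j) ^ a" for j by (simp add: uminus_power_if)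
  ultimately show ?thesis unfolding sum by (simp add: mon_single)
qed

section \<open>Central elements from supersymmetric polynomials\<close>

lemma commute_mult: "s * a = a * s \<Longrightarrow> s * b = b * (s::wb) \<Longrightarrow> s * (a * b) = a * b * s"
  by (metis mult.assoc)

text \<open>The cross relations of the degenerate affine Hecke algebra; they make symmetric
  expressions in \<open>L k\<close> and \<open>L (k+1)\<close> commute with the
  transposition.\<close>

lemma dAHA:
  assumes "same_side k (k+1)"
  defines "s \<equiv> T k (k+1)"
  shows "s * L k = L (k+1) * s - 1" "s * L (k+1) = L k * s + 1"
proof -
  have s: "s * s = 1" using T_square[OF assms(1)] by (simp add: s_def)
  have L: "L (k+1) = s * L k * s + s" using L_Suc[OF assms(1)] by (simp add: s_def)
  show "s * L k = L (k+1) * s - 1" unfolding L using s by (simp add: distrib_right mult.assoc)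
  have "s * L (k+1) = (s * s) * L k * s + s * s" unfolding L by (simp add: distrib_left mult.assoc)
  then show "s * L (k+1) = L k * s + 1" using s by simp
qed

text \<open>\<open>s\<close> commutes with x + y and with x y, hence by Newton's recursion with
  every x^d + y^d; the smaller exponent is split off as a power of x y.\<close>

lemma symmetric_commute:
  fixes s x y :: wb
  assumes "s * x = y * s - 1" "s * y = x * s + 1" "x * y = y * x"
  shows "s * (x ^ a * y ^ b + x ^ b * y ^ a) = (x ^ a * y ^ b + x ^ b * y ^ a) * s"
proof -
  have e1: "s * (x + y) = (x + y) * s" using assms by (simp add: algebra_simps)
  have e2: "s * (x * y) = (x * y) * s"
  proof -
    have "s * (x * y) = (y * s - 1) * y" using assms(1) by (simp add: mult.assoc[symmetric])
    also have "\<dots> = y * (s * y) - y" by (simp add: algebra_simps)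
    also have "\<dots> = y * x * s" using assms(2) by (simp add: algebra_simps)
    finally show ?thesis using assms(3) by simp
  qed
  have p: "s * (x ^ d + y ^ d) = (x ^ d + y ^ d) * s" for d
  proof (induction d rule: less_induct)
    case (less d)
    consider "d = 0" | "d = 1" | d' where "d = Suc (Suc d')" by (metis One_nat_def nat.exhaust)
    then show ?case
    proof cases
      case 1 then show ?thesis by (simp only: power_0 distrib_left distrib_right mult_1_left mult_1_right)
    next
      case 3
      have xy: "x * y ^ n = y ^ n * x" for n using assms(3) by (rule commute_power)
      have yx: "y * x ^ n = x ^ n * y" for n using assms(3)[symmetric] by (rule commute_power)
      have "x ^ d + y ^ d = (x + y) * (x ^ Suc d' + y ^ Suc d') - x * y * (x ^ d' + y ^ d')"
      proof -
        have "(x + y) * (x ^ Suc d' + y ^ Suc d') = x ^ d + y ^ d + x * y * y ^ d' + y * x * x ^ d'"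
          unfolding 3 by (simp add: algebra_simps)
        moreover have "x * y * (x ^ d' + y ^ d') = x * y * y ^ d' + y * x * x ^ d'"
          using assms(3) by (simp add: distrib_left)
        ultimately show ?thesis by simp
      qed
      moreover have "s * ((x + y) * (x ^ Suc d' + y ^ Suc d')) = (x + y) * (x ^ Suc d' + y ^ Suc d') * s"
        using less[of "Suc d'"] 3 by (intro commute_mult e1) simp
      moreover have "s * (x * y * (x ^ d' + y ^ d')) = x * y * (x ^ d' + y ^ d') * s"
        using less[of d'] 3 by (intro commute_mult[OF e2]) simp
      ultimately show ?thesis by (simp only: right_diff_distrib left_diff_distrib)
    qed (use e1 in auto)
  qed
  have w: "s * (x ^ a * y ^ (a + d) + x ^ (a + d) * y ^ a) = (x ^ a * y ^ (a + d) + x ^ (a + d) * y ^ a) * s" for a d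
  proof -
    have m: "(x * y) ^ a = x ^ a * y ^ a" by (induction a) (auto simp: mult.assoc, metis assms(3) commute_power mult.assoc)
    have yx: "x ^ d * y ^ a = y ^ a * x ^ d" using commute_power[OF commute_power[OF assms(3), symmetric], of a d] by simp
    have "x ^ a * y ^ (a + d) + x ^ (a + d) * y ^ a = (x * y) ^ a * (x ^ d + y ^ d)"
      unfolding m power_add distrib_left using yx by (simp add: mult.assoc)
    moreover have "s * (x * y) ^ a = (x * y) ^ a * s" using e2 by (rule commute_power)
    ultimately show ?thesis using p[of d] by (simp only: commute_mult)
  qed
  show ?thesis
  proof (cases "a \<le> b")
    case True then show ?thesis using w[of a "b - a"] by simp
  next
    case False then show ?thesis using w[of b "a - b"] by (simp add: add.commute)
  qed
qed

text \<open>By symmetry of \<open>c\<close>, twice \<open>ev c\<close> is a combination of sums of a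
  monomial and its image under the swap of \<open>k\<close> and \<open>k+1\<close>; each such sum
  commutes with the transposition.\<close>

lemma T_adjacent_commute_ev:
  assumes c: "comb_supersym c" and s: "same_side k (k+1)"
  shows "T k (k+1) * ev c = ev c * T k (k+1)"
proof -
  let ?\<tau> = "Transposition.transpose k (k+1)" and ?s = "T k (k+1)"
  have kl: "k \<in> {1..nn}" "k+1 \<in> {1..nn}" "k \<noteq> k+1" using s by (auto simp: same_side_def)
  have "?\<tau> permutes {1..rk} \<or> ?\<tau> permutes {rk+1..nn}"
    using s by (auto simp: same_side_def intro!: permutes_swap_id)
  then have "comb c (\<lambda>m. mon (m \<circ> ?\<tau>)) = comb c mon"
    using c unfolding comb_supersym_def comb_sym_def by blast
  then have 2: "comb c (\<lambda>m. mon m + mon (m \<circ> ?\<tau>)) = ev c + ev c"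
    by (simp add: comb_add ev_def)
  have "?s * (mon m + mon (m \<circ> ?\<tau>)) = (mon m + mon (m \<circ> ?\<tau>)) * ?s" for m
  proof -
    let ?M = "mon (m(k := 0, k+1 := 0))"
    have o: "(m \<circ> ?\<tau>)(k := 0, k+1 := 0) = m(k := 0, k+1 := 0)" "(m \<circ> ?\<tau>) k = m (k+1)" "(m \<circ> ?\<tau>) (k+1) = m k"
      by (auto simp: transpose_def fun_eq_iff)
    have "mon m + mon (m \<circ> ?\<tau>) = ?M * (L k ^ m k * L (k+1) ^ m (k+1) + L k ^ m (k+1) * L (k+1) ^ m k)"
      using mon_split[OF kl, of m] mon_split[OF kl, of "m \<circ> ?\<tau>"] by (simp only: o distrib_left)
    moreover have "?s * ?M = ?M * ?s"
    proof (rule commute_mon)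
      fix i assume "i \<in> {1..nn}" "(m(k := 0, k+1 := 0)) i \<noteq> 0"
      then have "i \<noteq> k" "i \<noteq> k+1" by (auto split: if_splits)
      then show "?s * L i = L i * ?s" using \<open>i \<in> {1..nn}\<close> s by (intro T_L_commute) auto
    qed
    ultimately show ?thesis
      using symmetric_commute[OF dAHA[OF s] L_commute[OF kl(1,2)], of "m k" "m (k+1)"] by (simp only: commute_mult)
  qed
  then have "?s * (ev c + ev c) = (ev c + ev c) * ?s"
    unfolding 2[symmetric] comb_mult_left[symmetric] comb_mult_right[symmetric] by simp
  then have "sc (1/2) * (?s * (ev c + ev c)) = sc (1/2) * ((ev c + ev c) * ?s)" by simp
  moreover have "sc (1/2) * (x + x) = x" for x by (rule wb_eqI) simp
  ultimately show ?thesis by (simp add: distrib_left distrib_right)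
qed

text \<open>Next to the wall arc, on either side, \<open>L (rk+1)\<close> acts as
  \<open>- L rk\<close>, which carries out the substitution x_r = t, y_1 = -t with t =
  \<open>L rk\<close>. Independence of t leaves monomials in the other variables, and these commute
  with the arc.\<close>

lemma wall_arc_commute_ev:
  assumes c: "comb_supersym c" and rs: "1 \<le> rk" "1 \<le> sk"
  shows "E rk (rk+1) * ev c = ev c * E rk (rk+1)"
proof -
  let ?e = "E rk (rk+1)"
  have a: "arc rk (rk+1)" and kl: "rk \<in> {1..nn}" "rk+1 \<in> {1..nn}" "rk \<noteq> rk+1" using rs by (auto simp: arc_def)
  have indep: "comb c (\<lambda>p. sg p * V (wt p) (off p)) = comb c (\<lambda>p. if wt p = 0 then V 0 (off p) else 0)" for V
    using c rs unfolding comb_supersym_def comb_indep_def by auto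
  have com: "?e * mon (off m) = mon (off m) * ?e" for m
  proof (rule commute_mon)
    fix i assume i: "i \<in> {1..nn}" "off m i \<noteq> 0"
    then have "i \<noteq> rk" "i \<noteq> rk+1" by (auto simp: off_def split: if_splits)
    then consider "i < rk" | "rk+1 < i" by linarith
    then show "?e * L i = L i * ?e"
    proof cases
      case 1
      have "T j i * ?e = ?e * T j i" if "j \<in> {1..<i}" for j
        using 1 a that by (intro T_E_disjoint) (auto simp: same_side_def)
      then show ?thesis using 1 by (simp add: L_def sum_distrib_left sum_distrib_right)
    next
      case 2 then show ?thesis using i a by (intro E_L_commute) auto
    qed
  qed
  have p1: "L (rk+1) ^ b * ?e = (- L rk) ^ b * ?e" "?e * L (rk+1) ^ b = ?e * (- L rk) ^ b" for b
  proof -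
    have 1: "L (rk+1) * ?e = - L rk * ?e" "?e * L (rk+1) = ?e * (- L rk)"
      using L_wall[OF rs] by (simp_all add: algebra_simps eq_neg_iff_add_eq_0)
    have cm: "L (rk+1) * (- L rk) ^ n = (- L rk) ^ n * L (rk+1)" for n
      using L_commute[OF kl(2,1)] by (intro commute_power) simp
    show "L (rk+1) ^ b * ?e = (- L rk) ^ b * ?e"
    proof (induction b)
      case (Suc b)
      have "L (rk+1) ^ Suc b * ?e = L (rk+1) * ((- L rk) ^ b * ?e)" using Suc by (simp add: mult.assoc)
      also have "\<dots> = (- L rk) ^ b * (- L rk * ?e)" using cm 1(1) by (metis mult.assoc)
      finally show ?case by (metis mult.assoc power_Suc2)
    qed simp
    show "?e * L (rk+1) ^ b = ?e * (- L rk) ^ b"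
    proof (induction b)
      case (Suc b)
      have "?e * L (rk+1) ^ Suc b = ?e * (- L rk) ^ b * L (rk+1)" using Suc by (metis mult.assoc power_Suc2)
      also have "\<dots> = ?e * (- L rk) * (- L rk) ^ b" using cm 1(2) by (metis mult.assoc)
      finally show ?case by (metis mult.assoc power_Suc)
    qed simp
  qed
  have neg: "(- L rk) ^ b = (-1) ^ b * L rk ^ b" for b by (simp add: uminus_power_if)
  have sgc: "sg m * x = x * sg m" for m x unfolding sg_sc by (rule sc_comm[symmetric])
  have ms: "mon m = mon (off m) * (L rk ^ m rk * L (rk+1) ^ m (rk+1))" for m
    unfolding off_def by (rule mon_split[OF kl])
  have r: "mon m * ?e = sg m * (mon (off m) * L rk ^ wt m * ?e)" for m
  proof -
    have "mon m * ?e = mon (off m) * L rk ^ m rk * (L (rk+1) ^ m (rk+1) * ?e)" unfolding ms[of m] by (simp add: mult.assoc)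
    also have "\<dots> = mon (off m) * L rk ^ m rk * (sg m * (L rk ^ m (rk+1) * ?e))"
      unfolding p1(1) neg by (simp add: sg_def mult.assoc)
    also have "\<dots> = sg m * (mon (off m) * L rk ^ m rk * (L rk ^ m (rk+1) * ?e))"
      using sgc[of m "mon (off m) * L rk ^ m rk"] by (simp only: mult.assoc[symmetric])
    finally show ?thesis by (simp add: wt_def power_add mult.assoc)
  qed
  have l: "?e * mon m = sg m * (?e * L rk ^ wt m * mon (off m))" for m
  proof -
    have "mon m = (L rk ^ m rk * L (rk+1) ^ m (rk+1)) * mon (off m)"
      unfolding ms[of m]
      by (intro commute_mult commute_power mon_commute_L[symmetric] kl)
    also have "L rk ^ m rk * L (rk+1) ^ m (rk+1) = L (rk+1) ^ m (rk+1) * L rk ^ m rk"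
      by (rule commute_power, rule commute_power[symmetric], rule L_commute[OF kl(2,1)])
    finally have "?e * mon m = (?e * L (rk+1) ^ m (rk+1)) * L rk ^ m rk * mon (off m)" by (simp add: mult.assoc)
    also have "\<dots> = ?e * (sg m * (L rk ^ m (rk+1) * L rk ^ m rk * mon (off m)))"
      unfolding p1(2) neg by (simp add: sg_def mult.assoc)
    also have "\<dots> = sg m * (?e * (L rk ^ m (rk+1) * L rk ^ m rk) * mon (off m))"
      using sgc[of m ?e] by (simp only: mult.assoc[symmetric])
    finally show ?thesis by (simp add: wt_def power_add[symmetric] add.commute)
  qed
  have "ev c * ?e = comb c (\<lambda>m. sg m * (mon (off m) * L rk ^ wt m * ?e))"
    unfolding ev_def comb_mult_right[symmetric] r ..
  also have "\<dots> = comb c (\<lambda>p. if wt p = 0 then mon (off p) * L rk ^ 0 * ?e else 0)"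
    by (rule indep[of "\<lambda>k m. mon m * L rk ^ k * ?e"])
  also have "\<dots> = comb c (\<lambda>p. if wt p = 0 then ?e * L rk ^ 0 * mon (off p) else 0)"
    by (rule comb_cong) (simp only: com power_0 mult_1_right)
  also have "\<dots> = comb c (\<lambda>m. sg m * (?e * L rk ^ wt m * mon (off m)))"
    by (rule indep[of "\<lambda>k m. ?e * L rk ^ k * mon m", symmetric])
  also have "\<dots> = ?e * ev c"
    unfolding ev_def comb_mult_left[symmetric] l ..
  finally show ?thesis by simp
qed

section \<open>From commuting with transpositions and one arc to commuting with all permutations and
  arcs\<close>

definition center :: "wb set" where "center = {z. \<forall>a. z * a = a * z}"

lemma commute_T:
  assumes z: "\<And>k. same_side k (k+1) \<Longrightarrow> T k (k+1) * z = z * T k (k+1)" and s: "same_side a b"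
  shows "T a b * z = z * T a b"
proof -
  have "same_side a (a+d) \<Longrightarrow> T a (a+d) * z = z * T a (a+d)" for a d
  proof (induction d)
    case 0 then show ?case by (simp add: P_id id_def[symmetric])
  next
    case (Suc d)
    show ?case
    proof (cases "d = 0")
      case True then show ?thesis using z Suc by simp
    next
      case False
      let ?b = "a + d"
      have s: "same_side a ?b" "same_side ?b (?b+1)" using Suc.prems by (auto simp: same_side_def)
      have "T ?b (?b+1) * T a ?b = T a (?b+1) * T ?b (?b+1)"
        using P_T[OF wp_transpose[OF s(2)] s(1)] False by (simp add: transpose_def)
      then have "T a (?b+1) = T ?b (?b+1) * T a ?b * T ?b (?b+1)"
        using T_square[OF s(2)] by (simp add: mult.assoc)
      moreover have "z * T ?b (?b+1) = T ?b (?b+1) * z" "z * T a ?b = T a ?b * z"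
        using Suc.IH[OF s(1)] z[OF s(2)] by auto
      then have "z * (T ?b (?b+1) * T a ?b * T ?b (?b+1)) = (T ?b (?b+1) * T a ?b * T ?b (?b+1)) * z"
        by (intro commute_mult)
      ultimately show ?thesis by simp
    qed
  qed
  note * = this
  show ?thesis
  proof (cases "a \<le> b")
    case True then show ?thesis using *[of a "b - a"] s by simp
  next
    case False
    then show ?thesis using *[of b "a - b"] s by (simp add: T_commute[of a b] same_side_def)
  qed
qed

lemma wp_split:
  assumes "wp \<sigma>"
  obtains \<sigma>1 \<sigma>2 where "\<sigma> = \<sigma>1 \<circ> \<sigma>2" "\<sigma>1 permutes {1..rk}" "\<sigma>2 permutes {rk+1..nn}"
proof -
  define \<sigma>1 where "\<sigma>1 i = (if i \<le> rk then \<sigma> i else i)" for i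
  define \<sigma>2 where "\<sigma>2 i = (if i \<le> rk then i else \<sigma> i)" for i
  have p: "\<sigma> permutes {1..nn}" and le: "\<sigma> i \<le> rk \<longleftrightarrow> i \<le> rk" for i
    using assms by (auto simp: wall_perm_def)
  have inj: "\<sigma> i = \<sigma> j \<longleftrightarrow> i = j" for i j using permutes_inj[OF p] by (simp add: inj_eq)
  have out: "i \<notin> {1..nn} \<Longrightarrow> \<sigma> i = i" for i using p by (simp add: permutes_def)
  have 1: "\<sigma>1 permutes {1..rk}"
  proof (rule bij_imp_permutes)
    show "bij_betw \<sigma>1 {1..rk} {1..rk}"
      unfolding bij_betw_def
    proof
      show i: "inj_on \<sigma>1 {1..rk}" by (auto simp: inj_on_def \<sigma>1_def inj)
      have "\<sigma>1 ` {1..rk} \<subseteq> {1..rk}"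
      proof
        fix y assume "y \<in> \<sigma>1 ` {1..rk}"
        then obtain i where "y = \<sigma> i" "1 \<le> i" "i \<le> rk" by (auto simp: \<sigma>1_def)
        then show "y \<in> {1..rk}" using le[of i] wall_perm_mem[OF assms, of i] by auto
      qed
      then show "\<sigma>1 ` {1..rk} = {1..rk}" using i by (simp add: endo_inj_surj)
    qed
    show "x \<notin> {1..rk} \<Longrightarrow> \<sigma>1 x = x" for x using out[of 0] by (cases x) (auto simp: \<sigma>1_def)
  qed
  have 2: "\<sigma>2 permutes {rk+1..nn}"
  proof (rule bij_imp_permutes)
    show "bij_betw \<sigma>2 {rk+1..nn} {rk+1..nn}"
      unfolding bij_betw_def
    proof
      show i: "inj_on \<sigma>2 {rk+1..nn}" by (auto simp: inj_on_def \<sigma>2_def inj)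
      have "\<sigma>2 ` {rk+1..nn} \<subseteq> {rk+1..nn}"
      proof
        fix y assume "y \<in> \<sigma>2 ` {rk+1..nn}"
        then obtain i where "y = \<sigma> i" "rk < i" "i \<le> nn" by (auto simp: \<sigma>2_def)
        then show "y \<in> {rk+1..nn}" using le[of i] wall_perm_mem[OF assms, of i] by auto
      qed
      then show "\<sigma>2 ` {rk+1..nn} = {rk+1..nn}" using i by (simp add: endo_inj_surj)
    qed
    show "x \<notin> {rk+1..nn} \<Longrightarrow> \<sigma>2 x = x" for x using out[of x] by (auto simp: \<sigma>2_def)
  qed
  have "\<sigma> = \<sigma>1 \<circ> \<sigma>2" by (rule ext) (use le in \<open>auto simp: \<sigma>1_def \<sigma>2_def\<close>)
  then show thesis using that 1 2 by blast
qed

lemma wp_left: "\<sigma> permutes {1..rk} \<Longrightarrow> wp \<sigma>"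
proof -
  assume p: "\<sigma> permutes {1..rk}"
  have "\<sigma> permutes {1..nn}" using permutes_subset[OF p] by auto
  moreover have "\<sigma> i \<le> rk \<longleftrightarrow> i \<le> rk" for i
    using permutes_in_image[OF p, of i] permutes_not_in[OF p, of i] by (cases "i \<in> {1..rk}") auto
  ultimately show ?thesis by (simp add: wall_perm_def)
qed

lemma wp_right: "\<sigma> permutes {rk+1..nn} \<Longrightarrow> wp \<sigma>"
proof -
  assume p: "\<sigma> permutes {rk+1..nn}"
  have "\<sigma> permutes {1..nn}" using permutes_subset[OF p] by auto
  moreover have "\<sigma> i \<le> rk \<longleftrightarrow> i \<le> rk" for i
    using permutes_in_image[OF p, of i] permutes_not_in[OF p, of i] by (cases "i \<in> {rk+1..nn}") auto
  ultimately show ?thesis by (simp add: wall_perm_def)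
qed

lemma commute_P:
  assumes z: "\<And>a b. same_side a b \<Longrightarrow> T a b * z = z * T a b" and \<sigma>: "wp \<sigma>"
  shows "P \<sigma> * z = z * P \<sigma>"
proof -
  have gen: "P \<sigma> * z = z * P \<sigma>"
    if A: "finite A" "\<sigma> permutes A" "\<And>\<tau>. \<tau> permutes A \<Longrightarrow> wp \<tau>" "\<And>a b. a \<in> A \<Longrightarrow> b \<in> A \<Longrightarrow> same_side a b" for \<sigma> A
  proof -
    have "\<sigma> permutes A \<and> P \<sigma> * z = z * P \<sigma>" using A(2,1)
    proof (induction rule: permutes_induct)
      case id show ?case using permutes_id[of A] by (simp only: P_id mult_1_left mult_1_right simp_thms)
    next
      case (swap a b p)
      then have "P (Transposition.transpose a b \<circ> p) = T a b * P p"
        using A(3) A(4)[of a b] by (simp add: P_mult wp_transpose)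
      then show ?case using swap z[OF A(4)[of a b]] permutes_compose[OF _ permutes_swap_id[of a A b]]
        by (metis mult.assoc)
    qed
    then show ?thesis by simp
  qed
  obtain \<sigma>1 \<sigma>2 where s: "\<sigma> = \<sigma>1 \<circ> \<sigma>2" "\<sigma>1 permutes {1..rk}" "\<sigma>2 permutes {rk+1..nn}" using wp_split[OF \<sigma>] .
  have "P \<sigma>1 * z = z * P \<sigma>1" by (rule gen[OF _ s(2) wp_left]) (auto simp: same_side_def)
  moreover have "P \<sigma>2 * z = z * P \<sigma>2" by (rule gen[OF _ s(3) wp_right]) (auto simp: same_side_def)
  moreover have "P \<sigma> = P \<sigma>1 * P \<sigma>2" using s by (simp add: P_mult wp_left wp_right)
  ultimately show ?thesis using commute_mult[of z "P \<sigma>1" "P \<sigma>2"] by simp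
qed

text \<open>All arcs are conjugate to the wall arc under permutations respecting the wall.\<close>

lemma commute_E:
  assumes z: "\<And>\<sigma>. wp \<sigma> \<Longrightarrow> P \<sigma> * z = z * P \<sigma>" "1 \<le> rk \<Longrightarrow> 1 \<le> sk \<Longrightarrow> E rk (rk+1) * z = z * E rk (rk+1)" and a: "arc i j"
  shows "E i j * z = z * E i j"
proof -
  have rs: "1 \<le> rk" "1 \<le> sk" using a by (auto simp: arc_def)
  have s: "same_side i rk" "same_side j (rk+1)" using a rs by (auto simp: arc_def same_side_def)
  define \<sigma> where "\<sigma> = Transposition.transpose i rk \<circ> Transposition.transpose j (rk+1)"
  have w: "wp \<sigma>" unfolding \<sigma>_def using s by (intro wall_perm_comp wp_transpose)
  have "\<sigma> rk = i" "\<sigma> (rk+1) = j" using a unfolding \<sigma>_def by (auto simp: transpose_def arc_def)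
  then have e: "P \<sigma> * E rk (rk+1) = E i j * P \<sigma>" using P_E[OF w, of rk "rk+1"] rs by (simp add: arc_def)
  then have "E i j = P \<sigma> * E rk (rk+1) * P (inv \<sigma>)" using P_inv[OF w] by (simp add: mult.assoc)
  moreover have "z * (P \<sigma> * E rk (rk+1) * P (inv \<sigma>)) = P \<sigma> * E rk (rk+1) * P (inv \<sigma>) * z"
    using z(1)[OF w] z(1)[OF wall_perm_inv[OF w]] z(2)[OF rs] by (intro commute_mult) simp_all
  ultimately show ?thesis by simp
qed

section \<open>The filtration by the number of horizontal strands\<close>

text \<open>Horizontal strands cross the wall, so each one is counted once, through its end left of
  the wall.\<close>

definition ar :: "diag \<Rightarrow> nat" where "ar d = card {i \<in> {1..rk}. fst (d (True, i))}"

lemma W_wall: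
  assumes "d \<in> W" "i \<in> {1..nn}" "d (b, i) = (b', j)"
  shows "j \<in> {1..nn}" "b = b' \<Longrightarrow> j \<le> rk \<longleftrightarrow> \<not> i \<le> rk" "b \<noteq> b' \<Longrightarrow> j \<le> rk \<longleftrightarrow> i \<le> rk" "d (b', j) = (b, i)"
proof -
  have v: "(b, i) \<in> verts nn" using assms(2) by simp
  have w: "wdiag rk sk d" using assms(1) by (simp add: W_iff)
  note a = bspec[OF conjunct2[OF w[unfolded wdiag_def]] v]
  show "j \<in> {1..nn}" using a assms(3) by simp
  show "b = b' \<Longrightarrow> j \<le> rk \<longleftrightarrow> \<not> i \<le> rk" "b \<noteq> b' \<Longrightarrow> j \<le> rk \<longleftrightarrow> i \<le> rk" "d (b', j) = (b, i)"
    using a assms(3) by (auto simp: left_of_wall_def)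
qed

text \<open>On the left of the wall the vertical strands match the rows bijectively, so both rows
  have equally many horizontal ends there.\<close>

lemma ar_flip:
  assumes d: "d \<in> W"
  shows "ar (flip_diag d) = ar d"
proof -
  let ?A = "{i\<in>{1..rk}. \<not> fst (d (True, i))}" and ?B = "{i\<in>{1..rk}. fst (d (False, i))}"
  have "bij_betw (\<lambda>i. snd (d (True, i))) ?A ?B"
  proof (rule bij_betwI[where g = "\<lambda>i. snd (d (False, i))"])
    have 1: "snd (d (True, i)) \<in> {1..rk} \<and> d (False, snd (d (True, i))) = (True, i)" if i: "i \<in> ?A" for i
    proof -
      obtain j where j: "d (True, i) = (False, j)" using i by (cases "d (True, i)") auto
      show ?thesis using W_wall[OF d _ j] i j by auto
    qed
    have 2: "snd (d (False, i)) \<in> {1..rk} \<and> d (True, snd (d (False, i))) = (False, i)" if i: "i \<in> ?B" for i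
    proof -
      obtain j where j: "d (False, i) = (True, j)" using i by (cases "d (False, i)") auto
      show ?thesis using W_wall[OF d _ j] i j by auto
    qed
    show "(\<lambda>i. snd (d (True, i))) \<in> ?A \<rightarrow> ?B" using 1 by fastforce
    show "(\<lambda>i. snd (d (False, i))) \<in> ?B \<rightarrow> ?A" using 2 by fastforce
    show "snd (d (False, snd (d (True, i)))) = i" if "i \<in> ?A" for i using 1[OF that] by simp
    show "snd (d (True, snd (d (False, i)))) = i" if "i \<in> ?B" for i using 2[OF that] by simp
  qed
  then have c: "card ?A = card ?B" by (rule bij_betw_same_card)
  have s: "card {i\<in>{1..rk}. Q i} + card {i\<in>{1..rk}. \<not> Q i} = rk" for Q
  proof -
    have "{1..rk} = {i\<in>{1..rk}. Q i} \<union> {i\<in>{1..rk}. \<not> Q i}" by auto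
    then have "rk = card ({i\<in>{1..rk}. Q i} \<union> {i\<in>{1..rk}. \<not> Q i})" by (metis card_atLeastAtMost diff_Suc_1)
    also have "\<dots> = card {i\<in>{1..rk}. Q i} + card {i\<in>{1..rk}. \<not> Q i}"
      by (rule card_Un_disjoint) auto
    finally show ?thesis by simp
  qed
  have "ar (flip_diag d) = card {i\<in>{1..rk}. \<not> fst (d (False, i))}"
    by (simp add: ar_def flip_diag_def)
  then show ?thesis
    using c s[of "\<lambda>i. fst (d (True, i))"] s[of "\<lambda>i. fst (d (False, i))"] by (simp add: ar_def)
qed

lemma compose_top_arc:
  assumes "up \<in> W" "lo \<in> W" "i \<in> {1..nn}" "up (True, i) = (True, j)"
  shows "compose nn up lo (True, i) = (True, j)"
proof -
  have w: "wdiag rk sk up" "wdiag rk sk lo" using assms by (auto simp: W_iff)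
  have j: "j \<in> {1..nn}" "j \<noteq> i" using W_wall[OF assms(1,3,4)] by auto
  have "(emb_up (True, i), emb_up (up (True, i))) \<in> stack_edges nn up lo"
    unfolding stack_edges_def using assms(3) by fastforce
  then have "(emb_out (True, i), emb_out (True, j)) \<in> stack_conn nn up lo"
    unfolding stack_conn_def using assms(4) by (auto simp: emb_up_def emb_out_def)
  then show ?thesis using j assms(3) by (intro compose_eqI[OF w]) auto
qed

lemma ar_compose_upper: assumes "up \<in> W" "lo \<in> W" shows "ar up \<le> ar (compose nn up lo)"
  unfolding ar_def
proof (rule card_mono)
  show "{i \<in> {1..rk}. fst (up (True, i))} \<subseteq> {i \<in> {1..rk}. fst (compose nn up lo (True, i))}"
  proof
    fix i assume i: "i \<in> {i \<in> {1..rk}. fst (up (True, i))}"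
    then obtain j where "up (True, i) = (True, j)" by (cases "up (True, i)") auto
    then show "i \<in> {i \<in> {1..rk}. fst (compose nn up lo (True, i))}"
      using compose_top_arc[OF assms, of i j] i by simp
  qed
qed simp

lemma ar_compose_lower: assumes "up \<in> W" "lo \<in> W" shows "ar lo \<le> ar (compose nn up lo)"
proof -
  have "ar (flip_diag lo) \<le> ar (compose nn (flip_diag lo) (flip_diag up))"
    using assms by (intro ar_compose_upper) auto
  then show ?thesis using assms compose_flip[of rk sk up lo] by (simp add: ar_flip W_iff[symmetric])
qed

lemma ar_le: assumes "d \<in> W" shows "ar d \<le> rk" "ar d \<le> sk"
proof -
  have "ar d \<le> card {1..rk}" unfolding ar_def by (rule card_mono) auto
  then show "ar d \<le> rk" by simp
  have "card {i \<in> {1..rk}. fst (d (True, i))} \<le> card {rk+1..nn}"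
  proof (rule card_inj_on_le)
    have *: "d (True, i) = (True, snd (d (True, i)))" if "i \<in> {i \<in> {1..rk}. fst (d (True, i))}" for i
      using that by (auto simp: prod_eq_iff)
    show "inj_on (\<lambda>i. snd (d (True, i))) {i \<in> {1..rk}. fst (d (True, i))}"
      by (rule inj_onI) (metis * wdiag_simps(1)[OF assms] prod.inject)
    show "(\<lambda>i. snd (d (True, i))) ` {i \<in> {1..rk}. fst (d (True, i))} \<subseteq> {rk+1..nn}"
    proof
      fix y assume "y \<in> (\<lambda>i. snd (d (True, i))) ` {i \<in> {1..rk}. fst (d (True, i))}"
      then obtain i where i: "i \<in> {i \<in> {1..rk}. fst (d (True, i))}" "y = snd (d (True, i))" by blast
      then have "d (True, i) = (True, y)" using * by simp
      then show "y \<in> {rk+1..nn}" using W_wall[OF assms, of i True True y] i(1) by auto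
    qed
  qed simp
  then show "ar d \<le> sk" by (simp add: ar_def)
qed

section \<open>The two-sided ideals of the filtration\<close>

definition J :: "nat \<Rightarrow> wb set" where "J k = {x. \<forall>d. coef x d \<noteq> 0 \<longrightarrow> k \<le> ar d}"

lemma coef_mult_nonzero:
  assumes "coef (x * y) d \<noteq> 0"
  obtains d1 d2 where "d1 \<in> W" "d2 \<in> W" "coef x d1 \<noteq> 0" "coef y d2 \<noteq> 0" "compose nn d2 d1 = d"
proof -
  obtain d1 where d1: "d1 \<in> W" "(\<Sum>d2\<in>W. coef x d1 * coef y d2 * dl ^ loops nn d2 d1 * (if compose nn d2 d1 = d then 1 else 0)) \<noteq> 0"
    using assms unfolding coef_mult by (metis (no_types, lifting) sum.not_neutral_contains_not_neutral)
  then obtain d2 where "d2 \<in> W" "coef x d1 * coef y d2 * dl ^ loops nn d2 d1 * (if compose nn d2 d1 = d then 1 else 0) \<noteq> 0"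
    by (metis (no_types, lifting) sum.not_neutral_contains_not_neutral)
  then show thesis using that d1(1) by (auto split: if_splits)
qed

lemma J_left: assumes "x \<in> J k" shows "y * x \<in> J k"
  unfolding J_def
proof (intro CollectI allI impI)
  fix d assume "coef (y * x) d \<noteq> 0"
  then obtain d1 d2 where "d1 \<in> W" "d2 \<in> W" "coef y d1 \<noteq> 0" "coef x d2 \<noteq> 0" "compose nn d2 d1 = d"
    by (rule coef_mult_nonzero)
  then show "k \<le> ar d" using ar_compose_upper[of d2 d1] assms unfolding J_def by force
qed

lemma J_right: assumes "x \<in> J k" shows "x * y \<in> J k"
  unfolding J_def
proof (intro CollectI allI impI)
  fix d assume "coef (x * y) d \<noteq> 0"
  then obtain d1 d2 where "d1 \<in> W" "d2 \<in> W" "coef x d1 \<noteq> 0" "coef y d2 \<noteq> 0" "compose nn d2 d1 = d"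
    by (rule coef_mult_nonzero)
  then show "k \<le> ar d" using ar_compose_lower[of d2 d1] assms unfolding J_def by force
qed

lemma J_zero [simp]: "0 \<in> J k" by (simp add: J_def)
lemma J_add: "x \<in> J k \<Longrightarrow> y \<in> J k \<Longrightarrow> x + y \<in> J k" unfolding J_def by simp (metis add.left_neutral)
lemma J_minus: "x \<in> J k \<Longrightarrow> - x \<in> J k" by (simp add: J_def)
lemma J_diff: "x \<in> J k \<Longrightarrow> y \<in> J k \<Longrightarrow> x - y \<in> J k" using J_add[OF _ J_minus] by (metis add_uminus_conv_diff)
lemma J_sum: "(\<And>i. i \<in> A \<Longrightarrow> f i \<in> J k) \<Longrightarrow> (\<Sum>i\<in>A. f i) \<in> J k"
  by (induction A rule: infinite_finite_induct) (auto intro: J_add)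
lemma J_D: "d \<in> W \<Longrightarrow> k \<le> ar d \<Longrightarrow> D d \<in> J k" by (simp add: J_def coef_D)
lemma J_0: "x \<in> J 0" by (simp add: J_def)

lemma J_top: assumes "x \<in> J k" "rk < k \<or> sk < k" shows "x = 0"
proof (rule wb_eqI)
  fix d assume "d \<in> W"
  then have "\<not> k \<le> ar d" using ar_le[of d] assms(2) by linarith
  then show "coef x d = coef 0 d" using assms(1) unfolding J_def by auto
qed

section \<open>The standard diagram of each level\<close>

definition lv :: "nat \<Rightarrow> bool" where "lv k \<longleftrightarrow> k \<le> rk \<and> k \<le> sk"
text \<open>The \<open>k\<close> vertices on each side nearest to the wall, written without
  truncated subtraction; the map \<open>2*rk+1-i\<close> reflects this region in the wall.\<close>

definition region :: "nat \<Rightarrow> nat \<Rightarrow> bool" where "region k i \<longleftrightarrow> rk < i + k \<and> i \<le> rk + k"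

text \<open>k nested horizontal strands around the wall in each row, the other strands straight.\<close>

definition Fd :: "nat \<Rightarrow> diag" where
  "Fd k x = (if x \<in> verts nn then (if region k (snd x) then (fst x, 2*rk+1 - snd x) else (\<not> fst x, snd x)) else x)"

definition fk :: "nat \<Rightarrow> wb" where "fk k = D (Fd k)"

lemma region_facts:
  assumes "lv k" "region k i"
  shows "1 \<le> i" "i \<le> nn" "region k (2*rk+1-i)" "2*rk+1-(2*rk+1-i) = i" "2*rk+1-i \<le> rk \<longleftrightarrow> \<not> i \<le> rk"
  using assms by (auto simp: lv_def region_def)

lemma Fd_W: assumes "lv k" shows "Fd k \<in> W"
  unfolding W_iff wdiag_iff
proof (intro conjI allI impI ballI)
  fix x assume "x \<notin> verts nn" then show "Fd k x = x" by (simp add: Fd_def)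
next
  fix x assume "x \<in> verts nn"
  then obtain b i where x: "x = (b, i)" "1 \<le> i" "i \<le> nn" by (cases x) auto
  show "Fd k x \<in> verts nn"
    using x region_facts[OF assms, of i] region_facts[OF assms, of "2*rk+1-i"] by (auto simp: Fd_def)
  show "Fd k (Fd k x) = x"
    using x region_facts[OF assms, of i] region_facts[OF assms, of "2*rk+1-i"] by (auto simp: Fd_def)
  show "pos_end rk (Fd k x) \<longleftrightarrow> \<not> pos_end rk x"
    using x region_facts(5)[OF assms, of i] by (auto simp: Fd_def pos_end_def left_of_wall_def)
qed

lemma card_region: assumes "lv k" shows "card {i\<in>{1..rk}. region k i} = k"
proof -
  have "{i\<in>{1..rk}. region k i} = {rk+1-k..rk}" using assms by (auto simp: region_def lv_def)
  then show ?thesis using assms by (simp add: lv_def)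
qed

lemma ar_Fd: assumes "lv k" shows "ar (Fd k) = k"
proof -
  have "{i\<in>{1..rk}. fst (Fd k (True, i))} = {i\<in>{1..rk}. region k i}"
    by (auto simp: Fd_def)
  then show ?thesis using card_region[OF assms] by (simp add: ar_def)
qed

lemma fk_J: "lv k \<Longrightarrow> fk k \<in> J k"
  by (simp add: fk_def J_D Fd_W ar_Fd)

lemma flip_Fd: "flip_diag (Fd k) = Fd k"
  by (rule ext) (auto simp: flip_diag_def Fd_def verts_def)

lemma fl_fk: "lv k \<Longrightarrow> fl (fk k) = fk k"
  by (simp add: fk_def fl_D Fd_W flip_Fd)

lemma fk_0: "fk 0 = 1"
proof -
  have "Fd 0 = id_diag nn" by (rule ext) (auto simp: Fd_def id_diag_def region_def)
  then show ?thesis by (simp add: fk_def D_one)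
qed

text \<open>The pair just outside the first \<open>k\<close> arcs is vertical in
  \<open>Fd k\<close>, so surgery closes it without producing a loop.\<close>

lemma fk_Suc:
  assumes "lv (Suc k)"
  shows "fk (Suc k) = E (rk - k) (rk + k + 1) * fk k"
proof -
  let ?i = "rk - k" and ?j = "rk + k + 1"
  have a: "arc ?i ?j" using assms by (auto simp: arc_def lv_def)
  have l: "lv k" using assms by (simp add: lv_def)
  have F: "Fd k (b, ?i) = (\<not> b, ?i)" "Fd k (b, ?j) = (\<not> b, ?j)" for b
    using a assms by (auto simp: Fd_def region_def arc_def lv_def)
  have "surgery (Fd k) (False, ?i) (False, ?j) z = Fd (Suc k) z" for z
  proof -
    obtain b m where z: "z = (b, m)" by (cases z)
    have r: "region (Suc k) m \<longleftrightarrow> region k m \<or> m = ?i \<or> m = ?j" using assms by (auto simp: region_def lv_def)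
    have nr: "\<not> region k ?i" "\<not> region k ?j" using assms by (auto simp: region_def lv_def)
    have ij: "2*rk+1-?i = ?j" "2*rk+1-?j = ?i" "?i \<noteq> ?j" using assms by (auto simp: lv_def)
    have v: "(b, ?i) \<in> verts nn" "(b, ?j) \<in> verts nn" using a by (auto simp: arc_def)
    consider "m = ?i" | "m = ?j" | "m \<noteq> ?i \<and> m \<noteq> ?j" by auto
    then show ?thesis
    proof cases
      case 1
      have "Fd (Suc k) z = (b, ?j)" unfolding z 1 Fd_def using v(1) r 1 ij(1) by simp
      then show ?thesis unfolding z 1 surgery_def F using ij(3) by (cases b) simp_all
    next
      case 2
      have "Fd (Suc k) z = (b, ?i)" unfolding z 2 Fd_def using v(2) r 2 ij(2) by simp
      then show ?thesis unfolding z 2 surgery_def F using ij(3) by (cases b) simp_all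
    next
      case 3
      have "Fd (Suc k) z = Fd k z" unfolding z Fd_def using r 3 by simp
      then show ?thesis unfolding z surgery_def F using 3 by simp
    qed
  qed
  then have "surgery (Fd k) (False, ?i) (False, ?j) = Fd (Suc k)" by blast
  then show ?thesis
    using E_mult_D[OF a Fd_W[OF l]] F(1)[of False] by (simp add: fk_def)
qed

text \<open>By \<open>fk_Suc\<close>, \<open>fk k\<close> is a product of arcs whose ends lie in the
  region.\<close>

lemma commute_fk:
  assumes "\<And>i j. arc i j \<Longrightarrow> region k i \<Longrightarrow> region k j \<Longrightarrow> x * E i j = E i j * x" "lv k"
  shows "x * fk k = fk k * x"
  using assms
proof (induction k)
  case 0 then show ?case by (simp add: fk_0)
next
  case (Suc k)
  have l: "lv k" using Suc.prems by (simp add: lv_def)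
  have "x * fk k = fk k * x"
  proof (rule Suc.IH[OF _ l])
    fix i j assume "arc i j" "region k i" "region k j"
    then show "x * E i j = E i j * x" by (intro Suc.prems(1)) (auto simp: region_def)
  qed
  moreover have "x * E (rk - k) (rk + k + 1) = E (rk - k) (rk + k + 1) * x"
    using Suc.prems(2) by (intro Suc.prems(1)) (auto simp: arc_def region_def lv_def)
  ultimately show ?case unfolding fk_Suc[OF Suc.prems(2)] by (intro commute_mult)
qed

definition G :: "nat \<Rightarrow> (nat \<Rightarrow> nat) set" where "G k = {\<sigma>. wp \<sigma> \<and> (\<forall>i. region k i \<longrightarrow> \<sigma> i = i)}"

lemma G_fk_commute: assumes "\<sigma> \<in> G k" "lv k" shows "P \<sigma> * fk k = fk k * P \<sigma>"
proof (rule commute_fk[OF _ assms(2)])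
  fix i j assume "arc i j" "region k i" "region k j"
  then show "P \<sigma> * E i j = E i j * P \<sigma>" using P_E[of \<sigma> i j] assms(1) by (simp add: G_def)
qed

definition top_std :: "nat \<Rightarrow> diag \<Rightarrow> bool" where
  "top_std k d \<longleftrightarrow> (\<forall>i. region k i \<longrightarrow> d (True, i) = (True, 2*rk+1-i))"

lemma mult_fk_top_std:
  assumes "lv k" "coef (x * fk k) d \<noteq> 0"
  shows "top_std k d"
proof -
  obtain d1 d2 where d: "d1 \<in> W" "d2 \<in> W" "coef x d1 \<noteq> 0" "coef (fk k) d2 \<noteq> 0" "compose nn d2 d1 = d"
    using assms(2) by (rule coef_mult_nonzero)
  then have d2: "d2 = Fd k" using Fd_W[OF assms(1)] by (auto simp: fk_def coef_D split: if_splits)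
  show ?thesis unfolding top_std_def
  proof (intro allI impI)
    fix i assume i: "region k i"
    then have "Fd k (True, i) = (True, 2*rk+1-i)" using region_facts[OF assms(1) i] by (simp add: Fd_def)
    then show "d (True, i) = (True, 2*rk+1-i)"
      using compose_top_arc[OF d(2,1), of i "2*rk+1-i"] region_facts[OF assms(1) i] d(5) d2 by simp
  qed
qed

lemma fk_mult_bot_std:
  assumes "lv k" "coef (fk k * x) d \<noteq> 0"
  shows "top_std k (flip_diag d)"
proof -
  have "coef (fl x * fk k) (flip_diag d) = coef (fl (fk k * x)) (flip_diag d)"
    by (simp add: fl_mult fl_fk[OF assms(1)])
  also have "\<dots> = coef (fk k * x) d" by (simp add: fl.rep_eq)
  finally have "coef (fl x * fk k) (flip_diag d) \<noteq> 0" using assms(2) by simp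
  then show ?thesis by (rule mult_fk_top_std[OF assms(1)])
qed

text \<open>The \<open>k\<close> standard arcs fill the region of each row, so all other vertices
  carry vertical strands, and these form a permutation that fixes the region.\<close>

lemma std_diag:
  assumes l: "lv k" and d: "d \<in> W" and top: "top_std k d" and bot: "top_std k (flip_diag d)" and ar: "ar d = k"
  shows "\<exists>\<rho>\<in>G k. D d = P \<rho> * fk k"
proof -
  have t: "d (True, i) = (True, 2*rk+1-i)" if "region k i" for i using top that by (simp add: top_std_def)
  have b: "d (False, i) = (False, 2*rk+1-i)" if "region k i" for i
  proof -
    have "apfst Not (d (False, i)) = (True, 2*rk+1-i)" using bot that by (simp add: top_std_def flip_diag_def)
    then show ?thesis by (cases "d (False, i)") auto
  qed
  \<comment> \<open>Counting leaves no horizontal end on the left outside the region.\<close>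
  have H: "{i\<in>{1..rk}. region k i} = {i\<in>{1..rk}. fst (d (True, i))}"
  proof (rule card_subset_eq)
    show "{i\<in>{1..rk}. region k i} \<subseteq> {i\<in>{1..rk}. fst (d (True, i))}"
      by (rule subsetI) (simp add: t)
    show "card {i\<in>{1..rk}. region k i} = card {i\<in>{1..rk}. fst (d (True, i))}"
      using card_region[OF l] ar by (simp add: ar_def)
  qed simp
  have v: "\<exists>j. d (True, i) = (False, j) \<and> d (False, j) = (True, i) \<and> j \<in> {1..nn} \<and> \<not> region k j \<and> (j \<le> rk \<longleftrightarrow> i \<le> rk)"
    if i: "i \<in> {1..nn}" "\<not> region k i" for i
  proof -
    obtain c j where j: "d (True, i) = (c, j)" by (cases "d (True, i)")
    note w = W_wall[OF d i(1) j]
    have "\<not> c"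
    proof
      assume c: "c"
      have "\<not> i \<le> rk"
      proof
        assume "i \<le> rk"
        then have "i \<in> {i\<in>{1..rk}. fst (d (True, i))}" using i j c by simp
        then show False using H i by blast
      qed
      then have "j \<le> rk" using w(2) c by simp
      then have "j \<in> {i\<in>{1..rk}. fst (d (True, i))}" using w(1,4) c by simp
      then have "region k j" using H by blast
      then have "i = 2*rk+1-j" using t[of j] w(4) c by simp
      then show False using region_facts(3)[OF l \<open>region k j\<close>] i by simp
    qed
    moreover have "\<not> region k j"
    proof
      assume "region k j"
      then show False using b[of j] w(4) calculation by simp
    qed
    ultimately show ?thesis using j w by auto
  qed
  define \<rho> where "\<rho> i = (if i \<in> {1..nn} \<and> \<not> region k i then snd (d (True, i)) else i)" for i
  have \<rho>: "d (True, i) = (False, \<rho> i)" "d (False, \<rho> i) = (True, i)" "\<rho> i \<in> {1..nn}" "\<not> region k (\<rho> i)" "\<rho> i \<le> rk \<longleftrightarrow> i \<le> rk"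
    if i: "i \<in> {1..nn}" "\<not> region k i" for i
    using v[OF i] i by (auto simp: \<rho>_def)
  have \<rho>_reg: "\<rho> i = i" if "region k i \<or> i \<notin> {1..nn}" for i using that by (auto simp: \<rho>_def)
  have inj: "inj_on \<rho> {1..nn}"
  proof (rule inj_onI)
    fix i j assume ij: "i \<in> {1..nn}" "j \<in> {1..nn}" "\<rho> i = \<rho> j"
    show "i = j"
    proof (cases "region k i")
      case True
      then have i: "\<rho> i = i" by (simp add: \<rho>_reg)
      have "region k (\<rho> j)" using True unfolding ij(3)[symmetric] i .
      then have "region k j" using \<rho>(4)[OF ij(2)] by blast
      then have "\<rho> j = j" by (simp add: \<rho>_reg)
      then show ?thesis using ij(3) unfolding i by (rule trans[rotated])
    next
      case False
      have "\<not> region k j"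
      proof
        assume j: "region k j"
        then have "\<rho> j = j" by (simp add: \<rho>_reg)
        then show False using \<rho>(4)[OF ij(1) False] j unfolding ij(3) by simp
      qed
      then have "(True, i) = (True, j)"
        using \<rho>(2)[OF ij(1) False] \<rho>(2)[OF ij(2)] unfolding ij(3) by simp
      then show ?thesis by simp
    qed
  qed
  have into: "\<rho> i \<in> {1..nn}" if "i \<in> {1..nn}" for i
    using \<rho>(3)[OF that] \<rho>_reg[of i] that by (cases "region k i") auto
  have "\<rho> permutes {1..nn}"
  proof (rule bij_imp_permutes)
    show "bij_betw \<rho> {1..nn} {1..nn}" unfolding bij_betw_def
      using inj into endo_inj_surj[of "{1..nn}" \<rho>] by blast
  qed (use \<rho>_reg in auto)
  moreover have "\<rho> i \<le> rk \<longleftrightarrow> i \<le> rk" for i using \<rho>(5)[of i] \<rho>_reg[of i] by (cases "i \<in> {1..nn} \<and> \<not> region k i") auto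
  ultimately have wp: "wp \<rho>" by (simp add: wall_perm_def)
  have G: "\<rho> \<in> G k" using wp \<rho>_reg by (simp add: G_def)
  have key: "d (relabel_bot \<rho> y) = relabel_bot \<rho> (Fd k y)" for y
  proof -
    obtain c i where y: "y = (c, i)" by (cases y)
    consider "i \<notin> {1..nn}" | "i \<in> {1..nn}" "region k i" | "i \<in> {1..nn}" "\<not> region k i" by blast
    then show ?thesis
    proof cases
      case 1
      then have "(c, i) \<notin> verts nn" by auto
      then show ?thesis using wdiag_simps(2)[OF d] \<rho>_reg[of i] 1 unfolding y by (cases c) (auto simp: Fd_def)
    next
      case 2
      then have "Fd k y = (c, 2*rk+1-i)" unfolding y by (auto simp: Fd_def)
      moreover have "\<rho> i = i" "\<rho> (2*rk+1-i) = 2*rk+1-i" using 2 region_facts(3)[OF l] \<rho>_reg by auto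
      ultimately show ?thesis using t[OF 2(2)] b[OF 2(2)] unfolding y by (cases c) auto
    next
      case 3
      then have "Fd k y = (\<not> c, i)" unfolding y by (auto simp: Fd_def)
      then show ?thesis using \<rho>[OF 3] unfolding y by (cases c) auto
    qed
  qed
  have "relabel_bot \<rho> \<circ> Fd k \<circ> relabel_bot (inv \<rho>) = d"
  proof
    fix x
    have "relabel_bot \<rho> (relabel_bot (inv \<rho>) x) = x"
      using wall_perm_inv_apply[OF wp] by (cases x; cases "fst x") auto
    then show "(relabel_bot \<rho> \<circ> Fd k \<circ> relabel_bot (inv \<rho>)) x = d x"
      using key[of "relabel_bot (inv \<rho>) x"] by simp
  qed
  then have "D d = P \<rho> * fk k" using P_mult_D[OF wp Fd_W[OF l]] by (simp add: fk_def)
  then show ?thesis using G by blast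
qed

section \<open>Bringing arbitrary diagrams to standard form\<close>

lemma extend_perm:
  assumes "finite X" "A \<subseteq> X" "inj_on f A" "f ` A \<subseteq> X"
  obtains g where "g permutes X" "\<And>a. a \<in> A \<Longrightarrow> g a = f a"
proof -
  have "card (X - A) = card (X - f ` A)"
    using assms by (simp add: card_Diff_subset finite_subset card_image)
  then obtain h where h: "bij_betw h (X - A) (X - f ` A)"
    using assms(1) finite_same_card_bij by (metis finite_Diff)
  define g where "g a = (if a \<in> A then f a else if a \<in> X then h a else a)" for a
  have "bij_betw g A (f ` A)" using assms(3) by (auto simp: bij_betw_def inj_on_def g_def)
  moreover have "bij_betw g (X - A) (X - f ` A)"
    using h by (subst bij_betw_cong[of "X - A" g h]) (auto simp: g_def)
  ultimately have "bij_betw g (A \<union> (X - A)) (f ` A \<union> (X - f ` A))"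
    by (rule bij_betw_combine) auto
  moreover have "A \<union> (X - A) = X" "f ` A \<union> (X - f ` A) = X" using assms by auto
  ultimately have "bij_betw g X X" by simp
  then have "g permutes X" by (rule bij_imp_permutes) (use assms in \<open>auto simp: g_def\<close>)
  then show thesis using that by (simp add: g_def)
qed

text \<open>The left ends of the bottom arcs are moved to the left half of the region by any
  bijection, their partners to the reflected places, and both choices are extended to permutations
  of the two sides.\<close>

lemma normalize_bottom:
  assumes d: "d \<in> W"
  shows "\<exists>\<sigma>. wp \<sigma> \<and> top_std (ar d) (flip_diag (relabel_bot \<sigma> \<circ> d \<circ> relabel_bot (inv \<sigma>)))"
proof -
  let ?k = "ar d"
  have l: "lv ?k" using ar_le[OF d] by (simp add: lv_def)
  define A where "A = {i\<in>{1..rk}. \<not> fst (d (False, i))}"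
  define p where "p i = snd (d (False, i))" for i
  have dp: "d (False, i) = (False, p i)" if "i \<in> A" for i using that by (auto simp: A_def p_def prod_eq_iff)
  have pA: "p i \<in> {rk+1..nn}" "d (False, p i) = (False, i)" if "i \<in> A" for i
    using W_wall[OF d _ dp[OF that]] that by (auto simp: A_def)
  have finA: "finite A" "A \<subseteq> {1..rk}" by (auto simp: A_def)
  have injp: "inj_on p A" by (rule inj_onI) (use pA(2) in \<open>metis prod.inject\<close>)
  have "ar (flip_diag d) = card A" by (simp add: ar_def flip_diag_def A_def)
  then have cA: "card A = ?k" using ar_flip[OF d] by simp
  have "card A = card {rk+1-?k..rk}" using cA l by (simp add: lv_def)
  then obtain g where g: "bij_betw g A {rk+1-?k..rk}" using finite_same_card_bij[OF finA(1)] by blast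
  have gA: "g i \<in> {rk+1-?k..rk}" if "i \<in> A" for i using g that by (auto simp: bij_betw_def)
  obtain \<sigma>1 where s1: "\<sigma>1 permutes {1..rk}" "\<And>a. a \<in> A \<Longrightarrow> \<sigma>1 a = g a"
  proof (rule extend_perm[of "{1..rk}" A g])
    show "g ` A \<subseteq> {1..rk}" using gA l by (fastforce simp: lv_def)
  qed (use finA g in \<open>auto simp: bij_betw_def\<close>)
  \<comment> \<open>The right end of the arc whose left end goes to \<open>g i\<close> is sent to
    the reflection of \<open>g i\<close>.\<close>
  define q where "q j = 2*rk+1 - g (inv_into A p j)" for j
  have qp: "q (p i) = 2*rk+1 - g i" if "i \<in> A" for i using that injp by (simp add: q_def)
  obtain \<sigma>2 where s2: "\<sigma>2 permutes {rk+1..nn}" "\<And>a. a \<in> p ` A \<Longrightarrow> \<sigma>2 a = q a"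
  proof (rule extend_perm[of "{rk+1..nn}" "p ` A" q])
    show "p ` A \<subseteq> {rk+1..nn}" using pA by blast
    show "q ` p ` A \<subseteq> {rk+1..nn}"
    proof
      fix y assume "y \<in> q ` p ` A"
      then obtain i where i: "i \<in> A" "y = 2*rk+1 - g i" using qp by auto
      then show "y \<in> {rk+1..nn}" using gA[OF i(1)] l by (auto simp: lv_def)
    qed
    show "inj_on q (p ` A)"
    proof (rule inj_onI)
      fix x y assume "x \<in> p ` A" "y \<in> p ` A" "q x = q y"
      then obtain i j where ij: "i \<in> A" "j \<in> A" "x = p i" "y = p j" "2*rk+1 - g i = 2*rk+1 - g j" using qp by auto
      then have "g i = g j" using gA[OF ij(1)] gA[OF ij(2)] by auto
      then show "x = y" using g ij by (auto simp: bij_betw_def inj_on_def)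
    qed
  qed auto
  define \<sigma> where "\<sigma> = \<sigma>1 \<circ> \<sigma>2"
  have wp: "wp \<sigma>" unfolding \<sigma>_def by (intro wall_perm_comp wp_left wp_right s1 s2)
  have \<sigma>A: "\<sigma> i = g i" "\<sigma> (p i) = 2*rk+1 - g i" if i: "i \<in> A" for i
  proof -
    have "\<sigma>2 i = i" using permutes_not_in[OF s2(1), of i] i by (auto simp: A_def)
    then show "\<sigma> i = g i" using s1(2)[OF i] by (simp add: \<sigma>_def)
    have "\<sigma>2 (p i) = 2*rk+1 - g i" using s2(2)[of "p i"] i qp by simp
    moreover have "\<sigma>1 (2*rk+1 - g i) = 2*rk+1 - g i"
      using gA[OF i] by (intro permutes_not_in[OF s1(1)]) auto
    ultimately show "\<sigma> (p i) = 2*rk+1 - g i" by (simp add: \<sigma>_def)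
  qed
  let ?d = "relabel_bot \<sigma> \<circ> d \<circ> relabel_bot (inv \<sigma>)"
  have d': "?d \<in> W" using compose_perm_diag(3)[of rk sk d \<sigma>] wp d by (simp add: W_iff)
  have left: "?d (False, i) = (False, 2*rk+1-i)" if i: "region ?k i" "i \<le> rk" for i
  proof -
    have "i \<in> {rk+1-?k..rk}" using i l by (auto simp: region_def lv_def)
    then have "i \<in> g ` A" using bij_betw_imp_surj_on[OF g] by simp
    then obtain a where a: "a \<in> A" "i = g a" by blast
    then have "inv \<sigma> i = a" using \<sigma>A(1)[OF a(1)] wall_perm_inv_apply(1)[OF wp, of a] by simp
    then show ?thesis using dp[OF a(1)] \<sigma>A(2)[OF a(1)] a(2) by simp
  qed
  have "?d (False, i) = (False, 2*rk+1-i)" if i: "region ?k i" for i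
  proof (cases "i \<le> rk")
    case True then show ?thesis using left i by blast
  next
    case False
    note rf = region_facts[OF l i]
    have "?d (False, 2*rk+1-i) = (False, i)" using left[OF rf(3)] rf(4,5) False by metis
    then show ?thesis using wdiag_simps(1)[OF d', of "(False, 2*rk+1-i)"] by simp
  qed
  then have "top_std ?k (flip_diag ?d)" by (simp add: top_std_def flip_diag_def)
  then show ?thesis using wp by blast
qed

text \<open>The bottom row is normalised, then by reflection the top row; \<open>std_diag\<close>
  identifies the result, and its permutation is absorbed in an outer factor.\<close>

lemma diag_factor:
  assumes d: "d \<in> W"
  shows "\<exists>\<sigma> \<tau>. wp \<sigma> \<and> wp \<tau> \<and> D d = P \<sigma> * fk (ar d) * P \<tau>"
proof -
  let ?k = "ar d"
  have l: "lv ?k" using ar_le[OF d] by (simp add: lv_def)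
  have rel: "relabel_bot \<sigma> \<circ> d \<circ> relabel_bot (inv \<sigma>) \<in> W" "ar (relabel_bot \<sigma> \<circ> d \<circ> relabel_bot (inv \<sigma>)) = ar d"
    "top_std k d \<Longrightarrow> top_std k (relabel_bot \<sigma> \<circ> d \<circ> relabel_bot (inv \<sigma>))" if "d \<in> W" "wp \<sigma>" for d \<sigma> k
    using compose_perm_diag(3)[of rk sk d \<sigma>] that by (auto simp: W_iff ar_def top_std_def)
  obtain \<sigma> where \<sigma>: "wp \<sigma>" "top_std ?k (flip_diag (relabel_bot \<sigma> \<circ> d \<circ> relabel_bot (inv \<sigma>)))"
    using normalize_bottom[OF d] by blast
  define d1 where "d1 = relabel_bot \<sigma> \<circ> d \<circ> relabel_bot (inv \<sigma>)"
  have d1: "d1 \<in> W" "ar d1 = ?k" "top_std ?k (flip_diag d1)" "D d1 = P \<sigma> * D d"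
    unfolding d1_def using rel[OF d \<sigma>(1)] \<sigma>(2) P_mult_D[OF \<sigma>(1) d] by auto
  have f: "flip_diag d1 \<in> W" "ar (flip_diag d1) = ?k" using d1 ar_flip by auto
  obtain \<tau> where \<tau>: "wp \<tau>" "top_std ?k (flip_diag (relabel_bot \<tau> \<circ> flip_diag d1 \<circ> relabel_bot (inv \<tau>)))"
    using normalize_bottom[OF f(1)] f(2) by auto
  define d2 where "d2 = relabel_bot \<tau> \<circ> flip_diag d1 \<circ> relabel_bot (inv \<tau>)"
  have d2: "d2 \<in> W" "ar d2 = ?k" "top_std ?k (flip_diag d2)" "top_std ?k d2" "D d2 = P \<tau> * D (flip_diag d1)"
    unfolding d2_def using rel[OF f(1) \<tau>(1)] \<tau>(2) d1(3) f(2) P_mult_D[OF \<tau>(1) f(1)] by auto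
  obtain \<rho> where \<rho>: "\<rho> \<in> G ?k" "D d2 = P \<rho> * fk ?k" using std_diag[OF l d2(1,4,3,2)] by blast
  have w\<rho>: "wp \<rho>" using \<rho> by (simp add: G_def)
  have "P (inv \<tau>) * (P \<rho> * fk ?k) = D (flip_diag d1)"
    using P_inv(2)[OF \<tau>(1)] d2(5) \<rho>(2) by (metis mult.assoc mult_1_left)
  then have "fl (P (inv \<tau>) * (P \<rho> * fk ?k)) = D d1" using fl_D[OF f(1)] by simp
  then have "D d1 = fk ?k * P (inv \<rho>) * P \<tau>"
    using fl_P[OF wall_perm_inv[OF \<tau>(1)]] fl_P[OF w\<rho>] fl_fk[OF l] wall_perm_bij[OF \<tau>(1)]
    by (simp add: fl_mult inv_inv_eq mult.assoc)
  then have "D d = P (inv \<sigma>) * (fk ?k * P (inv \<rho>) * P \<tau>)"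
    using P_inv(2)[OF \<sigma>(1)] d1(4) by (metis mult.assoc mult_1_left)
  also have "\<dots> = P (inv \<sigma>) * fk ?k * P (inv \<rho> \<circ> \<tau>)"
    using P_mult[OF wall_perm_inv[OF w\<rho>] \<tau>(1)] by (simp add: mult.assoc)
  finally show ?thesis using wall_perm_inv[OF \<sigma>(1)] wall_perm_comp[OF wall_perm_inv[OF w\<rho>] \<tau>(1)] by blast
qed

text \<open>By \<open>diag_factor\<close> and \<open>commute_fk\<close>, commuting with permutations
  and arcs is enough to commute with every diagram.\<close>

lemma center_I:
  assumes zP: "\<And>\<sigma>. wp \<sigma> \<Longrightarrow> P \<sigma> * z = z * P \<sigma>" and zE: "\<And>i j. arc i j \<Longrightarrow> E i j * z = z * E i j"
  shows "z \<in> center"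
proof -
  have "z * a = a * z" for a
  proof (induction a rule: wb_induct)
    case (diag d)
    obtain \<sigma> \<tau> where s: "wp \<sigma>" "wp \<tau>" "D d = P \<sigma> * fk (ar d) * P \<tau>" using diag_factor[OF diag] by blast
    have "z * fk (ar d) = fk (ar d) * z"
      by (rule commute_fk) (use zE ar_le[OF diag] in \<open>auto simp: lv_def\<close>)
    then show ?case unfolding s(3) using zP[OF s(1)] zP[OF s(2)] by (intro commute_mult) auto
  next
    case (scale c x) then show ?case using commute_mult[of z "sc c" x] sc_comm by auto
  qed (auto simp: algebra_simps)
  then show ?thesis by (simp add: center_def)
qed

lemma Zs_center: assumes "z \<in> Zs" shows "z \<in> center"
proof -
  obtain c where c: "comb_supersym c" "z = ev c" using assms by (rule Zs_E)
  have "P \<sigma> * z = z * P \<sigma>" if "wp \<sigma>" for \<sigma>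
    using commute_P[OF commute_T that] T_adjacent_commute_ev[OF c(1)] c(2) by blast
  then show ?thesis
    using commute_E[of z] wall_arc_commute_ev[OF c(1)] c(2) by (intro center_I) auto
qed

lemma center_commute: "z \<in> center \<Longrightarrow> z * a = a * z"
  by (simp add: center_def)

text \<open>Diagrams with exactly \<open>k\<close> arcs are
  \<open>P \<sigma> * fk k * P \<tau>\<close>, and a central \<open>y\<close> slides through to
  \<open>fk k\<close>; those with more arcs lie in \<open>J (Suc k)\<close> anyway.\<close>

lemma center_J:
  assumes y: "y \<in> center" "y * fk k \<in> J (Suc k)" and x: "x \<in> J k"
  shows "y * x \<in> J (Suc k)"
proof -
  have "y * (sc (coef x d) * D d) \<in> J (Suc k)" if d: "d \<in> W" for d
  proof (cases "coef x d = 0")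
    case False
    then have k: "k \<le> ar d" using x by (simp add: J_def)
    have "y * D d \<in> J (Suc k)"
    proof (cases "ar d = k")
      case True
      obtain \<sigma> \<tau> where s: "D d = P \<sigma> * fk k * P \<tau>" using diag_factor[OF d] True by blast
      have "y * D d = P \<sigma> * (y * fk k) * P \<tau>"
        unfolding s using center_commute[OF y(1), of "P \<sigma>"] by (simp add: mult.assoc[symmetric])
      then show ?thesis using y(2) J_left J_right by simp
    next
      case False
      then show ?thesis using J_left J_D[OF d] k by simp
    qed
    then have "sc (coef x d) * (y * D d) \<in> J (Suc k)" by (rule J_left)
    then show ?thesis by (metis mult.assoc sc_comm)
  qed simp
  then have "(\<Sum>d\<in>W. y * (sc (coef x d) * D d)) \<in> J (Suc k)" by (rule J_sum)
  then show ?thesis using wb_expand[of x] by (simp add: sum_distrib_left[symmetric])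
qed

section \<open>Averages over the vertical permutations\<close>

text \<open>An average without division: the factor \<open>card (G k)\<close> is carried along until
  \<open>level_step\<close>.\<close>

definition av :: "nat \<Rightarrow> wb \<Rightarrow> wb" where "av k x = (\<Sum>g\<in>G k. P g * x * P (inv g))"

lemma finite_G: "finite (G k)"
  by (rule finite_subset[of _ "{p. p permutes {1..nn}}"]) (auto simp: G_def wall_perm_def finite_permutations)

lemma G_id: "id \<in> G k" by (simp add: G_def)
lemma G_comp: "\<sigma> \<in> G k \<Longrightarrow> \<tau> \<in> G k \<Longrightarrow> \<sigma> \<circ> \<tau> \<in> G k" by (simp add: G_def wall_perm_comp)
lemma G_inv: "\<sigma> \<in> G k \<Longrightarrow> inv \<sigma> \<in> G k"
proof -
  assume s: "\<sigma> \<in> G k"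
  then have w: "wp \<sigma>" by (simp add: G_def)
  have "inv \<sigma> i = i" if "region k i" for i
  proof -
    have "\<sigma> i = i" using s that by (simp add: G_def)
    then show ?thesis using wall_perm_inv_apply(1)[OF w, of i] by simp
  qed
  then show ?thesis using wall_perm_inv[OF w] by (simp add: G_def)
qed
lemma G_wp: "\<sigma> \<in> G k \<Longrightarrow> wp \<sigma>" by (simp add: G_def)

lemma card_G: "of_nat (card (G k)) \<noteq> (0::complex)"
  using finite_G[of k] G_id[of k] by auto

lemma av_add: "av k (x + y) = av k x + av k y"
  by (simp add: av_def algebra_simps sum.distrib)

lemma av_zero: "av k 0 = 0" by (simp add: av_def)

lemma av_sum: "av k (\<Sum>i\<in>A. f i) = (\<Sum>i\<in>A. av k (f i))"
  by (induction A rule: infinite_finite_induct) (auto simp: av_add av_zero)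

lemma av_one: "av k 1 = sc (of_nat (card (G k)))"
  using P_inv(1)[OF G_wp] by (simp add: av_def)

lemma av_conj:
  assumes h: "h \<in> G k"
  shows "av k (P h * x * P (inv h)) = av k x"
proof -
  have b: "bij_betw (\<lambda>g. g \<circ> h) (G k) (G k)"
  proof (rule bij_betwI[where g = "\<lambda>g. g \<circ> inv h"])
    have "h \<circ> inv h = id" "inv h \<circ> h = id" using permutes_inv_o G_wp[OF h] unfolding wall_perm_def by blast+
    then show "x \<circ> h \<circ> inv h = x" "x \<circ> inv h \<circ> h = x" for x by (simp_all add: comp_assoc)
  qed (use h G_comp G_inv in auto)
  have "av k (P h * x * P (inv h)) = (\<Sum>g\<in>G k. P (g \<circ> h) * x * P (inv (g \<circ> h)))"
    unfolding av_def
  proof (intro sum.cong refl)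
    fix g assume g: "g \<in> G k"
    have "inv (g \<circ> h) = inv h \<circ> inv g" using G_wp g h wall_perm_bij by (metis o_inv_distrib)
    then have "P (g \<circ> h) = P g * P h" "P (inv (g \<circ> h)) = P (inv h) * P (inv g)"
      using P_mult[OF G_wp[OF g] G_wp[OF h]] P_mult[OF wall_perm_inv[OF G_wp[OF h]] wall_perm_inv[OF G_wp[OF g]]]
      by simp_all
    then show "P g * (P h * x * P (inv h)) * P (inv g) = P (g \<circ> h) * x * P (inv (g \<circ> h))"
      by (simp only: mult.assoc)
  qed
  also have "\<dots> = av k x" unfolding av_def by (rule sum.reindex_bij_betw[OF b])
  finally show ?thesis .
qed

text \<open>At level \<open>k\<close>, such an \<open>x\<close> cannot be told apart from an element
  of \<open>Zs\<close>. Collecting all of them allows the class averages of \<open>G k\<close> to be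
  treated one at a time.\<close>

definition Rep :: "nat \<Rightarrow> wb \<Rightarrow> bool" where
  "Rep k x \<longleftrightarrow> (\<exists>q\<in>Zs. q * fk k - x * fk k \<in> J (Suc k))"

lemma Rep_add: assumes "Rep k x" "Rep k y" shows "Rep k (x + y)"
proof -
  obtain q q' where q: "q \<in> Zs" "q * fk k - x * fk k \<in> J (Suc k)" "q' \<in> Zs" "q' * fk k - y * fk k \<in> J (Suc k)"
    using assms unfolding Rep_def by blast
  have "(q + q') * fk k - (x + y) * fk k = (q * fk k - x * fk k) + (q' * fk k - y * fk k)" by (simp add: algebra_simps)
  then show ?thesis unfolding Rep_def using q J_add Zs_add by metis
qed

lemma Rep_scale: assumes "Rep k x" shows "Rep k (sc c * x)"
proof -
  obtain q where q: "q \<in> Zs" "q * fk k - x * fk k \<in> J (Suc k)" using assms unfolding Rep_def by blast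
  have "(sc c * q) * fk k - (sc c * x) * fk k = sc c * (q * fk k - x * fk k)" by (simp add: algebra_simps)
  then show ?thesis unfolding Rep_def using J_left[OF q(2)] Zs_mult[OF Zs_sc q(1)] by metis
qed

lemma Rep_sc: "Rep k (sc c)"
  unfolding Rep_def by (rule bexI[of _ "sc c"]) (simp_all add: Zs_sc)

lemma Rep_zero: "Rep k 0" using Rep_sc[of k 0] by simp

lemma Rep_diff: assumes "Rep k x" "Rep k y" shows "Rep k (x - y)"
  using Rep_add[OF assms(1) Rep_scale[OF assms(2), of "-1"]] by simp

lemma Rep_sum: "(\<And>i. i \<in> A \<Longrightarrow> Rep k (f i)) \<Longrightarrow> Rep k (\<Sum>i\<in>A. f i)"
  by (induction A rule: infinite_finite_induct) (auto intro: Rep_add Rep_zero)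

text \<open>On \<open>fk k\<close> the right factor \<open>p\<close> may be replaced by a central
  element, which then leaves the average.\<close>

lemma Rep_av_mult:
  assumes l: "lv k" and x: "Rep k (av k x)" and p: "Rep k p"
  shows "Rep k (av k (x * p))"
proof -
  obtain q where q: "q \<in> Zs" "q * fk k - av k x * fk k \<in> J (Suc k)" using x unfolding Rep_def by blast
  obtain q' where q': "q' \<in> Zs" "q' * fk k - p * fk k \<in> J (Suc k)" using p unfolding Rep_def by blast
  have c: "q' * a = a * q'" for a using center_commute[OF Zs_center[OF q'(1)]] .
  have av_fk: "av k (x * y) * fk k = (\<Sum>g\<in>G k. (P g * x) * (y * fk k) * P (inv g))" for y
    unfolding av_def sum_distrib_right
  proof (intro sum.cong refl)
    fix g assume "g \<in> G k"
    then show "P g * (x * y) * P (inv g) * fk k = P g * x * (y * fk k) * P (inv g)"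
      using G_fk_commute[OF G_inv l] by (simp add: mult.assoc)
  qed
  have "q' * av k x = av k (x * q')"
    unfolding av_def sum_distrib_left
  proof (intro sum.cong refl)
    fix g
    have "q' * (P g * x * P (inv g)) = (P g * x) * q' * P (inv g)" using c[of "P g * x"] by (simp add: mult.assoc[symmetric])
    then show "q' * (P g * x * P (inv g)) = P g * (x * q') * P (inv g)" by (simp add: mult.assoc)
  qed
  then have "q' * av k x * fk k - av k (x * p) * fk k = (\<Sum>g\<in>G k. (P g * x) * (q' * fk k - p * fk k) * P (inv g))"
    by (simp add: av_fk right_diff_distrib left_diff_distrib sum_subtractf)
  also have "\<dots> \<in> J (Suc k)" by (intro J_sum J_right J_left q'(2))
  finally have 1: "q' * av k x * fk k - av k (x * p) * fk k \<in> J (Suc k)" .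
  have 2: "q' * (q * fk k - av k x * fk k) \<in> J (Suc k)" by (rule J_left[OF q(2)])
  have "(q' * q) * fk k - av k (x * p) * fk k = q' * (q * fk k - av k x * fk k) + (q' * av k x * fk k - av k (x * p) * fk k)"
    by (simp add: algebra_simps)
  then have "(q' * q) * fk k - av k (x * p) * fk k \<in> J (Suc k)" using J_add[OF 2 1] by (simp only:)
  then show ?thesis unfolding Rep_def using Zs_mult[OF q'(1) q(1)] by blast
qed

text \<open>Since \<open>z * fk k = fk k * z\<close>, the diagrams in it with exactly
  \<open>k\<close> arcs are standard in both rows, hence of the form \<open>P \<rho> * fk k\<close>.
  Conjugating by \<open>G k\<close> leaves \<open>z * fk k\<close> unchanged and turns the
  permutations into averages.\<close>

lemma center_level:
  assumes l: "lv k" and z: "z \<in> center"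
  shows "\<exists>(S::diag set) c \<rho>. finite S \<and> (\<forall>d\<in>S. \<rho> d \<in> G k) \<and>
    sc (of_nat (card (G k))) * z * fk k - (\<Sum>d\<in>S. sc (c d) * av k (P (\<rho> d))) * fk k \<in> J (Suc k)"
proof -
  define S where "S = {d\<in>W. coef (z * fk k) d \<noteq> 0 \<and> ar d = k}"
  define c where "c d = coef (z * fk k) d" for d :: diag
  have finS: "finite S" unfolding S_def by simp
  have "\<exists>\<rho>\<in>G k. D d = P \<rho> * fk k" if "d \<in> S" for d
    using that mult_fk_top_std[OF l, of z d] fk_mult_bot_std[OF l, of z d] center_commute[OF z, of "fk k"]
    unfolding S_def by (intro std_diag[OF l]) auto
  then obtain \<rho> where \<rho>: "\<And>d. d \<in> S \<Longrightarrow> \<rho> d \<in> G k \<and> D d = P (\<rho> d) * fk k" by metis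
  let ?w = "\<Sum>d\<in>S. sc (c d) * P (\<rho> d)"
  have "z * fk k = (\<Sum>d\<in>W. sc (c d) * D d)" unfolding c_def by (rule wb_expand)
  also have "\<dots> = (\<Sum>d\<in>S. sc (c d) * D d) + (\<Sum>d\<in>W - S. sc (c d) * D d)"
    by (subst sum.subset_diff[of S W]) (auto simp: S_def add.commute)
  also have "(\<Sum>d\<in>S. sc (c d) * D d) = ?w * fk k"
    unfolding sum_distrib_right using \<rho> by (intro sum.cong refl) (simp add: mult.assoc)
  finally have e: "z * fk k - ?w * fk k = (\<Sum>d\<in>W - S. sc (c d) * D d)" by simp
  have "z * fk k \<in> J k" using fk_J[OF l] by (rule J_left)
  then have "sc (c d) * D d \<in> J (Suc k)" if "d \<in> W - S" for d
  proof (cases "c d = 0")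
    case False
    then have "k \<le> ar d" "ar d \<noteq> k" using that \<open>z * fk k \<in> J k\<close> unfolding c_def S_def J_def by auto
    then show ?thesis using that J_D[of d "Suc k"] by (intro J_left) auto
  qed simp
  then have w: "z * fk k - ?w * fk k \<in> J (Suc k)" unfolding e by (rule J_sum)
  have "sc (of_nat (card (G k))) * z * fk k - av k ?w * fk k = (\<Sum>g\<in>G k. P g * (z * fk k - ?w * fk k) * P (inv g))"
  proof -
    have 1: "P g * (z * fk k) * P (inv g) = z * fk k" if g: "g \<in> G k" for g
    proof -
      have "P g * (z * fk k) * P (inv g) = z * (P g * fk k) * P (inv g)"
        using center_commute[OF z, of "P g"] by (simp add: mult.assoc[symmetric])
      also have "\<dots> = z * fk k * (P g * P (inv g))" using G_fk_commute[OF g l] by (simp add: mult.assoc)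
      finally show ?thesis using P_inv(1)[OF G_wp[OF g]] by simp
    qed
    have 2: "P g * (?w * fk k) * P (inv g) = P g * ?w * P (inv g) * fk k" if g: "g \<in> G k" for g
      using G_fk_commute[OF G_inv[OF g] l] by (simp add: mult.assoc)
    have "(\<Sum>g\<in>G k. P g * (z * fk k - ?w * fk k) * P (inv g)) = (\<Sum>g\<in>G k. z * fk k - P g * ?w * P (inv g) * fk k)"
      using 1 2 by (intro sum.cong refl) (simp only: right_diff_distrib left_diff_distrib)
    also have "\<dots> = of_nat (card (G k)) * (z * fk k) - av k ?w * fk k"
      by (simp add: sum_subtractf av_def sum_distrib_right)
    finally show ?thesis by (simp add: mult.assoc)
  qed
  also have "\<dots> \<in> J (Suc k)" by (intro J_sum J_right J_left w)
  also have "av k ?w = (\<Sum>d\<in>S. sc (c d) * av k (P (\<rho> d)))"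
  proof -
    have "av k (sc a * x) = sc a * av k x" for a x
    proof -
      have "P g * (sc a * x) * P (inv g) = sc a * (P g * x * P (inv g))" for g by (metis mult.assoc sc_comm)
      then show ?thesis by (simp add: av_def sum_distrib_left)
    qed
    then show ?thesis by (simp add: av_sum)
  qed
  finally have "sc (of_nat (card (G k))) * z * fk k - (\<Sum>d\<in>S. sc (c d) * av k (P (\<rho> d))) * fk k \<in> J (Suc k)" .
  then show ?thesis using finS \<rho> by blast
qed

section \<open>Power sums of Jucys-Murphy elements generate the class averages\<close>

definition supp :: "(nat \<Rightarrow> nat) \<Rightarrow> nat set" where "supp \<sigma> = {i. \<sigma> i \<noteq> i}"

text \<open>A product of transpositions sharing the letter \<open>i\<close>, as it arises from
  expanding powers of Jucys-Murphy elements. If \<open>i\<close> and the letters of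
  \<open>js\<close> are distinct, it is a single cycle through all of them.\<close>

definition cyc :: "nat list \<Rightarrow> nat \<Rightarrow> (nat \<Rightarrow> nat)" where
  "cyc js i = foldr (\<lambda>j p. Transposition.transpose j i \<circ> p) js id"

lemma cyc_simps [simp]: "cyc [] i = id" "cyc (j # js) i = Transposition.transpose j i \<circ> cyc js i"
  by (simp_all add: cyc_def)

lemma cyc_snoc: "cyc (js @ [j]) i = cyc js i \<circ> Transposition.transpose j i"
  by (induction js) (simp_all add: comp_assoc)

lemma supp_cyc: "supp (cyc js i) \<subseteq> insert i (set js)"
proof -
  have "cyc js i x = x" if "x \<notin> insert i (set js)" for x
    using that by (induction js) (auto simp: transpose_def)
  then show ?thesis unfolding supp_def by blast
qed

text \<open>The cycle through \<open>y\<close> is peeled off from the right: with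
  \<open>w = \<sigma> y\<close>, the map \<open>\<sigma>\<close> composed with the transposition of
  \<open>w\<close> and \<open>y\<close> fixes \<open>w\<close>, so the support shrinks.
  \<open>Q\<close> will be the side of the wall.\<close>

lemma cycle_decomp:
  assumes "finite (supp \<sigma>)" "bij \<sigma>" "\<And>x. Q (\<sigma> x) \<longleftrightarrow> Q x"
  shows "\<exists>ys \<tau>. \<sigma> = \<tau> \<circ> cyc ys y \<and> distinct (y # ys) \<and> set ys \<subseteq> supp \<sigma> \<and> (\<forall>x\<in>set (y # ys). \<tau> x = x) \<and>
    supp \<tau> \<subseteq> supp \<sigma> \<and> bij \<tau> \<and> (\<forall>x. Q (\<tau> x) \<longleftrightarrow> Q x) \<and> (\<forall>x\<in>set ys. Q x \<longleftrightarrow> Q y)"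
  using assms
proof (induction "card (supp \<sigma>)" arbitrary: \<sigma> rule: less_induct)
  case less
  show ?case
  proof (cases "\<sigma> y = y")
    case True
    show ?thesis by (intro exI[of _ "[]"] exI[of _ \<sigma>]) (use True less.prems in auto)
  next
    case False
    define w where "w = \<sigma> y"
    define \<sigma>' where "\<sigma>' = \<sigma> \<circ> Transposition.transpose w y"
    have inj: "\<sigma> a = \<sigma> b \<longleftrightarrow> a = b" for a b using less.prems(2) by (meson bij_is_inj inj_eq)
    have \<sigma>w: "\<sigma> w \<noteq> w" using inj[of w y] False by (auto simp: w_def)
    have sub: "supp \<sigma>' \<subseteq> supp \<sigma> - {w}"
    proof
      fix x assume x: "x \<in> supp \<sigma>'"
      have "x \<noteq> w" using x by (auto simp: supp_def \<sigma>'_def w_def)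
      moreover have "x \<in> supp \<sigma>"
        using x calculation False by (cases "x = y") (auto simp: supp_def \<sigma>'_def transpose_def w_def)
      ultimately show "x \<in> supp \<sigma> - {w}" by blast
    qed
    have lt: "card (supp \<sigma>') < card (supp \<sigma>)"
      using sub less.prems(1) \<sigma>w by (intro psubset_card_mono) (auto simp: supp_def)
    have Q: "Q (\<sigma>' x) \<longleftrightarrow> Q x" for x
    proof -
      have "Q w \<longleftrightarrow> Q y" using less.prems(3)[of y] by (simp add: w_def)
      then have "Q (Transposition.transpose w y x) \<longleftrightarrow> Q x" by (auto simp: transpose_def)
      then show ?thesis using less.prems(3) by (simp add: \<sigma>'_def)
    qed
    have bij': "bij \<sigma>'" unfolding \<sigma>'_def using less.prems(2) by (intro bij_comp bij_swap) auto
    have "\<exists>ys \<tau>. \<sigma>' = \<tau> \<circ> cyc ys y \<and> distinct (y # ys) \<and> set ys \<subseteq> supp \<sigma>' \<and> (\<forall>x\<in>set (y # ys). \<tau> x = x) \<and>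
      supp \<tau> \<subseteq> supp \<sigma>' \<and> bij \<tau> \<and> (\<forall>x. Q (\<tau> x) \<longleftrightarrow> Q x) \<and> (\<forall>x\<in>set ys. Q x \<longleftrightarrow> Q y)"
      using less.hyps[OF lt _ bij' Q] finite_subset[OF sub] less.prems(1) by blast
    then obtain ys \<tau> where h: "\<sigma>' = \<tau> \<circ> cyc ys y" "distinct (y # ys)" "set ys \<subseteq> supp \<sigma>'" "\<forall>x\<in>set (y # ys). \<tau> x = x"
      "supp \<tau> \<subseteq> supp \<sigma>'" "bij \<tau>" "\<forall>x. Q (\<tau> x) \<longleftrightarrow> Q x" "\<forall>x\<in>set ys. Q x \<longleftrightarrow> Q y" by blast
    have "\<sigma> = \<sigma>' \<circ> Transposition.transpose w y" by (simp add: \<sigma>'_def comp_assoc)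
    then have 1: "\<sigma> = \<tau> \<circ> cyc (ys @ [w]) y" using h(1) by (simp add: cyc_snoc comp_assoc)
    have 2: "w \<notin> set ys" "\<tau> w = w" using h(3,5) sub by (auto simp: supp_def)
    have 3: "w \<noteq> y" using False by (simp add: w_def)
    have 4: "w \<in> supp \<sigma>" using \<sigma>w by (simp add: supp_def)
    have 5: "Q w \<longleftrightarrow> Q y" using less.prems(3)[of y] by (simp add: w_def)
    show ?thesis
      by (intro exI[of _ "ys @ [w]"] exI[of _ \<tau>] conjI) (use 1 2 3 4 5 h sub in auto)
  qed
qed

definition blk :: "nat \<Rightarrow> nat set \<Rightarrow> bool" where "blk k B \<longleftrightarrow> B = {1..rk-k} \<or> B = {rk+k+1..nn}"

text \<open>Jucys-Murphy element of the symmetric group on the block \<open>B\<close>. For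
  \<open>i\<close> in a left block it equals \<open>L i\<close>; on the right it lacks the arcs, the
  constant \<delta> and the letters of the region.\<close>

definition KK :: "nat set \<Rightarrow> nat \<Rightarrow> wb" where "KK B i = (\<Sum>j\<in>{j\<in>B. j < i}. T j i)"
definition pp :: "nat set \<Rightarrow> nat \<Rightarrow> wb" where "pp B a = (\<Sum>i\<in>B. KK B i ^ a)"
definition seqs :: "nat set \<Rightarrow> nat \<Rightarrow> nat \<Rightarrow> nat list set" where
  "seqs B i a = {js. set js \<subseteq> {j\<in>B. j < i} \<and> length js = a}"

lemma power_of_sum:
  fixes f :: "'a \<Rightarrow> wb"
  assumes "finite A"
  shows "(\<Sum>j\<in>A. f j) ^ a = (\<Sum>js | set js \<subseteq> A \<and> length js = a. prod_list (map f js))"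
proof (induction a)
  case 0
  have "{js. set js \<subseteq> A \<and> length js = 0} = {[]}" by auto
  then show ?case by simp
next
  case (Suc a)
  let ?S = "{js. set js \<subseteq> A \<and> length js = a}"
  have e: "{js. set js \<subseteq> A \<and> length js = Suc a} = (\<lambda>(j, js). j # js) ` (A \<times> ?S)"
    by (auto simp: length_Suc_conv image_iff)
  have "(\<Sum>js | set js \<subseteq> A \<and> length js = Suc a. prod_list (map f js)) = (\<Sum>(j, js)\<in>A \<times> ?S. f j * prod_list (map f js))"
    unfolding e by (subst sum.reindex) (auto simp: inj_on_def split_def)
  also have "\<dots> = (\<Sum>j\<in>A. \<Sum>js\<in>?S. f j * prod_list (map f js))"
    by (simp add: sum.cartesian_product)
  finally show ?case using Suc by (simp add: sum_product)
qed

lemma finite_seqs: "finite B \<Longrightarrow> finite (seqs B i a)"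
  unfolding seqs_def by (rule finite_lists_length_eq) auto

lemma blk_facts:
  assumes "lv k" "blk k B"
  shows "finite B" "i \<in> B \<Longrightarrow> j \<in> B \<Longrightarrow> same_side i j" "i \<in> B \<Longrightarrow> \<not> region k i" "i \<in> B \<Longrightarrow> i \<in> {1..nn}"
  using assms by (auto simp: blk_def lv_def same_side_def region_def)

lemma cyc_G:
  assumes "lv k" "blk k B" "i \<in> B" "set js \<subseteq> B"
  shows "cyc js i \<in> G k \<and> P (cyc js i) = prod_list (map (\<lambda>j. T j i) js)"
  using assms(4)
proof (induction js)
  case Nil then show ?case using G_id[of k] P_id by (simp only: cyc_simps list.map prod_list.Nil simp_thms)
next
  case (Cons j js)
  have s: "same_side j i" using blk_facts(2)[OF assms(1,2)] assms(3) Cons.prems by auto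
  have "Transposition.transpose j i \<in> G k"
    using wp_transpose[OF s] blk_facts(3)[OF assms(1,2)] assms(3) Cons.prems by (auto simp: G_def transpose_def)
  moreover have "P (Transposition.transpose j i \<circ> cyc js i) = T j i * P (cyc js i)"
  proof -
    have "cyc js i \<in> G k" using Cons by simp
    then show ?thesis using P_mult[OF wp_transpose[OF s] G_wp] by metis
  qed
  moreover have "cyc js i \<in> G k" "P (cyc js i) = prod_list (map (\<lambda>j. T j i) js)" using Cons by simp_all
  ultimately show ?case unfolding cyc_simps list.map prod_list.Cons using G_comp by (simp only: simp_thms)
qed

lemma P_mult_pp:
  assumes "lv k" "blk k B" "\<tau> \<in> G k"
  shows "P \<tau> * pp B a = (\<Sum>i\<in>B. \<Sum>js\<in>seqs B i a. P (\<tau> \<circ> cyc js i))"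
proof -
  have "P \<tau> * (KK B i ^ a) = (\<Sum>js\<in>seqs B i a. P (\<tau> \<circ> cyc js i))" if i: "i \<in> B" for i
  proof -
    have fin: "finite {j\<in>B. j < i}" using blk_facts(1)[OF assms(1,2)] by simp
    have "P \<tau> * (KK B i ^ a) = (\<Sum>js\<in>seqs B i a. P \<tau> * prod_list (map (\<lambda>j. T j i) js))"
      unfolding KK_def power_of_sum[OF fin] sum_distrib_left seqs_def ..
    also have "\<dots> = (\<Sum>js\<in>seqs B i a. P (\<tau> \<circ> cyc js i))"
    proof (intro sum.cong refl)
      fix js assume "js \<in> seqs B i a"
      then have "set js \<subseteq> B" by (auto simp: seqs_def)
      then have c: "cyc js i \<in> G k" "P (cyc js i) = prod_list (map (\<lambda>j. T j i) js)"
        using cyc_G[OF assms(1,2) i] by auto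
      show "P \<tau> * prod_list (map (\<lambda>j. T j i) js) = P (\<tau> \<circ> cyc js i)"
        using P_mult[OF G_wp[OF assms(3)] G_wp[OF c(1)]] c(2) by simp
    qed
    finally show ?thesis .
  qed
  then show ?thesis by (simp add: pp_def sum_distrib_left)
qed

text \<open>Sending the letters of one cycle to those of the other and fixing the support of
  \<open>\<tau>\<close> extends to a permutation \<open>g\<close> of the block; it commutes with
  \<open>\<tau>\<close> and conjugates the cycles into each other.\<close>

lemma conj_cyc:
  assumes l: "lv k" and B: "blk k B" and \<tau>: "\<tau> \<in> G k"
    and y: "distinct (y # ys)" "set (y # ys) \<subseteq> B" "set (y # ys) \<inter> supp \<tau> = {}"
    and j: "distinct (i # js)" "set (i # js) \<subseteq> B" "set (i # js) \<inter> supp \<tau> = {}" and len: "length ys = length js"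
  shows "\<exists>g\<in>G k. \<tau> \<circ> cyc js i = g \<circ> (\<tau> \<circ> cyc ys y) \<circ> inv g"
proof -
  define f where "f x = (if x \<in> supp \<tau> then x else the (map_of (zip (y # ys) (i # js)) x))" for x
  let ?A = "set (y # ys) \<union> (supp \<tau> \<inter> B)"
  have f_nth: "f ((y # ys) ! m) = (i # js) ! m" if "m < length (i # js)" for m
  proof -
    have "(y # ys) ! m \<in> set (y # ys)" using that len by (intro nth_mem) simp
    then have "(y # ys) ! m \<notin> supp \<tau>" using y(3) by blast
    moreover have "map_of (zip (y # ys) (i # js)) ((y # ys) ! m) = Some ((i # js) ! m)"
      using that len y(1) by (intro map_of_zip_nth) auto
    ultimately show ?thesis by (simp add: f_def)
  qed
  have map_f: "map f (y # ys) = i # js"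
  proof (rule nth_equalityI)
    show "length (map f (y # ys)) = length (i # js)" using len by simp
    fix m assume "m < length (map f (y # ys))"
    then have "m < length (y # ys)" "m < length (i # js)" using len by auto
    then show "map f (y # ys) ! m = (i # js) ! m" using nth_map[of m "y # ys" f] f_nth[of m] by (simp only:)
  qed
  have im: "f ` set (y # ys) = set (i # js)" using map_f by (metis list.set_map)
  have inj1: "inj_on f (set (y # ys))"
    using map_f j(1) y(1) by (metis distinct_map)
  have inj: "inj_on f ?A"
  proof (rule inj_onI)
    fix a b assume ab: "a \<in> ?A" "b \<in> ?A" "f a = f b"
    have s: "f c = c" if "c \<in> supp \<tau>" for c using that by (simp add: f_def)
    have n: "f c \<notin> supp \<tau>" if "c \<in> set (y # ys)" for c using im j(3) that by blast
    show "a = b"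
    proof (cases "a \<in> supp \<tau>")
      case True
      then have "b \<in> supp \<tau>" using n[of b] ab s[OF True] by auto
      then show ?thesis using s True ab(3) by metis
    next
      case False
      then have a: "a \<in> set (y # ys)" using ab(1) by blast
      then have "b \<notin> supp \<tau>" using n[of a] ab(3) s[of b] by auto
      then have "b \<in> set (y # ys)" using ab(2) by blast
      then show ?thesis using inj1 a ab(3) by (meson inj_onD)
    qed
  qed
  have sub: "f ` ?A \<subseteq> B"
  proof -
    have "f ` (supp \<tau> \<inter> B) \<subseteq> B" by (auto simp: f_def)
    then show ?thesis unfolding image_Un im using j(2) by blast
  qed
  obtain g where g: "g permutes B" "\<And>a. a \<in> ?A \<Longrightarrow> g a = f a"
    using extend_perm[OF blk_facts(1)[OF l B] _ inj sub] y(2) by blast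
  have wpg: "wp g"
  proof -
    have "B \<subseteq> {1..rk} \<or> B \<subseteq> {rk+1..nn}" using B by (auto simp: blk_def)
    then show ?thesis using permutes_subset[OF g(1)] wp_left wp_right by blast
  qed
  have gG: "g \<in> G k"
    unfolding G_def using wpg permutes_not_in[OF g(1)] blk_facts(3)[OF l B] by blast
  have g\<tau>: "g x = x" if "x \<in> supp \<tau>" for x
  proof (cases "x \<in> B")
    case True then show ?thesis using g(2)[of x] that by (simp add: f_def)
  next
    case False then show ?thesis by (rule permutes_not_in[OF g(1)])
  qed
  have gi: "g a = g b \<longleftrightarrow> a = b" for a b using permutes_inj[OF g(1)] by (simp add: inj_eq)
  have \<tau>i: "\<tau> a = \<tau> b \<longleftrightarrow> a = b" for a b using G_wp[OF \<tau>] wall_perm_bij by (meson bij_is_inj inj_eq)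
  have com: "g \<circ> \<tau> = \<tau> \<circ> g"
  proof
    fix x show "(g \<circ> \<tau>) x = (\<tau> \<circ> g) x"
    proof (cases "x \<in> supp \<tau>")
      case True
      then have "\<tau> x \<in> supp \<tau>" using \<tau>i by (auto simp: supp_def)
      then show ?thesis using g\<tau> True by simp
    next
      case False
      have "g x \<notin> supp \<tau>"
      proof
        assume a: "g x \<in> supp \<tau>"
        then have "g (g x) = g x" by (rule g\<tau>)
        then have "g x = x" using gi by simp
        then show False using a False by simp
      qed
      then show ?thesis using False by (simp add: supp_def)
    qed
  qed
  have cc: "g \<circ> cyc zs z = cyc (map g zs) (g z) \<circ> g" for zs z
  proof (induction zs)
    case (Cons a zs)
    have "g \<circ> Transposition.transpose a z = Transposition.transpose (g a) (g z) \<circ> g"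
      by (rule ext) (auto simp: transpose_def gi)
    then have "g \<circ> (Transposition.transpose a z \<circ> cyc zs z) = Transposition.transpose (g a) (g z) \<circ> (g \<circ> cyc zs z)"
      by (simp only: comp_assoc[symmetric])
    also have "\<dots> = Transposition.transpose (g a) (g z) \<circ> (cyc (map g zs) (g z) \<circ> g)" by (simp only: Cons)
    finally show ?case by (simp only: cyc_simps list.map comp_assoc)
  qed simp
  have "map g (y # ys) = i # js"
  proof -
    have "map g (y # ys) = map f (y # ys)" by (rule map_cong[OF refl]) (use g(2) in blast)
    then show ?thesis using map_f by (rule trans)
  qed
  then have gys: "map g ys = js" "g y = i" by auto
  have "g \<circ> (\<tau> \<circ> cyc ys y) = \<tau> \<circ> cyc js i \<circ> g"
    using com cc[of ys y] gys by (metis comp_assoc)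
  moreover have "g \<circ> inv g = id" using permutes_inv_o[OF g(1)] by simp
  ultimately have "g \<circ> (\<tau> \<circ> cyc ys y) \<circ> inv g = \<tau> \<circ> cyc js i"
    by (metis comp_assoc comp_id)
  then show ?thesis using gG by metis
qed

text \<open>Induction on the size of the support. With a cycle of \<open>a + 1\<close> letters split
  off as \<open>\<tau> \<circ> cyc ys y\<close>, the product of \<open>P \<tau>\<close> and the
  \<open>a\<close>-th power sum expands into terms conjugate to \<open>\<sigma>\<close> and terms of
  smaller support, and averages do not distinguish conjugates.\<close>

lemma Rep_av_P:
  assumes l: "lv k" and p: "\<And>B a. blk k B \<Longrightarrow> 1 \<le> a \<Longrightarrow> Rep k (pp B a)" and \<sigma>: "\<sigma> \<in> G k"
  shows "Rep k (av k (P \<sigma>))"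
  using \<sigma>
proof (induction "card (supp \<sigma>)" arbitrary: \<sigma> rule: less_induct)
  case less
  have supp_sub: "supp \<pi> \<subseteq> {1..nn}" if "\<pi> \<in> G k" for \<pi>
  proof
    fix x assume x: "x \<in> supp \<pi>"
    have p: "\<pi> permutes {1..nn}" using that by (simp add: G_def wall_perm_def)
    show "x \<in> {1..nn}"
    proof (rule ccontr)
      assume "x \<notin> {1..nn}"
      then show False using permutes_not_in[OF p, of x] x by (simp add: supp_def)
    qed
  qed
  show ?case
  proof (cases "supp \<sigma> = {}")
    case True
    then have "\<sigma> = id" by (auto simp: supp_def fun_eq_iff)
    then show ?thesis unfolding P_id[folded \<open>\<sigma> = id\<close>] av_one by (intro Rep_sc)
  next
    case False
    have fin: "finite (supp \<sigma>)" using supp_sub[OF less.prems] finite_subset by blast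
    \<comment> \<open>With the largest moved point as distinguished letter, the other letters of its
      cycle are smaller, so the word \<open>ys\<close> occurs in the expansion of
      \<open>KK B y ^ a\<close>.\<close>
    define y where "y = Max (supp \<sigma>)"
    have y: "y \<in> supp \<sigma>" "\<And>x. x \<in> supp \<sigma> \<Longrightarrow> x \<le> y" using fin False by (auto simp: y_def)
    have w: "wp \<sigma>" using less.prems by (rule G_wp)
    have "\<And>x. \<sigma> x \<le> rk \<longleftrightarrow> x \<le> rk" using wall_perm_le[OF w] .
    from cycle_decomp[where \<sigma>=\<sigma> and Q="\<lambda>x. x \<le> rk" and y=y, OF fin wall_perm_bij[OF w] this]
    obtain ys \<tau> where h: "\<sigma> = \<tau> \<circ> cyc ys y" "distinct (y # ys)" "set ys \<subseteq> supp \<sigma>" "\<forall>x\<in>set (y # ys). \<tau> x = x"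
      "supp \<tau> \<subseteq> supp \<sigma>" "bij \<tau>" "\<forall>x. \<tau> x \<le> rk \<longleftrightarrow> x \<le> rk" "\<forall>x\<in>set ys. x \<le> rk \<longleftrightarrow> y \<le> rk"
      by (elim exE conjE) (rule that; assumption)
    have \<tau>G: "\<tau> \<in> G k"
    proof -
      have "\<tau> x = x" if "x \<notin> supp \<sigma>" for x using that h(5) by (auto simp: supp_def)
      moreover have "\<tau> permutes {1..nn}" unfolding permutes_def
      proof (intro conjI allI impI)
        show "\<tau> x = x" if "x \<notin> {1..nn}" for x using that supp_sub[OF less.prems] calculation by blast
        show "\<exists>!x. \<tau> x = v" for v using h(6) by (metis bij_pointE)
      qed
      moreover have "x \<notin> supp \<sigma>" if "region k x" for x using that less.prems by (simp add: G_def supp_def)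
      ultimately show ?thesis unfolding G_def wall_perm_def using h(7) by blast
    qed
    define B where "B = (if y \<le> rk then {1..rk-k} else {rk+k+1..nn})"
    have B: "blk k B" by (simp add: B_def blk_def)
    have inB: "x \<in> B" if "x \<in> supp \<sigma>" "x \<le> rk \<longleftrightarrow> y \<le> rk" for x
    proof -
      have "\<not> region k x" using that(1) less.prems by (auto simp: G_def supp_def)
      moreover have "x \<in> {1..nn}" using supp_sub[OF less.prems] that(1) by blast
      ultimately show ?thesis using that(2) by (auto simp: B_def region_def)
    qed
    have ysB: "set (y # ys) \<subseteq> B" using inB y(1) h(3,8) by auto
    have dis: "set (y # ys) \<inter> supp \<tau> = {}" using h(4) by (auto simp: supp_def)
    define a where "a = length ys"
    have a1: "1 \<le> a"
    proof (rule ccontr)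
      assume "\<not> 1 \<le> a"
      then have "ys = []" by (cases ys) (auto simp: a_def)
      then have "\<sigma> = \<tau>" using h(1) by (simp only: cyc_simps comp_id)
      then show False using h(4) y(1) by (simp add: supp_def)
    qed
    have f\<tau>: "finite (supp \<tau>)" using h(5) fin finite_subset by blast
    have card\<sigma>: "card (supp \<tau>) + Suc a \<le> card (supp \<sigma>)"
    proof -
      have "card (supp \<tau> \<union> set (y # ys)) = card (supp \<tau>) + card (set (y # ys))"
        using f\<tau> dis by (intro card_Un_disjoint) auto
      moreover have "card (set (y # ys)) = Suc a" using distinct_card[OF h(2)] by (simp add: a_def)
      moreover have "card (supp \<tau> \<union> set (y # ys)) \<le> card (supp \<sigma>)"
        using fin h(3,5) y(1) by (intro card_mono) auto
      ultimately show ?thesis by simp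
    qed
    let ?I = "Sigma B (\<lambda>i. seqs B i a)"
    \<comment> \<open>Words without repetition that avoid the support of \<open>\<tau>\<close>; all
      others lead to permutations moving at most \<open>card (supp \<tau>) + a\<close>
      points.\<close>
    define good where "good q \<longleftrightarrow> distinct (fst q # snd q) \<and> set (fst q # snd q) \<inter> supp \<tau> = {}" for q :: "nat \<times> nat list"
    let ?\<pi> = "\<lambda>q. \<tau> \<circ> cyc (snd q) (fst q)"
    have finI: "finite ?I" using blk_facts(1)[OF l B] finite_seqs by blast
    have qB: "fst q \<in> B" "set (snd q) \<subseteq> B" "length (snd q) = a" if "q \<in> ?I" for q
      using that by (auto simp: seqs_def)
    have \<pi>G: "?\<pi> q \<in> G k" if "q \<in> ?I" for q
    proof -
      have "cyc (snd q) (fst q) \<in> G k" using cyc_G[OF l B qB(1,2)[OF that]] by (rule conjunct1)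
      then show ?thesis using G_comp[OF \<tau>G] by blast
    qed
    have bad: "Rep k (av k (P (?\<pi> q)))" if q: "q \<in> ?I" "\<not> good q" for q
    proof (rule less.hyps[OF _ \<pi>G[OF q(1)]])
      have len: "length (snd q) = a" by (rule qB(3)[OF q(1)])
      have s: "supp (?\<pi> q) \<subseteq> supp \<tau> \<union> set (fst q # snd q)"
      proof
        fix x assume x: "x \<in> supp (?\<pi> q)"
        show "x \<in> supp \<tau> \<union> set (fst q # snd q)"
        proof (rule ccontr)
          assume n: "x \<notin> supp \<tau> \<union> set (fst q # snd q)"
          then have "cyc (snd q) (fst q) x = x" using supp_cyc[of "snd q" "fst q"] unfolding supp_def by auto
          then show False using x n by (simp add: supp_def)
        qed
      qed
      have "card (supp \<tau> \<union> set (fst q # snd q)) < card (supp \<tau>) + Suc a"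
      proof (cases "distinct (fst q # snd q)")
        case True
        then have "supp \<tau> \<inter> set (fst q # snd q) \<noteq> {}" using q(2) by (auto simp: good_def)
        then have "card (supp \<tau> \<inter> set (fst q # snd q)) > 0" using f\<tau> by (simp add: card_gt_0_iff)
        moreover have "card (supp \<tau>) + card (set (fst q # snd q)) = card (supp \<tau> \<union> set (fst q # snd q)) + card (supp \<tau> \<inter> set (fst q # snd q))"
          using f\<tau> by (intro card_Un_Int) auto
        moreover have "card (set (fst q # snd q)) \<le> Suc a" using card_length[of "fst q # snd q"] len by simp
        ultimately show ?thesis by linarith
      next
        case False
        then have "card (set (fst q # snd q)) \<noteq> length (fst q # snd q)" using card_distinct by blast
        then have "card (set (fst q # snd q)) < Suc a" using card_length[of "fst q # snd q"] len by simp
        moreover have "card (supp \<tau> \<union> set (fst q # snd q)) \<le> card (supp \<tau>) + card (set (fst q # snd q))" by (rule card_Un_le)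
        ultimately show ?thesis by linarith
      qed
      moreover have "card (supp (?\<pi> q)) \<le> card (supp \<tau> \<union> set (fst q # snd q))"
        using s f\<tau> by (intro card_mono) auto
      ultimately show "card (supp (?\<pi> q)) < card (supp \<sigma>)" using card\<sigma> by linarith
    qed
    have gd: "av k (P (?\<pi> q)) = av k (P \<sigma>)" if q: "q \<in> ?I" "good q" for q
    proof -
      have "set (fst q # snd q) \<subseteq> B" "length ys = length (snd q)" using qB[OF q(1)] by (auto simp: a_def)
      then have "\<exists>g\<in>G k. ?\<pi> q = g \<circ> (\<tau> \<circ> cyc ys y) \<circ> inv g"
        using q(2) unfolding good_def by (intro conj_cyc[OF l B \<tau>G h(2) ysB dis]) simp_all
      then obtain g where g: "g \<in> G k" "?\<pi> q = g \<circ> \<sigma> \<circ> inv g" unfolding h(1)[symmetric] by blast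
      have "P (?\<pi> q) = P g * P \<sigma> * P (inv g)"
        unfolding g(2) using P_mult[OF wall_perm_comp[OF G_wp[OF g(1)] w] G_wp[OF G_inv[OF g(1)]]] P_mult[OF G_wp[OF g(1)] w] by simp
      then show ?thesis using av_conj[OF g(1)] by simp
    qed
    have tot: "Rep k (av k (P \<tau> * pp B a))"
    proof (rule Rep_av_mult[OF l _ p[OF B a1]])
      show "Rep k (av k (P \<tau>))" using less.hyps[OF _ \<tau>G] card\<sigma> by simp
    qed
    have "av k (P \<tau> * pp B a) = (\<Sum>q\<in>?I. av k (P (?\<pi> q)))"
      unfolding P_mult_pp[OF l B \<tau>G] using blk_facts(1)[OF l B] finite_seqs
      by (simp add: av_sum sum.Sigma split_def)
    also have "\<dots> = (\<Sum>q\<in>{q\<in>?I. good q}. av k (P (?\<pi> q))) + (\<Sum>q\<in>{q\<in>?I. \<not> good q}. av k (P (?\<pi> q)))"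
    proof -
      have "?I = {q\<in>?I. good q} \<union> {q\<in>?I. \<not> good q}" by blast
      then have "(\<Sum>q\<in>?I. av k (P (?\<pi> q))) = (\<Sum>q\<in>{q\<in>?I. good q} \<union> {q\<in>?I. \<not> good q}. av k (P (?\<pi> q)))" by simp
      also have "\<dots> = (\<Sum>q\<in>{q\<in>?I. good q}. av k (P (?\<pi> q))) + (\<Sum>q\<in>{q\<in>?I. \<not> good q}. av k (P (?\<pi> q)))"
        by (rule sum.union_disjoint) (use finI in auto)
      finally show ?thesis .
    qed
    also have "(\<Sum>q\<in>{q\<in>?I. good q}. av k (P (?\<pi> q))) = (\<Sum>q\<in>{q\<in>?I. good q}. av k (P \<sigma>))"
      by (rule sum.cong[OF refl], rule gd) simp_all
    also have "\<dots> = sc (of_nat (card {q\<in>?I. good q})) * av k (P \<sigma>)" by simp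
    finally have e: "av k (P \<tau> * pp B a) - (\<Sum>q\<in>{q\<in>?I. \<not> good q}. av k (P (?\<pi> q))) = sc (of_nat (card {q\<in>?I. good q})) * av k (P \<sigma>)"
      by (simp only: diff_eq_eq)
    have "Rep k (sc (of_nat (card {q\<in>?I. good q})) * av k (P \<sigma>))"
      unfolding e[symmetric] by (intro Rep_diff tot Rep_sum bad) auto
    then have "Rep k (sc (1 / of_nat (card {q\<in>?I. good q})) * (sc (of_nat (card {q\<in>?I. good q})) * av k (P \<sigma>)))" by (rule Rep_scale)
    \<comment> \<open>The word of \<open>\<sigma>\<close> itself is good, so the number of good
      words can be divided out.\<close>
    moreover have "(y, ys) \<in> {q\<in>?I. good q}"
    proof -
      have "x < y" if "x \<in> set ys" for x
      proof -
        have "x \<noteq> y" using that h(2) by auto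
        moreover have "x \<le> y" using that h(3) y(2) by blast
        ultimately show ?thesis by simp
      qed
      then have "ys \<in> seqs B y a" using ysB by (auto simp: seqs_def a_def)
      moreover have "good (y, ys)" using h(2) dis unfolding good_def by simp
      ultimately show ?thesis using ysB by simp
    qed
    then have "card {q\<in>?I. good q} \<noteq> 0"
      using finite_subset[OF _ finI, of "{q\<in>?I. good q}"] by (metis (no_types, lifting) card_0_eq empty_iff mem_Collect_eq subsetI)
    then have "sc (1 / of_nat (card {q\<in>?I. good q})) * (sc (of_nat (card {q\<in>?I. good q})) * av k (P \<sigma>)) = av k (P \<sigma>)"
      by (simp only: mult.assoc[symmetric] sc_times[symmetric]) simp
    ultimately show ?thesis by simp
  qed
qed

lemma sc_cancel: "a * b = 1 \<Longrightarrow> sc a * (sc b * x) = x"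
  by (metis mult.assoc mult_1_left sc_simps(2) sc_times)

text \<open>\<open>q\<close> imitates a multiple of \<open>z\<close> on \<open>fk k\<close>, and
  multiplying by \<open>Q\<close> pushes it into \<open>J k\<close>. The corrected difference
  \<open>y\<close> kills \<open>fk k\<close> modulo \<open>J (Suc k)\<close>, and regularity moves
  \<open>y\<close> itself into \<open>J (Suc k)\<close>.\<close>

lemma level_step:
  assumes regular: "\<And>x::wb. \<exists>a. x = x * a * x"
    and l: "lv k" and p: "\<And>B a. blk k B \<Longrightarrow> 1 \<le> a \<Longrightarrow> Rep k (pp B a)"
    and Q: "Q \<in> Zs" "Q \<in> J k" "c \<noteq> 0" "Q * fk k - sc c * fk k \<in> J (Suc k)"
    and z: "z \<in> center" "z \<in> J k"
  shows "\<exists>z'\<in>Zs. z - z' \<in> J (Suc k)"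
proof -
  obtain S c' \<rho> where s: "finite (S :: diag set)" "\<forall>d\<in>S. \<rho> d \<in> G k"
    "sc (of_nat (card (G k))) * z * fk k - (\<Sum>d\<in>S. sc (c' d) * av k (P (\<rho> d))) * fk k \<in> J (Suc k)"
    using center_level[OF l z(1)] by blast
  have "Rep k (\<Sum>d\<in>S. sc (c' d) * av k (P (\<rho> d)))"
    using s(2) by (intro Rep_sum Rep_scale Rep_av_P[OF l p]) auto
  then obtain q where q: "q \<in> Zs" "q * fk k - (\<Sum>d\<in>S. sc (c' d) * av k (P (\<rho> d))) * fk k \<in> J (Suc k)"
    unfolding Rep_def by blast
  define m where "m = (of_nat (card (G k)) :: complex)"
  have m: "m \<noteq> 0" using card_G by (simp add: m_def)
  have 1: "sc m * z * fk k - q * fk k \<in> J (Suc k)" using J_diff[OF s(3) q(2)] by (simp add: m_def)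
  \<comment> \<open>\<open>m\<close> undoes the undivided average and \<open>c\<close> the action of
    \<open>Q\<close> on \<open>fk k\<close>.\<close>
  define z' where "z' = sc (1 / (m * c)) * (q * Q)"
  have z': "z' \<in> Zs" unfolding z'_def by (intro Zs_mult Zs_sc q Q)
  define y where "y = z - z'"
  have yc: "y \<in> center" using z(1) Zs_center[OF z'] unfolding y_def center_def by (simp add: algebra_simps)
  have "sc (1 / m) * (sc m * z * fk k - q * fk k) - sc (1 / (m * c)) * (q * (Q * fk k - sc c * fk k)) = y * fk k"
  proof -
    have a: "sc (1 / m) * (sc m * (z * fk k)) = z * fk k"
    proof -
      have "1 / m * m = 1" using m by simp
      then show ?thesis by (rule sc_cancel)
    qed
    have b: "sc (1 / (m * c)) * (q * (sc c * fk k)) = sc (1 / m) * (q * fk k)"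
    proof -
      have "q * (sc c * fk k) = sc c * (q * fk k)" by (metis mult.assoc sc_comm)
      then have "sc (1 / (m * c)) * (q * (sc c * fk k)) = sc (1 / (m * c) * c) * (q * fk k)"
        by (simp only: sc_times mult.assoc)
      then show ?thesis using Q(3) by simp
    qed
    show ?thesis unfolding y_def z'_def by (simp only: right_diff_distrib left_diff_distrib a b mult.assoc) simp
  qed
  moreover have "\<dots> \<in> J (Suc k)" using J_diff[OF J_left[OF 1] J_left[OF J_left[OF Q(4)]]] calculation by metis
  ultimately have yf: "y * fk k \<in> J (Suc k)" by simp
  have yJ: "y \<in> J k" unfolding y_def z'_def by (intro J_diff J_left z Q)
  obtain a where a: "y = y * a * y" using regular by blast
  have "y * (a * y) \<in> J (Suc k)" by (rule center_J[OF yc yf J_left[OF yJ]])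
  then have "y \<in> J (Suc k)" using a by (simp add: mult.assoc)
  then show ?thesis using z' by (auto simp: y_def)
qed

section \<open>Semisimplicity implies von Neumann regularity\<close>

definition lideal :: "wb set \<Rightarrow> bool" where
  "lideal I \<longleftrightarrow> 0 \<in> I \<and> (\<forall>x\<in>I. \<forall>y\<in>I. x + y \<in> I) \<and> (\<forall>a. \<forall>x\<in>I. a * x \<in> I)"

lemma range_coef: "range coef = WB rk sk"
  using type_definition.Rep_range[OF type_definition_wb] .

lemma coef_plus: "coef x + coef y = coef (x + y)"
  by (rule ext) simp

lemma lideal_vimage: assumes "left_ideal rk sk dl I" shows "lideal (coef -` I)"
proof -
  have "coef 0 = 0" by (rule ext) simp
  then show ?thesis
    using assms coef unfolding left_ideal_def lideal_def by (auto simp: coef_plus[symmetric] times_wb.rep_eq)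
qed

lemma lideal_image: assumes "lideal N" shows "left_ideal rk sk dl (coef ` N)"
  unfolding left_ideal_def
proof (intro conjI ballI)
  have z: "coef 0 = 0" by (rule ext) simp
  show "coef ` N \<subseteq> WB rk sk" using coef by blast
  show "0 \<in> coef ` N" using assms z unfolding lideal_def by (metis imageI)
  fix x assume x: "x \<in> coef ` N"
  then obtain u where u: "u \<in> N" "x = coef u" by blast
  show "x + y \<in> coef ` N" if "y \<in> coef ` N" for y
    using that u assms unfolding lideal_def by (auto simp: coef_plus)
  fix a assume "a \<in> WB rk sk"
  then obtain b where "a = coef b" using range_coef by blast
  then show "wb_mult rk sk dl a x \<in> coef ` N"
    using u assms unfolding lideal_def by (metis imageI times_wb.rep_eq)
qed

text \<open>The Jacobson radical is the intersection of the maximal left ideals, so a nonzero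
  element escapes one of them when it vanishes.\<close>

lemma avoid_element:
  assumes ss: "wb_semisimple rk sk dl" and x: "x \<noteq> 0"
  obtains M where "lideal M" "x \<notin> M" "\<And>N. lideal N \<Longrightarrow> M \<subseteq> N \<Longrightarrow> N \<noteq> M \<Longrightarrow> N = UNIV"
proof -
  have "coef x \<noteq> 0" using x by (metis coef_inject coef_simps(1) ext zero_fun_apply)
  then have "coef x \<notin> jacobson_rad rk sk dl" using ss unfolding wb_semisimple_def by simp
  then obtain I where I: "max_left_ideal rk sk dl I" "coef x \<notin> I"
    unfolding jacobson_rad_def using coef by blast
  define M where "M = coef -` I"
  have IM: "I = coef ` M"
  proof -
    have "I \<subseteq> range coef" using I(1) unfolding range_coef max_left_ideal_def left_ideal_def by (elim conjE)
    then show ?thesis unfolding M_def by (simp add: image_vimage_eq Int_absorb2)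
  qed
  show thesis
  proof (rule that[of M])
    show "lideal M" unfolding M_def using I(1) by (intro lideal_vimage) (simp add: max_left_ideal_def)
    show "x \<notin> M" using I(2) by (simp add: M_def)
    fix N assume N: "lideal N" "M \<subseteq> N" "N \<noteq> M"
    have "coef ` N = WB rk sk"
    proof (rule ccontr)
      assume "coef ` N \<noteq> WB rk sk"
      moreover have "I \<subseteq> coef ` N" using N(2) IM by (simp add: image_mono)
      ultimately have "coef ` N = I" using I(1) lideal_image[OF N(1)] unfolding max_left_ideal_def by simp
      then show False using N(3) IM by (metis coef_inject inj_image_eq_iff injI)
    qed
    then have "coef ` N = coef ` UNIV" using range_coef by simp
    then show "N = UNIV" by (metis coef_inject inj_image_eq_iff injI)
  qed
qed

text \<open>Take a left ideal \<open>N\<close> of least dimension such that \<open>I\<close> and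
  \<open>N\<close> span everything. If it met \<open>I\<close> in a nonzero \<open>x\<close>, a
  maximal \<open>M\<close> avoiding \<open>x\<close> would together with \<open>I \<inter> N\<close>
  span everything, and \<open>N \<inter> M\<close> would be a smaller choice.\<close>

lemma lideal_complement:
  assumes ss: "wb_semisimple rk sk dl" and I: "lideal I"
  obtains N where "lideal N" "I \<inter> N = {0}" "\<And>z. \<exists>u\<in>I. \<exists>v\<in>N. z = u + v"
proof -
  interpret vs: vector_space "\<lambda>c x. sc c * x"
    by unfold_locales (auto simp: algebra_simps sc_times)
  obtain B where B: "B \<subseteq> D ` W" "vs.independent B" "D ` W \<subseteq> vs.span B"
    using vs.maximal_independent_subset[of "D ` W"] by blast
  have "x \<in> vs.span B" for x
    by (subst wb_expand) (intro vs.span_sum vs.span_scale, use B(3) in blast)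
  then interpret fs: finite_dimensional_vector_space "\<lambda>c x. sc c * x" B
    using B by unfold_locales (auto intro: finite_subset)
  have sub: "vs.span N = N" if "lideal N" for N
    using that by (simp add: vs.subspace_def lideal_def)
  define Q where "Q N \<longleftrightarrow> lideal N \<and> (\<forall>z. \<exists>u\<in>I. \<exists>v\<in>N. z = u + v)" for N
  have "\<exists>u\<in>I. \<exists>v\<in>UNIV. z = u + v" for z
    using I unfolding lideal_def by (intro bexI[of _ 0] bexI[of _ z]) auto
  then have "Q UNIV" unfolding Q_def by (simp add: lideal_def)
  then obtain N where N: "Q N" "\<And>N'. Q N' \<Longrightarrow> vs.dim N \<le> vs.dim N'"
    using ex_has_least_nat[of Q UNIV vs.dim] by blast
  have lN: "lideal N" using N(1) by (simp add: Q_def)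
  have "I \<inter> N = {0}"
  proof (rule ccontr)
    assume "I \<inter> N \<noteq> {0}"
    moreover have "0 \<in> I \<inter> N" using I lN by (simp add: lideal_def)
    ultimately obtain x where x: "x \<in> I" "x \<in> N" "x \<noteq> 0" by blast
    obtain M where M: "lideal M" "x \<notin> M" "\<And>N. lideal N \<Longrightarrow> M \<subseteq> N \<Longrightarrow> N \<noteq> M \<Longrightarrow> N = UNIV"
      using avoid_element[OF ss x(3)] by blast
    let ?S = "{m + y | m y. m \<in> M \<and> y \<in> I \<inter> N}"
    have "lideal ?S"
      unfolding lideal_def
    proof (intro conjI ballI allI)
      have "0 + 0 \<in> ?S" using M(1) I lN unfolding lideal_def by blast
      then show "0 \<in> ?S" by simp
      fix a assume "a \<in> ?S"
      then obtain m y where a: "a = m + y" "m \<in> M" "y \<in> I \<inter> N" by blast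
      show "a + b \<in> ?S" if bS: "b \<in> ?S" for b
      proof -
        obtain m' y' where b: "b = m' + y'" "m' \<in> M" "y' \<in> I \<inter> N" using bS by blast
        have "a + b = (m + m') + (y + y')" by (simp add: a b algebra_simps)
        moreover have "m + m' \<in> M" "y + y' \<in> I \<inter> N" using a b M(1) I lN unfolding lideal_def by blast+
        ultimately show ?thesis by blast
      qed
      fix c
      have "c * a = c * m + c * y" by (simp add: a algebra_simps)
      moreover have "c * m \<in> M" "c * y \<in> I \<inter> N" using a M(1) I lN unfolding lideal_def by blast+
      ultimately show "c * a \<in> ?S" by blast
    qed
    moreover have "M \<subseteq> ?S"
    proof
      fix m assume "m \<in> M"
      then have "m + 0 \<in> ?S" using I lN unfolding lideal_def by blast
      then show "m \<in> ?S" by simp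
    qed
    moreover have "0 + x \<in> ?S" using x M(1) unfolding lideal_def by blast
    then have "?S \<noteq> M" using M(2) by auto
    ultimately have S: "?S = UNIV" by (rule M(3))
    have lNM: "lideal (N \<inter> M)" using lN M(1) by (simp add: lideal_def)
    have "Q (N \<inter> M)" unfolding Q_def
    proof (intro conjI lNM allI)
      fix z
      obtain u v where uv: "u \<in> I" "v \<in> N" "z = u + v" using N(1) unfolding Q_def by blast
      obtain m y where my: "v = m + y" "m \<in> M" "y \<in> I \<inter> N" using S by blast
      have "(-1) * y \<in> N" using my(3) lN unfolding lideal_def by blast
      then have "v + (-1) * y \<in> N" using uv(2) lN unfolding lideal_def by blast
      then have "m \<in> N \<inter> M" using my by simp
      moreover have "u + y \<in> I" using uv(1) my(3) I unfolding lideal_def by blast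
      moreover have "z = (u + y) + m" using uv(3) my(1) by (simp add: algebra_simps)
      ultimately show "\<exists>u\<in>I. \<exists>v\<in>N \<inter> M. z = u + v" by blast
    qed
    then have "vs.dim N \<le> vs.dim (N \<inter> M)" by (rule N(2))
    moreover have "vs.span (N \<inter> M) \<subset> vs.span N" unfolding sub[OF lN] sub[OF lNM] using x(2) M(2) by blast
    then have "vs.dim (N \<inter> M) < vs.dim N" by (rule fs.dim_psubset)
    ultimately show False by simp
  qed
  then show thesis using that lN N(1) unfolding Q_def by blast
qed

text \<open>Write 1 = a x + n with n in a complement of the left ideal generated by x. Then x - x a
  x = x n lies in both ideals and vanishes.\<close>

lemma semisimple_regular:
  assumes "wb_semisimple rk sk dl"
  shows "\<exists>a. x = x * a * (x::wb)"
proof -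
  let ?I = "{a * x | a. True}"
  have I: "lideal ?I" unfolding lideal_def
  proof (intro conjI ballI allI)
    have "0 * x \<in> ?I" by blast
    then show "0 \<in> ?I" by simp
    fix u assume "u \<in> ?I"
    then obtain a where a: "u = a * x" by blast
    show "u + v \<in> ?I" if v: "v \<in> ?I" for v
    proof -
      obtain b where "v = b * x" using v by blast
      then have "u + v = (a + b) * x" using a by (simp add: distrib_right)
      then show ?thesis by blast
    qed
    show "c * u \<in> ?I" for c using a by (metis (mono_tags, lifting) mem_Collect_eq mult.assoc)
  qed
  obtain N where N: "lideal N" "?I \<inter> N = {0}" "\<And>z. \<exists>u\<in>?I. \<exists>v\<in>N. z = u + v"
    using lideal_complement[OF assms I] by blast
  obtain a n where an: "n \<in> N" "1 = a * x + n" using N(3)[of 1] by blast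
  have e: "x - x * a * x = x * n"
  proof -
    have "x * (a * x + n) = x * (a * x) + x * n" by (rule distrib_left)
    then have "x = x * (a * x) + x * n" unfolding an(2)[symmetric] mult_1_right .
    then show ?thesis by (metis add_diff_cancel_left' mult.assoc)
  qed
  have "x - x * a * x = (1 - x * a) * x" by (simp add: algebra_simps)
  then have "x - x * a * x \<in> ?I" by blast
  moreover have "x * n \<in> N" using N(1) an(1) unfolding lideal_def by blast
  ultimately have "x - x * a * x \<in> ?I \<inter> N" using e by simp
  then have "x - x * a * x = 0" unfolding N(2) by simp
  then show ?thesis by (intro exI[of _ a]) simp
qed

section \<open>Polynomials in one element\<close>

definition pe :: "complex poly \<Rightarrow> wb \<Rightarrow> wb" where
  "pe p x = fold_coeffs (\<lambda>a f. sc a + x * f) p 0"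

lemma pe_0 [simp]: "pe 0 x = 0" by (simp add: pe_def)

lemma pe_pCons [simp]: "pe (pCons a p) x = sc a + x * pe p x"
  by (cases "p = 0 \<and> a = 0") (auto simp: pe_def)

lemma pe_1 [simp]: "pe 1 x = 1"
  by (simp add: one_pCons)

lemma pe_add: "pe (p + q) x = pe p x + pe q x"
proof (induction p arbitrary: q)
  case (pCons a p q)
  then show ?case by (cases q) (simp add: algebra_simps)
qed simp

lemma pe_smult: "pe (smult c p) x = sc c * pe p x"
proof (induction p)
  case (pCons a p)
  have "x * (sc c * pe p x) = sc c * (x * pe p x)" by (metis mult.assoc sc_comm)
  then show ?case using pCons by (simp add: distrib_left sc_times)
qed simp

lemma pe_minus: "pe (- p) x = - pe p x"
  using pe_smult[of "-1" p x] by simp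

lemma pe_diff: "pe (p - q) x = pe p x - pe q x"
  using pe_add[of p "- q" x] by (simp add: pe_minus)

lemma pe_mult: "pe (p * q) x = pe p x * pe q x"
  by (induction p) (simp_all add: pe_add pe_smult algebra_simps)

lemma pe_pcompose: "pe (pcompose p q) x = pe p (pe q x)"
  by (induction p) (simp_all add: pcompose_pCons pe_add pe_mult)

lemma pe_power: "pe (p ^ k) x = pe p x ^ k"
  by (induction k) (simp_all add: pe_mult)

lemma pe_intertwine: "y * x = x' * y \<Longrightarrow> y * pe p x = pe p x' * y"
proof (induction p)
  case (pCons a p)
  have "y * (x * pe p x) = x' * (y * pe p x)" using pCons.prems by (simp only: mult.assoc[symmetric])
  then show ?case using pCons by (simp add: distrib_left distrib_right sc_comm[of y] mult.assoc)
qed simp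

lemma pe_diff_factor:
  assumes "x * y = y * x"
  shows "\<exists>q. pe p x - pe p y = (x - y) * q \<and> (\<forall>c. c * x = x * c \<longrightarrow> c * y = y * c \<longrightarrow> c * q = q * c)"
proof (induction p)
  case 0 show ?case by (intro exI[of _ 0]) simp
next
  case (pCons a p)
  then obtain q where q: "pe p x - pe p y = (x - y) * q" "\<forall>c. c * x = x * c \<longrightarrow> c * y = y * c \<longrightarrow> c * q = q * c" by blast
  have "pe (pCons a p) x - pe (pCons a p) y = x * (pe p x - pe p y) + (x - y) * pe p y" by (simp add: algebra_simps)
  also have "\<dots> = (x - y) * (x * q + pe p y)" unfolding q(1) using assms by (simp add: algebra_simps) (simp add: mult.assoc[symmetric])
  finally have 1: "pe (pCons a p) x - pe (pCons a p) y = (x - y) * (x * q + pe p y)" .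
  have "c * (x * q + pe p y) = (x * q + pe p y) * c" if "c * x = x * c" "c * y = y * c" for c
    using commute_mult[OF that(1) q(2)[rule_format, OF that]] pe_intertwine[OF that(2)] by (simp add: distrib_left distrib_right)
  then show ?case using 1 by blast
qed

text \<open>In terms of spectra, an eigenvalue of b equals one of a or differs from one by 1. The
  intertwiner \<phi> satisfies \<phi> a = b \<phi> and \<phi>^2 = 1 - (b - a)^2, so (b - a - 1)(b -
  a + 1) annihilates F(b); as F(a) = 0, these two factors divide F(b - 1) and F(b + 1).\<close>

lemma spectrum_step:
  assumes s: "s * s = 1" "s * a = b * s - 1" "s * b = a * s + 1" and ab: "a * b = b * a" and F: "pe F a = 0"
  shows "pe (F * pcompose F [:-1,1:] * pcompose F [:1,1:]) b = 0"
proof -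
  define \<phi> where "\<phi> = s * (a - b) + 1"
  have \<phi>: "\<phi> * a = b * \<phi>"
  proof -
    have "\<phi> * a = (s * a) * a - (s * b) * a + a" using ab by (simp add: \<phi>_def algebra_simps)
    also have "\<dots> = (b * s - 1) * a - (a * s + 1) * a + a" unfolding s(2,3) ..
    also have "\<dots> = b * (s * a) - a * (s * a) - a" by (simp add: algebra_simps)
    also have "\<dots> = b * (b * s - 1) - a * (b * s - 1) - a" unfolding s(2) ..
    finally have 1: "\<phi> * a = b * (b * s - 1) - a * (b * s - 1) - a" .
    have "b * \<phi> = b * (s * a) - b * (s * b) + b" by (simp add: \<phi>_def algebra_simps)
    also have "\<dots> = b * (b * s - 1) - b * (a * s + 1) + b" unfolding s(2,3) ..
    finally have 2: "b * \<phi> = b * (b * s - 1) - b * (a * s + 1) + b" .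
    have "b * (a * s) = a * (b * s)" using ab by (simp add: mult.assoc[symmetric])
    then show ?thesis unfolding 1 2 by (simp add: algebra_simps)
  qed
  have \<phi>2: "\<phi> * \<phi> = 1 - (b - a) * (b - a)"
  proof -
    have f: "\<phi> = (b - a) * s - 1"
      unfolding \<phi>_def right_diff_distrib s(2,3) by (simp add: algebra_simps)
    have "\<phi> * \<phi> = ((b - a) * s - 1) * (s * (a - b) + 1)" using f \<phi>_def by metis
    also have "\<dots> = (b - a) * (s * s) * (a - b) + ((b - a) * s - (s * (a - b) + 1))"
      by (simp add: algebra_simps)
    also have "(b - a) * s - (s * (a - b) + 1) = 1"
      using f \<phi>_def by (metis add_diff_cancel_left' diff_add_cancel add.commute)
    finally show ?thesis using s(1) by (simp add: algebra_simps)
  qed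
  have k0: "pe F b * (\<phi> * \<phi>) = 0"
  proof -
    have "pe F b * \<phi> = \<phi> * pe F a" using pe_intertwine[OF \<phi>] by simp
    then show ?thesis using F by (simp add: mult.assoc[symmetric])
  qed
  have cb: "(b + c) * a = a * (b + c)" if "c * a = a * c" for c using ab that by (simp add: algebra_simps)
  obtain q1 where q1: "pe F (b - 1) - pe F a = (b - 1 - a) * q1" "\<forall>c. c * (b - 1) = (b - 1) * c \<longrightarrow> c * a = a * c \<longrightarrow> c * q1 = q1 * c"
    using pe_diff_factor[of "b - 1" a F] ab by (auto simp: algebra_simps)
  obtain q2 where q2: "pe F (b + 1) - pe F a = (b + 1 - a) * q2"
    using pe_diff_factor[of "b + 1" a F] ab by (auto simp: algebra_simps)
  have com: "q1 * (b + 1 - a) = (b + 1 - a) * q1"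
    using q1(2)[rule_format, of "b + 1 - a"] ab by (simp add: algebra_simps)
  have "(b - 1 - a) * (b + 1 - a) = - (\<phi> * \<phi>)" unfolding \<phi>2 by (simp add: algebra_simps)
  then have "pe F b * ((b - 1 - a) * (b + 1 - a)) = 0" using k0 by simp
  moreover have "pe F b * pe F (b - 1) * pe F (b + 1) = pe F b * ((b - 1 - a) * (b + 1 - a)) * (q1 * q2)"
  proof -
    have "pe F b * pe F (b - 1) * pe F (b + 1) = pe F b * ((b - 1 - a) * q1) * ((b + 1 - a) * q2)"
      using q1(1) q2 F by simp
    also have "\<dots> = pe F b * (b - 1 - a) * (q1 * (b + 1 - a)) * q2" by (simp only: mult.assoc)
    finally show ?thesis unfolding com by (simp only: mult.assoc)
  qed
  ultimately have "pe F b * pe F (b - 1) * pe F (b + 1) = 0" by simp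
  then show ?thesis by (simp add: pe_mult pe_pcompose) (simp add: algebra_simps)
qed

section \<open>Spectra of Jucys-Murphy elements\<close>

abbreviation XX :: "nat \<Rightarrow> nat set" where "XX k \<equiv> {1..rk-k}"
abbreviation YY :: "nat \<Rightarrow> nat set" where "YY k \<equiv> {rk+k+1..nn}"

lemma blk_XX: "blk k (XX k)" and blk_YY: "blk k (YY k)"
  by (auto simp: blk_def)

text \<open>An annihilating polynomial for the Jucys-Murphy element at position t + 1 of a block:
  each step of \<open>spectrum_step\<close> lets an eigenvalue stay or change by 1, so the roots are
  integers between -t and t.\<close>

primrec SP :: "nat \<Rightarrow> complex poly" where
  "SP 0 = [:0, 1:]"
| "SP (Suc t) = SP t * pcompose (SP t) [:-1, 1:] * pcompose (SP t) [:1, 1:]"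

context
  fixes k m M :: nat and B :: "nat set"
  assumes l: "lv k" and B: "blk k B" and Bi: "B = {m+1..M}"
begin

lemma KK_dAHA:
  assumes "i \<in> B" "i+1 \<in> B"
  defines "s \<equiv> T i (i+1)"
  shows "s * s = 1" "s * KK B i = KK B (i+1) * s - 1" "s * KK B (i+1) = KK B i * s + 1"
proof -
  note ss = blk_facts(2)[OF l B]
  have w: "wp (Transposition.transpose i (i+1))" using ss[OF assms(1,2)] by (rule wp_transpose)
  show s: "s * s = 1" unfolding s_def using ss[OF assms(1,2)] by (rule T_square)
  have e: "{j\<in>B. j < i+1} = insert i {j\<in>B. j < i}" using assms(1) by auto
  have f: "finite {j\<in>B. j < i}" using blk_facts(1)[OF l B] by simp
  have "s * T j i = T j (i+1) * s" if "j \<in> {j\<in>B. j < i}" for j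
    unfolding s_def using P_T[OF w ss[of j i]] that assms(1) by (simp add: transpose_def)
  then have 1: "s * KK B i = (\<Sum>j\<in>{j\<in>B. j < i}. T j (i+1)) * s"
    unfolding KK_def by (simp add: sum_distrib_left sum_distrib_right)
  have 2: "KK B (i+1) = s + (\<Sum>j\<in>{j\<in>B. j < i}. T j (i+1))"
    unfolding KK_def e using f by (simp add: s_def)
  show A: "s * KK B i = KK B (i+1) * s - 1" unfolding 1 2 by (simp add: distrib_right s)
  have "s * (s * KK B i) = s * (KK B (i+1) * s - 1)" unfolding A ..
  then have "KK B i = s * KK B (i+1) * s - s"
    by (simp only: mult.assoc[symmetric] s mult_1_left mult_1_right right_diff_distrib)
  then have "KK B i * s = (s * KK B (i+1) * s - s) * s" by (rule arg_cong)
  also have "\<dots> = s * KK B (i+1) - 1" by (simp only: left_diff_distrib mult.assoc s mult_1_right)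
  finally show "s * KK B (i+1) = KK B i * s + 1" by simp
qed

lemma T_KK_commute:
  assumes "a \<in> B" "b \<in> B" "i \<in> B" "a < i" "b < i"
  shows "T a b * KK B i = KK B i * T a b"
proof -
  let ?t = "Transposition.transpose a b" and ?A = "{j\<in>B. j < i}"
  note ss = blk_facts(2)[OF l B]
  have p: "?t permutes ?A" using assms by (intro permutes_swap_id) auto
  have "T a b * KK B i = (\<Sum>j\<in>?A. T (?t j) i * T a b)"
    unfolding KK_def sum_distrib_left
  proof (intro sum.cong refl)
    fix j assume "j \<in> ?A"
    then have "T a b * T j i = T (?t j) (?t i) * T a b" using ss assms by (intro P_T wp_transpose) auto
    moreover have "?t i = i" using assms by (simp add: transpose_def)
    ultimately show "T a b * T j i = T (?t j) i * T a b" by simp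
  qed
  also have "\<dots> = (\<Sum>j\<in>?A. T j i) * T a b"
    unfolding sum_distrib_right using sum.permute[OF p, of "\<lambda>j. T j i * T a b"] by (simp add: o_def)
  finally show ?thesis by (simp add: KK_def)
qed

lemma KK_commute:
  assumes "i \<in> B" "i+1 \<in> B"
  shows "KK B i * KK B (i+1) = KK B (i+1) * KK B i"
  unfolding KK_def[of B i] sum_distrib_left sum_distrib_right
  using assms by (intro sum.cong refl T_KK_commute) auto

lemma SP_KK: "m + 1 + t \<le> M \<Longrightarrow> pe (SP t) (KK B (m+1+t)) = 0"
proof (induction t)
  case 0
  have "{j\<in>B. j < m+1} = {}" using Bi by auto
  then have "KK B (m+1+0) = 0" unfolding KK_def by (simp only: add_0_right sum.empty)
  then show ?case by (simp only: SP.simps pe_pCons pe_0 sc_simps) simp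
next
  case (Suc t)
  have i: "m+1+t \<in> B" "m+1+t+1 \<in> B" using Suc.prems Bi by auto
  have "pe (SP (Suc t)) (KK B (m+1+t+1)) = 0"
    unfolding SP.simps using KK_dAHA[OF i] KK_commute[OF i] Suc by (intro spectrum_step) auto
  then show ?case by simp
qed

end

lemma SP_root: "poly (SP t) c = 0 \<Longrightarrow> \<exists>z::int. c = of_int z \<and> \<bar>z\<bar> \<le> int t"
proof (induction t arbitrary: c)
  case 0 then show ?case by (intro exI[of _ 0]) simp
next
  case (Suc t)
  then consider "poly (SP t) c = 0" | "poly (SP t) (c - 1) = 0" | "poly (SP t) (c + 1) = 0"
    by (auto simp: poly_pcompose add.commute)
  then show ?case
  proof cases
    case 1 then show ?thesis using Suc.IH[of c] by force
  next
    case 2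
    then obtain z :: int where z: "c - 1 = of_int z" "\<bar>z\<bar> \<le> int t" using Suc.IH by blast
    then show ?thesis by (intro exI[of _ "z+1"]) (auto simp: algebra_simps)
  next
    case 3
    then obtain z :: int where z: "c + 1 = of_int z" "\<bar>z\<bar> \<le> int t" using Suc.IH by blast
    then show ?thesis by (intro exI[of _ "z-1"]) (auto simp: algebra_simps)
  qed
qed

text \<open>All roots being integers, the imaginary unit is not one.\<close>

lemma SP_nonzero: "SP t \<noteq> 0"
proof
  assume "SP t = 0"
  then obtain z :: int where "\<i> = complex_of_int z" using SP_root[of t \<i>] by auto
  then have "Im \<i> = Im (complex_of_int z)" by (rule arg_cong)
  then show False by simp
qed

lemma SP_dvd: "t \<le> u \<Longrightarrow> SP t dvd SP u"
proof (induction u)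
  case (Suc u)
  then show ?case by (cases "t = Suc u") (auto simp: mult.assoc intro: dvd_mult2)
qed simp

lemma pe_dvd: "p dvd q \<Longrightarrow> pe p x = 0 \<Longrightarrow> pe q x = 0"
  by (auto simp: pe_mult elim!: dvdE)

lemma SP_XX: assumes "lv k" "i \<in> XX k" shows "pe (SP (rk-1)) (KK (XX k) i) = 0"
proof (rule pe_dvd)
  have "pe (SP (i-1)) (KK (XX k) (0+1+(i-1))) = 0"
    by (rule SP_KK[OF assms(1) blk_XX, where M="rk-k"]) (use assms(2) in auto)
  then show "pe (SP (i-1)) (KK (XX k) i) = 0" using assms(2) by simp
  show "SP (i-1) dvd SP (rk-1)" using assms(2) by (intro SP_dvd) auto
qed

lemma SP_YY: assumes "lv k" "i \<in> YY k" shows "pe (SP (sk-1)) (KK (YY k) i) = 0"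
proof (rule pe_dvd)
  have "pe (SP (i-(rk+k+1))) (KK (YY k) (rk+k+1+(i-(rk+k+1)))) = 0"
    by (rule SP_KK[OF assms(1) blk_YY, where M=nn]) (use assms(2) in auto)
  then show "pe (SP (i-(rk+k+1))) (KK (YY k) i) = 0" using assms(2) by simp
  show "SP (i-(rk+k+1)) dvd SP (sk-1)" using assms(2) by (intro SP_dvd) auto
qed

text \<open>For non-integral \<delta> the last alternative holds vacuously, so this covers all
  semisimple parameters except the four exceptional algebras.\<close>

definition generic :: bool where
  "generic \<longleftrightarrow> rk = 0 \<or> sk = 0 \<or> (\<forall>z::int. dl = of_int z \<longrightarrow> int rk + int sk - 2 < \<bar>z\<bar>)"

text \<open>A common root of the annihilating polynomials \<open>A\<close> of the left elements and
  \<open>C\<close> of the negated, shifted right ones would make \<delta> an integer of absolute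
  value at most r + s - 2. Hence they are coprime, and a Bezout identity yields one \<open>h\<close>
  for all levels.\<close>

lemma separating_poly:
  assumes generic
  shows "\<exists>h. \<forall>k. lv k \<longrightarrow> (\<forall>i\<in>XX k. pe h (KK (XX k) i) = 1) \<and> (\<forall>j\<in>YY k. pe h (- (sc dl + KK (YY k) j)) = 0)"
proof (cases "rk = 0 \<or> sk = 0")
  case True
  then show ?thesis
  proof
    assume "rk = 0" then show ?thesis by (intro exI[of _ 0]) simp
  next
    assume "sk = 0" then show ?thesis by (intro exI[of _ 1]) (simp add: lv_def)
  qed
next
  case False
  define A where "A = SP (rk-1)"
  \<comment> \<open>The map from x to -\<delta> - x is an involution, so \<open>C\<close>
    annihilates -(\<delta> + y) whenever \<open>SP (sk-1)\<close> annihilates y.\<close>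
  define C where "C = pcompose (SP (sk-1)) [:-dl, -1:]"
  define g where "g = gcd A C"
  have g0: "g \<noteq> 0" using SP_nonzero by (simp add: g_def A_def)
  have nr: "poly g c \<noteq> 0" for c
  proof
    assume c: "poly g c = 0"
    have "g dvd A" "g dvd C" by (simp_all add: g_def)
    then have "poly A c = 0" "poly C c = 0" using c by (auto elim!: dvdE)
    then have "poly (SP (rk-1)) c = 0" "poly (SP (sk-1)) (- dl - c) = 0" by (simp_all add: A_def C_def poly_pcompose)
    then obtain z w :: int where z: "c = of_int z" "\<bar>z\<bar> \<le> int (rk-1)" and w: "- dl - c = of_int w" "\<bar>w\<bar> \<le> int (sk-1)"
      using SP_root by metis
    have "dl = - c - of_int w" using w(1)[symmetric] by simp
    then have "dl = of_int (- z - w)" using z(1) by simp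
    then have "int rk + int sk - 2 < \<bar>- z - w\<bar>" using assms False unfolding generic_def by blast
    then show False using z(2) w(2) False by linarith
  qed
  then obtain a where a: "a \<noteq> 0" "g = [:a:]"
    using fundamental_theorem_of_algebra_alt[of g] by blast
  obtain u v where uv: "u * A + v * C = g"
    using bezout_coefficients_fst_snd[of A C] unfolding g_def by blast
  define h where "h = smult (1/a) (v * C)"
  have h': "h = 1 - smult (1/a) (u * A)"
  proof -
    have "smult (1/a) (u * A + v * C) = 1" unfolding uv a(2) using a(1) by (simp add: one_pCons)
    then show ?thesis by (simp add: h_def smult_add_right algebra_simps)
  qed
  show ?thesis
  proof (intro exI[of _ h] allI impI conjI ballI)
    fix k i assume "lv k" "i \<in> XX k"
    then have "pe A (KK (XX k) i) = 0" unfolding A_def by (rule SP_XX)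
    then show "pe h (KK (XX k) i) = 1" unfolding h' by (simp add: pe_diff pe_smult pe_mult)
  next
    fix k j assume "lv k" "j \<in> YY k"
    then have "pe (SP (sk-1)) (KK (YY k) j) = 0" by (rule SP_YY)
    moreover have "pe [:-dl, -1:] (- (sc dl + KK (YY k) j)) = KK (YY k) j" by simp
    ultimately have "pe C (- (sc dl + KK (YY k) j)) = 0" unfolding C_def pe_pcompose by simp
    then show "pe h (- (sc dl + KK (YY k) j)) = 0" unfolding h_def by (simp add: pe_smult pe_mult)
  qed
qed

section \<open>Supersymmetric power sums on the levels\<close>

definition PS :: "complex poly \<Rightarrow> wb" where
  "PS g = (\<Sum>i\<in>{1..rk}. pe g (L i)) - (\<Sum>j\<in>{rk+1..nn}. pe g (- L j))"

text \<open>The statement is strengthened by a factor of degree \<open>t\<close>, which lets the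
  induction peel off one coefficient of \<open>g\<close> at a time.\<close>

lemma PS_Zs: "PS g \<in> Zs"
proof -
  have "(\<Sum>i\<in>{1..rk}. L i ^ t * pe g (L i)) - (\<Sum>j\<in>{rk+1..nn}. (- L j) ^ t * pe g (- L j)) \<in> Zs" for t
  proof (induction g arbitrary: t)
    case 0 then show ?case by (simp add: Zs_zero)
  next
    case (pCons a p)
    have e: "x ^ t * pe (pCons a p) x = sc a * x ^ t + x ^ Suc t * pe p x" for x
      by (simp add: distrib_left sc_comm mult.assoc[symmetric] power_commutes)
    have "(\<Sum>i\<in>{1..rk}. L i ^ t * pe (pCons a p) (L i)) - (\<Sum>j\<in>{rk+1..nn}. (- L j) ^ t * pe (pCons a p) (- L j)) =
      sc a * ((\<Sum>i\<in>{1..rk}. L i ^ t) - (\<Sum>j\<in>{rk+1..nn}. (- L j) ^ t)) +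
      ((\<Sum>i\<in>{1..rk}. L i ^ Suc t * pe p (L i)) - (\<Sum>j\<in>{rk+1..nn}. (- L j) ^ Suc t * pe p (- L j)))"
      unfolding e sum.distrib right_diff_distrib sum_distrib_left by (simp only: algebra_simps)
    then show ?case by (simp only:) (intro Zs_add Zs_mult Zs_sc Zs_power_sum pCons.IH)
  qed
  from this[of 0] show ?thesis by (simp add: PS_def)
qed

lemma Fd_bot: "lv k \<Longrightarrow> region k i \<Longrightarrow> Fd k (False, i) = (False, 2*rk+1-i)"
  using region_facts[of k i] by (simp add: Fd_def)

lemma E_fk_region:
  assumes "lv k" "region k i" "i \<le> rk" "rk < q" "q \<le> nn" "q \<noteq> 2*rk+1-i"
  shows "E i q * fk k = T (2*rk+1-i) q * fk k"
proof -
  note rf = region_facts[OF assms(1,2)]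
  have "E i q * D (Fd k) = T q (2*rk+1-i) * D (Fd k)"
    using Fd_W[OF assms(1)] Fd_bot[OF assms(1,2)] assms rf region_facts(2)[OF assms(1) rf(3)]
    by (intro E_mult_left) (auto simp: arc_def same_side_def)
  then show ?thesis by (simp add: fk_def T_commute)
qed

text \<open>The analogue of \<open>L_wall\<close> for every nested arc. On \<open>fk k\<close>, arcs
  from \<open>a < i\<close> become the transpositions of \<open>L i\<close>, the arc from
  \<open>i\<close> gives \<delta>, and arcs from the inner vertices become the transpositions
  occurring in \<open>L (2*rk+1-i)\<close> and cancel them.\<close>

lemma L_fk_pair:
  assumes l: "lv k" and i: "region k i" "i \<le> rk"
  shows "L (2*rk+1-i) * fk k = - L i * fk k"
proof -
  let ?q = "2*rk+1-i"
  note rf = region_facts[OF l i(1)]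
  have q: "rk < ?q" "?q \<le> nn" "\<not> ?q \<le> rk" using rf(5) i region_facts(2)[OF l rf(3)] by auto
  have s: "{1..rk} = {1..<i} \<union> ({i} \<union> {i+1..rk})" using rf i by auto
  have 1: "E a ?q * fk k = T a i * fk k" if "a \<in> {1..<i}" for a
  proof -
    have "E a ?q * D (Fd k) = T a i * D (Fd k)"
      using Fd_W[OF l] Fd_bot[OF l i(1)] that i q rf by (intro E_mult_right) (auto simp: arc_def same_side_def)
    then show ?thesis by (simp add: fk_def)
  qed
  have 2: "E i ?q * fk k = sc dl * fk k"
    unfolding fk_def using Fd_W[OF l] Fd_bot[OF l i(1)] i q rf by (intro E_mult_same) (auto simp: arc_def)
  have 3: "(\<Sum>a\<in>{i+1..rk}. E a ?q * fk k) = (\<Sum>j\<in>{rk+1..<?q}. T j ?q * fk k)"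
  proof -
    have "(\<Sum>a\<in>{i+1..rk}. E a ?q * fk k) = (\<Sum>a\<in>{i+1..rk}. T (2*rk+1-a) ?q * fk k)"
      using i q by (intro sum.cong refl E_fk_region[OF l]) (auto simp: region_def)
    also have "\<dots> = (\<Sum>j\<in>{rk+1..<?q}. T j ?q * fk k)"
      by (rule sum.reindex_bij_witness[of _ "\<lambda>j. 2*rk+1-j" "\<lambda>j. 2*rk+1-j"]) (use i in auto)
    finally show ?thesis .
  qed
  have "(\<Sum>a\<in>{1..rk}. E a ?q) * fk k = (\<Sum>a\<in>{1..<i}. E a ?q * fk k) + (\<Sum>a\<in>{i} \<union> {i+1..rk}. E a ?q * fk k)"
    unfolding sum_distrib_right s by (rule sum.union_disjoint) auto
  also have "(\<Sum>a\<in>{i} \<union> {i+1..rk}. E a ?q * fk k) = E i ?q * fk k + (\<Sum>a\<in>{i+1..rk}. E a ?q * fk k)"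
    by (subst sum.union_disjoint) auto
  also have "(\<Sum>a\<in>{1..<i}. E a ?q * fk k) = (\<Sum>a\<in>{1..<i}. T a i * fk k)"
    by (rule sum.cong[OF refl 1])
  finally have "(\<Sum>a\<in>{1..rk}. E a ?q) * fk k = (\<Sum>a\<in>{1..<i}. T a i * fk k) + (sc dl * fk k + (\<Sum>j\<in>{rk+1..<?q}. T j ?q * fk k))"
    unfolding 2 3 .
  then have "L ?q * fk k = - (\<Sum>a\<in>{1..<i}. T a i * fk k)"
    using q by (simp add: L_def distrib_right left_diff_distrib sum_distrib_right)
  then show ?thesis using i by (simp add: L_def[of i] sum_distrib_right)
qed

text \<open>A permutation in \<open>G k\<close> carries the pair just outside the region to the ends
  of this arc, and there the arc completes \<open>fk k\<close> to \<open>fk (Suc k)\<close>.\<close>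

lemma E_fk_outside:
  assumes l: "lv k" and i: "i \<in> XX k" and q: "q \<in> YY k"
  shows "E i q * fk k \<in> J (Suc k)"
proof -
  let ?i = "rk - k" and ?q = "rk + k + 1"
  have l': "lv (Suc k)" using l i q by (auto simp: lv_def)
  define \<sigma> where "\<sigma> = Transposition.transpose i ?i \<circ> Transposition.transpose q ?q"
  have ss: "same_side i ?i" "same_side q ?q" using i q l by (auto simp: same_side_def lv_def)
  have w: "wp \<sigma>" unfolding \<sigma>_def by (intro wall_perm_comp wp_transpose ss)
  have "\<sigma> x = x" if "region k x" for x
    using that i q l unfolding \<sigma>_def by (auto simp: transpose_def region_def lv_def)
  then have \<sigma>: "\<sigma> \<in> G k" using w by (simp add: G_def)
  have "\<sigma> ?i = i" "\<sigma> ?q = q" using i q l unfolding \<sigma>_def by (auto simp: transpose_def lv_def)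
  moreover have "arc ?i ?q" using l' by (auto simp: arc_def lv_def)
  ultimately have "P \<sigma> * E ?i ?q = E i q * P \<sigma>" using P_E[OF w] by metis
  then have "P \<sigma> * fk (Suc k) * P (inv \<sigma>) = E i q * (P \<sigma> * fk k) * P (inv \<sigma>)"
    unfolding fk_Suc[OF l'] by (simp only: mult.assoc[symmetric])
  also have "\<dots> = E i q * fk k * (P \<sigma> * P (inv \<sigma>))"
    unfolding G_fk_commute[OF \<sigma> l] by (simp only: mult.assoc)
  finally have "E i q * fk k = P \<sigma> * fk (Suc k) * P (inv \<sigma>)" using P_inv(1)[OF w] by simp
  then show ?thesis using J_right[OF J_left[OF fk_J[OF l']]] by simp
qed

text \<open>Arcs from the region turn into the transpositions with letters of the region and cancel
  them; arcs from the remaining left vertices create a further horizontal strand and vanish at this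
  level.\<close>

lemma L_fk_right:
  assumes l: "lv k" and q: "q \<in> YY k"
  shows "L q * fk k - (sc dl + KK (YY k) q) * fk k \<in> J (Suc k)"
proof -
  have q': "rk < q" "q \<le> nn" "\<not> q \<le> rk" "rk + k < q" using q by auto
  have s: "{1..rk} = XX k \<union> {rk-k+1..rk}" using l by (auto simp: lv_def)
  have s2: "{rk+1..<q} = {rk+1..rk+k} \<union> {j\<in>YY k. j < q}" using q by auto
  have 1: "(\<Sum>a\<in>{rk-k+1..rk}. E a q * fk k) = (\<Sum>j\<in>{rk+1..rk+k}. T j q * fk k)"
  proof -
    have "(\<Sum>a\<in>{rk-k+1..rk}. E a q * fk k) = (\<Sum>a\<in>{rk-k+1..rk}. T (2*rk+1-a) q * fk k)"
      using q' l by (intro sum.cong refl E_fk_region[OF l]) (auto simp: region_def lv_def)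
    also have "\<dots> = (\<Sum>j\<in>{rk+1..rk+k}. T j q * fk k)"
      by (rule sum.reindex_bij_witness[of _ "\<lambda>j. 2*rk+1-j" "\<lambda>j. 2*rk+1-j"]) (use l in \<open>auto simp: lv_def\<close>)
    finally show ?thesis .
  qed
  have 2: "(\<Sum>a\<in>{1..rk}. E a q) * fk k = (\<Sum>a\<in>XX k. E a q * fk k) + (\<Sum>j\<in>{rk+1..rk+k}. T j q * fk k)"
    unfolding sum_distrib_right s 1[symmetric] by (rule sum.union_disjoint) auto
  have 3: "(\<Sum>j\<in>{rk+1..<q}. T j q) * fk k = (\<Sum>j\<in>{rk+1..rk+k}. T j q * fk k) + KK (YY k) q * fk k"
    unfolding sum_distrib_right s2 KK_def by (rule sum.union_disjoint) auto
  have "L q * fk k - (sc dl + KK (YY k) q) * fk k = - (\<Sum>a\<in>XX k. E a q * fk k)"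
    unfolding L_def using q'(3) 2 3 by (simp add: distrib_right left_diff_distrib)
  then show ?thesis by (simp only:) (intro J_minus J_sum E_fk_outside[OF l _ q])
qed

lemma pe_cong_exact:
  assumes "x * f = y * f" "x * y = y * x"
  shows "pe p x * f = pe p y * f"
proof (induction p)
  case (pCons a p)
  have "x * pe p y = pe p y * x" using assms(2) by (rule pe_intertwine)
  then have "x * (pe p y * f) = pe p y * (x * f)" by (simp only: mult.assoc[symmetric])
  also have "\<dots> = (pe p y * y) * f" unfolding assms(1) by (simp only: mult.assoc)
  also have "pe p y * y = y * pe p y" using pe_intertwine[of y y y p] by simp
  finally show ?case using pCons by (simp add: distrib_right mult.assoc)
qed simp

lemma pe_cong_J:
  assumes "x * f - y * f \<in> J m" "y * f = f * y"
  shows "pe p x * f - pe p y * f \<in> J m"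
proof (induction p)
  case (pCons a p)
  have c: "pe p y * f = f * pe p y" using pe_intertwine[of f y y p] assms(2) by simp
  have "pe (pCons a p) x * f - pe (pCons a p) y * f = x * (pe p x * f) - y * (pe p y * f)"
    by (simp add: distrib_right mult.assoc)
  also have "\<dots> = x * (pe p x * f - pe p y * f) + (x * f - y * f) * pe p y"
    unfolding right_diff_distrib left_diff_distrib c by (simp only: mult.assoc) simp
  finally show ?case using J_add[OF J_left[OF pCons(2)] J_right[OF assms(1)]] by simp
qed simp

lemma KK_fk_commute:
  assumes l: "lv k" and B: "blk k B" "i \<in> B"
  shows "KK B i * fk k = fk k * KK B i"
  unfolding KK_def sum_distrib_left sum_distrib_right
proof (intro sum.cong refl)
  fix j assume j: "j \<in> {j\<in>B. j < i}"
  then have "cyc [j] i \<in> G k" using cyc_G[OF l B, of "[j]"] by simp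
  moreover have "cyc [j] i = Transposition.transpose j i" by (simp only: cyc_simps comp_id)
  ultimately have "Transposition.transpose j i \<in> G k" by (simp only:)
  then show "T j i * fk k = fk k * T j i" using G_fk_commute l by blast
qed

text \<open>The two ends of a nested arc contribute opposite terms, by \<open>L_fk_pair\<close>.
  What remains are the Jucys-Murphy elements of the two blocks of vertical strands, shifted by
  \<delta> on the right.\<close>

lemma PS_fk:
  assumes l: "lv k"
  shows "PS g * fk k - ((\<Sum>i\<in>XX k. pe g (KK (XX k) i)) - (\<Sum>j\<in>YY k. pe g (- (sc dl + KK (YY k) j)))) * fk k \<in> J (Suc k)"
proof -
  have s: "{1..rk} = XX k \<union> {rk-k+1..rk}" "{rk+1..nn} = {rk+1..rk+k} \<union> YY k" using l by (auto simp: lv_def)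
  have L: "L i = KK (XX k) i" if "i \<in> XX k" for i
  proof -
    have "{j\<in>XX k. j < i} = {1..<i}" using that by auto
    moreover have "i \<le> rk" using that by auto
    ultimately show ?thesis by (simp only: L_def KK_def if_True)
  qed
  have pair: "(\<Sum>i\<in>{rk-k+1..rk}. pe g (L i) * fk k) = (\<Sum>j\<in>{rk+1..rk+k}. pe g (- L j) * fk k)"
  proof -
    have "(\<Sum>i\<in>{rk-k+1..rk}. pe g (L i) * fk k) = (\<Sum>i\<in>{rk-k+1..rk}. pe g (- L (2*rk+1-i)) * fk k)"
    proof (intro sum.cong refl pe_cong_exact)
      fix i assume "i \<in> {rk-k+1..rk}"
      then have i: "region k i" "i \<le> rk" using l by (auto simp: region_def lv_def)
      note rf = region_facts[OF l i(1)]
      show "L i * fk k = - L (2*rk+1-i) * fk k" using L_fk_pair[OF l i] by simp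
      have "i \<in> {1..nn}" "2*rk+1-i \<in> {1..nn}" using rf region_facts(1,2)[OF l rf(3)] by auto
      then show "L i * - L (2*rk+1-i) = - L (2*rk+1-i) * L i" using L_commute by simp
    qed
    also have "\<dots> = (\<Sum>j\<in>{rk+1..rk+k}. pe g (- L j) * fk k)"
      by (rule sum.reindex_bij_witness[of _ "\<lambda>j. 2*rk+1-j" "\<lambda>j. 2*rk+1-j"]) (use l in \<open>auto simp: lv_def\<close>)
    finally show ?thesis .
  qed
  have e1: "(\<Sum>i\<in>{1..rk}. pe g (L i)) * fk k = (\<Sum>i\<in>XX k. pe g (KK (XX k) i)) * fk k + (\<Sum>i\<in>{rk-k+1..rk}. pe g (L i) * fk k)"
  proof -
    have "(\<Sum>i\<in>{1..rk}. pe g (L i)) * fk k = (\<Sum>i\<in>XX k. pe g (L i) * fk k) + (\<Sum>i\<in>{rk-k+1..rk}. pe g (L i) * fk k)"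
      unfolding sum_distrib_right s(1) by (rule sum.union_disjoint) auto
    then show ?thesis using L by (simp add: sum_distrib_right)
  qed
  have e2: "(\<Sum>j\<in>{rk+1..nn}. pe g (- L j)) * fk k = (\<Sum>j\<in>{rk+1..rk+k}. pe g (- L j) * fk k) + (\<Sum>j\<in>YY k. pe g (- L j) * fk k)"
    unfolding sum_distrib_right s(2) by (rule sum.union_disjoint) auto
  have "pe g (- L j) * fk k - pe g (- (sc dl + KK (YY k) j)) * fk k \<in> J (Suc k)" if j: "j \<in> YY k" for j
  proof (rule pe_cong_J)
    have "- (L j * fk k - (sc dl + KK (YY k) j) * fk k) \<in> J (Suc k)" by (rule J_minus[OF L_fk_right[OF l j]])
    then show "- L j * fk k - - (sc dl + KK (YY k) j) * fk k \<in> J (Suc k)"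
      by (simp only: minus_diff_eq mult_minus_left diff_minus_eq_add uminus_add_conv_diff)
    show "- (sc dl + KK (YY k) j) * fk k = fk k * - (sc dl + KK (YY k) j)"
      using KK_fk_commute[OF l blk_YY j] by (simp add: left_diff_distrib right_diff_distrib sc_comm)
  qed
  then have "(\<Sum>j\<in>YY k. pe g (- L j) * fk k - pe g (- (sc dl + KK (YY k) j)) * fk k) \<in> J (Suc k)" by (rule J_sum)
  then have "- (\<Sum>j\<in>YY k. pe g (- L j) * fk k - pe g (- (sc dl + KK (YY k) j)) * fk k) \<in> J (Suc k)" by (rule J_minus)
  note * = this
  have e3: "(\<Sum>j\<in>YY k. pe g (- (sc dl + KK (YY k) j))) * fk k = (\<Sum>j\<in>YY k. pe g (- (sc dl + KK (YY k) j)) * fk k)"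
    by (rule sum_distrib_right)
  have "a + b - (b + c) - (a - d) = - (c - d)" for a b c d :: wb by simp
  then show ?thesis using *
    unfolding PS_def left_diff_distrib e1 e2 e3 pair sum_subtractf by (simp only:)
qed

lemma Rep_PS:
  assumes "lv k"
  shows "Rep k ((\<Sum>i\<in>XX k. pe g (KK (XX k) i)) - (\<Sum>j\<in>YY k. pe g (- (sc dl + KK (YY k) j))))"
  unfolding Rep_def using PS_Zs PS_fk[OF assms] by blast

section \<open>The centre in the semisimple cases\<close>

text \<open>The remainder is pushed down one level at a time, and no diagram has more than
  \<open>min rk sk\<close> arcs.\<close>

lemma center_subset_Zs:
  assumes step: "\<And>k z. lv k \<Longrightarrow> z \<in> center \<Longrightarrow> z \<in> J k \<Longrightarrow> \<exists>z'\<in>Zs. z - z' \<in> J (Suc k)"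
  shows "center \<subseteq> Zs"
proof
  fix z assume z: "z \<in> center"
  have "\<exists>z'\<in>Zs. z - z' \<in> J k" if "k \<le> Suc (min rk sk)" for k
    using that
  proof (induction k)
    case 0 then show ?case using Zs_zero J_0 by blast
  next
    case (Suc k)
    then obtain z' where z': "z' \<in> Zs" "z - z' \<in> J k" by auto
    have "z - z' \<in> center" using z Zs_center[OF z'(1)] unfolding center_def by (simp add: algebra_simps)
    moreover have "lv k" using Suc.prems by (simp add: lv_def)
    ultimately obtain z'' where z'': "z'' \<in> Zs" "z - z' - z'' \<in> J (Suc k)" using step z'(2) by blast
    then show ?case using Zs_add[OF z'(1)] by (metis diff_diff_eq)
  qed
  then obtain z' where z': "z' \<in> Zs" "z - z' \<in> J (Suc (min rk sk))" by blast
  have "z - z' = 0" by (rule J_top[OF z'(2)]) auto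
  then show "z \<in> Zs" using z'(1) by simp
qed

lemma generic_center:
  assumes regular: "\<And>x::wb. \<exists>a. x = x * a * x" and g: generic
  shows "center \<subseteq> Zs"
proof (rule center_subset_Zs)
  fix k z assume l: "lv k" and z: "z \<in> center" "z \<in> J k"
  obtain h where h: "\<And>k i. lv k \<Longrightarrow> i \<in> XX k \<Longrightarrow> pe h (KK (XX k) i) = 1"
    "\<And>k j. lv k \<Longrightarrow> j \<in> YY k \<Longrightarrow> pe h (- (sc dl + KK (YY k) j)) = 0"
    using separating_poly[OF g] by blast
  \<comment> \<open>\<open>h\<close> is 1 on the left elements and 0 on the right ones, so
    \<open>PS h\<close> counts the left vertical strands of level \<open>i\<close>.\<close>
  have PSh: "PS h * fk i - sc (of_nat (rk - i)) * fk i \<in> J (Suc i)" if "lv i" for i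
    using PS_fk[OF that, of h] h[OF that] by simp
  \<comment> \<open>One factor for each level below \<open>t\<close>, killing that level; reversing
    the list makes \<open>Q (Suc t)\<close> gain its new factor on the left.\<close>
  define Q where "Q t = prod_list (map (\<lambda>i. PS h - sc (of_nat (rk - i))) (rev [0..<t]))" for t
  have Q_Suc: "Q (Suc t) = (PS h - sc (of_nat (rk - t))) * Q t" for t by (simp add: Q_def)
  have QZ: "Q t \<in> Zs" for t
    unfolding Q_def by (rule Zs_prod_list) (intro Zs_diff PS_Zs Zs_sc)
  have QJ: "Q t \<in> J t" if "t \<le> k" for t
    using that
  proof (induction t)
    case 0 show ?case by (rule J_0)
  next
    case (Suc t)
    have lt: "lv t" using l Suc.prems by (simp add: lv_def)
    have f: "(PS h - sc (of_nat (rk - t))) * fk t \<in> J (Suc t)" using PSh[OF lt] by (simp only: left_diff_distrib)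
    have c: "PS h - sc (of_nat (rk - t)) \<in> center" by (intro Zs_center Zs_diff PS_Zs Zs_sc)
    have q: "Q t \<in> J t" using Suc by simp
    show ?case unfolding Q_Suc by (rule center_J[OF c f q])
  qed
  \<comment> \<open>The scalar by which \<open>Q t\<close> acts on level \<open>k\<close>; at
    \<open>t = k\<close> it is nonzero because the strand counts \<open>rk - i\<close>
    differ.\<close>
  define c where "c t = (\<Prod>i<t. of_nat (rk - k) - of_nat (rk - i) :: complex)" for t
  have Qf: "Q t * fk k - sc (c t) * fk k \<in> J (Suc k)" for t
  proof (induction t)
    case 0 then show ?case by (simp add: Q_def c_def)
  next
    case (Suc t)
    let ?y = "PS h - sc (of_nat (rk - t))"
    have c: "c (Suc t) = c t * (of_nat (rk - k) - of_nat (rk - t))" by (simp add: c_def)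
    have "Q (Suc t) * fk k - sc (c (Suc t)) * fk k = ?y * (Q t * fk k - sc (c t) * fk k) + sc (c t) * (PS h * fk k - sc (of_nat (rk - k)) * fk k)"
    proof -
      have "PS h * (sc (c t) * fk k) = sc (c t) * (PS h * fk k)" by (metis mult.assoc sc_comm)
      moreover have "sc (of_nat (rk - t)) * (sc (c t) * fk k) = sc (c t) * (sc (of_nat (rk - t)) * fk k)" by (metis mult.assoc sc_comm)
      ultimately show ?thesis unfolding Q_Suc c sc_times sc_simps left_diff_distrib right_diff_distrib mult.assoc by simp
    qed
    then show ?case using J_add[OF J_left[OF Suc.IH] J_left[OF PSh[OF l]]] by (simp only:)
  qed
  have c0: "c k \<noteq> 0"
  proof -
    have "of_nat (rk - k) \<noteq> (of_nat (rk - i) :: complex)" if "i < k" for i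
      using that l by (simp add: lv_def)
    then show ?thesis by (simp add: c_def)
  qed
  have R: "Rep k (pp B a)" if B: "blk k B" and a: "1 \<le> a" for B a
  proof -
    have "B = XX k \<or> B = YY k" using B by (simp add: blk_def)
    then show ?thesis
    proof
      assume B: "B = XX k"
      \<comment> \<open>The factor \<open>h\<close> removes the right power sum.\<close>
      have "Rep k ((\<Sum>i\<in>XX k. pe (h * [:0,1:] ^ a) (KK (XX k) i)) - (\<Sum>j\<in>YY k. pe (h * [:0,1:] ^ a) (- (sc dl + KK (YY k) j))))"
        by (rule Rep_PS[OF l])
      then show ?thesis unfolding B pp_def using h[OF l] by (simp add: pe_mult pe_power)
    next
      assume B: "B = YY k"
      \<comment> \<open>The factor \<open>1 - h\<close> removes the left power sum, and the linear
        polynomial turns -(\<delta> + y) back into y.\<close>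
      have "Rep k ((\<Sum>i\<in>XX k. pe ((1 - h) * [:-dl,-1:] ^ a) (KK (XX k) i)) - (\<Sum>j\<in>YY k. pe ((1 - h) * [:-dl,-1:] ^ a) (- (sc dl + KK (YY k) j))))"
        by (rule Rep_PS[OF l])
      then have "Rep k (- pp (YY k) a)" unfolding pp_def using h[OF l] by (simp add: pe_mult pe_power pe_diff)
      from Rep_scale[OF this, of "-1"] show ?thesis unfolding B by simp
    qed
  qed
  show "\<exists>z'\<in>Zs. z - z' \<in> J (Suc k)"
    by (rule level_step[OF regular l R QZ QJ c0 Qf z]) simp_all
qed

section \<open>The four exceptional algebras with \<delta> = 0\<close>

lemma pe_Zs: "y \<in> Zs \<Longrightarrow> pe p y \<in> Zs"
  by (induction p) (auto intro: Zs_zero Zs_add Zs_sc Zs_mult)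

lemma pp_single: assumes "1 \<le> a" "M \<le> m + 1" shows "pp {m+1..M} a = 0"
proof -
  have "KK {m+1..M} i ^ a = 0" if "i \<in> {m+1..M}" for i
  proof -
    have "{j\<in>{m+1..M}. j < i} = {}" using that assms by auto
    then have "KK {m+1..M} i = 0" unfolding KK_def by (simp only: sum.empty)
    then show ?thesis using assms by (simp add: power_0_left)
  qed
  then show ?thesis unfolding pp_def by (intro sum.neutral) blast
qed

lemma pp_pair: "pp {m+1..m+2} 1 = T (m+1) (m+2)"
proof -
  have s: "{m+1..m+2} = {m+1, m+2}" by auto
  have "{j\<in>{m+1..m+2}. j < m+1} = {}" "{j\<in>{m+1..m+2}. j < m+2} = {m+1}" by auto
  then have "KK {m+1..m+2} (m+1) = 0" "KK {m+1..m+2} (m+2) = T (m+1) (m+2)"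
    unfolding KK_def by (simp_all only: sum.empty) simp
  then show ?thesis unfolding pp_def power_one_right by (subst s) simp
qed

lemma pp_triple: "pp {m+1..m+3} 1 = T (m+1) (m+2) + T (m+1) (m+3) + T (m+2) (m+3)"
proof -
  have s: "{m+1..m+3} = {m+1, m+2, m+3}" by auto
  have e: "{j\<in>{m+1..m+3}. j < m+1} = {}" "{j\<in>{m+1..m+3}. j < m+2} = {m+1}" "{j\<in>{m+1..m+3}. j < m+3} = {m+1, m+2}" by auto
  have "KK {m+1..m+3} (m+1) = 0" "KK {m+1..m+3} (m+2) = T (m+1) (m+2)" "KK {m+1..m+3} (m+3) = T (m+1) (m+3) + T (m+2) (m+3)"
    unfolding KK_def e by simp_all
  then show ?thesis unfolding pp_def power_one_right by (subst s) (simp add: add.assoc)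
qed

text \<open>Read a, b and a b a as the three transpositions of three letters; their sum X satisfies
  X^3 = 9 X. The polynomial x^4 - 9 x^2 is taken because it is even, so that it has the scalar value
  -8 at a single transposition.\<close>

lemma triple_cube:
  fixes a b :: wb
  assumes "a * a = 1" "b * b = 1" "b * a * b = a * b * a"
  shows "pe [:0,0,-9,0,1:] (a + a * b * a + b) = 0"
proof -
  have 1: "a * (a * x) = x" "b * (b * x) = x" "b * (a * (b * x)) = a * (b * (a * x))" for x
    using assms by (metis mult.assoc mult_1_left)+
  have 3: "b * (a * b) = a * (b * a)" using assms(3) by (simp add: mult.assoc)
  define X where "X = a + a * b * a + b"
  have sq: "X * X = sc 3 + sc 3 * (a * b) + sc 3 * (b * a)"
  proof -
    have "sc 3 = sc (1 + 1 + 1)" by simp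
    then have s3: "sc 3 = 1 + 1 + 1" by (simp only: sc_simps)
    show ?thesis unfolding s3 X_def
      by (simp only: distrib_left distrib_right mult.assoc 1 3 assms(1,2) mult_1_left mult_1_right add.assoc add.commute add.left_commute)
  qed
  have ab: "X * (a * b) = X" "X * (b * a) = X"
    unfolding X_def by (simp_all only: distrib_left distrib_right mult.assoc 1 3 assms(1,2) mult_1_left mult_1_right add.assoc add.commute add.left_commute)
  have cu: "X * (X * X) = sc 9 * X"
  proof -
    have p: "X * (sc 3 * y) = sc 3 * (X * y)" for y by (metis mult.assoc sc_comm)
    have "X * (X * X) = sc 3 * X + sc 3 * X + sc 3 * X"
      unfolding sq distrib_left p ab sc_comm[of X 3] ..
    moreover have "sc 9 = sc 3 + sc 3 + sc 3" by (simp only: sc_simps(3)[symmetric]) simp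
    ultimately show ?thesis by (simp only: distrib_right)
  qed
  have "pe [:0,0,-9,0,1:] X = X * (X * (sc (-9) + X * X))" by simp
  also have "\<dots> = X * (X * sc (-9) + X * (X * X))" by (simp only: distrib_left)
  also have "\<dots> = X * (sc (-9) * X + sc 9 * X)" unfolding cu sc_comm[of X] ..
  also have "\<dots> = X * ((sc (-9) + sc 9) * X)" by (simp only: distrib_right)
  also have "sc (-9) + sc 9 = 0" by (simp only: sc_simps(3)[symmetric]) simp
  finally show ?thesis unfolding X_def by simp
qed

definition small :: bool where
  "small \<longleftrightarrow> dl = 0 \<and> (rk = 1 \<and> sk \<in> {2,3} \<or> sk = 1 \<and> rk \<in> {2,3})"

text \<open>At every level one block has at most one letter, so with \<delta> = 0 the plain power
  sums act as those of the other block up to sign. The factor required in \<open>J 1\<close> is a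
  polynomial in \<open>PS [:0,1:]\<close>, which acts on level \<open>k\<close> as the sum
  \<open>b k\<close> of all transpositions within the blocks.\<close>

lemma small_center:
  assumes regular: "\<And>x::wb. \<exists>a. x = x * a * x" and s: small
  shows "center \<subseteq> Zs"
proof (rule center_subset_Zs)
  fix k z assume l: "lv k" and z: "z \<in> center" "z \<in> J k"
  have dl: "dl = 0" using s by (simp add: small_def)
  have rep: "Rep k (pp (XX k) a - sc ((-1) ^ a) * pp (YY k) a)" for a
  proof -
    have "(\<Sum>j\<in>YY k. pe ([:0,1:] ^ a) (- (sc dl + KK (YY k) j))) = sc ((-1) ^ a) * pp (YY k) a"
      unfolding pp_def sum_distrib_left dl
    proof (intro sum.cong refl)
      fix j
      have "(- KK (YY k) j) ^ a = (-1) ^ a * KK (YY k) j ^ a" by (simp add: uminus_power_if)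
      moreover have "pe ([:0,1:] ^ a) (- (sc 0 + KK (YY k) j)) = (- KK (YY k) j) ^ a" by (simp add: pe_power)
      moreover have "sc ((-1) ^ a) = (-1) ^ a" by (simp add: sc_power)
      ultimately show "pe ([:0,1:] ^ a) (- (sc 0 + KK (YY k) j)) = sc ((-1) ^ a) * KK (YY k) j ^ a"
        by (simp only:)
    qed
    then show ?thesis using Rep_PS[OF l, of "[:0,1:] ^ a"] by (simp add: pe_power pp_def)
  qed
  have one: "(\<forall>a\<ge>1. pp (XX k) a = 0) \<or> (\<forall>a\<ge>1. pp (YY k) a = 0)"
    using s pp_single[of _ "rk-k" 0] pp_single[of _ nn "rk+k"] by (auto simp: small_def)
  have R: "Rep k (pp B a)" if B: "blk k B" and a: "1 \<le> a" for B a
  proof -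
    have c: "sc ((-1) ^ a) * (sc ((-1) ^ a) * x) = x" for x
      by (rule sc_cancel) (simp add: power_add[symmetric])
    have "Rep k (pp (XX k) a) \<and> Rep k (pp (YY k) a)"
      using one
    proof
      assume "\<forall>a\<ge>1. pp (XX k) a = 0"
      then have x: "pp (XX k) a = 0" using a by simp
      then have "Rep k (- (sc ((-1) ^ a) * pp (YY k) a))" using rep[of a] by simp
      from Rep_scale[OF this, of "- ((-1) ^ a)"] have "Rep k (pp (YY k) a)" using c by simp
      then show ?thesis using x Rep_zero by simp
    next
      assume "\<forall>a\<ge>1. pp (YY k) a = 0"
      then have "pp (YY k) a = 0" using a by simp
      then show ?thesis using rep[of a] Rep_zero by simp
    qed
    then show ?thesis using B by (auto simp: blk_def)
  qed
  define b where "b k = pp (XX k) 1 + pp (YY k) 1" for k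
  define y where "y = PS [:0,1:]"
  have yb: "y * fk k - b k * fk k \<in> J (Suc k)" if "lv k" for k
  proof -
    have "(\<Sum>i\<in>XX k. pe [:0,1:] (KK (XX k) i)) - (\<Sum>j\<in>YY k. pe [:0,1:] (- (sc dl + KK (YY k) j))) = b k"
      by (simp add: b_def pp_def dl sum_negf)
    then show ?thesis using PS_fk[OF that, of "[:0,1:]"] by (simp only: y_def)
  qed
  have bf: "b k * fk k = fk k * b k" if "lv k" for k
    unfolding b_def pp_def power_one_right
    using KK_fk_commute[OF that blk_XX] KK_fk_commute[OF that blk_YY]
    by (simp add: distrib_left distrib_right sum_distrib_left sum_distrib_right)
  have py: "pe p y * fk k - pe p (b k) * fk k \<in> J (Suc k)" if "lv k" for k p
    by (rule pe_cong_J[OF yb[OF that] bf[OF that]])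
  \<comment> \<open>\<open>p\<close> has to vanish at level 0 and be a nonzero scalar at level 1.
    The choice x^2 - 1 serves blocks of two letters, where level 1 has no transposition, and x^4 - 9
    x^2 serves blocks of three, where level 1 has exactly one.\<close>
  have ex: "\<exists>p c. pe p (b 0) = 0 \<and> pe p (b 1) = sc c \<and> c \<noteq> 0"
  proof -
    have t2: "pe [:-1,0,1:] (T i j) = 0" "pe [:0,0,-9,0,1:] (T i j) = sc (-8)" if "same_side i j" for i j
    proof -
      note t = T_square[OF that]
      show "pe [:-1,0,1:] (T i j) = 0" using t by simp
      have "pe [:0,0,-9,0,1:] (T i j) = T i j * (T i j * (sc (-9) + T i j * T i j))" by simp
      also have "\<dots> = (T i j * T i j) * (sc (-9) + T i j * T i j)" by (simp only: mult.assoc)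
      also have "\<dots> = sc (-9) + sc 1" unfolding t by simp
      also have "\<dots> = sc (-8)" by (simp only: sc_simps(3)[symmetric]) simp
      finally show "pe [:0,0,-9,0,1:] (T i j) = sc (-8)" .
    qed
    have t3: "pe [:0,0,-9,0,1:] (T (m+1) (m+2) + T (m+1) (m+3) + T (m+2) (m+3)) = 0"
      if ss: "same_side (m+1) (m+2)" "same_side (m+2) (m+3)" "same_side (m+1) (m+3)" for m
    proof -
      have 1: "T (m+1) (m+2) * T (m+2) (m+3) = T (m+1) (m+3) * T (m+1) (m+2)"
        using P_T[OF wp_transpose[OF ss(1)] ss(2)] by (simp add: transpose_def)
      have 2: "T (m+2) (m+3) * T (m+1) (m+2) = T (m+1) (m+3) * T (m+2) (m+3)"
        using P_T[OF wp_transpose[OF ss(2)] ss(1)] by (simp add: transpose_def)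
      have a: "T (m+1) (m+2) * T (m+2) (m+3) * T (m+1) (m+2) = T (m+1) (m+3)"
        unfolding 1 using T_square[OF ss(1)] by (simp add: mult.assoc)
      have b: "T (m+2) (m+3) * T (m+1) (m+2) * T (m+2) (m+3) = T (m+1) (m+3)"
        unfolding 2 using T_square[OF ss(2)] by (simp add: mult.assoc)
      show ?thesis
        using triple_cube[OF T_square[OF ss(1)] T_square[OF ss(2)]] a b by simp
    qed
    consider "rk = 1" "sk = 2" | "rk = 1" "sk = 3" | "sk = 1" "rk = 2" | "sk = 1" "rk = 3"
      using s by (auto simp: small_def)
    then show ?thesis
    proof cases
      case 1
      have b: "b 0 = T (1+1) (1+2)" "b 1 = 0"
        using pp_pair[of 1] pp_single[of 1 1 0] pp_single[of 1 0 0] pp_single[of 1 3 2] by (simp_all add: b_def 1 numeral_eq_Suc)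
      have s: "same_side (1+1) (1+2)" using 1 by (simp add: same_side_def)
      have "pe [:-1,0,1:] (b 0) = 0" unfolding b by (rule t2(1)[OF s])
      moreover have "pe [:-1,0,1:] (b 1) = sc (-1)" unfolding b by simp
      moreover have "(-1::complex) \<noteq> 0" by simp
      ultimately show ?thesis by blast
    next
      case 2
      have b: "b 0 = T (1+1) (1+2) + T (1+1) (1+3) + T (1+2) (1+3)" "b 1 = T (2+1) (2+2)"
        using pp_triple[of 1] pp_pair[of 2] pp_single[of 1 1 0] pp_single[of 1 0 0] by (simp_all add: b_def 2 numeral_eq_Suc)
      have s: "same_side (1+1) (1+2)" "same_side (1+2) (1+3)" "same_side (1+1) (1+3)" "same_side (2+1) (2+2)"
        using 2 by (simp_all add: same_side_def)
      have "pe [:0,0,-9,0,1:] (b 0) = 0" unfolding b by (rule t3[OF s(1-3)])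
      moreover have "pe [:0,0,-9,0,1:] (b 1) = sc (-8)" unfolding b by (rule t2(2)[OF s(4)])
      moreover have "(-8::complex) \<noteq> 0" by simp
      ultimately show ?thesis by blast
    next
      case 3
      have b: "b 0 = T (0+1) (0+2)" "b 1 = 0"
        using pp_pair[of 0] pp_single[of 1 3 2] pp_single[of 1 1 0] pp_single[of 1 3 3] by (simp_all add: b_def 3 numeral_eq_Suc)
      have s: "same_side (0+1) (0+2)" using 3 by (simp add: same_side_def)
      have "pe [:-1,0,1:] (b 0) = 0" unfolding b by (rule t2(1)[OF s])
      moreover have "pe [:-1,0,1:] (b 1) = sc (-1)" unfolding b by simp
      moreover have "(-1::complex) \<noteq> 0" by simp
      ultimately show ?thesis by blast
    next
      case 4
      have b: "b 0 = T (0+1) (0+2) + T (0+1) (0+3) + T (0+2) (0+3)" "b 1 = T (0+1) (0+2)"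
        using pp_triple[of 0] pp_pair[of 0] pp_single[of 1 4 3] pp_single[of 1 4 4] by (simp_all add: b_def 4 numeral_eq_Suc)
      have s: "same_side (0+1) (0+2)" "same_side (0+2) (0+3)" "same_side (0+1) (0+3)"
        using 4 by (simp_all add: same_side_def)
      have "pe [:0,0,-9,0,1:] (b 0) = 0" unfolding b by (rule t3[OF s])
      moreover have "pe [:0,0,-9,0,1:] (b 1) = sc (-8)" unfolding b by (rule t2(2)[OF s(1)])
      moreover have "(-8::complex) \<noteq> 0" by simp
      ultimately show ?thesis by blast
    qed
  qed
  then obtain p c where p: "pe p (b 0) = 0" "pe p (b 1) = sc c" "c \<noteq> 0" by blast
  have "k = 0 \<or> k = 1" using l s by (auto simp: lv_def small_def)
  then show "\<exists>z'\<in>Zs. z - z' \<in> J (Suc k)"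
  proof
    assume "k = 0"
    then show ?thesis using level_step[OF regular l R Zs_one, of 1] J_0 z by simp
  next
    assume k: "k = 1"
    have l0: "lv 0" by (simp add: lv_def)
    have "pe p y \<in> J (Suc 0)" using py[OF l0, of p] p(1) by (simp add: fk_0)
    moreover have "pe p y * fk k - sc c * fk k \<in> J (Suc k)" using py[OF l, of p] p(2) k by simp
    ultimately show ?thesis
      using level_step[OF regular l R pe_Zs[OF PS_Zs], of p "[:0,1:]" c] p(3) z k by (simp add: y_def)
  qed
qed

section \<open>The remaining parameters are not semisimple\<close>

lemma E_bot_arc:
  assumes "arc i j" "coef (E i j * y) d \<noteq> 0"
  shows "d \<in> W" "d (False, i) = (False, j)"
proof -
  show "d \<in> W" using assms(2) coef_outside by blast
  obtain d1 d2 where d: "d1 \<in> W" "d2 \<in> W" "coef (E i j) d1 \<noteq> 0" "compose nn d2 d1 = d"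
    using assms(2) by (rule coef_mult_nonzero)
  then have "d1 = e_diag nn i j" using e_diag_W[OF assms(1)] by (auto simp: E_def coef_D split: if_splits)
  then have "d = surgery d2 (False, i) (False, j)"
    using compose_e_diag(1)[of rk sk d2 i j] d assms(1) by (simp add: W_iff arc_def)
  then show "d (False, i) = (False, j)" by (simp add: surgery_def)
qed

lemma two_arcs:
  assumes d: "d \<in> W" and i: "arc i j" "d (False, i) = (False, j)" and i': "arc i' j'" "d (False, i') = (False, j')" and ne: "i \<noteq> i'"
  shows "2 \<le> ar d"
proof -
  have "ar d = card {i\<in>{1..rk}. \<not> fst (d (False, i))}"
    using ar_flip[OF d] by (simp add: ar_def flip_diag_def)
  moreover have "card {i, i'} \<le> card {i\<in>{1..rk}. \<not> fst (d (False, i))}"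
    using i i' by (intro card_mono) (auto simp: arc_def)
  ultimately show ?thesis using ne by simp
qed

text \<open>Every diagram with a horizontal strand can be written with an arc as rightmost factor,
  so all of \<open>J 1\<close> multiplies \<open>x\<close> into \<open>J t\<close>; now x = (x a) x
  with x a in \<open>J 1\<close>.\<close>

lemma regular_in_J:
  assumes regular: "\<And>x::wb. \<exists>a. x = x * a * x" and x: "x \<in> J 1" and E: "\<And>i j. arc i j \<Longrightarrow> E i j * x \<in> J t"
  shows "x \<in> J t"
proof -
  have D: "D d * x \<in> J t" if d: "d \<in> W" "1 \<le> ar d" for d
  proof -
    obtain k where k: "ar d = Suc k" using d(2) by (metis Suc_le_D One_nat_def)
    have l: "lv (Suc k)" using ar_le[OF d(1)] k by (simp add: lv_def)
    have lk: "lv k" using l by (simp add: lv_def)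
    let ?i = "rk - k" and ?j = "rk + k + 1"
    have a: "arc ?i ?j" using l by (auto simp: arc_def lv_def)
    \<comment> \<open>Reflecting \<open>fk_Suc\<close> brings the arc to the right end.\<close>
    have "fl (fk (Suc k)) = fl (E ?i ?j * fk k)" unfolding fk_Suc[OF l] ..
    then have f: "fk (Suc k) = fk k * E ?i ?j" by (simp only: fl_mult fl_fk[OF l] fl_fk[OF lk] fl_E[OF a])
    obtain \<sigma> \<tau> where s: "wp \<tau>" "D d = P \<sigma> * fk (Suc k) * P \<tau>" using diag_factor[OF d(1)] k by auto
    let ?i' = "inv \<tau> ?i" and ?j' = "inv \<tau> ?j"
    have wi: "wp (inv \<tau>)" by (rule wall_perm_inv[OF s(1)])
    have a': "arc ?i' ?j'"
      using a wall_perm_mem[OF wi, of ?i] wall_perm_mem[OF wi, of ?j] wall_perm_le[OF wi, of ?i] wall_perm_le[OF wi, of ?j]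
      by (auto simp: arc_def)
    have "P \<tau> * E ?i' ?j' = E ?i ?j * P \<tau>"
      using P_E[OF s(1) a'] by (simp only: wall_perm_inv_apply(2)[OF s(1)])
    then have "D d * x = P \<sigma> * fk k * P \<tau> * (E ?i' ?j' * x)"
      unfolding s(2) f by (simp only: mult.assoc) (simp only: mult.assoc[symmetric])
    then show ?thesis using J_left[OF E[OF a']] by simp
  qed
  have JD: "y * x \<in> J t" if y: "y \<in> J 1" for y
  proof -
    have "sc (coef y d) * D d * x \<in> J t" if "d \<in> W" for d
    proof (cases "coef y d = 0")
      case False
      then have "1 \<le> ar d" using y by (simp add: J_def)
      then have "sc (coef y d) * (D d * x) \<in> J t" using D[OF that] J_left by blast
      then show ?thesis by (simp only: mult.assoc)
    qed simp
    then have "(\<Sum>d\<in>W. sc (coef y d) * D d * x) \<in> J t" by (rule J_sum)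
    then have "(\<Sum>d\<in>W. sc (coef y d) * D d) * x \<in> J t" by (simp only: sum_distrib_right)
    then show ?thesis using wb_expand[of y] by simp
  qed
  obtain a where a: "x = x * a * x" using regular by blast
  have "x * a * x \<in> J t" by (rule JD[OF J_right[OF x]])
  then show ?thesis using a by simp
qed

text \<open>The coefficient 1 at the identity survives the constructions below and finally appears
  as a nonzero coefficient of a diagram with a single arc.\<close>

definition unital :: "nat set \<Rightarrow> wb \<Rightarrow> bool" where
  "unital B v \<longleftrightarrow> (\<exists>w. w id = 1 \<and> v = (\<Sum>\<sigma> | \<sigma> permutes B. sc (w \<sigma>) * P \<sigma>))"

lemma unital_I:
  fixes I :: "'a set"
  assumes I: "finite I" "z \<in> I" and v: "v = (\<Sum>i\<in>I. sc (c i) * P (\<tau> i))" and c: "c z = 1" "\<tau> z = id"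
    and t: "\<And>i. i \<in> I \<Longrightarrow> \<tau> i permutes B" "\<And>i. i \<in> I \<Longrightarrow> \<tau> i = id \<Longrightarrow> i = z" and B: "finite B"
  shows "unital B v"
proof -
  define w where "w \<sigma> = (\<Sum>i\<in>{i\<in>I. \<tau> i = \<sigma>}. c i)" for \<sigma>
  have fin: "finite {\<sigma>. \<sigma> permutes B}" using B by (rule finite_permutations)
  have "\<tau> ` I \<subseteq> {\<sigma>. \<sigma> permutes B}" using t(1) by blast
  then have "v = (\<Sum>\<sigma> | \<sigma> permutes B. \<Sum>i\<in>{i\<in>I. \<tau> i = \<sigma>}. sc (c i) * P (\<tau> i))"
    unfolding v by (rule sum.group[OF I(1) fin, symmetric])
  also have "\<dots> = (\<Sum>\<sigma> | \<sigma> permutes B. sc (w \<sigma>) * P \<sigma>)"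
    by (intro sum.cong refl) (simp add: w_def sc_sum sum_distrib_right)
  finally have v': "v = (\<Sum>\<sigma> | \<sigma> permutes B. sc (w \<sigma>) * P \<sigma>)" .
  have "{i\<in>I. \<tau> i = id} = {z}" using I(2) c(2) t(2) by blast
  then have "w id = 1" unfolding w_def using c(1) by simp
  then show ?thesis unfolding unital_def using v' by blast
qed

text \<open>A point outside \<open>A\<close> is fixed by \<open>\<tau>\<close>, so
  \<open>\<tau>\<close> moves at most the common point, and a permutation cannot move just one
  point.\<close>

lemma perm_trivial_intersection:
  assumes "\<sigma> permutes A" "\<tau> permutes B" "A \<inter> B = {} \<or> (\<exists>a. A \<inter> B = {a})" "\<sigma> \<circ> \<tau> = id"
  shows "\<sigma> = id" "\<tau> = id"
proof -
  have x: "\<sigma> (\<tau> x) = x" for x using assms(4) by (metis comp_apply id_apply)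
  have fix_out: "\<tau> x = x" if "x \<notin> A" for x
  proof -
    have "\<tau> x \<notin> A" using x[of x] permutes_in_image[OF assms(1), of "\<tau> x"] that by simp
    then show ?thesis using x[of x] permutes_not_in[OF assms(1)] by metis
  qed
  have "\<tau> x = x" for x
  proof (cases "x \<in> A \<inter> B")
    case False then show ?thesis using fix_out permutes_not_in[OF assms(2)] by blast
  next
    case True
    then have AB: "A \<inter> B = {x}" using assms(3) by (metis empty_iff singletonD)
    show ?thesis
    proof (rule ccontr)
      assume n: "\<tau> x \<noteq> x"
      have "\<tau> x \<in> B" using permutes_in_image[OF assms(2)] True by blast
      then have "\<tau> x \<notin> A" using AB n by blast
      then have "\<tau> (\<tau> x) = \<tau> x" by (rule fix_out)
      then show False using n permutes_inj[OF assms(2)] by (metis inj_eq)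
    qed
  qed
  then show t: "\<tau> = id" by (simp add: fun_eq_iff)
  show "\<sigma> = id" using assms(4) unfolding t by simp
qed

lemma scaled_P_mult:
  assumes "wp \<sigma>" "wp \<tau>"
  shows "sc a * P \<sigma> * (sc b * P \<tau>) = sc (a * b) * P (\<sigma> \<circ> \<tau>)"
proof -
  have "P \<sigma> * (sc b * P \<tau>) = sc b * (P \<sigma> * P \<tau>)" by (metis mult.assoc sc_comm)
  then show ?thesis using P_mult[OF assms] by (simp only: sc_times mult.assoc)
qed

text \<open>The identity arises only as the product of the two identities, so its coefficient stays
  1.\<close>

lemma unital_mult:
  assumes u: "unital A u" and v: "unital B v" and AB: "A \<inter> B = {} \<or> (\<exists>a. A \<inter> B = {a})"
    and C: "A \<subseteq> C" "B \<subseteq> C" "finite C" and w: "\<And>\<sigma>. \<sigma> permutes C \<Longrightarrow> wp \<sigma>"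
  shows "unital C (u * v)"
proof -
  obtain c where c: "c id = 1" "u = (\<Sum>\<sigma> | \<sigma> permutes A. sc (c \<sigma>) * P \<sigma>)" using u unfolding unital_def by blast
  obtain c' where c': "c' id = 1" "v = (\<Sum>\<sigma> | \<sigma> permutes B. sc (c' \<sigma>) * P \<sigma>)" using v unfolding unital_def by blast
  have fin: "finite A" "finite B" using C finite_subset by blast+
  have pC: "\<sigma> permutes C" "\<tau> permutes C" if "\<sigma> permutes A" "\<tau> permutes B" for \<sigma> \<tau>
    using permutes_subset[OF that(1) C(1)] permutes_subset[OF that(2) C(2)] .
  let ?I = "{\<sigma>. \<sigma> permutes A} \<times> {\<sigma>. \<sigma> permutes B}"
  show ?thesis
  proof (rule unital_I[where I="?I" and z="(id, id)" and c="\<lambda>(\<sigma>, \<tau>). c \<sigma> * c' \<tau>" and \<tau>="\<lambda>(\<sigma>, \<tau>). \<sigma> \<circ> \<tau>"])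
    have "sc (c \<sigma>) * P \<sigma> * (sc (c' \<tau>) * P \<tau>) = sc (c \<sigma> * c' \<tau>) * P (\<sigma> \<circ> \<tau>)" if "\<sigma> permutes A" "\<tau> permutes B" for \<sigma> \<tau>
      using pC[OF that] w by (intro scaled_P_mult) simp_all
    then show "u * v = (\<Sum>p\<in>?I. sc (case p of (\<sigma>, \<tau>) \<Rightarrow> c \<sigma> * c' \<tau>) * P (case p of (\<sigma>, \<tau>) \<Rightarrow> \<sigma> \<circ> \<tau>))"
      unfolding c(2) c'(2) sum_product by (simp add: sum.cartesian_product split_def)
    show "(case p of (\<sigma>, \<tau>) \<Rightarrow> \<sigma> \<circ> \<tau>) permutes C" if "p \<in> ?I" for p
    proof -
      obtain \<sigma> \<tau> where p: "p = (\<sigma>, \<tau>)" by (cases p)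
      then have s: "\<sigma> permutes A" "\<tau> permutes B" using that by auto
      show ?thesis unfolding p prod.case by (rule permutes_compose[OF pC(2)[OF s] pC(1)[OF s]])
    qed
    show "p = (id, id)" if p: "p \<in> ?I" "(case p of (\<sigma>, \<tau>) \<Rightarrow> \<sigma> \<circ> \<tau>) = id" for p
    proof -
      obtain \<sigma> \<tau> where q: "p = (\<sigma>, \<tau>)" by (cases p)
      then have "\<sigma> permutes A" "\<tau> permutes B" "\<sigma> \<circ> \<tau> = id" using p by auto
      then have "\<sigma> = id" "\<tau> = id" using perm_trivial_intersection[OF _ _ AB] by blast+
      then show ?thesis unfolding q by simp
    qed
    show "finite ?I" using fin finite_permutations by blast
    show "(id, id) \<in> ?I" by (simp add: permutes_id)
  qed (use c c' C in auto)
qed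

lemma unital_fl:
  assumes u: "unital B u" and B: "finite B" and w: "\<And>\<sigma>. \<sigma> permutes B \<Longrightarrow> wp \<sigma>"
  shows "unital B (fl u)"
proof -
  obtain c where c: "c id = 1" "u = (\<Sum>\<sigma> | \<sigma> permutes B. sc (c \<sigma>) * P \<sigma>)" using u unfolding unital_def by blast
  show ?thesis
  proof (rule unital_I[where I="{\<sigma>. \<sigma> permutes B}" and z=id and c=c and \<tau>=inv])
    show "fl u = (\<Sum>\<sigma> | \<sigma> permutes B. sc (c \<sigma>) * P (inv \<sigma>))"
      unfolding c(2) fl_sum using fl_P[OF w] by (intro sum.cong refl) (simp add: fl_sc_mult)
    show "inv \<sigma> permutes B" if "\<sigma> \<in> {\<sigma>. \<sigma> permutes B}" for \<sigma> using permutes_inv that by blast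
    show "\<sigma> = id" if "\<sigma> \<in> {\<sigma>. \<sigma> permutes B}" "inv \<sigma> = id" for \<sigma>
    proof -
      have "inv (inv \<sigma>) = \<sigma>" using permutes_inv_inv that(1) by blast
      then show ?thesis using that(2) by simp
    qed
    show "inv id = (id :: nat \<Rightarrow> nat)" by simp
    show "id \<in> {\<sigma>. \<sigma> permutes B}" by (simp add: permutes_id)
  qed (use c B in \<open>auto simp: finite_permutations\<close>)
qed

text \<open>\<open>EE\<close>, the sum of all arcs, commutes with permutations, and on the arc from
  \<open>rk\<close> to \<open>nn\<close> it acts modulo \<open>J 2\<close> as the last factor in
  \<open>e\<close>. So \<open>EE\<close> sends \<open>x\<close> into \<open>J 2\<close>, although
  \<open>x\<close> has coefficient 1 at that single arc.\<close>

lemma eigen_contradiction: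
  assumes regular: "\<And>x::wb. \<exists>a. x = x * a * x" and rs: "1 \<le> rk" "1 \<le> sk"
    and u: "unital A u1" "A = {1..rk}" "unital B u2" "B = {rk+1..nn}"
    and e: "u1 * u2 * (sc dl + L rk + KK (YY 0) nn) = 0"
  shows False
proof -
  define u where "u = u1 * u2"
  let ?e = "E rk nn"
  have a: "arc rk nn" using rs by (simp add: arc_def)
  define EE where "EE = (\<Sum>i\<in>{1..rk}. \<Sum>j\<in>{rk+1..nn}. E i j)"
  have arcs: "arc i j" if "i \<in> {1..rk}" "j \<in> {rk+1..nn}" for i j using that by (simp add: arc_def)
  have EP: "EE * P \<sigma> = P \<sigma> * EE" if \<sigma>: "wp \<sigma>" for \<sigma>
  proof -
    have p1: "bij_betw \<sigma> {1..rk} {1..rk}" and p2: "bij_betw \<sigma> {rk+1..nn} {rk+1..nn}"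
    proof -
      have inj: "inj_on \<sigma> S" for S using \<sigma> wall_perm_bij by (meson bij_is_inj inj_on_subset subset_UNIV)
      have "\<sigma> ` {1..rk} \<subseteq> {1..rk}" "\<sigma> ` {rk+1..nn} \<subseteq> {rk+1..nn}"
      proof -
        show "\<sigma> ` {1..rk} \<subseteq> {1..rk}"
        proof
          fix y assume "y \<in> \<sigma> ` {1..rk}"
          then obtain i where "y = \<sigma> i" "1 \<le> i" "i \<le> rk" by auto
          then show "y \<in> {1..rk}" using wall_perm_mem[OF \<sigma>, of i] wall_perm_le[OF \<sigma>, of i] by simp
        qed
        show "\<sigma> ` {rk+1..nn} \<subseteq> {rk+1..nn}"
        proof
          fix y assume "y \<in> \<sigma> ` {rk+1..nn}"
          then obtain i where "y = \<sigma> i" "rk + 1 \<le> i" "i \<le> nn" by auto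
          then show "y \<in> {rk+1..nn}" using wall_perm_mem[OF \<sigma>, of i] wall_perm_le[OF \<sigma>, of i] by simp
        qed
      qed
      then show "bij_betw \<sigma> {1..rk} {1..rk}" "bij_betw \<sigma> {rk+1..nn} {rk+1..nn}"
        unfolding bij_betw_def using inj by (simp_all add: endo_inj_surj)
    qed
    have "P \<sigma> * EE = (\<Sum>i\<in>{1..rk}. \<Sum>j\<in>{rk+1..nn}. E (\<sigma> i) (\<sigma> j) * P \<sigma>)"
      unfolding EE_def sum_distrib_left using P_E[OF \<sigma> arcs] by (intro sum.cong refl)
    also have "\<dots> = (\<Sum>i\<in>{1..rk}. \<Sum>j\<in>{rk+1..nn}. E (\<sigma> i) j * P \<sigma>)"
      by (intro sum.cong refl sum.reindex_bij_betw[OF p2])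
    also have "\<dots> = (\<Sum>i\<in>{1..rk}. \<Sum>j\<in>{rk+1..nn}. E i j * P \<sigma>)"
      by (rule sum.reindex_bij_betw[OF p1, of "\<lambda>i. \<Sum>j\<in>{rk+1..nn}. E i j * P \<sigma>"])
    finally show ?thesis by (simp add: EE_def sum_distrib_right)
  qed
  obtain w1 where w1: "w1 id = 1" "u1 = (\<Sum>\<sigma> | \<sigma> permutes A. sc (w1 \<sigma>) * P \<sigma>)" using u(1) unfolding unital_def by blast
  obtain w2 where w2: "w2 id = 1" "u2 = (\<Sum>\<sigma> | \<sigma> permutes B. sc (w2 \<sigma>) * P \<sigma>)" using u(3) unfolding unital_def by blast
  define I where "I = {\<sigma>. \<sigma> permutes A} \<times> {\<sigma>. \<sigma> permutes B}"
  define c where "c p = w1 (fst p) * w2 (snd p)" for p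
  define \<tau> where "\<tau> p = fst p \<circ> snd p" for p :: "(nat \<Rightarrow> nat) \<times> (nat \<Rightarrow> nat)"
  define i0 where "i0 = (id :: nat \<Rightarrow> nat, id :: nat \<Rightarrow> nat)"
  have wAB: "wp \<sigma>" "wp \<rho>" if "\<sigma> permutes A" "\<rho> permutes B" for \<sigma> \<rho>
    using that wp_left wp_right unfolding u(2,4) by blast+
  have I1: "finite I" unfolding I_def u(2,4) by (simp add: finite_permutations)
  have I2: "i0 \<in> I" by (simp add: I_def i0_def permutes_id)
  have I3: "u = (\<Sum>p\<in>I. sc (c p) * P (\<tau> p))"
    unfolding u_def w1(2) w2(2) sum_product I_def sum.cartesian_product
  proof (rule sum.cong[OF refl])
    fix p assume "p \<in> {\<sigma>. \<sigma> permutes A} \<times> {\<sigma>. \<sigma> permutes B}"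
    then have "wp (fst p)" "wp (snd p)" using wAB by auto
    then show "(case p of (i, j) \<Rightarrow> sc (w1 i) * P i * (sc (w2 j) * P j)) = sc (c p) * P (\<tau> p)"
      unfolding c_def \<tau>_def split_def by (rule scaled_P_mult)
  qed
  have I4: "c i0 = 1" "\<tau> i0 = id" by (simp_all add: c_def \<tau>_def i0_def w1(1) w2(1))
  have I6: "wp (\<tau> p)" if "p \<in> I" for p
    using that wAB wall_perm_comp unfolding I_def \<tau>_def by auto
  have I7: "p = i0" if p: "p \<in> I" "\<tau> p = id" for p
  proof -
    have AB: "A \<inter> B = {} \<or> (\<exists>a. A \<inter> B = {a})" using u(2,4) by auto
    have "fst p permutes A" "snd p permutes B" using p(1) by (auto simp: I_def)
    from perm_trivial_intersection[OF this AB p(2)[unfolded \<tau>_def]] show ?thesis by (simp add: i0_def prod_eq_iff)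
  qed
  note I = I1 I2 I3 I4 I6 I7
  have EEu: "EE * u = u * EE"
    unfolding I(3) sum_distrib_left sum_distrib_right
  proof (intro sum.cong refl)
    fix i assume "i \<in> I"
    then show "EE * (sc (c i) * P (\<tau> i)) = sc (c i) * P (\<tau> i) * EE" using EP[OF I(6)] by (metis mult.assoc sc_comm)
  qed
  \<comment> \<open>Arcs disjoint from \<open>?e\<close> create a second horizontal strand, those
    sharing one vertex become transpositions, and \<open>?e\<close> itself gives \<delta>.\<close>
  have EEe: "EE * ?e - (sc dl + L rk + KK (YY 0) nn) * ?e \<in> J 2"
  proof -
    have 1: "E i j * ?e \<in> J 2" if "i \<in> {1..<rk}" "j \<in> {rk+1..<nn}" for i j
      unfolding J_def
    proof (intro CollectI allI impI)
      fix d assume d: "coef (E i j * ?e) d \<noteq> 0"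
      have aij: "arc i j" using that by (simp add: arc_def)
      have "E i j * ?e = ?e * E i j" using that by (intro E_E_disjoint[OF aij a]) auto
      then have d': "coef (?e * E i j) d \<noteq> 0" using d by simp
      show "2 \<le> ar d" using two_arcs[OF E_bot_arc(1)[OF aij d] aij E_bot_arc(2)[OF aij d] a E_bot_arc(2)[OF a d']] that by simp
    qed
    have s: "{1..rk} = insert rk {1..<rk}" "{rk+1..nn} = insert nn {rk+1..<nn}" using rs by auto
    have y: "{j\<in>YY 0. j < nn} = {rk+1..<nn}" by auto
    have r1: "(\<Sum>j\<in>{rk+1..nn}. E rk j * ?e) = sc dl * ?e + KK (YY 0) nn * ?e"
    proof -
      have t: "E rk j * ?e = T j nn * ?e" if "j \<in> {rk+1..<nn}" for j
        using that rs by (intro E_E_left a) (auto simp: arc_def)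
      have "(\<Sum>j\<in>{rk+1..nn}. E rk j * ?e) = ?e * ?e + (\<Sum>j\<in>{rk+1..<nn}. E rk j * ?e)"
        unfolding s(2) by (rule sum.insert) auto
      also have "(\<Sum>j\<in>{rk+1..<nn}. E rk j * ?e) = (\<Sum>j\<in>{rk+1..<nn}. T j nn * ?e)" by (rule sum.cong[OF refl t])
      finally show ?thesis unfolding KK_def y E_square[OF a] by (simp only: sum_distrib_right)
    qed
    have r2: "(\<Sum>j\<in>{rk+1..nn}. E i j * ?e) = T i rk * ?e + (\<Sum>j\<in>{rk+1..<nn}. E i j * ?e)" if "i \<in> {1..<rk}" for i
    proof -
      have "E i nn * ?e = T i rk * ?e" using that a by (intro E_E_right a) (auto simp: arc_def)
      moreover have "(\<Sum>j\<in>{rk+1..nn}. E i j * ?e) = E i nn * ?e + (\<Sum>j\<in>{rk+1..<nn}. E i j * ?e)"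
        unfolding s(2) by (rule sum.insert) auto
      ultimately show ?thesis by (simp only:)
    qed
    have "EE * ?e = (\<Sum>i\<in>{1..rk}. \<Sum>j\<in>{rk+1..nn}. E i j * ?e)" by (simp add: EE_def sum_distrib_right)
    also have "\<dots> = (\<Sum>j\<in>{rk+1..nn}. E rk j * ?e) + (\<Sum>i\<in>{1..<rk}. \<Sum>j\<in>{rk+1..nn}. E i j * ?e)"
      by (subst s(1)) simp
    also have "(\<Sum>i\<in>{1..<rk}. \<Sum>j\<in>{rk+1..nn}. E i j * ?e) = L rk * ?e + (\<Sum>i\<in>{1..<rk}. \<Sum>j\<in>{rk+1..<nn}. E i j * ?e)"
    proof -
      have "(\<Sum>i\<in>{1..<rk}. \<Sum>j\<in>{rk+1..nn}. E i j * ?e) = (\<Sum>i\<in>{1..<rk}. T i rk * ?e + (\<Sum>j\<in>{rk+1..<nn}. E i j * ?e))"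
        by (rule sum.cong[OF refl r2])
      then show ?thesis by (simp add: sum.distrib L_def sum_distrib_right)
    qed
    finally have "EE * ?e - (sc dl + L rk + KK (YY 0) nn) * ?e = (\<Sum>i\<in>{1..<rk}. \<Sum>j\<in>{rk+1..<nn}. E i j * ?e)"
      unfolding r1 by (simp add: distrib_right)
    then show ?thesis using 1 by (simp only:) (intro J_sum)
  qed
  define x where "x = u * ?e"
  have EEx: "EE * x \<in> J 2"
  proof -
    have "EE * x = u * (EE * ?e - (sc dl + L rk + KK (YY 0) nn) * ?e)"
      unfolding x_def right_diff_distrib mult.assoc[symmetric] EEu using e by (simp add: u_def)
    then show ?thesis using J_left[OF EEe] by simp
  qed
  \<comment> \<open>Different arcs cannot cancel here: a diagram with fewer than two arcs has a
    unique bottom arc, which reveals the \<open>E i j\<close> that produced it.\<close>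
  have Ex: "E i j * x \<in> J 2" if aij: "arc i j" for i j
    unfolding J_def
  proof (intro CollectI allI impI, rule ccontr)
    fix d assume d: "coef (E i j * x) d \<noteq> 0" and n: "\<not> 2 \<le> ar d"
    have ij: "i \<in> {1..rk}" "j \<in> {rk+1..nn}" using aij by (auto simp: arc_def)
    have z: "coef (E i' j' * x) d = 0" if ij': "i' \<in> {1..rk}" "j' \<in> {rk+1..nn}" "(i', j') \<noteq> (i, j)" for i' j'
    proof (rule ccontr)
      assume d': "coef (E i' j' * x) d \<noteq> 0"
      note b = E_bot_arc[OF aij d] and b' = E_bot_arc[OF arcs[OF ij'(1,2)] d']
      have "i \<noteq> i'" using b(2) b'(2) ij'(3) by auto
      then show False using two_arcs[OF b(1) aij b(2) arcs[OF ij'(1,2)] b'(2)] n by simp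
    qed
    have "coef (EE * x) d = (\<Sum>i'\<in>{1..rk}. \<Sum>j'\<in>{rk+1..nn}. coef (E i' j' * x) d)"
      by (simp add: EE_def sum_distrib_right)
    also have "\<dots> = (\<Sum>p\<in>{1..rk} \<times> {rk+1..nn}. coef (E (fst p) (snd p) * x) d)"
      by (simp add: sum.cartesian_product split_def)
    also have "\<dots> = (\<Sum>p\<in>{(i, j)}. coef (E (fst p) (snd p) * x) d)"
    proof (rule sum.mono_neutral_right)
      show "\<forall>p\<in>{1..rk} \<times> {rk+1..nn} - {(i, j)}. coef (E (fst p) (snd p) * x) d = 0"
      proof
        fix p assume "p \<in> {1..rk} \<times> {rk+1..nn} - {(i, j)}"
        then show "coef (E (fst p) (snd p) * x) d = 0" by (intro z) auto
      qed
    qed (use ij in auto)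
    finally have "coef (EE * x) d \<noteq> 0" using d by simp
    then show False using EEx n by (simp add: J_def)
  qed
  have eW: "e_diag nn rk nn \<in> W" by (rule e_diag_W[OF a])
  have are: "ar (e_diag nn rk nn) = 1"
  proof -
    have "{i \<in> {1..rk}. fst (e_diag nn rk nn (True, i))} = {rk}" using rs by (auto simp: e_diag_def)
    then show ?thesis unfolding ar_def by simp
  qed
  have "x \<in> J 1" unfolding x_def E_def by (intro J_left J_D eW) (simp add: are)
  then have xJ: "x \<in> J 2" by (rule regular_in_J[OF regular _ Ex])
  \<comment> \<open>The vertical strands force the permutation to fix all vertices off the arc, and
    the two ends of the arc lie on different sides of the wall.\<close>
  have one: "\<tau> i = id" if i: "i \<in> I" "relabel_bot (\<tau> i) \<circ> e_diag nn rk nn \<circ> relabel_bot (inv (\<tau> i)) = e_diag nn rk nn" for i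
  proof -
    let ?\<sigma> = "\<tau> i"
    have w: "wp ?\<sigma>" using I(6) i(1) .
    have f: "?\<sigma> m = m" if m: "m \<in> {1..nn}" "m \<noteq> rk" "m \<noteq> nn" for m
    proof -
      have "e_diag nn rk nn (True, m) = (False, m)" using m by (simp add: e_diag_def)
      moreover have "(relabel_bot ?\<sigma> \<circ> e_diag nn rk nn \<circ> relabel_bot (inv ?\<sigma>)) (True, m) = e_diag nn rk nn (True, m)" using i(2) by simp
      ultimately show ?thesis by simp
    qed
    have inj: "?\<sigma> p = ?\<sigma> q \<longleftrightarrow> p = q" for p q using wall_perm_bij[OF w] by (meson bij_is_inj inj_eq)
    have rr: "?\<sigma> rk \<in> {1..nn}" "?\<sigma> nn \<in> {1..nn}" "?\<sigma> rk \<le> rk" "rk < ?\<sigma> nn"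
      using wall_perm_mem[OF w, of rk] wall_perm_mem[OF w, of nn] wall_perm_le[OF w, of rk] wall_perm_le[OF w, of nn] rs by auto
    have f1: "?\<sigma> rk = rk"
    proof (rule ccontr)
      assume n: "?\<sigma> rk \<noteq> rk"
      have "?\<sigma> rk \<noteq> nn" using rr(3) rs by simp
      then have "?\<sigma> (?\<sigma> rk) = ?\<sigma> rk" by (rule f[OF rr(1) n])
      then show False unfolding inj using n by blast
    qed
    have f2: "?\<sigma> nn = nn"
    proof (rule ccontr)
      assume n: "?\<sigma> nn \<noteq> nn"
      have "?\<sigma> (?\<sigma> nn) = ?\<sigma> nn" by (rule f[OF rr(2) _ n]) (use rr(4) in linarith)
      then show False unfolding inj using n by blast
    qed
    have f3: "?\<sigma> m = m" if "m \<notin> {1..nn}" for m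
    proof -
      have "?\<sigma> permutes {1..nn}" using w unfolding wall_perm_def by (rule conjunct1)
      then show ?thesis using that by (rule permutes_not_in)
    qed
    show ?thesis
    proof (rule ext)
      fix m show "?\<sigma> m = id m" unfolding id_apply using f[of m] f1 f2 f3[of m] by metis
    qed
  qed
  have "coef x (e_diag nn rk nn) = (\<Sum>i\<in>I. c i * coef (P (\<tau> i) * ?e) (e_diag nn rk nn))"
    unfolding x_def I(3) sum_distrib_right coef_sum mult.assoc coef_sc ..
  also have "\<dots> = (\<Sum>i\<in>I. if i = i0 then c i else 0)"
  proof (intro sum.cong refl)
    fix i assume i: "i \<in> I"
    note w = I(6)[OF i]
    have m: "P (\<tau> i) * ?e = D (relabel_bot (\<tau> i) \<circ> e_diag nn rk nn \<circ> relabel_bot (inv (\<tau> i)))"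
      unfolding E_def by (rule P_mult_D[OF w eW])
    have dW: "relabel_bot (\<tau> i) \<circ> e_diag nn rk nn \<circ> relabel_bot (inv (\<tau> i)) \<in> W"
      using compose_perm_diag(3)[of rk sk "e_diag nn rk nn" "\<tau> i"] w eW by (simp only: W_iff)
    have "P (\<tau> i) * ?e = ?e" if "i = i0" using I(5) that by (simp add: P_id)
    then show "c i * coef (P (\<tau> i) * ?e) (e_diag nn rk nn) = (if i = i0 then c i else 0)"
      using one[OF i] I(7)[OF i] coef_D[OF dW, of "e_diag nn rk nn"] coef_D[OF eW, of "e_diag nn rk nn"] unfolding m
      by (cases "i = i0") (auto simp: E_def)
  qed
  also have "\<dots> = 1" using I(1,2,4) by simp
  finally have "coef x (e_diag nn rk nn) \<noteq> 0" by simp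
  then show False using xJ are by (auto simp: J_def)
qed

section \<open>Eigenvectors from symmetrisers and antisymmetrisers\<close>

definition sgw :: "bool \<Rightarrow> (nat \<Rightarrow> nat) \<Rightarrow> complex" where "sgw \<epsilon> \<sigma> = (if \<epsilon> then of_int (sign \<sigma>) else 1)"
definition sv :: "bool \<Rightarrow> complex" where "sv \<epsilon> = (if \<epsilon> then -1 else 1)"
text \<open>Antisymmetriser if \<open>\<epsilon>\<close> is true, symmetriser otherwise, left
  unnormalised so that the identity has coefficient 1.\<close>

definition SA :: "bool \<Rightarrow> nat set \<Rightarrow> wb" where "SA \<epsilon> S = (\<Sum>\<sigma> | \<sigma> permutes S. sc (sgw \<epsilon> \<sigma>) * P \<sigma>)"

lemma SA_unital: "unital S (SA \<epsilon> S)"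
  unfolding unital_def SA_def by (intro exI[of _ "sgw \<epsilon>"]) (simp add: sgw_def)

lemma sv_simps: "sv \<epsilon> * sv \<epsilon> = 1" "sv (\<not> \<epsilon>) = - sv \<epsilon>"
  by (auto simp: sv_def)

lemma sgw_transpose:
  assumes "finite S" "\<sigma> permutes S" "a \<noteq> b"
  shows "sgw \<epsilon> (Transposition.transpose a b \<circ> \<sigma>) = sv \<epsilon> * sgw \<epsilon> \<sigma>" "sgw \<epsilon> (\<sigma> \<circ> Transposition.transpose a b) = sv \<epsilon> * sgw \<epsilon> \<sigma>"
  using permutes_imp_permutation[OF assms(1,2)] permutation_swap_id[of a b] assms(3)
  by (simp_all add: sgw_def sv_def sign_compose sign_swap_id)

context
  fixes b N :: nat and B :: "nat set"
  assumes B: "B = {b+1..b+N}" and wB: "\<And>\<sigma>. \<sigma> permutes B \<Longrightarrow> wp \<sigma>" and ss: "\<And>i j. i \<in> B \<Longrightarrow> j \<in> B \<Longrightarrow> same_side i j"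
begin

lemma wS: "S \<subseteq> B \<Longrightarrow> \<sigma> permutes S \<Longrightarrow> wp \<sigma>"
  using permutes_subset wB by blast

lemma finS: "S \<subseteq> B \<Longrightarrow> finite S"
  using B finite_subset by blast

lemma T_SA:
  assumes S: "S \<subseteq> B" and ab: "i \<in> S" "j \<in> S" "i \<noteq> j"
  shows "T i j * SA \<epsilon> S = sc (sv \<epsilon>) * SA \<epsilon> S" "SA \<epsilon> S * T i j = sc (sv \<epsilon>) * SA \<epsilon> S"
proof -
  let ?t = "Transposition.transpose i j"
  have tp: "?t permutes S" using ab by (intro permutes_swap_id)
  have tw: "wp ?t" using wS[OF S tp] .
  have sc1: "sc (sv \<epsilon>) * (sc (sv \<epsilon> * a) * x) = sc a * x" for a x
    by (simp only: mult.assoc[symmetric] sc_times[symmetric] sv_simps(1) mult_1_left)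
  have "T i j * SA \<epsilon> S = (\<Sum>\<sigma> | \<sigma> permutes S. sc (sgw \<epsilon> \<sigma>) * P (?t \<circ> \<sigma>))"
    unfolding SA_def sum_distrib_left
  proof (rule sum.cong[OF refl])
    fix \<sigma> assume "\<sigma> \<in> {\<sigma>. \<sigma> permutes S}"
    then have "P (?t \<circ> \<sigma>) = T i j * P \<sigma>" using P_mult[OF tw] wS[OF S] by simp
    then show "T i j * (sc (sgw \<epsilon> \<sigma>) * P \<sigma>) = sc (sgw \<epsilon> \<sigma>) * P (?t \<circ> \<sigma>)" by (metis mult.assoc sc_comm)
  qed
  also have "\<dots> = (\<Sum>\<sigma> | \<sigma> permutes S. sc (sv \<epsilon>) * (sc (sgw \<epsilon> \<sigma>) * P \<sigma>))"
  proof (rule sum.reindex_bij_witness[of _ "\<lambda>\<sigma>. ?t \<circ> \<sigma>" "\<lambda>\<sigma>. ?t \<circ> \<sigma>"])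
    fix \<sigma> assume "\<sigma> \<in> {\<sigma>. \<sigma> permutes S}"
    then have p: "\<sigma> permutes S" by simp
    show "?t \<circ> (?t \<circ> \<sigma>) = \<sigma>" by (simp add: fun_eq_iff)
    then show "?t \<circ> (?t \<circ> \<sigma>) = \<sigma>" .
    show "?t \<circ> \<sigma> \<in> {\<sigma>. \<sigma> permutes S}" using permutes_compose[OF p tp] by simp
    then show "?t \<circ> \<sigma> \<in> {\<sigma>. \<sigma> permutes S}" .
    show "sc (sv \<epsilon>) * (sc (sgw \<epsilon> (?t \<circ> \<sigma>)) * P (?t \<circ> \<sigma>)) = sc (sgw \<epsilon> \<sigma>) * P (?t \<circ> \<sigma>)"
      unfolding sgw_transpose(1)[OF finS[OF S] p ab(3)] by (rule sc1)
  qed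
  finally show "T i j * SA \<epsilon> S = sc (sv \<epsilon>) * SA \<epsilon> S" by (simp add: SA_def sum_distrib_left)
  have "SA \<epsilon> S * T i j = (\<Sum>\<sigma> | \<sigma> permutes S. sc (sgw \<epsilon> \<sigma>) * P (\<sigma> \<circ> ?t))"
    unfolding SA_def sum_distrib_right
  proof (rule sum.cong[OF refl])
    fix \<sigma> assume "\<sigma> \<in> {\<sigma>. \<sigma> permutes S}"
    then have "P (\<sigma> \<circ> ?t) = P \<sigma> * T i j" using P_mult[OF _ tw] wS[OF S] by simp
    then show "sc (sgw \<epsilon> \<sigma>) * P \<sigma> * T i j = sc (sgw \<epsilon> \<sigma>) * P (\<sigma> \<circ> ?t)" by (simp only: mult.assoc)
  qed
  also have "\<dots> = (\<Sum>\<sigma> | \<sigma> permutes S. sc (sv \<epsilon>) * (sc (sgw \<epsilon> \<sigma>) * P \<sigma>))"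
  proof (rule sum.reindex_bij_witness[of _ "\<lambda>\<sigma>. \<sigma> \<circ> ?t" "\<lambda>\<sigma>. \<sigma> \<circ> ?t"])
    fix \<sigma> assume "\<sigma> \<in> {\<sigma>. \<sigma> permutes S}"
    then have p: "\<sigma> permutes S" by simp
    show "\<sigma> \<circ> ?t \<circ> ?t = \<sigma>" by (simp add: fun_eq_iff)
    then show "\<sigma> \<circ> ?t \<circ> ?t = \<sigma>" .
    show "\<sigma> \<circ> ?t \<in> {\<sigma>. \<sigma> permutes S}" using permutes_compose[OF tp p] by simp
    then show "\<sigma> \<circ> ?t \<in> {\<sigma>. \<sigma> permutes S}" .
    show "sc (sv \<epsilon>) * (sc (sgw \<epsilon> (\<sigma> \<circ> ?t)) * P (\<sigma> \<circ> ?t)) = sc (sgw \<epsilon> \<sigma>) * P (\<sigma> \<circ> ?t)"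
      unfolding sgw_transpose(2)[OF finS[OF S] p ab(3)] by (rule sc1)
  qed
  finally show "SA \<epsilon> S * T i j = sc (sv \<epsilon>) * SA \<epsilon> S" by (simp add: SA_def sum_distrib_left)
qed

text \<open>A coset decomposition; it turns the vanishing of a product with the larger symmetriser
  into a value for the sum of the \<open>T r j\<close>.\<close>

lemma SA_insert:
  assumes S: "insert r S \<subseteq> B" "r \<notin> S"
  shows "SA \<epsilon> (insert r S) = SA \<epsilon> S + sc (sv \<epsilon>) * (\<Sum>j\<in>S. T r j * SA \<epsilon> S)"
proof -
  have S': "S \<subseteq> B" using S by blast
  have "SA \<epsilon> (insert r S) = (\<Sum>j\<in>insert r S. \<Sum>q | q permutes S. sc (sgw \<epsilon> (Transposition.transpose r j \<circ> q)) * P (Transposition.transpose r j \<circ> q))"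
    unfolding SA_def by (rule sum_over_permutations_insert[OF finS[OF S'] S(2)])
  also have "\<dots> = SA \<epsilon> S + (\<Sum>j\<in>S. \<Sum>q | q permutes S. sc (sgw \<epsilon> (Transposition.transpose r j \<circ> q)) * P (Transposition.transpose r j \<circ> q))"
    by (subst sum.insert[OF finS[OF S'] S(2)]) (simp only: transpose_same SA_def id_comp)
  also have "(\<Sum>j\<in>S. \<Sum>q | q permutes S. sc (sgw \<epsilon> (Transposition.transpose r j \<circ> q)) * P (Transposition.transpose r j \<circ> q)) = (\<Sum>j\<in>S. sc (sv \<epsilon>) * (T r j * SA \<epsilon> S))"
    unfolding SA_def sum_distrib_left
  proof (intro sum.cong refl)
    fix j q assume j: "j \<in> S" and "q \<in> {q. q permutes S}"
    then have q: "q permutes S" by simp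
    have rj: "r \<noteq> j" using j S(2) by blast
    have "wp (Transposition.transpose r j)" using ss[of r j] j S(1) by (intro wp_transpose) auto
    then have "P (Transposition.transpose r j \<circ> q) = T r j * P q" using P_mult wS[OF S' q] by simp
    moreover have "sc (sgw \<epsilon> q) * (T r j * P q) = T r j * (sc (sgw \<epsilon> q) * P q)" by (metis mult.assoc sc_comm)
    ultimately show "sc (sgw \<epsilon> (Transposition.transpose r j \<circ> q)) * P (Transposition.transpose r j \<circ> q) = sc (sv \<epsilon>) * (T r j * (sc (sgw \<epsilon> q) * P q))"
      unfolding sgw_transpose(1)[OF finS[OF S'] q rj] sc_times by (simp only: mult.assoc)
  qed
  finally show ?thesis by (simp only: sum_distrib_left)
qed

lemma T_SA_commute:
  assumes "S \<subseteq> B" "i \<in> B - S" "j \<in> B - S"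
  shows "T i j * SA \<epsilon> S = SA \<epsilon> S * T i j"
  unfolding SA_def sum_distrib_left sum_distrib_right
proof (rule sum.cong[OF refl])
  fix \<sigma> assume "\<sigma> \<in> {\<sigma>. \<sigma> permutes S}"
  then have s: "\<sigma> permutes S" by simp
  have "P \<sigma> * T i j = T (\<sigma> i) (\<sigma> j) * P \<sigma>" using ss assms by (intro P_T wS[OF assms(1) s]) auto
  moreover have "\<sigma> i = i" "\<sigma> j = j" using permutes_not_in[OF s] assms by auto
  ultimately have "P \<sigma> * T i j = T i j * P \<sigma>" by simp
  then show "T i j * (sc (sgw \<epsilon> \<sigma>) * P \<sigma>) = sc (sgw \<epsilon> \<sigma>) * P \<sigma> * T i j" by (metis mult.assoc sc_comm)
qed

text \<open>\<open>S\<close> and \<open>H\<close> are the two legs of a hook with corner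
  \<open>b+1\<close>, carrying opposite symmetry; the last letter ends \<open>H\<close>, at distance
  \<open>N - m\<close> from the corner, which is its content up to sign. Extending \<open>S\<close>
  by the last letter kills the product, which evaluates the transpositions with \<open>S\<close>;
  those with the rest of \<open>H\<close> act directly.\<close>

lemma hook_eigenvector:
  assumes m: "1 \<le> m" "m < N"
  shows "\<exists>v. unital B v \<and> KK B (b+N) * v = sc (- sv \<epsilon> * of_nat (N - m)) * v"
proof -
  let ?r = "b+N"
  define S where "S = {b+1..b+m}"
  define H where "H = insert (b+1) {b+m+1..b+N}"
  define v where "v = SA \<epsilon> S * SA (\<not> \<epsilon>) H"
  have sub: "S \<subseteq> B" "H \<subseteq> B" "insert ?r S \<subseteq> B" and rS: "?r \<notin> S" using m by (auto simp: S_def H_def B)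
  have SH: "S \<inter> H = {b+1}" using m by (auto simp: S_def H_def)
  have un: "unital B v" unfolding v_def
    by (rule unital_mult[OF SA_unital SA_unital _ sub(1,2) _ wB]) (use SH B in auto)
  have in1: "b+1 \<in> insert ?r S" "?r \<in> insert ?r S" "b+1 \<in> H" "?r \<in> H" "b+1 \<noteq> ?r" using m by (auto simp: S_def H_def)
  let ?Z = "SA \<epsilon> (insert ?r S) * SA (\<not> \<epsilon>) H"
  \<comment> \<open>The transposition of corner and last letter can be absorbed by both factors,
    with opposite signs.\<close>
  have "?Z = 0"
  proof -
    have t: "T (b+1) ?r * T (b+1) ?r = 1" using ss sub in1 by (intro T_square) auto
    have "?Z = SA \<epsilon> (insert ?r S) * (T (b+1) ?r * T (b+1) ?r) * SA (\<not> \<epsilon>) H" unfolding t by simp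
    also have "\<dots> = (SA \<epsilon> (insert ?r S) * T (b+1) ?r) * (T (b+1) ?r * SA (\<not> \<epsilon>) H)" by (simp only: mult.assoc)
    also have "\<dots> = (sc (sv \<epsilon>) * SA \<epsilon> (insert ?r S)) * (sc (sv (\<not> \<epsilon>)) * SA (\<not> \<epsilon>) H)"
      unfolding T_SA(2)[OF sub(3) in1(1,2,5)] T_SA(1)[OF sub(2) in1(3,4,5)] ..
    also have "\<dots> = sc (sv \<epsilon> * sv (\<not> \<epsilon>)) * ?Z" unfolding sc_times by (metis mult.assoc sc_comm)
    also have "sv \<epsilon> * sv (\<not> \<epsilon>) = -1" by (simp add: sv_def)
    finally have z: "?Z = - ?Z" by simp
    show ?thesis
    proof (rule wb_eqI)
      fix d
      have "coef ?Z d = - coef ?Z d" using arg_cong[OF z, of "\<lambda>x. coef x d"] by simp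
      then show "coef ?Z d = coef 0 d" by simp
    qed
  qed
  then have "v + sc (sv \<epsilon>) * (\<Sum>j\<in>S. T ?r j * v) = 0"
    unfolding SA_insert[OF sub(3) rS] v_def by (simp only: distrib_right sum_distrib_right mult.assoc)
  then have "sc (sv \<epsilon>) * (v + sc (sv \<epsilon>) * (\<Sum>j\<in>S. T ?r j * v)) = 0" by simp
  then have "sc (sv \<epsilon>) * v + (\<Sum>j\<in>S. T ?r j * v) = 0"
    unfolding distrib_left by (simp only: sc_cancel[OF sv_simps(1)])
  then have s1: "(\<Sum>j\<in>S. T ?r j * v) = sc (- sv \<epsilon>) * v" by (simp add: eq_neg_iff_add_eq_0 add.commute)
  have s2: "T j ?r * v = sc (- sv \<epsilon>) * v" if j: "j \<in> {b+m+1..<b+N}" for j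
  proof -
    have "T j ?r * SA \<epsilon> S = SA \<epsilon> S * T j ?r" using j m by (intro T_SA_commute sub) (auto simp: S_def B)
    then have "T j ?r * v = SA \<epsilon> S * (T j ?r * SA (\<not> \<epsilon>) H)" unfolding v_def by (simp only: mult.assoc[symmetric])
    also have "T j ?r * SA (\<not> \<epsilon>) H = sc (sv (\<not> \<epsilon>)) * SA (\<not> \<epsilon>) H" using j m by (intro T_SA sub) (auto simp: H_def)
    finally show ?thesis unfolding v_def sv_simps(2) by (metis mult.assoc sc_comm)
  qed
  have e: "{j\<in>B. j < ?r} = S \<union> {b+m+1..<b+N}" using m by (auto simp: B S_def)
  have "KK B ?r * v = (\<Sum>j\<in>S. T j ?r * v) + (\<Sum>j\<in>{b+m+1..<b+N}. T j ?r * v)"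
    unfolding KK_def e sum_distrib_right by (rule sum.union_disjoint) (auto simp: S_def)
  also have "(\<Sum>j\<in>S. T j ?r * v) = sc (- sv \<epsilon>) * v" using s1 by (simp only: T_commute[of _ ?r])
  also have "(\<Sum>j\<in>{b+m+1..<b+N}. T j ?r * v) = (\<Sum>j\<in>{b+m+1..<b+N}. sc (- sv \<epsilon>) * v)" by (rule sum.cong[OF refl s2])
  also have "\<dots> = sc (of_nat (N - m - 1)) * (sc (- sv \<epsilon>) * v)" by simp
  also have "sc (- sv \<epsilon>) * v + \<dots> = sc (- sv \<epsilon> * of_nat (N - m)) * v"
  proof -
    have "- sv \<epsilon> * of_nat (N - m) = - sv \<epsilon> + of_nat (N - m - 1) * - sv \<epsilon>"
      using m by (simp add: of_nat_diff algebra_simps)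
    then show ?thesis by (simp only: sc_simps(3) sc_times distrib_right mult.assoc)
  qed
  finally show ?thesis using un by blast
qed

lemma two_element_unital:
  assumes "i \<in> B" "j \<in> B" "i \<noteq> j"
  shows "SA False {i, j} = 1 + T i j" "SA True {i, j} = 1 - T i j"
proof -
  have s: "insert i {j} \<subseteq> B" "i \<notin> {j}" using assms by auto
  have "SA \<epsilon> {j} = 1" for \<epsilon>
  proof -
    have "{\<sigma>. \<sigma> permutes {j}} = {id}" using permutes_sing by auto
    then show ?thesis by (simp add: SA_def sgw_def P_id)
  qed
  then show "SA False {i, j} = 1 + T i j" "SA True {i, j} = 1 - T i j"
    using SA_insert[OF s, of False] SA_insert[OF s, of True] by (simp_all add: sv_def)
qed

text \<open>\<open>v\<close> is a Young symmetriser for two columns, \<open>R\<close> with N - 2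
  letters and {p2, r}, with rows {p1, p2} and {p3, r}. The last letter \<open>r\<close> occupies the
  second box of the second row, of content 0; this shape needs N >= 4.\<close>

lemma zero_eigenvector:
  assumes N: "4 \<le> N"
  shows "\<exists>v. unital B v \<and> KK B (b+N) * v = 0"
proof -
  define p1 p2 p3 r where "p1 = b+1" and "p2 = b+2" and "p3 = b+3" and "r = b+N"
  define R where "R = B - {p2, r}"
  have ne: "p1 \<noteq> p2" "p1 \<noteq> p3" "p1 \<noteq> r" "p2 \<noteq> p3" "p2 \<noteq> r" "p3 \<noteq> r" using N by (auto simp: p1_def p2_def p3_def r_def)
  have mem: "p1 \<in> B" "p2 \<in> B" "p3 \<in> B" "r \<in> B" using N by (auto simp: B p1_def p2_def p3_def r_def)
  have RB: "R \<subseteq> B" "insert r R \<subseteq> B" "r \<notin> R" "p2 \<notin> R" "p1 \<in> R" "p3 \<in> R" using mem ne by (auto simp: R_def)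
  define v where "v = SA True R * (SA True {p2, r} * (SA False {p3, r} * SA False {p1, p2}))"
  have un: "unital B v"
  proof -
    have fB: "finite B" by (simp add: B)
    let ?I = "{\<sigma>. \<sigma> permutes R} \<times> ({\<sigma>. \<sigma> permutes {p2, r}} \<times> ({\<sigma>. \<sigma> permutes {p3, r}} \<times> {\<sigma>. \<sigma> permutes {p1, p2}}))"
    let ?\<tau> = "\<lambda>\<sigma>. fst \<sigma> \<circ> (fst (snd \<sigma>) \<circ> (fst (snd (snd \<sigma>)) \<circ> snd (snd (snd \<sigma>))))"
    let ?c = "\<lambda>\<sigma>. sgw True (fst \<sigma>) * (sgw True (fst (snd \<sigma>)) * (sgw False (fst (snd (snd \<sigma>))) * sgw False (snd (snd (snd \<sigma>)))))"
    have sB: "{p2, r} \<subseteq> B" "{p3, r} \<subseteq> B" "{p1, p2} \<subseteq> B" using mem by auto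
    show ?thesis
    proof (rule unital_I[where I="?I" and z="(id, id, id, id)" and c="?c" and \<tau>="?\<tau>"])
      have prod: "(\<Sum>\<sigma>\<in>X. sc (f \<sigma>) * P (g \<sigma>)) * (\<Sum>\<sigma>\<in>Y. sc (f' \<sigma>) * P (g' \<sigma>)) = (\<Sum>\<sigma>\<in>X \<times> Y. sc (f (fst \<sigma>) * f' (snd \<sigma>)) * P (g (fst \<sigma>) \<circ> g' (snd \<sigma>)))"
        if "\<And>\<sigma>. \<sigma> \<in> X \<Longrightarrow> wp (g \<sigma>)" "\<And>\<sigma>. \<sigma> \<in> Y \<Longrightarrow> wp (g' \<sigma>)" for X :: "'x set" and Y :: "'y set" and f g f' g'
        unfolding sum_product sum.cartesian_product
      proof (rule sum.cong[OF refl])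
        fix p assume "p \<in> X \<times> Y"
        then have "wp (g (fst p))" "wp (g' (snd p))" using that by auto
        then show "(case p of (i, j) \<Rightarrow> sc (f i) * P (g i) * (sc (f' j) * P (g' j))) = sc (f (fst p) * f' (snd p)) * P (g (fst p) \<circ> g' (snd p))"
          unfolding split_def by (rule scaled_P_mult)
      qed
      have w: "wp \<sigma>" if "\<sigma> permutes R \<or> \<sigma> permutes {p2, r} \<or> \<sigma> permutes {p3, r} \<or> \<sigma> permutes {p1, p2}" for \<sigma>
        using that wS RB(1) sB by blast
      have c1: "SA False {p3, r} * SA False {p1, p2} = (\<Sum>\<sigma>\<in>{\<sigma>. \<sigma> permutes {p3, r}} \<times> {\<sigma>. \<sigma> permutes {p1, p2}}.
        sc (sgw False (fst \<sigma>) * sgw False (snd \<sigma>)) * P (fst \<sigma> \<circ> snd \<sigma>))"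
        unfolding SA_def by (rule prod) (use w in auto)
      have c2: "SA True {p2, r} * (SA False {p3, r} * SA False {p1, p2}) = (\<Sum>\<sigma>\<in>{\<sigma>. \<sigma> permutes {p2, r}} \<times> ({\<sigma>. \<sigma> permutes {p3, r}} \<times> {\<sigma>. \<sigma> permutes {p1, p2}}).
        sc (sgw True (fst \<sigma>) * (sgw False (fst (snd \<sigma>)) * sgw False (snd (snd \<sigma>)))) * P (fst \<sigma> \<circ> (fst (snd \<sigma>) \<circ> snd (snd \<sigma>))))"
        unfolding c1 unfolding SA_def by (rule prod) (use w wall_perm_comp in auto)
      show "v = (\<Sum>\<sigma>\<in>?I. sc (?c \<sigma>) * P (?\<tau> \<sigma>))"
        unfolding v_def c2 unfolding SA_def by (rule prod) (use w wall_perm_comp in auto)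
      show "finite ?I" using finS[OF RB(1)] by (simp add: finite_permutations)
      show "(id, id, id, id) \<in> ?I" by (simp add: permutes_id)
      show "?c (id, id, id, id) = 1" "?\<tau> (id, id, id, id) = id" by (simp_all add: sgw_def)
      show "?\<tau> \<sigma> permutes B" if "\<sigma> \<in> ?I" for \<sigma>
      proof -
        have "fst \<sigma> permutes B" "fst (snd \<sigma>) permutes B" "fst (snd (snd \<sigma>)) permutes B" "snd (snd (snd \<sigma>)) permutes B"
          using that permutes_subset[OF _ RB(1)] permutes_subset[OF _ sB(1)] permutes_subset[OF _ sB(2)] permutes_subset[OF _ sB(3)] by auto
        then show ?thesis by (intro permutes_compose)
      qed
      \<comment> \<open>Following first p2 and then r through the product forces all factors but the
        first to be the identity, and then the first as well.\<close>
      show "\<sigma> = (id, id, id, id)" if s: "\<sigma> \<in> ?I" "?\<tau> \<sigma> = id" for \<sigma>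
      proof -
        obtain x y u w where q: "\<sigma> = (x, y, u, w)" by (metis prod.exhaust)
        have p: "x permutes R" "y permutes {p2, r}" "u permutes {p3, r}" "w permutes {p1, p2}" using s(1) unfolding q by auto
        have id: "x (y (u (w t))) = t" for t using s(2) unfolding q by (simp add: fun_eq_iff)
        have out: "y (u (w t)) = t" if "t \<notin> R" for t
        proof -
          have "y (u (w t)) \<notin> R" using permutes_in_image[OF p(1), of "y (u (w t))"] id[of t] that by simp
          then show ?thesis using permutes_not_in[OF p(1)] id[of t] by metis
        qed
        have w2: "w p2 = p2"
        proof (rule ccontr)
          assume "w p2 \<noteq> p2"
          then have "w p2 = p1" using permutes_in_image[OF p(4), of p2] by auto
          moreover have "u p1 = p1" "y p1 = p1" using permutes_not_in[OF p(3), of p1] permutes_not_in[OF p(2), of p1] ne by auto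
          ultimately show False using out[OF RB(4)] ne(1) by simp
        qed
        have wr: "w r = r" using permutes_not_in[OF p(4), of r] ne by auto
        have ur: "u r = r"
        proof (rule ccontr)
          assume "u r \<noteq> r"
          then have "u r = p3" using permutes_in_image[OF p(3), of r] by auto
          moreover have "y p3 = p3" using permutes_not_in[OF p(2), of p3] ne by auto
          ultimately show False using out[OF RB(3)] wr ne(6) by simp
        qed
        have yr: "y r = r" using out[OF RB(3)] wr ur by simp
        have two: "\<sigma> = id" if "\<sigma> permutes {i, j}" "\<sigma> i = i" for \<sigma> and i j :: nat
        proof -
          have "\<sigma> j = j"
          proof (rule ccontr)
            assume n: "\<sigma> j \<noteq> j"
            then have "\<sigma> j = i" using permutes_in_image[OF that(1), of j] by auto
            then show False using that(2) n permutes_inj[OF that(1)] by (metis injD)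
          qed
          then show ?thesis using that permutes_not_in[OF that(1)] by (intro ext) (metis id_apply insertE singletonD)
        qed
        have "w = id" using two[of w p2 p1] p(4) w2 by (simp add: insert_commute)
        moreover have "u = id" using two[of u r p3] p(3) ur by (simp add: insert_commute)
        moreover have "y = id" using two[of y r p2] p(2) yr by (simp add: insert_commute)
        ultimately have "x = id" using id by (simp add: fun_eq_iff)
        then show ?thesis unfolding q using \<open>w = id\<close> \<open>u = id\<close> \<open>y = id\<close> by simp
      qed
    qed (rule fB)
  qed
  let ?A = "SA True (insert r R)"
  have A: "?A * T i j = - ?A" if "i \<in> insert r R" "j \<in> insert r R" "i \<noteq> j" for i j
    using T_SA(2)[OF RB(2) that, of True] by (simp add: sv_def)
  \<comment> \<open>After \<open>T p2 r\<close> is moved to the right, every summand meets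
    \<open>?A\<close> in 1 + T p3 r or 1 + T p1 r, and the antisymmetriser of a set containing both
    letters kills these.\<close>
  have "?A * ((1 - T p2 r) * ((1 + T p3 r) * (1 + T p1 p2))) = 0"
  proof -
    have a1: "?A * (1 + T p3 r) = 0" "?A * (1 + T p1 r) = 0"
      using A[of p3 r] A[of p1 r] RB ne by (simp_all add: distrib_left)
    have x1: "T p2 r * T p3 r = T p3 p2 * T p2 r"
      using P_T[OF wp_transpose[OF ss[OF mem(2,4)]] ss[OF mem(3,4)]] ne by (simp add: transpose_def)
    have x2: "T p2 r * T p1 p2 = T p1 r * T p2 r"
      using P_T[OF wp_transpose[OF ss[OF mem(2,4)]] ss[OF mem(1,2)]] ne by (simp add: transpose_def)
    have x3: "T p3 p2 * T p1 r = T p1 r * T p3 p2"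
      using ss mem ne by (intro T_T_disjoint) auto
    have y1: "T p2 r * (1 + T p3 r) = (1 + T p3 p2) * T p2 r" using x1 by (simp add: distrib_left distrib_right)
    have y2: "T p2 r * (1 + T p1 p2) = (1 + T p1 r) * T p2 r" using x2 by (simp add: distrib_left distrib_right)
    have y3: "(1 + T p3 p2) * (1 + T p1 r) = (1 + T p1 r) * (1 + T p3 p2)" using x3 by (simp add: distrib_left distrib_right)
    have "?A * ((1 - T p2 r) * ((1 + T p3 r) * (1 + T p1 p2))) = ?A * (1 + T p3 r) * (1 + T p1 p2) - ?A * ((T p2 r * (1 + T p3 r)) * (1 + T p1 p2))"
      by (simp only: left_diff_distrib right_diff_distrib mult_1_left mult.assoc)
    also have "\<dots> = - (?A * ((1 + T p3 p2) * (T p2 r * (1 + T p1 p2))))" unfolding a1 y1 by (simp add: mult.assoc)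
    also have "\<dots> = - (?A * ((1 + T p3 p2) * (1 + T p1 r) * T p2 r))" unfolding y2 by (simp only: mult.assoc)
    also have "\<dots> = - (?A * (1 + T p1 r) * ((1 + T p3 p2) * T p2 r))" unfolding y3 by (simp only: mult.assoc)
    finally show ?thesis unfolding a1 by simp
  qed
  then have "?A * (SA True {p2, r} * (SA False {p3, r} * SA False {p1, p2})) = 0"
    unfolding two_element_unital[OF mem(2,4) ne(5)] two_element_unital[OF mem(3,4) ne(6)] two_element_unital[OF mem(1,2) ne(1)] .
  then have "v + sc (sv True) * (\<Sum>j\<in>R. T r j * v) = 0"
    unfolding SA_insert[OF RB(2,3)] v_def by (simp only: distrib_right sum_distrib_right mult.assoc)
  then have s1: "(\<Sum>j\<in>R. T j r * v) = v" by (simp add: sv_def T_commute[of r])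
  have s2: "T p2 r * v = - v"
  proof -
    have "T p2 r * SA True R = SA True R * T p2 r" using mem RB by (intro T_SA_commute) auto
    then have "T p2 r * v = SA True R * ((T p2 r * SA True {p2, r}) * (SA False {p3, r} * SA False {p1, p2}))"
      unfolding v_def by (simp only: mult.assoc[symmetric])
    also have "T p2 r * SA True {p2, r} = - SA True {p2, r}" using T_SA(1)[of "{p2, r}" p2 r True] mem ne by (simp add: sv_def)
    finally show ?thesis unfolding v_def by simp
  qed
  have e: "{j\<in>B. j < r} = insert p2 R"
    unfolding R_def using ne(5) mem(2) by (auto simp: B r_def)
  have "KK B r * v = T p2 r * v + (\<Sum>j\<in>R. T j r * v)"
    unfolding KK_def e sum_distrib_right by (rule sum.insert[OF finS[OF RB(1)] RB(4)])
  then have "KK B r * v = 0" unfolding s1 s2 by simp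
  then show ?thesis using un by (auto simp: r_def)
qed

end

text \<open>The contents of removable boxes of Young diagrams with \<open>N\<close> boxes: 0 occurs
  for a single box and again as soon as a 2 by 2 square fits.\<close>

definition hook_content :: "nat \<Rightarrow> int \<Rightarrow> bool" where
  "hook_content N c \<longleftrightarrow> N = 1 \<and> c = 0 \<or> 1 \<le> \<bar>c\<bar> \<and> \<bar>c\<bar> \<le> int N - 1 \<or> c = 0 \<and> 4 \<le> N"

lemma hook_content_split:
  fixes r s :: nat and z :: int
  assumes rs: "1 \<le> r" "1 \<le> s" and z: "\<bar>z\<bar> \<le> int r + int s - 2"
    and "\<not> (z = 0 \<and> (r = 1 \<and> s \<in> {2,3} \<or> s = 1 \<and> r \<in> {2,3}))" "\<not> (r = 2 \<and> s = 2 \<and> \<bar>z\<bar> = 1)"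
  shows "\<exists>c1 c2. hook_content r c1 \<and> hook_content s c2 \<and> c1 + c2 = - z"
proof -
  have wit: ?thesis if "hook_content r c1" "hook_content s c2" "c1 + c2 = - z" for c1 c2 using that by blast
  consider "r = 1" | "s = 1" | "2 \<le> r" "2 \<le> s" using rs by linarith
  then show ?thesis
  proof cases
    case 1
    then show ?thesis using assms by (intro wit[of 0 "- z"]) (auto simp: hook_content_def)
  next
    case 2
    then show ?thesis using assms by (intro wit[of "- z" 0]) (simp_all add: hook_content_def, linarith)
  next
    case 3
    have big: "3 \<le> r \<or> 3 \<le> s" if "z = 1 \<or> z = -1"
    proof -
      have "\<not> (r = 2 \<and> s = 2)" using assms(5) that by auto
      then show ?thesis using 3 by linarith
    qed
    have "z = 0 \<or> z = 1 \<or> z = -1 \<or> 2 \<le> z \<or> z \<le> -2" by linarith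
    then consider "z = 0" | "z = 1" "3 \<le> r" | "z = 1" "3 \<le> s" | "z = -1" "3 \<le> r" | "z = -1" "3 \<le> s" | "2 \<le> z" | "z \<le> -2"
      using big by blast
    then show ?thesis
    proof cases
      case 1
      then show ?thesis using 3 by (intro wit[of 1 "-1"]) (auto simp: hook_content_def)
    next
      case 2
      then show ?thesis using 3 by (intro wit[of "-2" "1"]) (auto simp: hook_content_def)
    next
      case 3
      then show ?thesis using \<open>2 \<le> r\<close> by (intro wit[of "1" "-2"]) (auto simp: hook_content_def)
    next
      case 4
      then show ?thesis using 3 by (intro wit[of "2" "-1"]) (auto simp: hook_content_def)
    next
      case 5
      then show ?thesis using 3 by (intro wit[of "-1" "2"]) (auto simp: hook_content_def)
    next
      case 6
      \<comment> \<open>The left content takes as much as \<open>r - 1\<close> allows but leaves at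
        least 1 to the right block.\<close>
      then show ?thesis using 3 z
        by (intro wit[of "- min (int r - 1) (z - 1)" "min (int r - 1) (z - 1) - z"]) (auto simp: hook_content_def min_def abs_if)
    next
      case 7
      then show ?thesis using 3 z
        by (intro wit[of "min (int r - 1) (- z - 1)" "- z - min (int r - 1) (- z - 1)"]) (auto simp: hook_content_def min_def abs_if)
    qed
  qed
qed

text \<open>Reflection fixes \<open>KK\<close> and turns the eigenvectors for multiplication from
  the left into those for multiplication from the right, as \<open>eigen_contradiction\<close>
  requires.\<close>

lemma block_eigenvector:
  assumes B: "B = {b+1..b+N}" and wB: "\<And>\<sigma>. \<sigma> permutes B \<Longrightarrow> wp \<sigma>" and ss: "\<And>i j. i \<in> B \<Longrightarrow> j \<in> B \<Longrightarrow> same_side i j"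
    and c: "hook_content N c"
  shows "\<exists>u. unital B u \<and> u * KK B (b+N) = sc (of_int c) * u"
proof -
  have "\<exists>v. unital B v \<and> KK B (b+N) * v = sc (of_int c) * v"
  proof -
    consider "N = 1" "c = 0" | "1 \<le> c" "c \<le> int N - 1" | "c \<le> -1" "- c \<le> int N - 1" | "c = 0" "4 \<le> N"
      using c unfolding hook_content_def by linarith
    then show ?thesis
    proof cases
      case 1
      have e: "{j\<in>B. j < b+N} = {}" using 1 by (auto simp: B)
      have "KK B (b+N) = 0" unfolding KK_def e by simp
      then show ?thesis using 1 SA_unital[of B False] by (intro exI[of _ "SA False B"]) simp
    next
      case 2
      \<comment> \<open>Antisymmetrising the first \<open>m\<close> letters makes the eigenvalue
        \<open>N - m\<close> positive.\<close>
      define m where "m = N - nat c"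
      have m: "1 \<le> m" "m < N" "- sv True * of_nat (N - m) = of_int c" using 2 by (auto simp: m_def sv_def)
      show ?thesis using hook_eigenvector[OF B wB ss m(1,2), of True] unfolding m(3) .
    next
      case 3
      define m where "m = N - nat (- c)"
      have m: "1 \<le> m" "m < N" "- sv False * of_nat (N - m) = of_int c" using 3 by (auto simp: m_def sv_def)
      show ?thesis using hook_eigenvector[OF B wB ss m(1,2), of False] unfolding m(3) .
    next
      case 4
      then show ?thesis using zero_eigenvector[OF B wB ss 4(2)] by simp
    qed
  qed
  then obtain v where v: "unital B v" "KK B (b+N) * v = sc (of_int c) * v" by blast
  have "fl (KK B (b+N)) = KK B (b+N)"
    unfolding KK_def fl_sum
  proof (rule sum.cong[OF refl])
    fix j assume "j \<in> {j\<in>B. j < b+N}"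
    then show "fl (T j (b+N)) = T j (b+N)" by (intro fl_T ss) (auto simp: B)
  qed
  then have "fl v * KK B (b+N) = sc (of_int c) * fl v"
    using arg_cong[OF v(2), of fl] by (simp only: fl_mult fl_sc_mult[of _ v, unfolded fl_mult] fl_sc) (metis sc_comm)
  moreover have "unital B (fl v)" using unital_fl[OF v(1) _ wB] B by simp
  ultimately show ?thesis by blast
qed

lemma unital_commute_T:
  assumes u: "unital B u" and wB: "\<And>\<sigma>. \<sigma> permutes B \<Longrightarrow> wp \<sigma>" and ij: "same_side i j" "i \<notin> B" "j \<notin> B"
  shows "u * T i j = T i j * u"
proof -
  obtain c where c: "u = (\<Sum>\<sigma> | \<sigma> permutes B. sc (c \<sigma>) * P \<sigma>)" using u unfolding unital_def by blast
  show ?thesis unfolding c sum_distrib_left sum_distrib_right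
  proof (rule sum.cong[OF refl])
    fix \<sigma> assume "\<sigma> \<in> {\<sigma>. \<sigma> permutes B}"
    then have s: "\<sigma> permutes B" by simp
    have "P \<sigma> * T i j = T i j * P \<sigma>"
      using P_T[OF wB[OF s] ij(1)] permutes_not_in[OF s ij(2)] permutes_not_in[OF s ij(3)] by simp
    then show "sc (c \<sigma>) * P \<sigma> * T i j = T i j * (sc (c \<sigma>) * P \<sigma>)" by (metis mult.assoc sc_comm)
  qed
qed

section \<open>Failure of regularity at the remaining integral \<delta>\<close>

lemma integral_not_regular:
  assumes regular: "\<And>x::wb. \<exists>a. x = x * a * x" and rs: "1 \<le> rk" "1 \<le> sk" and z: "dl = of_int z"
    and c: "hook_content rk c1" "hook_content sk c2" "c1 + c2 = - z"
  shows False
proof -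
  let ?A = "{1..rk}" and ?B = "{rk+1..nn}"
  have ssA: "same_side i j" if "i \<in> ?A" "j \<in> ?A" for i j using that by (auto simp: same_side_def)
  have ssB: "same_side i j" if "i \<in> ?B" "j \<in> ?B" for i j using that by (auto simp: same_side_def)
  have A: "?A = {0+1..0+rk}" by simp
  obtain u1 where u1: "unital ?A u1" "u1 * KK ?A rk = sc (of_int c1) * u1"
    using block_eigenvector[OF A wp_left ssA c(1)] by auto
  obtain u2 where u2: "unital ?B u2" "u2 * KK ?B nn = sc (of_int c2) * u2"
    using block_eigenvector[OF refl wp_right ssB c(2)] by auto
  have LK: "L rk = KK ?A rk"
  proof -
    have "{j\<in>?A. j < rk} = {1..<rk}" by auto
    then show ?thesis by (simp add: L_def KK_def)
  qed
  have com: "u2 * L rk = L rk * u2"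
    unfolding LK KK_def sum_distrib_left sum_distrib_right
  proof (rule sum.cong[OF refl])
    fix j assume "j \<in> {j\<in>?A. j < rk}"
    then show "u2 * T j rk = T j rk * u2" by (intro unital_commute_T[OF u2(1) wp_right] ssA) auto
  qed
  have a: "u1 * u2 * L rk = sc (of_int c1) * (u1 * u2)"
  proof -
    have "u1 * u2 * L rk = (u1 * KK ?A rk) * u2" unfolding mult.assoc com unfolding LK ..
    then show ?thesis unfolding u1(2) by (simp only: mult.assoc)
  qed
  have Y: "YY 0 = ?B" by simp
  have b: "u1 * u2 * KK (YY 0) nn = sc (of_int c2) * (u1 * u2)"
    unfolding Y mult.assoc u2(2) by (metis mult.assoc sc_comm)
  have d: "u1 * u2 * sc dl = sc (of_int z) * (u1 * u2)" unfolding z by (rule sc_comm)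
  have "u1 * u2 * (sc dl + L rk + KK (YY 0) nn) = sc (of_int z + of_int c1 + of_int c2) * (u1 * u2)"
    unfolding distrib_left a b d by (simp only: sc_simps(3) distrib_right)
  also have "(of_int z + of_int c1 + of_int c2 :: complex) = 0"
  proof -
    have "z + c1 + c2 = 0" using c(3) by linarith
    then have "(of_int (z + c1 + c2) :: complex) = 0" by simp
    then show ?thesis by simp
  qed
  finally have "u1 * u2 * (sc dl + L rk + KK (YY 0) nn) = 0" by simp
  then show False by (rule eigen_contradiction[OF regular rs u1(1) refl u2(1) refl])
qed

text \<open>Here no hook contents add up to the required value; instead the two diagrams without
  propagating strands span the offending element.\<close>

lemma two_two_not_regular:
  assumes regular: "\<And>x::wb. \<exists>a. x = x * a * x" and rs: "rk = 2" "sk = 2" and z: "dl * dl = 1"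
  shows False
proof -
  have l: "lv 2" by (simp add: lv_def rs)
  let ?t = "Transposition.transpose (1::nat) 2"
  have s: "same_side 1 2" by (simp add: same_side_def rs)
  have w: "wp ?t" by (rule wp_transpose[OF s])
  define d' where "d' = relabel_bot ?t \<circ> Fd 2 \<circ> relabel_bot (inv ?t)"
  have FW: "Fd 2 \<in> W" by (rule Fd_W[OF l])
  have dW: "d' \<in> W" unfolding d'_def
    using compose_perm_diag(3)[of rk sk "Fd 2" ?t] w FW by (simp only: W_iff)
  have F: "Fd 2 (False, 1) = (False, 4)" "Fd 2 (False, 2) = (False, 3)"
    using Fd_bot[OF l, of 1] Fd_bot[OF l, of 2] by (simp_all add: region_def rs)
  have d: "d' (False, 1) = (False, 3)" "d' (False, 2) = (False, 4)"
    unfolding d'_def using F by (simp_all add: Transposition.transpose_def)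
  have g: "D d' = T 1 2 * fk 2" unfolding d'_def fk_def by (rule P_mult_D[OF w FW, symmetric])
  have g': "T 1 2 * D d' = fk 2" unfolding g mult.assoc[symmetric] T_square[OF s] by simp
  have T: "T 2 1 = T 1 2" by (rule T_commute)
  have ss': "same_side 2 1" by (simp add: same_side_def rs)
  have a: "arc 1 3" "arc 1 4" "arc 2 3" "arc 2 4" by (simp_all add: arc_def rs)
  have f: "E 1 3 * fk 2 = D d'" "E 1 4 * fk 2 = sc dl * fk 2" "E 2 3 * fk 2 = sc dl * fk 2" "E 2 4 * fk 2 = D d'"
    unfolding g unfolding fk_def
    using E_mult_right[OF a(1) FW F(2) _ s] E_mult_right[OF a(4) FW F(1) _ ss'] E_mult_same[OF a(2) FW F(1)] E_mult_same[OF a(3) FW F(2)]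
    by (simp_all add: T[unfolded One_nat_def])
  have h: "E 1 3 * D d' = sc dl * D d'" "E 1 4 * D d' = fk 2" "E 2 3 * D d' = fk 2" "E 2 4 * D d' = sc dl * D d'"
    using E_mult_right[OF a(2) dW d(2) _ s] E_mult_right[OF a(3) dW d(1) _ ss'] E_mult_same[OF a(1) dW d(1)] E_mult_same[OF a(4) dW d(2)]
    by (simp_all add: T[unfolded One_nat_def] g'[unfolded One_nat_def])
  \<comment> \<open>Each arc maps \<open>fk 2\<close> and \<open>D d'\<close> to multiples of one
    and the same diagram, with coefficients 1 and \<delta> or \<delta> and 1; since \<delta>^2 = 1,
    this combination is killed by all arcs.\<close>
  define x where "x = fk 2 - sc dl * D d'"
  have "x \<in> J 2" unfolding x_def g using fk_J[OF l] by (intro J_diff J_left)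
  then have xJ: "x \<in> J 1" by (auto simp: J_def)
  have sq: "sc dl * (sc dl * y) = y" for y by (simp only: mult.assoc[symmetric] sc_times[symmetric] z) simp
  have "E i j * x = 0" if "arc i j" for i j
  proof -
    have e: "E i j * x = E i j * fk 2 - sc dl * (E i j * D d')"
      unfolding x_def right_diff_distrib by (metis mult.assoc sc_comm)
    have "(i = 1 \<or> i = 2) \<and> (j = 3 \<or> j = 4)" using that by (auto simp: arc_def rs)
    then show ?thesis unfolding e using f h by (auto simp: sq)
  qed
  \<comment> \<open>With two strands on each side no diagram has three arcs, so \<open>J 3\<close>
    is zero.\<close>
  then have "x \<in> J 3" by (intro regular_in_J[OF regular xJ]) simp
  then have "x = 0" by (rule J_top) (simp add: rs)
  moreover have "coef x (Fd 2) = 1"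
  proof -
    have "d' \<noteq> Fd 2" using d(1) F(1) by auto
    then show ?thesis by (simp add: x_def fk_def coef_D[OF FW] coef_D[OF dW])
  qed
  ultimately show False by simp
qed

text \<open>For parameters neither generic nor exceptional, regularity itself is contradictory, so
  the inclusion holds vacuously there.\<close>

lemma semisimple_center:
  assumes "wb_semisimple rk sk dl"
  shows "center = Zs"
proof
  show "Zs \<subseteq> center" using Zs_center by blast
  have regular: "\<exists>a. x = x * a * x" for x :: wb by (rule semisimple_regular[OF assms])
  show "center \<subseteq> Zs"
  proof (cases "generic \<or> small")
    case True
    then show ?thesis using generic_center[OF regular] small_center[OF regular] by blast
  next
    case False
    then obtain z :: int where rs: "1 \<le> rk" "1 \<le> sk" and z: "dl = of_int z" "\<bar>z\<bar> \<le> int rk + int sk - 2"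
      unfolding generic_def by (auto simp: not_less)
    have "\<not> (rk = 2 \<and> sk = 2 \<and> \<bar>z\<bar> = 1)"
    proof
      assume q: "rk = 2 \<and> sk = 2 \<and> \<bar>z\<bar> = 1"
      then have "z = 1 \<or> z = -1" by linarith
      then have "dl * dl = 1" unfolding z(1) by auto
      then show False using two_two_not_regular[OF regular] q by blast
    qed
    moreover have "\<not> (z = 0 \<and> (rk = 1 \<and> sk \<in> {2,3} \<or> sk = 1 \<and> rk \<in> {2,3}))"
      using False z(1) unfolding small_def by auto
    ultimately obtain c1 c2 where "hook_content rk c1" "hook_content sk c2" "c1 + c2 = - z"
      using hook_content_split[OF rs z(2)] by blast
    then show ?thesis using integral_not_regular[OF regular rs z(1)] by blast
  qed
qed

lemma center_claim_params: "center_claim params"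
proof -
  have p: "params = (rk, sk, dl)" by (simp add: rk_def sk_def dl_def)
  have "wb_center rk sk dl = {eval_JM rk sk dl c | c. supersym rk sk c}" if "wb_semisimple rk sk dl"
  proof -
    have "wb_center rk sk dl = coef ` center"
    proof -
      have "wb_mult rk sk dl (coef x) (coef y) = wb_mult rk sk dl (coef y) (coef x) \<longleftrightarrow> x * y = y * x" for x y
        unfolding times_wb.rep_eq[symmetric] by (rule coef_inject)
      then show ?thesis unfolding wb_center_def center_def range_coef[symmetric] by auto
    qed
    also have "\<dots> = coef ` Zs" unfolding semisimple_center[OF that] ..
    also have "\<dots> = {eval_JM rk sk dl c | c. supersym rk sk c}" unfolding Zs_def coef_ev[symmetric] by auto
    finally show ?thesis .
  qed
  then show ?thesis unfolding p center_claim_def by simp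
qed

theorem mainTheorem10:
  fixes r s :: nat and \<delta> :: complex
  assumes "wb_semisimple r s \<delta>"
  shows "wb_center r s \<delta> = {eval_JM r s \<delta> c | c. supersym r s c}"
proof -
  have "center_claim (r, s, \<delta>)"
  proof (rule ccontr)
    assume "\<not> center_claim (r, s, \<delta>)"
    then have "\<not> center_claim params" unfolding params_def by (rule someI)
    then show False using center_claim_params by blast
  qed
  then show ?thesis using assms by (simp add: center_claim_def)
qed

end
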